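(* Let $C\in\mathcal S_1(H)_+$ have eigenpairs $(c_i,e_i)$, let $B^C$ be Brownian motion with covariance $C$, and let $t>0$. For $i<j$ let $$\Xi_{ij}(t)=t^{-1}\Bigl(\int_0^tW^i_s\,\mathrm dW^j_s-\int_0^tW^j_s\,\mathrm dW^i_s\Bigr).$$ The active family $(\Xi_{ij}(t))_{i<j,\ c_ic_j>0}$ is orthonormal in $L^2(\Omega)$, and second-chaos radonification defines, for every Hilbert space $E$, an isometry $$\operatorname{Rad}^{(2)}_{\Xi,t}:\mathcal S_2(\mathfrak h_{2,C},E)\to L^2(\Omega;E).$$ Moreover $$\alpha_{A^C_t}=\operatorname{Rad}^{(2)}_{\Xi,t}(K_{C,t}),\qquad\operatorname{Cov}(\alpha_{A^C_t})=K_{C,t}K_{C,t}^*=\frac{t^2}4\Lambda^2C.$$ If $C$ has infinite rank, then almost surely algebraic point evaluation on the active chaos space has no bounded extension to its $L^2$ closure.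
   Context: $H$ is a real separable Hilbert space; $(e_i)$ is an orthonormal eigenbasis of $C$, $B^C_t=\sum_i\sqrt{c_i}\,W^i_te_i$ with $W^i$ independent standard real Brownian motions. $A^C_t=\operatorname{Alt}_2\int_0^tB^C_s\otimes\mathrm dB^C_s$, $\operatorname{Alt}_2(u\otimes v)=\frac12(u\otimes v-v\otimes u)$, $u\otimes v:w\mapsto\langle w,v\rangle u$; for a skew Hilbert–Schmidt operator $A$, $\alpha_A\in\Lambda^2H$ is defined by $\langle Av,u\rangle=\langle\alpha_A,u\wedge v\rangle$, where $\langle u_1\wedge u_2,v_1\wedge v_2\rangle=\det(\langle u_a,v_b\rangle)$. $\mathfrak h_{2,C}$ is the active coefficient Hilbert space with orthonormal basis $f_{ij}$ indexed by $i<j$ with $c_ic_j>0$; $K_{C,t}:\mathfrak h_{2,C}\to\Lambda^2H$ is $K_{C,t}f_{ij}=\frac t2\sqrt{c_ic_j}\,e_i\wedge e_j$. $\mathcal S_2$ denotes Hilbert–Schmidt operators and $\operatorname{Rad}^{(2)}_{\Xi,t}(K)=\sum_{i<j,\,c_ic_j>0}\Xi_{ij}(t)\,Kf_{ij}$. The algebraic active chaos space is the linear span of the active $\Xi_{ij}(t)$ in $L^2(\Omega)$; algebraic point evaluation at $\omega$ is the linear functional on this span sending each $\Xi_{ij}(t)$ to its sample value $\Xi_{ij}(t)(\omega)$. $\operatorname{Cov}$ is the covariance operator on $\Lambda^2H$. *)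

theory Defs
  imports "HOL-Probability.Probability"
begin

section \<open>Orthonormal bases\<close>

definition orthonormal_on :: "'i set \<Rightarrow> ('i \<Rightarrow> 'a::real_inner) \<Rightarrow> bool" where
  "orthonormal_on I e \<longleftrightarrow> (\<forall>i\<in>I. \<forall>j\<in>I. e i \<bullet> e j = (if i = j then 1 else 0))"

definition orthonormal_basis :: "'i set \<Rightarrow> ('i \<Rightarrow> 'a::real_inner) \<Rightarrow> bool" where
  "orthonormal_basis I e \<longleftrightarrow> orthonormal_on I e \<and> closure (span (e ` I)) = UNIV"

lemma subspace_closure:
  fixes S :: "'a::real_normed_vector set"
  assumes S: "subspace S"
  shows "subspace (closure S)"
proof (rule subspaceI)
  show "0 \<in> closure S" by (rule subsetD[OF closure_subset subspace_0[OF S]])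
next
  fix x y assume "x \<in> closure S" "y \<in> closure S"
  then obtain p q where "\<And>n::nat. p n \<in> S" "p \<longlonglongrightarrow> x" "\<And>n::nat. q n \<in> S" "q \<longlonglongrightarrow> y"
    unfolding closure_sequential by metis
  then show "x + y \<in> closure S"
    unfolding closure_sequential
    by (intro exI[of _ "\<lambda>n. p n + q n"]) (auto intro: tendsto_add subspace_add[OF S])
next
  fix a :: real and x assume "x \<in> closure S"
  then obtain p where "\<And>n::nat. p n \<in> S" "p \<longlonglongrightarrow> x"
    unfolding closure_sequential by metis
  then show "a *\<^sub>R x \<in> closure S"
    unfolding closure_sequential
    by (intro exI[of _ "\<lambda>n. a *\<^sub>R p n"]) (auto intro: tendsto_scaleR subspace_scale[OF S])
qed

lemma closed_subspace_proper_orthogonal: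
  fixes S :: "'a::{real_inner, complete_space} set"
  assumes sub: "subspace S" and cl: "closed S" and x: "x \<notin> S"
  shows "\<exists>z. norm z = 1 \<and> (\<forall>s\<in>S. z \<bullet> s = 0)"
proof -
  define d where "d = infdist x S"
  have ne: "S \<noteq> {}" using subspace_0[OF sub] by blast
  have d_le: "d \<le> norm (x - s)" if "s \<in> S" for s
    using infdist_le[OF that, of x] by (simp add: d_def dist_norm)
  have d0: "0 \<le> d" by (simp add: d_def infdist_nonneg)
  have "\<exists>y\<in>S. norm (x - y) < d + inverse (real (Suc n))" for n
  proof (rule ccontr)
    assume "\<not> ?thesis"
    then have "d + inverse (real (Suc n)) \<le> dist x y" if "y \<in> S" for y
      using that by (force simp: dist_norm)
    then have "d + inverse (real (Suc n)) \<le> infdist x S"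
      unfolding infdist_notempty[OF ne] by (intro cINF_greatest ne) auto
    then show False by (simp add: d_def)
  qed
  then obtain y where yS: "\<And>n. y n \<in> S"
    and y: "\<And>n. norm (x - y n) < d + inverse (real (Suc n))"
    by metis
  have lim: "(\<lambda>n. norm (x - y n)) \<longlonglongrightarrow> d"
  proof (rule tendsto_sandwich[of "\<lambda>_. d" _ _ "\<lambda>n. d + inverse (real (Suc n))"])
    show "(\<lambda>n. d + inverse (real (Suc n))) \<longlonglongrightarrow> d"
      using tendsto_add[OF tendsto_const[of d] LIMSEQ_inverse_real_of_nat] by simp
  qed (use y d_le yS in \<open>auto intro!: always_eventually less_imp_le\<close>)
  have par: "(norm (y m - y n))\<^sup>2 \<le> 2 * (norm (x - y m))\<^sup>2 + 2 * (norm (x - y n))\<^sup>2 - 4 * d\<^sup>2" for m n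
  proof -
    have "(1/2) *\<^sub>R (y m + y n) \<in> S"
      using sub yS by (simp add: subspace_add subspace_scale)
    then have "d\<^sup>2 \<le> (norm (x - (1/2) *\<^sub>R (y m + y n)))\<^sup>2"
      using d_le d0 by (simp add: power_mono)
    moreover have "(norm (y m - y n))\<^sup>2 + 4 * (norm (x - (1/2) *\<^sub>R (y m + y n)))\<^sup>2
        = 2 * (norm (x - y m))\<^sup>2 + 2 * (norm (x - y n))\<^sup>2"
      by (simp add: power2_norm_eq_inner algebra_simps inner_commute)
    ultimately show ?thesis by linarith
  qed
  have "Cauchy y"
  proof (rule metric_CauchyI)
    fix r :: real assume r: "0 < r"
    have "(\<lambda>n. (norm (x - y n))\<^sup>2) \<longlonglongrightarrow> d\<^sup>2" by (intro tendsto_power lim)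
    then have "\<forall>\<^sub>F n in sequentially. (norm (x - y n))\<^sup>2 < d\<^sup>2 + r\<^sup>2 / 4"
      using r by (intro order_tendstoD) auto
    then obtain N where N: "\<And>n. n \<ge> N \<Longrightarrow> (norm (x - y n))\<^sup>2 < d\<^sup>2 + r\<^sup>2 / 4"
      unfolding eventually_sequentially by blast
    have "dist (y m) (y n) < r" if "m \<ge> N" "n \<ge> N" for m n
    proof -
      have "(norm (y m - y n))\<^sup>2 < r\<^sup>2" using par[of m n] N[OF that(1)] N[OF that(2)] by linarith
      then show ?thesis using r by (simp add: dist_norm power2_less_imp_less)
    qed
    then show "\<exists>M. \<forall>m\<ge>M. \<forall>n\<ge>M. dist (y m) (y n) < r" by blast
  qed
  then obtain p where p: "y \<longlonglongrightarrow> p" using Cauchy_convergent_iff convergent_def by blast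
  have pS: "p \<in> S" using cl yS p closed_sequentially by blast
  have "(\<lambda>n. norm (x - y n)) \<longlonglongrightarrow> norm (x - p)" by (intro tendsto_intros p)
  then have np: "norm (x - p) = d" using lim LIMSEQ_unique by blast
  define w where "w = x - p"
  have w0: "w \<noteq> 0" using x pS by (auto simp: w_def)
  have orth: "w \<bullet> s = 0" if s: "s \<in> S" for s
  proof (cases "s = 0")
    case False
    define a where "a = (w \<bullet> s) / (s \<bullet> s)"
    have "p + a *\<^sub>R s \<in> S" using sub pS s by (simp add: subspace_add subspace_scale)
    then have "(norm w)\<^sup>2 \<le> (norm (x - (p + a *\<^sub>R s)))\<^sup>2"
      using d_le d0 np by (simp add: w_def power_mono)
    also have "x - (p + a *\<^sub>R s) = w - a *\<^sub>R s" by (simp add: w_def)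
    also have "(norm (w - a *\<^sub>R s))\<^sup>2 = (norm w)\<^sup>2 - 2 * a * (w \<bullet> s) + a\<^sup>2 * (s \<bullet> s)"
      unfolding power2_norm_eq_inner by (simp add: algebra_simps inner_commute power2_eq_square)
    also have "\<dots> = (norm w)\<^sup>2 - (w \<bullet> s)\<^sup>2 / (s \<bullet> s)"
      using False by (simp add: a_def field_simps power2_eq_square)
    finally have "(w \<bullet> s)\<^sup>2 / (s \<bullet> s) \<le> 0" by simp
    moreover have "s \<bullet> s > 0" using False by simp
    ultimately have "(w \<bullet> s)\<^sup>2 \<le> 0" by (simp add: divide_le_0_iff)
    then show ?thesis by simp
  qed simp
  show ?thesis
    by (rule exI[of _ "(1 / norm w) *\<^sub>R w"]) (use w0 orth in auto)
qed

lemma orthonormal_basis_exists: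
  "\<exists>B :: 'a::{real_inner, complete_space} set. orthonormal_basis B (\<lambda>b. b)"
proof -
  let ?A = "{B :: 'a set. orthonormal_on B (\<lambda>b. b)}"
  have "\<exists>M\<in>?A. \<forall>X\<in>?A. M \<subseteq> X \<longrightarrow> X = M"
  proof (rule subset_Zorn')
    fix C assume C: "subset.chain ?A C"
    have CA: "orthonormal_on Z (\<lambda>b. b)" if "Z \<in> C" for Z
      using C that by (auto simp: subset.chain_def)
    have tot: "X \<subseteq> Y \<or> Y \<subseteq> X" if "X \<in> C" "Y \<in> C" for X Y
      using subset.chain_total[OF C that] by auto
    have "x \<bullet> y = (if x = y then 1 else 0)" if xy: "x \<in> \<Union>C" "y \<in> \<Union>C" for x y
    proof -
      obtain X where X: "x \<in> X" "X \<in> C" using xy(1) by (rule UnionE)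
      obtain Y where Y: "y \<in> Y" "Y \<in> C" using xy(2) by (rule UnionE)
      from tot[OF X(2) Y(2)] show ?thesis
      proof
        assume "X \<subseteq> Y"
        with X have "x \<in> Y" by (rule_tac subsetD)
        with CA[OF Y(2)] Y(1) show ?thesis by (simp add: orthonormal_on_def)
      next
        assume "Y \<subseteq> X"
        with Y have "y \<in> X" by (rule_tac subsetD)
        with CA[OF X(2)] X(1) show ?thesis by (simp add: orthonormal_on_def)
      qed
    qed
    then show "\<Union>C \<in> ?A" unfolding mem_Collect_eq orthonormal_on_def by (intro ballI)
  qed
  then obtain B :: "'a set" where B: "orthonormal_on B (\<lambda>b. b)"
    and max: "\<And>X. orthonormal_on X (\<lambda>b. b) \<Longrightarrow> B \<subseteq> X \<Longrightarrow> X = B" by auto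
  have "closure (span B) = UNIV"
  proof (rule ccontr)
    assume "closure (span B) \<noteq> UNIV"
    then obtain x where x: "x \<notin> closure (span B)" by auto
    have "subspace (closure (span B))" by (intro subspace_closure subspace_span)
    from closed_subspace_proper_orthogonal[OF this closed_closure x]
    obtain z where z: "norm z = 1" "\<forall>s\<in>closure (span B). z \<bullet> s = 0" by (elim exE conjE)
    have zB: "z \<bullet> b = 0" if "b \<in> B" for b
      by (rule bspec[OF z(2)]) (rule subsetD[OF closure_subset span_base[OF that]])
    have zz: "z \<bullet> z = 1" using z(1) by (simp add: norm_eq_1)
    have "orthonormal_on (insert z B) (\<lambda>b. b)"
      unfolding orthonormal_on_def
    proof (intro ballI)
      fix x y assume "x \<in> insert z B" "y \<in> insert z B"
      moreover have "z \<notin> B" using zB[of z] zz by auto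
      moreover have "b \<bullet> z = 0" if "b \<in> B" for b using zB[OF that] by (simp add: inner_commute)
      ultimately show "x \<bullet> y = (if x = y then 1 else 0)"
        using B zB zz by (auto simp: orthonormal_on_def)
    qed
    then have "insert z B = B" by (rule max) (rule subset_insertI)
    then have "z \<in> B" by (rule equalityE) simp
    then show False using zB[of z] zz by simp
  qed
  then show ?thesis using B unfolding orthonormal_basis_def by (intro exI[of _ B]) simp
qed

definition some_basis :: "'a::{real_inner, complete_space} set" where
  "some_basis = (SOME B. orthonormal_basis B (\<lambda>b. b))"

lemma some_basis: "orthonormal_basis some_basis (\<lambda>b. b)"
  unfolding some_basis_def using orthonormal_basis_exists by (rule someI_ex)

lemma bessel_summable:
  assumes "orthonormal_on B (\<lambda>b. b)"
  shows "(\<lambda>b. (b \<bullet> v)\<^sup>2) summable_on B"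
proof (rule nonneg_bdd_above_summable_on)
  show "bdd_above (sum (\<lambda>b. (b \<bullet> v)\<^sup>2) ` {F. F \<subseteq> B \<and> finite F})"
  proof (rule bdd_aboveI2)
    fix F assume "F \<in> {F. F \<subseteq> B \<and> finite F}"
    then have F: "F \<subseteq> B" "finite F" by auto
    define p where "p = (\<Sum>b\<in>F. (b \<bullet> v) *\<^sub>R b)"
    have bb: "b \<bullet> b' = (if b = b' then 1 else 0)" if "b \<in> F" "b' \<in> F" for b b'
      using assms F that unfolding orthonormal_on_def by blast
    have pp: "p \<bullet> p = (\<Sum>b\<in>F. (b \<bullet> v)\<^sup>2)"
    proof -
      have "p \<bullet> p = (\<Sum>b\<in>F. \<Sum>b'\<in>F. (b \<bullet> v) * ((b' \<bullet> v) * (b \<bullet> b')))"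
        by (simp add: p_def inner_sum_left inner_sum_right sum_distrib_left algebra_simps inner_commute)
      also have "\<dots> = (\<Sum>b\<in>F. \<Sum>b'\<in>F. if b = b' then (b \<bullet> v)\<^sup>2 else 0)"
        by (intro sum.cong refl) (auto simp: bb power2_eq_square)
      finally show ?thesis using F by simp
    qed
    have pv: "p \<bullet> v = (\<Sum>b\<in>F. (b \<bullet> v)\<^sup>2)"
      by (simp add: p_def inner_sum_left power2_eq_square)
    have "0 \<le> (v - p) \<bullet> (v - p)" by simp
    then show "sum (\<lambda>b. (b \<bullet> v)\<^sup>2) F \<le> v \<bullet> v"
      using pp pv by (simp add: algebra_simps inner_commute)
  qed
qed simp


section \<open>The Hilbert space of Hilbert--Schmidt operators\<close>

text \<open>The Hilbert--Schmidt inner product does not depend on the orthonormal basis used to compute it;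
  \<^const>\<open>some_basis\<close> is an arbitrary choice.\<close>

typedef (overloaded) ('a, 'b) hs =
  "{T :: 'a::{real_inner, complete_space} \<Rightarrow>\<^sub>L 'b::real_inner.
      (\<lambda>b. (norm (blinfun_apply T b))\<^sup>2) summable_on some_basis}"
  morphisms hs_op Abs_hs
  by (rule exI[of _ 0]) simp

setup_lifting type_definition_hs

definition hs_apply :: "('a::{real_inner, complete_space}, 'b::real_inner) hs \<Rightarrow> 'a \<Rightarrow> 'b" where
  "hs_apply T = blinfun_apply (hs_op T)"

lemma hs_summable: "(\<lambda>b. (norm (hs_apply T b))\<^sup>2) summable_on some_basis"
  using hs_op[of T] by (simp add: hs_apply_def)

lemma square_summable_add:
  fixes f g :: "'i \<Rightarrow> 'a::real_inner"
  assumes "(\<lambda>i. (norm (f i))\<^sup>2) summable_on A" "(\<lambda>i. (norm (g i))\<^sup>2) summable_on A"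
  shows "(\<lambda>i. (norm (f i + g i))\<^sup>2) summable_on A"
proof (rule summable_on_comparison_test)
  show "(\<lambda>i. 2 * (norm (f i))\<^sup>2 + 2 * (norm (g i))\<^sup>2) summable_on A"
    by (intro summable_on_add summable_on_cmult_right assms)
  fix i
  have "0 \<le> (norm (f i - g i))\<^sup>2" by simp
  then show "(norm (f i + g i))\<^sup>2 \<le> 2 * (norm (f i))\<^sup>2 + 2 * (norm (g i))\<^sup>2"
    by (simp add: power2_norm_eq_inner algebra_simps inner_commute)
qed auto

lemma square_summable_inner:
  fixes f g :: "'i \<Rightarrow> 'a::real_inner"
  assumes "(\<lambda>i. (norm (f i))\<^sup>2) summable_on A" "(\<lambda>i. (norm (g i))\<^sup>2) summable_on A"
  shows "(\<lambda>i. f i \<bullet> g i) summable_on A"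
proof -
  have "f i \<bullet> g i = (1/2) * ((norm (f i + g i))\<^sup>2 + ((-1) * (norm (f i))\<^sup>2 + (-1) * (norm (g i))\<^sup>2))" for i
    by (simp add: power2_norm_eq_inner algebra_simps inner_commute)
  then show ?thesis
    by (simp only:) (intro summable_on_cmult_right summable_on_add square_summable_add assms)
qed

lemma hs_inner_summable: "(\<lambda>b. hs_apply S b \<bullet> hs_apply T b) summable_on some_basis"
  by (intro square_summable_inner hs_summable)

instantiation hs :: ("{real_inner, complete_space}", real_inner) real_vector
begin

lift_definition zero_hs :: "('a, 'b) hs" is 0 by simp
lift_definition plus_hs :: "('a, 'b) hs \<Rightarrow> ('a, 'b) hs \<Rightarrow> ('a, 'b) hs" is "(+)"
  by (simp add: blinfun.add_left square_summable_add)
lift_definition uminus_hs :: "('a, 'b) hs \<Rightarrow> ('a, 'b) hs" is uminus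
  by (simp add: blinfun.minus_left)
lift_definition scaleR_hs :: "real \<Rightarrow> ('a, 'b) hs \<Rightarrow> ('a, 'b) hs" is scaleR
  by (simp add: blinfun.scaleR_left power_mult_distrib summable_on_cmult_right)
definition minus_hs :: "('a, 'b) hs \<Rightarrow> ('a, 'b) hs \<Rightarrow> ('a, 'b) hs" where
  "minus_hs S T = S + - T"

instance
  by standard (simp_all add: minus_hs_def, (transfer, simp add: algebra_simps)+)

end

lemma hs_apply_simps [simp]:
  "hs_apply 0 x = 0"
  "hs_apply (S + T) x = hs_apply S x + hs_apply T x"
  "hs_apply (a *\<^sub>R S) x = a *\<^sub>R hs_apply S x"
  by (simp_all add: hs_apply_def zero_hs.rep_eq plus_hs.rep_eq scaleR_hs.rep_eq
      blinfun.add_left blinfun.scaleR_left)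

lemma hs_eq_0_iff: "T = 0 \<longleftrightarrow> (\<forall>b\<in>some_basis. hs_apply T b = 0)"
proof
  assume *: "\<forall>b\<in>some_basis. hs_apply T b = 0"
  let ?N = "{x. hs_apply T x = 0}"
  have bl: "bounded_linear (hs_apply T)"
    unfolding hs_apply_def by (rule blinfun.bounded_linear_right)
  have "closed ?N"
    by (intro closed_Collect_eq continuous_on_const linear_continuous_on bl)
  moreover have "span some_basis \<subseteq> ?N"
    using * by (intro span_minimal)
      (auto simp: subspace_def hs_apply_def blinfun.zero_right blinfun.add_right blinfun.scaleR_right)
  ultimately have "closure (span some_basis) \<subseteq> ?N" by (rule closure_minimal[rotated])
  then have "hs_apply T x = 0" for x
    using some_basis unfolding orthonormal_basis_def by auto
  then show "T = 0"
    unfolding hs_apply_def by transfer (simp add: blinfun_eqI)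
qed simp

instantiation hs :: ("{real_inner, complete_space}", real_inner) real_inner
begin

definition inner_hs :: "('a, 'b) hs \<Rightarrow> ('a, 'b) hs \<Rightarrow> real" where
  "inner_hs S T = (\<Sum>\<^sub>\<infinity>b\<in>some_basis. hs_apply S b \<bullet> hs_apply T b)"
definition norm_hs :: "('a, 'b) hs \<Rightarrow> real" where
  "norm_hs T = sqrt (T \<bullet> T)"
definition dist_hs :: "('a, 'b) hs \<Rightarrow> ('a, 'b) hs \<Rightarrow> real" where
  "dist_hs S T = norm (S - T)"
definition sgn_hs :: "('a, 'b) hs \<Rightarrow> ('a, 'b) hs" where
  "sgn_hs T = T /\<^sub>R norm T"
definition uniformity_hs :: "(('a, 'b) hs \<times> ('a, 'b) hs) filter" where
  "uniformity_hs = (INF e\<in>{0 <..}. principal {(S, T). dist S T < e})"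
definition open_hs :: "('a, 'b) hs set \<Rightarrow> bool" where
  "open_hs U = (\<forall>S\<in>U. eventually (\<lambda>(S', T). S' = S \<longrightarrow> T \<in> U) uniformity)"

instance
proof
  fix S T U :: "('a, 'b) hs" and r :: real
  show "dist S T = norm (S - T)" by (rule dist_hs_def)
  show "sgn T = T /\<^sub>R norm T" by (rule sgn_hs_def)
  show "norm T = sqrt (T \<bullet> T)" by (rule norm_hs_def)
  show "S \<bullet> T = T \<bullet> S" by (simp add: inner_hs_def inner_commute)
  show "(S + T) \<bullet> U = S \<bullet> U + T \<bullet> U"
    by (simp add: inner_hs_def inner_add_left infsum_add hs_inner_summable)
  show "r *\<^sub>R S \<bullet> T = r * (S \<bullet> T)"
    by (simp add: inner_hs_def infsum_cmult_right hs_inner_summable)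
  show "0 \<le> T \<bullet> T" by (simp add: inner_hs_def infsum_nonneg)
  show "T \<bullet> T = 0 \<longleftrightarrow> T = 0"
  proof
    assume "T \<bullet> T = 0"
    then have "hs_apply T b \<bullet> hs_apply T b = 0" if "b \<in> some_basis" for b
      using that hs_inner_summable[of T T]
      by (intro nonneg_infsum_le_0D[of "\<lambda>b. hs_apply T b \<bullet> hs_apply T b" some_basis])
        (auto simp: inner_hs_def)
    then show "T = 0" by (simp add: hs_eq_0_iff)
  qed (simp add: inner_hs_def)
qed (rule uniformity_hs_def open_hs_def)+

end

text \<open>\<open>tensor u v\<close> is the rank-one operator \<open>u \<otimes> v : w \<mapsto> \<langle>w, v\<rangle> u\<close>.\<close>

lift_definition tensor :: "'b::real_inner \<Rightarrow> 'a::{real_inner, complete_space} \<Rightarrow> ('a, 'b) hs" is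
  "\<lambda>u v. Blinfun (\<lambda>w. (w \<bullet> v) *\<^sub>R u)"
proof -
  fix u :: 'b and v :: 'a
  have "bounded_linear (\<lambda>w. (w \<bullet> v) *\<^sub>R u)"
    by (intro bounded_linear_scaleR_const bounded_linear_inner_left)
  moreover have "(\<lambda>b. (b \<bullet> v)\<^sup>2) summable_on (some_basis :: 'a set)"
    by (intro bessel_summable conjunct1[OF some_basis[unfolded orthonormal_basis_def]])
  ultimately show "(\<lambda>b. (norm (blinfun_apply (Blinfun (\<lambda>w. (w \<bullet> v) *\<^sub>R u)) b))\<^sup>2)
      summable_on some_basis"
    by (simp add: bounded_linear_Blinfun_apply power_mult_distrib summable_on_cmult_left)
qed

lemma hs_apply_tensor [simp]: "hs_apply (tensor u v) w = (w \<bullet> v) *\<^sub>R u"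
proof -
  have "bounded_linear (\<lambda>w. (w \<bullet> v) *\<^sub>R u)"
    by (intro bounded_linear_scaleR_const bounded_linear_inner_left)
  then show ?thesis by (simp add: hs_apply_def tensor.rep_eq bounded_linear_Blinfun_apply)
qed

definition Alt2 :: "('h::{real_inner, complete_space}, 'h) hs \<Rightarrow> ('h, 'h) hs" where
  "Alt2 = (THE L. bounded_linear L \<and>
     (\<forall>u v. L (tensor u v) = (1/2) *\<^sub>R (tensor u v - tensor v u)))"


section \<open>Positive trace-class operators, exterior square\<close>

definition positive_trace_class :: "('h::real_inner \<Rightarrow>\<^sub>L 'h) \<Rightarrow> bool" where
  "positive_trace_class C \<longleftrightarrow>
     (\<forall>x y. blinfun_apply C x \<bullet> y = x \<bullet> blinfun_apply C y) \<and>
     (\<forall>x. 0 \<le> blinfun_apply C x \<bullet> x) \<and>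
     (\<forall>B. orthonormal_basis B (\<lambda>b. b) \<longrightarrow> (\<lambda>b. blinfun_apply C b \<bullet> b) summable_on B)"

definition finite_rank :: "('a::real_normed_vector \<Rightarrow>\<^sub>L 'b::real_normed_vector) \<Rightarrow> bool" where
  "finite_rank T \<longleftrightarrow> (\<exists>S. finite S \<and> range (blinfun_apply T) \<subseteq> span S)"

text \<open>A Hilbert space \<open>'l\<close> together with \<open>wedge\<close> is a realisation of \<open>\<Lambda>\<^sup>2H\<close> (unique up to a unique
  isometry intertwining the wedge maps) iff \<open>wedge\<close> is an alternating bilinear map with dense linear
  span and the determinant inner product.\<close>

definition exterior_square :: "('h::real_inner \<Rightarrow> 'h \<Rightarrow> 'l::real_inner) \<Rightarrow> bool" where
  "exterior_square wedge \<longleftrightarrow>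
     bilinear wedge \<and> (\<forall>u. wedge u u = 0) \<and>
     (\<forall>u1 u2 v1 v2. wedge u1 u2 \<bullet> wedge v1 v2
        = (u1 \<bullet> v1) * (u2 \<bullet> v2) - (u1 \<bullet> v2) * (u2 \<bullet> v1)) \<and>
     closure (span (range (\<lambda>(u, v). wedge u v))) = UNIV"

definition exterior_square_op ::
  "('h::real_inner \<Rightarrow> 'h \<Rightarrow> 'l::real_inner) \<Rightarrow> ('h \<Rightarrow>\<^sub>L 'h) \<Rightarrow> 'l \<Rightarrow>\<^sub>L 'l" where
  "exterior_square_op wedge C = (THE T. \<forall>u v.
     blinfun_apply T (wedge u v) = wedge (blinfun_apply C u) (blinfun_apply C v))"

text \<open>The bivector of a skew Hilbert--Schmidt operator.\<close>

definition bivector ::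
  "('h::{real_inner, complete_space} \<Rightarrow> 'h \<Rightarrow> 'l::real_inner) \<Rightarrow> ('h, 'h) hs \<Rightarrow> 'l" where
  "bivector wedge A = (THE \<alpha>. \<forall>u v. hs_apply A v \<bullet> u = \<alpha> \<bullet> wedge u v)"


section \<open>Square-integrable random elements\<close>

text \<open>Elements of \<open>L\<^sup>2(\<Omega>; E)\<close> are represented by functions and compared almost everywhere.
  Measurability is strong (Bochner) measurability, so \<open>E\<close> need not be separable.\<close>

definition strongly_measurable :: "'w measure \<Rightarrow> ('w \<Rightarrow> 'e::real_normed_vector) \<Rightarrow> bool" where
  "strongly_measurable M f \<longleftrightarrow>
     (\<exists>s. (\<forall>n. simple_function M (s n)) \<and> (\<forall>\<omega>\<in>space M. (\<lambda>n. s n \<omega>) \<longlonglongrightarrow> f \<omega>))"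

definition L2 :: "'w measure \<Rightarrow> ('w \<Rightarrow> 'e::real_inner) set" where
  "L2 M = {f. strongly_measurable M f \<and> integrable M (\<lambda>\<omega>. (norm (f \<omega>))\<^sup>2)}"

definition L2_norm :: "'w measure \<Rightarrow> ('w \<Rightarrow> 'e::real_inner) \<Rightarrow> real" where
  "L2_norm M f = sqrt (\<integral>\<omega>. (norm (f \<omega>))\<^sup>2 \<partial>M)"

definition L2_tendsto ::
  "'w measure \<Rightarrow> ('n \<Rightarrow> 'w \<Rightarrow> 'e::real_inner) \<Rightarrow> ('w \<Rightarrow> 'e) \<Rightarrow> 'n filter \<Rightarrow> bool" where
  "L2_tendsto M f g F \<longleftrightarrow> (\<forall>\<^sub>F n in F. f n \<in> L2 M) \<and> g \<in> L2 M \<and>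
     ((\<lambda>n. L2_norm M (\<lambda>\<omega>. f n \<omega> - g \<omega>)) \<longlongrightarrow> 0) F"

definition L2_orthonormal :: "'w measure \<Rightarrow> 'p set \<Rightarrow> ('p \<Rightarrow> 'w \<Rightarrow> real) \<Rightarrow> bool" where
  "L2_orthonormal M A X \<longleftrightarrow> (\<forall>p\<in>A. X p \<in> L2 M) \<and>
     (\<forall>p\<in>A. \<forall>q\<in>A. (\<integral>\<omega>. X p \<omega> * X q \<omega> \<partial>M) = (if p = q then 1 else 0))"

definition L2_linear_isometry ::
  "'w measure \<Rightarrow> ('k::real_normed_vector \<Rightarrow> 'w \<Rightarrow> 'e::real_inner) \<Rightarrow> bool" where
  "L2_linear_isometry M R \<longleftrightarrow>
     (\<forall>K. R K \<in> L2 M \<and> L2_norm M (R K) = norm K) \<and>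
     (\<forall>a b K K'. AE \<omega> in M. R (a *\<^sub>R K + b *\<^sub>R K') \<omega> = a *\<^sub>R R K \<omega> + b *\<^sub>R R K' \<omega>)"

definition covariance_op :: "'w measure \<Rightarrow> ('w \<Rightarrow> 'l::real_inner) \<Rightarrow> 'l \<Rightarrow>\<^sub>L 'l" where
  "covariance_op M X = (THE T. \<forall>a b. blinfun_apply T a \<bullet> b =
     (\<integral>\<omega>. (X \<omega> \<bullet> a - (\<integral>\<omega>'. X \<omega>' \<bullet> a \<partial>M)) * (X \<omega> \<bullet> b - (\<integral>\<omega>'. X \<omega>' \<bullet> b \<partial>M)) \<partial>M))"


section \<open>Brownian motion and the Ito integral\<close>

definition brownian_motion :: "'w measure \<Rightarrow> (real \<Rightarrow> 'w \<Rightarrow> real) \<Rightarrow> bool" where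
  "brownian_motion M W \<longleftrightarrow>
     (\<forall>t\<ge>0. W t \<in> borel_measurable M) \<and>
     (AE \<omega> in M. W 0 \<omega> = 0) \<and>
     (AE \<omega> in M. continuous_on {0..} (\<lambda>t. W t \<omega>)) \<and>
     (\<forall>s t. 0 \<le> s \<and> s < t \<longrightarrow>
        distributed M lborel (\<lambda>\<omega>. W t \<omega> - W s \<omega>) (normal_density 0 (sqrt (t - s)))) \<and>
     (\<forall>\<tau> n. 0 \<le> \<tau> 0 \<and> mono \<tau> \<longrightarrow>
        prob_space.indep_vars M (\<lambda>_. borel) (\<lambda>k \<omega>. W (\<tau> (Suc k)) \<omega> - W (\<tau> k) \<omega>) {..<n::nat})"

definition independent_processes ::
  "'w measure \<Rightarrow> 'i set \<Rightarrow> ('i \<Rightarrow> real \<Rightarrow> 'w \<Rightarrow> real) \<Rightarrow> bool" where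
  "independent_processes M I W \<longleftrightarrow>
     prob_space.indep_vars M (\<lambda>_. \<Pi>\<^sub>M t\<in>{0..}. borel) (\<lambda>i \<omega>. \<lambda>t\<in>{0..}. W i t \<omega>) I"

definition natural_filtration ::
  "'w measure \<Rightarrow> 'i set \<Rightarrow> ('i \<Rightarrow> real \<Rightarrow> 'w \<Rightarrow> real) \<Rightarrow> real \<Rightarrow> 'w measure" where
  "natural_filtration M I W s = sigma (space M)
     {W i r -` A \<inter> space M | i r A. i \<in> I \<and> 0 \<le> r \<and> r \<le> s \<and> A \<in> sets borel}"

text \<open>The elementary process \<open>\<Sum>\<^sub>k \<xi>\<^sub>k 1\<^bsub>(\<tau>\<^sub>k, \<tau>\<^bsub>k+1\<^esub>]\<^esub>\<close>, \<open>k < pieces\<close>.\<close>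

record ('w, 'x) elementary_process =
  pieces :: nat
  times :: "nat \<Rightarrow> real"
  coeff :: "nat \<Rightarrow> 'w \<Rightarrow> 'x"

definition elementary_adapted ::
  "'w measure \<Rightarrow> (real \<Rightarrow> 'w measure) \<Rightarrow> real \<Rightarrow> ('w, 'x::real_inner) elementary_process \<Rightarrow> bool" where
  "elementary_adapted M F T S \<longleftrightarrow>
     (\<forall>k<pieces S. 0 \<le> times S k \<and> times S k \<le> times S (Suc k) \<and> times S (Suc k) \<le> T \<and>
        strongly_measurable (F (times S k)) (coeff S k) \<and> coeff S k \<in> L2 M)"

definition elementary_value ::
  "('w, 'x::real_vector) elementary_process \<Rightarrow> real \<Rightarrow> 'w \<Rightarrow> 'x" where
  "elementary_value S s \<omega> =
     (\<Sum>k<pieces S. indicator {times S k<..times S (Suc k)} s *\<^sub>R coeff S k \<omega>)"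

definition elementary_integral ::
  "('x \<Rightarrow> 'b \<Rightarrow> 'y) \<Rightarrow> (real \<Rightarrow> 'w \<Rightarrow> 'b::real_vector) \<Rightarrow>
    ('w, 'x::real_vector) elementary_process \<Rightarrow> 'w \<Rightarrow> 'y::real_vector" where
  "elementary_integral prd Z S \<omega> =
     (\<Sum>k<pieces S. prd (coeff S k \<omega>) (Z (times S (Suc k)) \<omega> - Z (times S k) \<omega>))"

text \<open>\<open>J\<close> is a version of \<open>\<integral>\<^sub>0\<^sup>T prd(X\<^sub>s, dZ\<^sub>s)\<close>: the \<open>L\<^sup>2\<close>-limit of the integrals of adapted elementary
  processes converging to \<open>X\<close> in \<open>L\<^sup>2(ds \<otimes> P)\<close>. The bilinear map \<open>prd\<close> is multiplication for scalar
  integrals and \<^const>\<open>tensor\<close> for \<open>\<integral> X \<otimes> dZ\<close>.\<close>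

definition has_ito_integral ::
  "('x \<Rightarrow> 'b \<Rightarrow> 'y) \<Rightarrow> 'w measure \<Rightarrow> (real \<Rightarrow> 'w measure) \<Rightarrow> (real \<Rightarrow> 'w \<Rightarrow> 'x::real_inner) \<Rightarrow>
    (real \<Rightarrow> 'w \<Rightarrow> 'b::real_inner) \<Rightarrow> real \<Rightarrow> ('w \<Rightarrow> 'y::real_inner) \<Rightarrow> bool" where
  "has_ito_integral prd M F X Z T J \<longleftrightarrow>
     (\<forall>s\<in>{0..T}. strongly_measurable (F s) (X s) \<and> X s \<in> L2 M) \<and>
     (\<exists>S. (\<forall>n::nat. elementary_adapted M F T (S n)) \<and>
        (\<forall>n. (\<lambda>s. \<integral>\<^sup>+ \<omega>. ennreal ((norm (elementary_value (S n) s \<omega> - X s \<omega>))\<^sup>2) \<partial>M)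
            \<in> borel_measurable (restrict_space borel {0..T})) \<and>
        (\<lambda>n. \<integral>\<^sup>+ s\<in>{0..T}. (\<integral>\<^sup>+ \<omega>. ennreal ((norm (elementary_value (S n) s \<omega> - X s \<omega>))\<^sup>2) \<partial>M) \<partial>lborel)
            \<longlonglongrightarrow> 0 \<and>
        L2_tendsto M (\<lambda>n. elementary_integral prd Z (S n)) J sequentially)"

definition ito_integral ::
  "('x \<Rightarrow> 'b \<Rightarrow> 'y) \<Rightarrow> 'w measure \<Rightarrow> (real \<Rightarrow> 'w measure) \<Rightarrow> (real \<Rightarrow> 'w \<Rightarrow> 'x::real_inner) \<Rightarrow>
    (real \<Rightarrow> 'w \<Rightarrow> 'b::real_inner) \<Rightarrow> real \<Rightarrow> 'w \<Rightarrow> 'y::real_inner" where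
  "ito_integral prd M F X Z T = (SOME J. has_ito_integral prd M F X Z T J)"


section \<open>The area process and its second-chaos coordinates\<close>

text \<open>The sum converges almost surely for each \<open>t\<close>; it is \<open>0\<close> where it diverges.\<close>

definition hilbert_BM ::
  "nat set \<Rightarrow> (nat \<Rightarrow> real) \<Rightarrow> (nat \<Rightarrow> 'h::real_inner) \<Rightarrow> (nat \<Rightarrow> real \<Rightarrow> 'w \<Rightarrow> real) \<Rightarrow>
    real \<Rightarrow> 'w \<Rightarrow> 'h" where
  "hilbert_BM I c e W t \<omega> = (\<Sum>\<^sub>\<infinity>i\<in>I. (sqrt (c i) * W i t \<omega>) *\<^sub>R e i)"

definition levy_area ::
  "'w measure \<Rightarrow> nat set \<Rightarrow> (nat \<Rightarrow> real) \<Rightarrow> (nat \<Rightarrow> 'h::{real_inner, complete_space}) \<Rightarrow>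
    (nat \<Rightarrow> real \<Rightarrow> 'w \<Rightarrow> real) \<Rightarrow> real \<Rightarrow> 'w \<Rightarrow> ('h, 'h) hs" where
  "levy_area M I c e W t \<omega> =
     Alt2 (ito_integral tensor M (natural_filtration M I W) (hilbert_BM I c e W) (hilbert_BM I c e W) t \<omega>)"

definition Xi ::
  "'w measure \<Rightarrow> nat set \<Rightarrow> (nat \<Rightarrow> real \<Rightarrow> 'w \<Rightarrow> real) \<Rightarrow> real \<Rightarrow> nat \<times> nat \<Rightarrow> 'w \<Rightarrow> real" where
  "Xi M I W t = (\<lambda>(i, j) \<omega>. inverse t *
     (ito_integral (*) M (natural_filtration M I W) (W i) (W j) t \<omega> -
      ito_integral (*) M (natural_filtration M I W) (W j) (W i) t \<omega>))"

definition active :: "nat set \<Rightarrow> (nat \<Rightarrow> real) \<Rightarrow> (nat \<times> nat) set" where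
  "active I c = {(i, j). i \<in> I \<and> j \<in> I \<and> i < j \<and> 0 < c i * c j}"

text \<open>\<open>f\<close> is the orthonormal basis of the coefficient space indexed by \<open>A\<close>; \<open>Rad\<close> is the
  (unconditional) \<open>L\<^sup>2\<close>-sum of the series \<open>\<Sum>\<^bsub>p\<in>A\<^esub> \<Xi>\<^sub>p K f\<^sub>p\<close>.\<close>

definition Rad_partial ::
  "('p \<Rightarrow> 'k::{real_inner, complete_space}) \<Rightarrow> ('p \<Rightarrow> 'w \<Rightarrow> real) \<Rightarrow> ('k, 'e::real_inner) hs \<Rightarrow>
    'p set \<Rightarrow> 'w \<Rightarrow> 'e" where
  "Rad_partial f X K P \<omega> = (\<Sum>p\<in>P. X p \<omega> *\<^sub>R hs_apply K (f p))"

definition Rad ::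
  "'w measure \<Rightarrow> 'p set \<Rightarrow> ('p \<Rightarrow> 'k::{real_inner, complete_space}) \<Rightarrow> ('p \<Rightarrow> 'w \<Rightarrow> real) \<Rightarrow>
    ('k, 'e::real_inner) hs \<Rightarrow> 'w \<Rightarrow> 'e" where
  "Rad M A f X K = (SOME g. L2_tendsto M (Rad_partial f X K) g (finite_subsets_at_top A))"

definition K_op ::
  "nat set \<Rightarrow> (nat \<Rightarrow> real) \<Rightarrow> (nat \<Rightarrow> 'h) \<Rightarrow> ('h \<Rightarrow> 'h \<Rightarrow> 'l::real_inner) \<Rightarrow>
    (nat \<times> nat \<Rightarrow> 'k::{real_inner, complete_space}) \<Rightarrow> real \<Rightarrow> ('k, 'l) hs" where
  "K_op I c e wedge f t = (THE K. \<forall>(i, j)\<in>active I c.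
     hs_apply K (f (i, j)) = (t / 2 * sqrt (c i * c j)) *\<^sub>R wedge (e i) (e j))"


section \<open>Point evaluation on a chaos space\<close>

text \<open>The linear span of \<open>{X p | p \<in> A}\<close> in \<open>L\<^sup>2(\<Omega>)\<close>, as a set of representatives closed under
  almost-everywhere equality.\<close>

definition chaos_space :: "'w measure \<Rightarrow> 'p set \<Rightarrow> ('p \<Rightarrow> 'w \<Rightarrow> real) \<Rightarrow> ('w \<Rightarrow> real) set" where
  "chaos_space M A X = {g \<in> L2 M. \<exists>P a. finite P \<and> P \<subseteq> A \<and>
     (AE \<omega> in M. g \<omega> = (\<Sum>p\<in>P. a p * X p \<omega>))}"

definition L2_closure :: "'w measure \<Rightarrow> ('w \<Rightarrow> real) set \<Rightarrow> ('w \<Rightarrow> real) set" where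
  "L2_closure M V = {g. \<exists>h. (\<forall>n. h n \<in> V) \<and> L2_tendsto M h g sequentially}"

text \<open>Well defined on \<^const>\<open>chaos_space\<close> when the family is linearly independent in \<open>L\<^sup>2(\<Omega>)\<close>:
  the coefficients are then determined by the class of \<open>g\<close>.\<close>

definition point_eval :: "'w measure \<Rightarrow> 'p set \<Rightarrow> ('p \<Rightarrow> 'w \<Rightarrow> real) \<Rightarrow> 'w \<Rightarrow> ('w \<Rightarrow> real) \<Rightarrow> real" where
  "point_eval M A X \<omega> g = (THE r. \<exists>P a. finite P \<and> P \<subseteq> A \<and>
     (AE \<omega>' in M. g \<omega>' = (\<Sum>p\<in>P. a p * X p \<omega>')) \<and> r = (\<Sum>p\<in>P. a p * X p \<omega>))"

definition has_bounded_extension ::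
  "'w measure \<Rightarrow> ('w \<Rightarrow> real) set \<Rightarrow> (('w \<Rightarrow> real) \<Rightarrow> real) \<Rightarrow> bool" where
  "has_bounded_extension M V \<phi> \<longleftrightarrow> (\<exists>\<Lambda>.
     (\<forall>g\<in>L2_closure M V. \<forall>h\<in>L2_closure M V. \<forall>a b.
        \<Lambda> (\<lambda>\<omega>. a * g \<omega> + b * h \<omega>) = a * \<Lambda> g + b * \<Lambda> h) \<and>
     (\<exists>B. \<forall>g\<in>L2_closure M V. \<bar>\<Lambda> g\<bar> \<le> B * L2_norm M g) \<and>
     (\<forall>g\<in>V. \<Lambda> g = \<phi> g))"

end

theory Submission
  imports Defs
begin

text \<open>Everything rests on the scalar integrals \<open>I\<^sub>i\<^sub>j = \<integral>\<^sub>0\<^sup>t W\<^sup>i dW\<^sup>j\<close>. An increment of \<open>W\<^sup>j\<close> after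
  time \<open>s\<close> is independent of the past of \<open>W\<^sup>j\<close> together with the whole paths of all other motions
  (\<open>increment_independent\<close>). Consequently the elementary integrals of \<open>S\<close> against \<open>W\<^sup>j\<close> and of
  \<open>S'\<close> against \<open>W\<^sup>l\<close> have inner product \<open>\<delta>\<^sub>j\<^sub>l \<integral> E (S\<^sub>s S'\<^sub>s) ds\<close> (\<open>elementary_inner_sum\<close>,
  \<open>elementary_inner\<close>). This identifies every version of \<open>I\<^sub>i\<^sub>j\<close> with the \<open>L\<^sup>2\<close> limit of
  left-endpoint Riemann sums (\<open>riemann_sum_tendsto_ito\<close>) and gives
  \<open>E (I\<^sub>i\<^sub>j I\<^sub>k\<^sub>l) = \<delta>\<^sub>i\<^sub>k \<delta>\<^sub>j\<^sub>l t\<^sup>2/2\<close> (\<open>ito_inner\<close>), from which the orthonormality of the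
  \<open>\<Xi>\<^sub>i\<^sub>j = (I\<^sub>i\<^sub>j - I\<^sub>j\<^sub>i)/t\<close> is read off (\<open>Xi_orthonormal\<close>). Orthonormality makes
  \<open>K \<mapsto> \<Sum> \<Xi>\<^sub>p K f\<^sub>p\<close> isometric on finite sums, and completeness of \<open>L\<^sup>2\<close> (\<open>L2_complete\<close>)
  extends it to all Hilbert--Schmidt operators (\<open>Rad_tendsto\<close>, \<open>Rad_isometry\<close>).\<close>

text \<open>The bivector identity is an equality of coordinates along the orthonormal basis
  \<open>e\<^sub>i \<and> e\<^sub>j\<close>, \<open>i < j\<close>. Taking coordinates turns an elementary integral of tensors into a scalar one;
  therefore the matrix entries of \<open>\<integral> B \<otimes> dB\<close> are \<open>\<surd>(c\<^sub>i c\<^sub>j) I\<^sub>i\<^sub>j\<close>, whichever elementary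
  processes define the integral (\<open>tensor_ito_entry\<close>). After alternation the coordinate is
  \<open>t/2 \<surd>(c\<^sub>i c\<^sub>j) \<Xi>\<^sub>i\<^sub>j\<close>, which is also that of the radonification of \<open>K\<^sub>C\<^sub>,\<^sub>t\<close>
  (\<open>area_bivector_Rad\<close>). The radonification of any Hilbert--Schmidt operator \<open>K\<close> along a centred
  orthonormal family has covariance \<open>K K\<^sup>*\<close> (\<open>Rad_covariance\<close>), and for \<open>K = K\<^sub>C\<^sub>,\<^sub>t\<close> this is diagonal in the
  basis \<open>e\<^sub>i \<and> e\<^sub>j\<close> with the eigenvalues \<open>t\<^sup>2/4 c\<^sub>i c\<^sub>j\<close> of \<open>t\<^sup>2/4 \<Lambda>\<^sup>2C\<close> (\<open>K_op_adjoint\<close>).\<close>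

text \<open>Point evaluation at \<open>\<omega>\<close> is bounded only if the sample \<open>(\<Xi>\<^sub>p(\<omega>))\<^sub>p\<close> is square-summable
  (\<open>point_eval_unbounded\<close>). If \<open>C\<close> has infinite rank, there are infinitely many pairwise disjoint
  active pairs. Their coordinates are independent with a common nontrivial law, so that
  \<open>E exp (- \<Sum>\<^sub>m\<^sub><\<^sub>N \<Xi>\<^sub>m\<^sup>2) = \<psi>\<^sup>N\<close> with \<open>\<psi> < 1\<close>, and the squares almost surely have an infinite sum
  (\<open>Xi_squares_diverge\<close>). The factorisation with a common \<open>\<psi>\<close> is proved for the Riemann sums, which
  are fixed functions of finitely many Brownian increments, and passes to the limit
  (\<open>disjoint_pairs_Laplace\<close>).\<close>


section \<open>Orthogonal series and orthonormal bases\<close>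

lemma has_sum_bounded_linear_image:
  assumes "bounded_linear h" "(v has_sum x) A"
  shows "((\<lambda>i. h (v i)) has_sum h x) A"
proof -
  interpret bounded_linear h by fact
  have "((\<lambda>F. h (sum v F)) \<longlongrightarrow> h x) (finite_subsets_at_top A)"
    using assms(2) unfolding has_sum_def by (rule tendsto)
  then show ?thesis by (simp add: has_sum_def sum)
qed

lemma norm_sum_orthogonal:
  fixes v :: "'i \<Rightarrow> 'a::real_inner"
  assumes "finite F" "\<And>i j. i \<in> F \<Longrightarrow> j \<in> F \<Longrightarrow> i \<noteq> j \<Longrightarrow> v i \<bullet> v j = 0"
  shows "(norm (sum v F))\<^sup>2 = (\<Sum>i\<in>F. (norm (v i))\<^sup>2)"
proof -
  have "(norm (sum v F))\<^sup>2 = (\<Sum>i\<in>F. \<Sum>j\<in>F. v i \<bullet> v j)"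
    unfolding power2_norm_eq_inner inner_sum_left inner_sum_right by (rule sum.swap)
  also have "\<dots> = (\<Sum>i\<in>F. \<Sum>j\<in>F. if i = j then (norm (v i))\<^sup>2 else 0)"
    by (intro sum.cong refl) (auto simp: assms(2) power2_norm_eq_inner)
  finally show ?thesis using assms(1) by simp
qed

text \<open>By Pythagoras, finite sums of an orthogonal family differ by the square root of a tail of
  \<open>\<Sum>\<^sub>i \<parallel>v\<^sub>i\<parallel>\<^sup>2\<close>, so that they form a Cauchy net.\<close>

lemma orthogonal_summable:
  fixes v :: "'i \<Rightarrow> 'a::{real_inner, complete_space}"
  assumes orth: "\<And>i j. i \<in> A \<Longrightarrow> j \<in> A \<Longrightarrow> i \<noteq> j \<Longrightarrow> v i \<bullet> v j = 0"
    and sq: "(\<lambda>i. (norm (v i))\<^sup>2) summable_on A"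
  shows "v summable_on A"
proof -
  define S where "S = (\<Sum>\<^sub>\<infinity>i\<in>A. (norm (v i))\<^sup>2)"
  have lim: "((\<lambda>F. \<Sum>i\<in>F. (norm (v i))\<^sup>2) \<longlongrightarrow> S) (finite_subsets_at_top A)"
    using has_sum_infsum[OF sq] by (simp add: has_sum_def S_def)
  have "\<exists>P. eventually P (finite_subsets_at_top A) \<and>
      (\<forall>F G. P F \<and> P G \<longrightarrow> dist (sum v F) (sum v G) < \<epsilon>)" if \<epsilon>: "\<epsilon> > 0" for \<epsilon>
  proof -
    have "\<forall>\<^sub>F F in finite_subsets_at_top A. S - (\<epsilon>/2)\<^sup>2 < (\<Sum>i\<in>F. (norm (v i))\<^sup>2)"
      by (rule order_tendstoD(1)[OF lim]) (use \<epsilon> in simp)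
    then obtain F0 where F0: "finite F0" "F0 \<subseteq> A" "S - (\<epsilon>/2)\<^sup>2 < (\<Sum>i\<in>F0. (norm (v i))\<^sup>2)"
      unfolding eventually_finite_subsets_at_top by auto
    have near: "dist (sum v F) (sum v F0) < \<epsilon>/2" if F: "finite F" "F0 \<subseteq> F" "F \<subseteq> A" for F
    proof -
      have le: "(\<Sum>i\<in>F. (norm (v i))\<^sup>2) \<le> S"
        unfolding S_def by (rule finite_sum_le_infsum[OF sq]) (use F in auto)
      have "sum v F - sum v F0 = sum v (F - F0)"
        using F by (simp add: sum_diff)
      moreover have "(norm (sum v (F - F0)))\<^sup>2 = (\<Sum>i\<in>F - F0. (norm (v i))\<^sup>2)"
        using F by (intro norm_sum_orthogonal orth) auto
      ultimately have "(norm (sum v F - sum v F0))\<^sup>2 = (\<Sum>i\<in>F - F0. (norm (v i))\<^sup>2)"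
        by simp
      also have "\<dots> = (\<Sum>i\<in>F. (norm (v i))\<^sup>2) - (\<Sum>i\<in>F0. (norm (v i))\<^sup>2)"
        using F by (simp add: sum_diff)
      also have "\<dots> < (\<epsilon>/2)\<^sup>2" using F0(3) le by linarith
      finally show ?thesis unfolding dist_norm by (rule power2_less_imp_less) (use \<epsilon> in simp)
    qed
    have "dist (sum v F) (sum v G) < \<epsilon>"
      if "finite F \<and> F0 \<subseteq> F \<and> F \<subseteq> A" "finite G \<and> F0 \<subseteq> G \<and> G \<subseteq> A" for F G
      using dist_triangle2[of "sum v F" "sum v G" "sum v F0"] near[of F] near[of G] that by auto
    moreover have "\<forall>\<^sub>F F in finite_subsets_at_top A. finite F \<and> F0 \<subseteq> F \<and> F \<subseteq> A"
      using F0 unfolding eventually_finite_subsets_at_top by blast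
    ultimately show ?thesis
      by (intro exI[of _ "\<lambda>F. finite F \<and> F0 \<subseteq> F \<and> F \<subseteq> A"] conjI allI impI) auto
  qed
  then have "cauchy_filter (filtermap (sum v) (finite_subsets_at_top A))"
    by (simp add: cauchy_filter_metric_filtermap)
  moreover have "Topological_Spaces.complete (UNIV::'a set)"
    by (meson Cauchy_convergent UNIV_I complete_def convergent_def)
  ultimately obtain x where "(sum v \<longlongrightarrow> x) (finite_subsets_at_top A)"
    using complete_uniform[where S=UNIV] by (force simp add: filterlim_def)
  then show ?thesis using summable_on_def has_sum_def by blast
qed

lemma orthogonal_has_sum_norm:
  fixes v :: "'i \<Rightarrow> 'a::real_inner"
  assumes orth: "\<And>i j. i \<in> A \<Longrightarrow> j \<in> A \<Longrightarrow> i \<noteq> j \<Longrightarrow> v i \<bullet> v j = 0"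
    and sum: "(v has_sum x) A"
  shows "((\<lambda>i. (norm (v i))\<^sup>2) has_sum (norm x)\<^sup>2) A"
proof -
  have "((\<lambda>F. (norm (sum v F))\<^sup>2) \<longlongrightarrow> (norm x)\<^sup>2) (finite_subsets_at_top A)"
    using sum unfolding has_sum_def by (intro tendsto_intros)
  moreover have "\<forall>\<^sub>F F in finite_subsets_at_top A.
      (norm (sum v F))\<^sup>2 = (\<Sum>i\<in>F. (norm (v i))\<^sup>2)"
    by (rule eventually_finite_subsets_at_top_weakI) (intro norm_sum_orthogonal, auto intro: orth)
  ultimately show ?thesis unfolding has_sum_def by (simp add: tendsto_cong)
qed

lemma orthonormal_onD:
  assumes "orthonormal_on A e" "i \<in> A"
  shows "j \<in> A \<Longrightarrow> e i \<bullet> e j = (if i = j then 1 else 0)" and "norm (e i) = 1"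
  using assms by (auto simp: orthonormal_on_def norm_eq_1)

lemma orthonormal_basisD: "orthonormal_basis A e \<Longrightarrow> orthonormal_on A e"
  by (simp add: orthonormal_basis_def)

lemma orthonormal_on_inj: "orthonormal_on A e \<Longrightarrow> inj_on e A"
  by (rule inj_onI) (metis orthonormal_on_def zero_neq_one)

lemma orthonormal_combination_norm:
  assumes "orthonormal_on A e" "finite F" "F \<subseteq> A"
  shows "(norm (\<Sum>i\<in>F. a i *\<^sub>R e i))\<^sup>2 = (\<Sum>i\<in>F. (a i)\<^sup>2)"
proof -
  have "(norm (\<Sum>i\<in>F. a i *\<^sub>R e i))\<^sup>2 = (\<Sum>i\<in>F. (norm (a i *\<^sub>R e i))\<^sup>2)"
    using assms by (intro norm_sum_orthogonal) (auto simp: orthonormal_on_def subset_iff)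
  also have "\<dots> = (\<Sum>i\<in>F. (a i)\<^sup>2)"
    using assms by (intro sum.cong refl) (auto simp: orthonormal_onD power_mult_distrib)
  finally show ?thesis .
qed

lemma orthonormal_projection_defect:
  assumes "orthonormal_on A e" "finite F" "F \<subseteq> A"
  shows "(norm (x - (\<Sum>i\<in>F. (x \<bullet> e i) *\<^sub>R e i)))\<^sup>2 = (norm x)\<^sup>2 - (\<Sum>i\<in>F. (x \<bullet> e i)\<^sup>2)"
proof -
  have "(norm (x - (\<Sum>i\<in>F. (x \<bullet> e i) *\<^sub>R e i)))\<^sup>2
      = (norm x)\<^sup>2 - 2 * (x \<bullet> (\<Sum>i\<in>F. (x \<bullet> e i) *\<^sub>R e i)) + (norm (\<Sum>i\<in>F. (x \<bullet> e i) *\<^sub>R e i))\<^sup>2"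
    by (simp add: power2_norm_eq_inner algebra_simps inner_commute)
  also have "x \<bullet> (\<Sum>i\<in>F. (x \<bullet> e i) *\<^sub>R e i) = (\<Sum>i\<in>F. (x \<bullet> e i)\<^sup>2)"
    by (simp add: inner_sum_right power2_eq_square)
  finally show ?thesis by (simp add: orthonormal_combination_norm[OF assms])
qed

lemma bessel_finite:
  assumes "orthonormal_on A e" "finite F" "F \<subseteq> A"
  shows "(\<Sum>i\<in>F. (x \<bullet> e i)\<^sup>2) \<le> (norm x)\<^sup>2"
  using orthonormal_projection_defect[OF assms, of x] zero_le_power2[of "norm (x - (\<Sum>i\<in>F. (x \<bullet> e i) *\<^sub>R e i))"]
  by linarith

lemma bessel:
  assumes "orthonormal_on A e"
  shows "(\<lambda>i. (x \<bullet> e i)\<^sup>2) summable_on A" "(\<Sum>\<^sub>\<infinity>i\<in>A. (x \<bullet> e i)\<^sup>2) \<le> (norm x)\<^sup>2"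
proof -
  show *: "(\<lambda>i. (x \<bullet> e i)\<^sup>2) summable_on A"
    using bessel_finite[OF assms] by (intro nonneg_bdd_above_summable_on bdd_aboveI2) auto
  show "(\<Sum>\<^sub>\<infinity>i\<in>A. (x \<bullet> e i)\<^sup>2) \<le> (norm x)\<^sup>2"
    by (rule infsum_le_finite_sums[OF *]) (rule bessel_finite[OF assms])
qed

lemma basis_eqI:
  assumes e: "orthonormal_basis A e" and eq: "\<And>i. i \<in> A \<Longrightarrow> x \<bullet> e i = y \<bullet> e i"
  shows "x = y"
proof -
  let ?N = "{z. (x - y) \<bullet> z = 0}"
  have "closed ?N" by (intro closed_Collect_eq continuous_intros)
  moreover have "span (e ` A) \<subseteq> ?N"
    using eq by (intro span_minimal) (auto simp: subspace_def inner_add_right inner_diff_left)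
  ultimately have "closure (span (e ` A)) \<subseteq> ?N" by (rule closure_minimal[rotated])
  then have "UNIV \<subseteq> ?N" using e by (simp add: orthonormal_basis_def)
  then have "x - y \<in> ?N" by (rule subsetD) simp
  then show ?thesis by simp
qed

lemma bounded_linear_basis_eqI:
  assumes e: "orthonormal_basis A e" and F: "bounded_linear F" and G: "bounded_linear G"
    and eq: "\<And>i. i \<in> A \<Longrightarrow> F (e i) = G (e i)"
  shows "F x = G x"
proof -
  interpret F: bounded_linear F by fact
  interpret G: bounded_linear G by fact
  let ?N = "{z. F z = G z}"
  have "closed ?N" by (intro closed_Collect_eq linear_continuous_on F G)
  moreover have "span (e ` A) \<subseteq> ?N"
    using eq by (intro span_minimal) (auto simp: subspace_def F.add G.add F.scale G.scale F.zero G.zero)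
  ultimately have "closure (span (e ` A)) \<subseteq> ?N" by (rule closure_minimal[rotated])
  then show ?thesis using e by (auto simp: orthonormal_basis_def)
qed

text \<open>The projection onto finitely many basis vectors is the best approximation from their span; hence it is
  at least as close as an approximant given by density.\<close>

lemma parseval:
  assumes e: "orthonormal_basis A e"
  shows "((\<lambda>i. (x \<bullet> e i) *\<^sub>R e i) has_sum x) A"
  unfolding has_sum_def
proof (rule tendstoI)
  fix \<epsilon> :: real assume \<epsilon>: "\<epsilon> > 0"
  have on: "orthonormal_on A e" using e by (rule orthonormal_basisD)
  have "x \<in> closure (span (e ` A))" using e by (simp add: orthonormal_basis_def)
  then obtain y where y: "y \<in> span (e ` A)" "dist y x < \<epsilon>"
    using \<epsilon> by (auto simp: closure_approachable)
  obtain T r where T: "finite T" "T \<subseteq> e ` A" "y = (\<Sum>z\<in>T. r z *\<^sub>R z)"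
    using y(1) unfolding span_explicit by auto
  obtain F0 where F0: "F0 \<subseteq> A" "finite F0" "T = e ` F0"
    using finite_subset_image[OF T(1,2)] by auto
  have near: "dist (\<Sum>i\<in>F. (x \<bullet> e i) *\<^sub>R e i) x < \<epsilon>" if F: "finite F" "F0 \<subseteq> F" "F \<subseteq> A" for F
  proof -
    define p where "p = (\<Sum>i\<in>F. (x \<bullet> e i) *\<^sub>R e i)"
    have pe: "(x - p) \<bullet> e i = 0" if "i \<in> F" for i
    proof -
      have "p \<bullet> e i = (\<Sum>j\<in>F. if j = i then x \<bullet> e i else 0)"
        unfolding p_def inner_sum_left using F that
        by (intro sum.cong refl) (auto simp: orthonormal_onD[OF on] subset_iff)
      then show ?thesis using F that by (simp add: inner_diff_left)
    qed
    have span: "z \<in> span (e ` F) \<Longrightarrow> (x - p) \<bullet> z = 0" for z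
      by (induction rule: span_induct) (auto simp: pe subspace_def inner_add_right)
    have "y \<in> span (e ` F)"
      unfolding T(3) F0(3) using F by (intro span_sum span_scale span_base) auto
    moreover have "p \<in> span (e ` F)"
      unfolding p_def by (intro span_sum span_scale span_base) auto
    ultimately have "(x - p) \<bullet> (p - y) = 0" by (intro span) (rule span_diff)
    then have "(norm (x - y))\<^sup>2 = (norm (x - p))\<^sup>2 + (norm (p - y))\<^sup>2"
      using norm_add_Pythagorean[of "x - p" "p - y"] by (simp add: orthogonal_def)
    then have "(norm (x - p))\<^sup>2 \<le> (norm (x - y))\<^sup>2" by simp
    then have "norm (x - p) \<le> norm (x - y)" by (rule power2_le_imp_le) simp
    then show ?thesis using y(2) by (simp add: p_def dist_norm norm_minus_commute)
  qed
  show "\<forall>\<^sub>F F in finite_subsets_at_top A. dist (\<Sum>i\<in>F. (x \<bullet> e i) *\<^sub>R e i) x < \<epsilon>"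
    unfolding eventually_finite_subsets_at_top using F0 near by blast
qed

lemma parseval_inner:
  assumes "orthonormal_basis A e"
  shows "((\<lambda>i. (x \<bullet> e i) * (y \<bullet> e i)) has_sum (x \<bullet> y)) A"
  using has_sum_bounded_linear_image[OF bounded_linear_inner_left[of y] parseval[OF assms, of x]]
  by (simp add: inner_commute)

lemma parseval_norm:
  assumes "orthonormal_basis A e"
  shows "((\<lambda>i. (x \<bullet> e i)\<^sup>2) has_sum (norm x)\<^sup>2) A"
  unfolding power2_norm_eq_inner using parseval_inner[OF assms, of x x] by (simp add: power2_eq_square)

text \<open>In a complete space, an orthonormal family with trivial orthogonal complement spans a dense
  subspace, because a proper closed subspace has a nonzero orthogonal vector.\<close>

lemma total_orthonormal_basis:
  fixes e :: "'i \<Rightarrow> 'a::{real_inner, complete_space}"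
  assumes "orthonormal_on A e" "\<And>x. (\<And>i. i \<in> A \<Longrightarrow> x \<bullet> e i = 0) \<Longrightarrow> x = 0"
  shows "orthonormal_basis A e"
proof (rule ccontr)
  assume "\<not> ?thesis"
  then obtain x where x: "x \<notin> closure (span (e ` A))"
    using assms(1) by (auto simp: orthonormal_basis_def)
  have "subspace (closure (span (e ` A)))" by (intro subspace_closure subspace_span)
  from closed_subspace_proper_orthogonal[OF this closed_closure x]
  obtain z where z: "norm z = 1" "\<forall>s\<in>closure (span (e ` A)). z \<bullet> s = 0" by (elim exE conjE)
  have "z \<bullet> e i = 0" if "i \<in> A" for i
    by (rule bspec[OF z(2)], rule subsetD[OF closure_subset], rule span_base) (use that in simp)
  then have "z = 0" by (rule assms(2))
  with z(1) show False by simp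
qed

lemma orthonormal_summable:
  fixes g :: "'i \<Rightarrow> 'a::{real_inner, complete_space}"
  assumes g: "orthonormal_on A g" and a: "(\<lambda>i. (a i)\<^sup>2) summable_on A"
  shows "(\<lambda>i. a i *\<^sub>R g i) summable_on A"
proof (rule orthogonal_summable)
  show "(\<lambda>i. (norm (a i *\<^sub>R g i))\<^sup>2) summable_on A"
    using a by (rule summable_on_cong[THEN iffD1, rotated])
      (simp add: orthonormal_onD(2)[OF g] power_mult_distrib)
next
  fix i j assume "i \<in> A" "j \<in> A" "i \<noteq> j"
  then show "(a i *\<^sub>R g i) \<bullet> (a j *\<^sub>R g j) = 0"
    using orthonormal_onD(1)[OF g, of i j] by simp
qed

lemma orthonormal_has_sum_coeff:
  assumes g: "orthonormal_on A g" and s: "((\<lambda>i. a i *\<^sub>R g i) has_sum y) A" and k: "k \<in> A"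
  shows "y \<bullet> g k = a k"
proof -
  have "((\<lambda>i. (a i *\<^sub>R g i) \<bullet> g k) has_sum (y \<bullet> g k)) A"
    by (rule has_sum_bounded_linear_image[OF bounded_linear_inner_left s])
  moreover have "((\<lambda>i. (a i *\<^sub>R g i) \<bullet> g k) has_sum (a k)) A \<longleftrightarrow> ((\<lambda>i. a i) has_sum (a k)) {k}"
    by (rule has_sum_cong_neutral) (use k orthonormal_onD(1)[OF g _ k] in auto)
  moreover have "((\<lambda>i. a i) has_sum (a k)) {k}"
    by (rule has_sum_finiteI) auto
  ultimately show ?thesis using has_sum_unique by blast
qed

text \<open>By Bessel's inequality the coordinates along one orthonormal family are square-summable, so they can
  be reused as coordinates along another. Transposition of tensors and the passage from an
  operator to its bivector both arise in this way.\<close>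

lemma coordinate_transfer:
  fixes e :: "'i \<Rightarrow> 'a::real_inner" and g :: "'i \<Rightarrow> 'b::{real_inner, complete_space}"
  assumes e: "orthonormal_on A e" and g: "orthonormal_on A g"
  obtains U where "bounded_linear U" "\<And>x i. i \<in> A \<Longrightarrow> U x \<bullet> g i = x \<bullet> e i"
proof -
  define U where "U x = (\<Sum>\<^sub>\<infinity>i\<in>A. (x \<bullet> e i) *\<^sub>R g i)" for x
  have hs: "((\<lambda>i. (x \<bullet> e i) *\<^sub>R g i) has_sum U x) A" for x
    unfolding U_def by (rule has_sum_infsum[OF orthonormal_summable[OF g bessel(1)[OF e]]])
  have add: "U (x + y) = U x + U y" for x y
    by (rule has_sum_unique[OF hs])
      (use has_sum_add[OF hs[of x] hs[of y]] in \<open>simp add: inner_add_left algebra_simps\<close>)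
  have scale: "U (r *\<^sub>R x) = r *\<^sub>R U x" for r x
    by (rule has_sum_unique[OF hs])
      (use has_sum_bounded_linear_image[OF bounded_linear_scaleR_right[of r] hs[of x]]
        in \<open>simp add: algebra_simps\<close>)
  have bound: "norm (U x) \<le> norm x * 1" for x
  proof -
    have "((\<lambda>i. (norm ((x \<bullet> e i) *\<^sub>R g i))\<^sup>2) has_sum (norm (U x))\<^sup>2) A"
      by (rule orthogonal_has_sum_norm[OF _ hs]) (simp add: orthonormal_onD(1)[OF g])
    then have "((\<lambda>i. (x \<bullet> e i)\<^sup>2) has_sum (norm (U x))\<^sup>2) A"
      by (rule has_sum_cong[THEN iffD1, rotated]) (simp add: orthonormal_onD(2)[OF g])
    then have "(norm (U x))\<^sup>2 \<le> (norm x)\<^sup>2"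
      using bessel(2)[OF e, of x] by (simp add: infsumI)
    then have "norm (U x) \<le> norm x" by (rule power2_le_imp_le) simp
    then show ?thesis by simp
  qed
  have "bounded_linear U" by (rule bounded_linear_intro[OF add scale bound])
  from this orthonormal_has_sum_coeff[OF g hs] show ?thesis by (rule that)
qed


section \<open>Hilbert--Schmidt operators\<close>

lemma bounded_linear_hs_apply: "bounded_linear (hs_apply T)"
  unfolding hs_apply_def by (rule blinfun.bounded_linear_right)

lemma hs_apply_uminus [simp]: "hs_apply (- T) x = - hs_apply T x"
  using hs_apply_simps(3)[of "-1" T x] by simp

lemma hs_apply_diff [simp]: "hs_apply (S - T) x = hs_apply S x - hs_apply T x"
  by (simp only: minus_hs_def hs_apply_simps hs_apply_uminus diff_conv_add_uminus)

lemma hs_eqI: "(\<And>x. hs_apply S x = hs_apply T x) \<Longrightarrow> S = T"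
  using hs_eq_0_iff[of "S - T"] by simp

text \<open>Pairing with a rank-one operator is evaluation of a matrix entry. Norm bounds, completeness and
  bases of the Hilbert--Schmidt space all reduce to this identity.\<close>

lemma inner_tensor: "T \<bullet> tensor u v = hs_apply T v \<bullet> u"
proof -
  have "bounded_linear (\<lambda>x. hs_apply T x \<bullet> u)"
    by (rule bounded_linear_compose[OF bounded_linear_inner_left bounded_linear_hs_apply])
  from has_sum_bounded_linear_image[OF this parseval[OF some_basis, of v]]
  have "((\<lambda>b. hs_apply T ((v \<bullet> b) *\<^sub>R b) \<bullet> u) has_sum (hs_apply T v \<bullet> u)) some_basis" .
  then have "((\<lambda>b. hs_apply T b \<bullet> hs_apply (tensor u v) b) has_sum (hs_apply T v \<bullet> u)) some_basis"
    by (simp add: linear_scale[OF bounded_linear.linear[OF bounded_linear_hs_apply]] inner_commute)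
  then show ?thesis unfolding inner_hs_def by (rule infsumI)
qed

lemma tensor_inner_tensor: "tensor u v \<bullet> tensor u' v' = (u \<bullet> u') * (v \<bullet> v')"
  by (simp add: inner_tensor inner_commute)

lemma norm_tensor: "norm (tensor u v) = norm u * norm v"
  by (simp add: norm_eq_sqrt_inner tensor_inner_tensor real_sqrt_mult)

lemma bounded_bilinear_tensor: "bounded_bilinear tensor"
proof
  show "\<exists>K. \<forall>a b. norm (tensor a b) \<le> norm a * norm b * K"
    by (rule exI[of _ 1]) (simp add: norm_tensor)
qed (auto intro!: hs_eqI simp: algebra_simps inner_add_right)

lemma norm_hs_apply: "norm (hs_apply T x) \<le> norm T * norm x"
proof (cases "hs_apply T x = 0")
  case False
  have "norm (hs_apply T x) * norm (hs_apply T x) = T \<bullet> tensor (hs_apply T x) x"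
    by (simp add: inner_tensor power2_norm_eq_inner flip: power2_eq_square)
  also have "\<dots> \<le> norm T * norm (tensor (hs_apply T x) x)"
    by (rule norm_cauchy_schwarz)
  finally show ?thesis using False by (simp add: norm_tensor mult.commute mult.left_commute)
qed simp

lemma bounded_linear_hs_apply_left: "bounded_linear (\<lambda>T. hs_apply T x)"
  by (rule bounded_linear_intro[of _ "norm x"]) (auto simp: norm_hs_apply)

lemma norm_hs_finite_sum_le:
  assumes "finite F" "F \<subseteq> some_basis"
  shows "(\<Sum>b\<in>F. (norm (hs_apply T b))\<^sup>2) \<le> (norm T)\<^sup>2"
proof -
  have "(norm T)\<^sup>2 = (\<Sum>\<^sub>\<infinity>b\<in>some_basis. (norm (hs_apply T b))\<^sup>2)"
    by (simp add: power2_norm_eq_inner inner_hs_def)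
  then show ?thesis using finite_sum_le_infsum[OF hs_summable assms] by simp
qed

text \<open>A criterion for constructing Hilbert--Schmidt operators from bounds that survive pointwise limits.\<close>

lemma hs_of_finite_sums:
  fixes L :: "'a::{real_inner, complete_space} \<Rightarrow> 'b::real_inner"
  assumes L: "bounded_linear L"
    and le: "\<And>F. finite F \<Longrightarrow> F \<subseteq> some_basis \<Longrightarrow> (\<Sum>b\<in>F. (norm (L b))\<^sup>2) \<le> r\<^sup>2" and r: "0 \<le> r"
  obtains T where "hs_apply T = L" "norm T \<le> r"
proof
  have sum: "(\<lambda>b. (norm (L b))\<^sup>2) summable_on some_basis"
    using le by (intro nonneg_bdd_above_summable_on bdd_aboveI2) auto
  define T where "T = Abs_hs (Blinfun L)"
  show T: "hs_apply T = L"
    using sum unfolding hs_apply_def T_def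
    by (subst Abs_hs_inverse) (simp_all add: bounded_linear_Blinfun_apply[OF L])
  have "(norm T)\<^sup>2 = (\<Sum>\<^sub>\<infinity>b\<in>some_basis. (norm (L b))\<^sup>2)"
    by (simp add: power2_norm_eq_inner inner_hs_def T)
  also have "\<dots> \<le> r\<^sup>2" by (rule infsum_le_finite_sums[OF sum le])
  finally show "norm T \<le> r" by (rule power2_le_imp_le[OF _ r])
qed

text \<open>A Cauchy sequence converges pointwise; the bounds on finite sums over the basis pass to the pointwise
  limit, which is therefore a limit in the Hilbert--Schmidt norm.\<close>

instance hs :: ("{real_inner, complete_space}", "{real_inner, complete_space}") complete_space
proof
  fix X :: "nat \<Rightarrow> ('a, 'b) hs" assume X: "Cauchy X"
  have "Cauchy (\<lambda>n. hs_apply (X n) x)" for x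
    by (rule bounded_linear.Cauchy[OF bounded_linear_hs_apply_left X])
  then have "\<exists>y. (\<lambda>n. hs_apply (X n) x) \<longlonglongrightarrow> y" for x
    using Cauchy_convergent convergent_def by blast
  then obtain L where L: "\<And>x. (\<lambda>n. hs_apply (X n) x) \<longlonglongrightarrow> L x" by metis
  obtain B where B: "\<And>n. norm (X n) \<le> B" using Cauchy_Bseq[OF X] by (auto simp: Bseq_def)
  have lin: "bounded_linear L"
  proof (rule bounded_linear_intro[of _ B])
    show "L (x + y) = L x + L y" for x y
    proof (rule LIMSEQ_unique[OF L])
      show "(\<lambda>n. hs_apply (X n) (x + y)) \<longlonglongrightarrow> L x + L y"
        using tendsto_add[OF L[of x] L[of y]]
        by (simp add: linear_add[OF bounded_linear.linear[OF bounded_linear_hs_apply]])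
    qed
    show "L (r *\<^sub>R x) = r *\<^sub>R L x" for r x
    proof (rule LIMSEQ_unique[OF L])
      show "(\<lambda>n. hs_apply (X n) (r *\<^sub>R x)) \<longlonglongrightarrow> r *\<^sub>R L x"
        using tendsto_scaleR[OF tendsto_const[of r] L[of x]]
        by (simp add: linear_scale[OF bounded_linear.linear[OF bounded_linear_hs_apply]])
    qed
    show "norm (L x) \<le> norm x * B" for x
    proof (rule LIMSEQ_le_const2[OF tendsto_norm[OF L[of x]]])
      have "norm (hs_apply (X n) x) \<le> norm x * B" for n
        using norm_hs_apply[of "X n" x] mult_right_mono[OF B[of n] norm_ge_zero[of x]]
        by (simp add: mult.commute)
      then show "\<exists>N. \<forall>n\<ge>N. norm (hs_apply (X n) x) \<le> norm x * B" by blast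
    qed
  qed
  have near: "\<exists>N. \<forall>n\<ge>N. \<exists>T. hs_apply T = (\<lambda>x. L x - hs_apply (X n) x) \<and> norm T \<le> \<epsilon>"
    if \<epsilon>: "\<epsilon> > 0" for \<epsilon>
  proof -
    obtain N where N: "\<And>m n. m \<ge> N \<Longrightarrow> n \<ge> N \<Longrightarrow> dist (X m) (X n) < \<epsilon>"
      using metric_CauchyD[OF X \<epsilon>] by blast
    have "\<exists>T. hs_apply T = (\<lambda>x. L x - hs_apply (X n) x) \<and> norm T \<le> \<epsilon>" if n: "n \<ge> N" for n
    proof -
      have "bounded_linear (\<lambda>x. L x - hs_apply (X n) x)"
        by (rule bounded_linear_sub[OF lin bounded_linear_hs_apply])
      moreover have "(\<Sum>b\<in>F. (norm (L b - hs_apply (X n) b))\<^sup>2) \<le> \<epsilon>\<^sup>2"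
        if F: "finite F" "F \<subseteq> some_basis" for F
      proof (rule LIMSEQ_le_const2)
        show "(\<lambda>m. \<Sum>b\<in>F. (norm (hs_apply (X m) b - hs_apply (X n) b))\<^sup>2)
            \<longlonglongrightarrow> (\<Sum>b\<in>F. (norm (L b - hs_apply (X n) b))\<^sup>2)"
          by (intro tendsto_intros L)
        have "(\<Sum>b\<in>F. (norm (hs_apply (X m) b - hs_apply (X n) b))\<^sup>2) \<le> \<epsilon>\<^sup>2" if "m \<ge> N" for m
        proof -
          have "(\<Sum>b\<in>F. (norm (hs_apply (X m - X n) b))\<^sup>2) \<le> (norm (X m - X n))\<^sup>2"
            by (rule norm_hs_finite_sum_le[OF F])
          also have "\<dots> \<le> \<epsilon>\<^sup>2"
            using N[OF that n] by (intro power_mono) (auto simp: dist_norm)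
          finally show ?thesis by simp
        qed
        then show "\<exists>N. \<forall>m\<ge>N. (\<Sum>b\<in>F. (norm (hs_apply (X m) b - hs_apply (X n) b))\<^sup>2) \<le> \<epsilon>\<^sup>2"
          by blast
      qed
      ultimately obtain T where "hs_apply T = (\<lambda>x. L x - hs_apply (X n) x)" "norm T \<le> \<epsilon>"
        by (rule hs_of_finite_sums[OF _ _ less_imp_le[OF \<epsilon>]])
      then show ?thesis by blast
    qed
    then show ?thesis by blast
  qed
  obtain N T where T: "hs_apply T = (\<lambda>x. L x - hs_apply (X N) x)"
    using near[of 1] by (auto intro: order_refl)
  define Y where "Y = T + X N"
  have Y: "hs_apply Y x = L x" for x by (simp add: Y_def T)
  have "X \<longlonglongrightarrow> Y"
  proof (rule metric_LIMSEQ_I)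
    fix r :: real assume r: "0 < r"
    then obtain N where N: "\<forall>n\<ge>N. \<exists>T. hs_apply T = (\<lambda>x. L x - hs_apply (X n) x) \<and> norm T \<le> r / 2"
      using near[of "r / 2"] by auto
    have "dist (X n) Y < r" if "n \<ge> N" for n
    proof -
      obtain T where "hs_apply T = (\<lambda>x. L x - hs_apply (X n) x)" "norm T \<le> r / 2"
        using N \<open>n \<ge> N\<close> by blast
      moreover from this have "T = Y - X n" by (intro hs_eqI) (simp add: Y)
      ultimately show ?thesis using r by (simp add: dist_norm norm_minus_commute)
    qed
    then show "\<exists>N. \<forall>n\<ge>N. dist (X n) Y < r" by blast
  qed
  then show "convergent X" by (auto simp: convergent_def)
qed

lemma orthonormal_tensors:
  assumes "orthonormal_on I e" "orthonormal_on J g"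
  shows "orthonormal_on (I \<times> J) (\<lambda>(i, j). tensor (e i) (g j))"
  using assms by (auto simp: orthonormal_on_def tensor_inner_tensor)

lemma tensor_basis:
  fixes e :: "'i \<Rightarrow> 'b::{real_inner, complete_space}" and g :: "'j \<Rightarrow> 'a::{real_inner, complete_space}"
  assumes e: "orthonormal_basis I e" and g: "orthonormal_basis J g"
  shows "orthonormal_basis (I \<times> J) (\<lambda>(i, j). tensor (e i) (g j))"
proof (rule total_orthonormal_basis)
  show "orthonormal_on (I \<times> J) (\<lambda>(i, j). tensor (e i) (g j))"
    by (intro orthonormal_tensors orthonormal_basisD e g)
  fix T assume T: "\<And>p. p \<in> I \<times> J \<Longrightarrow> T \<bullet> (case p of (i, j) \<Rightarrow> tensor (e i) (g j)) = 0"
  have "hs_apply T (g j) = 0" if "j \<in> J" for j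
    by (rule basis_eqI[OF e]) (use T[of "(_, j)"] that in \<open>simp add: inner_tensor\<close>)
  then have "hs_apply T x = 0" for x
    by (rule bounded_linear_basis_eqI[OF g bounded_linear_hs_apply bounded_linear_zero])
  then show "T = 0" by (intro hs_eqI) simp
qed

text \<open>The operator \<open>\<Sum>\<^sub>p K f\<^sub>p \<otimes> f\<^sub>p\<close> agrees with \<open>K\<close> on the basis \<open>f\<close>, and its terms are orthogonal
  in the Hilbert--Schmidt space. This makes the norm independent of the basis used to compute it.\<close>

lemma hs_norm_basis:
  fixes K :: "('k::{real_inner, complete_space}, 'e::{real_inner, complete_space}) hs"
  assumes f: "orthonormal_basis A f"
  shows "((\<lambda>p. (norm (hs_apply K (f p)))\<^sup>2) has_sum (norm K)\<^sup>2) A"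
proof -
  have fo: "orthonormal_on A f" by (rule orthonormal_basisD[OF f])
  let ?v = "\<lambda>p. tensor (hs_apply K (f p)) (f p)"
  have orth: "?v p \<bullet> ?v q = 0" if "p \<in> A" "q \<in> A" "p \<noteq> q" for p q
    using orthonormal_onD(1)[OF fo that(1,2)] that(3) by (simp add: tensor_inner_tensor)
  have nv: "norm (?v p) = norm (hs_apply K (f p))" if "p \<in> A" for p
    using orthonormal_onD(2)[OF fo that] by (simp add: norm_tensor)
  have le: "(\<Sum>p\<in>F. (norm (hs_apply K (f p)))\<^sup>2) \<le> (norm K)\<^sup>2" if F: "finite F" "F \<subseteq> A" for F
  proof -
    define s where "s = (\<Sum>p\<in>F. (norm (hs_apply K (f p)))\<^sup>2)"
    have "s = K \<bullet> sum ?v F"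
      by (simp add: s_def inner_sum_right inner_tensor power2_norm_eq_inner)
    moreover have "(norm (sum ?v F))\<^sup>2 = (\<Sum>p\<in>F. (norm (?v p))\<^sup>2)"
      by (rule norm_sum_orthogonal) (use F orth in auto)
    then have "(norm (sum ?v F))\<^sup>2 = s"
      unfolding s_def using F nv by (subst sum.cong[OF refl]) (auto simp: subset_iff)
    moreover have "0 \<le> s" by (simp add: s_def sum_nonneg)
    ultimately have "s\<^sup>2 \<le> (norm K)\<^sup>2 * s"
      using Cauchy_Schwarz_ineq[of K "sum ?v F"] by (simp add: power2_norm_eq_inner)
    then show ?thesis using \<open>0 \<le> s\<close> unfolding s_def[symmetric]
      by (cases "s = 0") (auto simp: power2_eq_square)
  qed
  have sq: "(\<lambda>p. (norm (hs_apply K (f p)))\<^sup>2) summable_on A"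
    using le by (intro nonneg_bdd_above_summable_on bdd_aboveI2) auto
  have "?v summable_on A"
    by (rule orthogonal_summable[OF orth]) (use sq nv in \<open>auto cong: summable_on_cong\<close>)
  then obtain K' where K': "(?v has_sum K') A" by (auto simp: summable_on_def)
  have "hs_apply K' (f q) = hs_apply K (f q)" if q: "q \<in> A" for q
  proof (rule has_sum_unique)
    show "((\<lambda>p. hs_apply (?v p) (f q)) has_sum hs_apply K' (f q)) A"
      by (rule has_sum_bounded_linear_image[OF bounded_linear_hs_apply_left K'])
    have "((\<lambda>p. hs_apply (?v p) (f q)) has_sum hs_apply K (f q)) {q}"
      by (rule has_sum_finiteI) (use orthonormal_onD(1)[OF fo q q] in auto)
    then show "((\<lambda>p. hs_apply (?v p) (f q)) has_sum hs_apply K (f q)) A"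
      by (rule has_sum_cong_neutral[THEN iffD1, rotated -1])
        (use q orthonormal_onD(1)[OF fo q] in auto)
  qed
  then have "hs_apply K' x = hs_apply K x" for x
    by (rule bounded_linear_basis_eqI[OF f bounded_linear_hs_apply bounded_linear_hs_apply])
  then have "K' = K" by (rule hs_eqI)
  then have "((\<lambda>p. (norm (?v p))\<^sup>2) has_sum (norm K)\<^sup>2) A"
    using orthogonal_has_sum_norm[OF orth K'] by simp
  then show ?thesis by (rule has_sum_cong[THEN iffD1, rotated]) (simp add: nv)
qed

text \<open>The operator is the orthogonal series \<open>\<Sum>\<^sub>p k\<^sub>p w\<^sub>p \<otimes> f\<^sub>p\<close> in the Hilbert--Schmidt space.\<close>

lemma diagonal_hs:
  fixes f :: "'p \<Rightarrow> 'k::{real_inner, complete_space}" and w :: "'p \<Rightarrow> 'l::{real_inner, complete_space}"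
  assumes f: "orthonormal_basis A f" and w: "orthonormal_on A w"
    and k: "(\<lambda>p. (k p)\<^sup>2) summable_on A"
  obtains K where "\<And>p. p \<in> A \<Longrightarrow> hs_apply K (f p) = k p *\<^sub>R w p"
proof -
  have fo: "orthonormal_on A f" by (rule orthonormal_basisD[OF f])
  have "orthonormal_on A (\<lambda>p. tensor (w p) (f p))"
    using w fo by (auto simp: orthonormal_on_def tensor_inner_tensor)
  from orthonormal_summable[OF this k]
  obtain K where K: "((\<lambda>p. k p *\<^sub>R tensor (w p) (f p)) has_sum K) A"
    by (auto simp: summable_on_def)
  have "hs_apply K (f q) = k q *\<^sub>R w q" if q: "q \<in> A" for q
  proof (rule has_sum_unique)
    show "((\<lambda>p. hs_apply (k p *\<^sub>R tensor (w p) (f p)) (f q)) has_sum hs_apply K (f q)) A"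
      by (rule has_sum_bounded_linear_image[OF bounded_linear_hs_apply_left K])
    have "((\<lambda>p. hs_apply (k p *\<^sub>R tensor (w p) (f p)) (f q)) has_sum k q *\<^sub>R w q) {q}"
      by (rule has_sum_finiteI) (use orthonormal_onD(1)[OF fo q q] in auto)
    then show "((\<lambda>p. hs_apply (k p *\<^sub>R tensor (w p) (f p)) (f q)) has_sum k q *\<^sub>R w q) A"
      by (rule has_sum_cong_neutral[THEN iffD1, rotated -1])
        (use q orthonormal_onD(1)[OF fo q] in auto)
  qed
  then show ?thesis by (rule that)
qed

text \<open>The series \<open>K\<^sup>* y = \<Sum>\<^sub>b \<langle>K b, y\<rangle> b\<close> over a basis converges because
  \<open>\<Sum>\<^sub>b \<parallel>K b\<parallel>\<^sup>2\<close> does.\<close>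

lemma hs_adjoint:
  fixes K :: "('k::{real_inner, complete_space}, 'e::real_inner) hs"
  shows "bounded_linear (adjoint (hs_apply K))" "hs_apply K x \<bullet> y = x \<bullet> adjoint (hs_apply K) y"
proof -
  have so: "orthonormal_on (some_basis :: 'k set) (\<lambda>b. b)" by (rule orthonormal_basisD[OF some_basis])
  have "\<exists>z. \<forall>x. hs_apply K x \<bullet> y = x \<bullet> z" for y
  proof -
    have le: "(hs_apply K b \<bullet> y)\<^sup>2 \<le> (norm y)\<^sup>2 * (norm (hs_apply K b))\<^sup>2" for b
      using Cauchy_Schwarz_ineq[of "hs_apply K b" y] by (simp add: power2_norm_eq_inner mult.commute)
    have "(\<lambda>b. (hs_apply K b \<bullet> y)\<^sup>2) summable_on some_basis"
      by (rule summable_on_comparison_test[of "\<lambda>b. (norm y)\<^sup>2 * (norm (hs_apply K b))\<^sup>2"])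
        (simp_all add: summable_on_cmult_right hs_summable le)
    from orthonormal_summable[OF so this] obtain z
      where z: "((\<lambda>b. (hs_apply K b \<bullet> y) *\<^sub>R b) has_sum z) some_basis"
      by (auto simp: summable_on_def)
    have "hs_apply K x \<bullet> y = x \<bullet> z" for x
    proof (rule bounded_linear_basis_eqI[OF some_basis,
          where F = "\<lambda>x. hs_apply K x \<bullet> y" and G = "\<lambda>x. x \<bullet> z" and x = x])
      show "bounded_linear (\<lambda>x. hs_apply K x \<bullet> y)"
        by (rule bounded_linear_compose[OF bounded_linear_inner_left bounded_linear_hs_apply])
      show "bounded_linear (\<lambda>x. x \<bullet> z)" by (rule bounded_linear_inner_left)
      show "hs_apply K b \<bullet> y = b \<bullet> z" if "b \<in> some_basis" for b
        using orthonormal_has_sum_coeff[OF so z that] by (simp add: inner_commute)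
    qed
    then show ?thesis by blast
  qed
  then obtain A where A: "\<And>x y. hs_apply K x \<bullet> y = x \<bullet> A y" by metis
  have adj: "adjoint (hs_apply K) = A" by (rule adjoint_unique) (simp add: A)
  show "hs_apply K x \<bullet> y = x \<bullet> adjoint (hs_apply K) y" by (simp add: adj A)
  have ext: "u = v" if "\<And>x. x \<bullet> u = x \<bullet> v" for u v :: 'k
    using that[of "u - v"] by (metis inner_diff_right inner_eq_zero_iff right_minus_eq)
  show "bounded_linear (adjoint (hs_apply K))"
    unfolding adj
  proof (rule bounded_linear_intro[of _ "norm K"])
    show "A (u + v) = A u + A v" for u v
      by (rule ext) (simp add: inner_add_right flip: A)
    show "A (r *\<^sub>R u) = r *\<^sub>R A u" for r u
      by (rule ext) (simp flip: A)
    show "norm (A u) \<le> norm u * norm K" for u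
    proof (cases "A u = 0")
      case False
      have "norm (A u) * norm (A u) = hs_apply K (A u) \<bullet> u"
        by (simp add: A power2_norm_eq_inner flip: power2_eq_square)
      also have "\<dots> \<le> norm (hs_apply K (A u)) * norm u" by (rule norm_cauchy_schwarz)
      also have "\<dots> \<le> (norm K * norm (A u)) * norm u" by (intro mult_right_mono norm_hs_apply) simp
      finally show ?thesis using False by (simp add: mult.commute mult.left_commute)
    qed simp
  qed
qed


section \<open>The exterior square, the alternator and bivectors\<close>

definition increasing_pairs :: "nat set \<Rightarrow> (nat \<times> nat) set" where
  "increasing_pairs I = {(i, j). i \<in> I \<and> j \<in> I \<and> i < j}"

lemma active_subset: "active I c \<subseteq> increasing_pairs I"
  by (auto simp: active_def increasing_pairs_def)

lemma exterior_square_inner: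
  "exterior_square wedge \<Longrightarrow>
     wedge u1 u2 \<bullet> wedge v1 v2 = (u1 \<bullet> v1) * (u2 \<bullet> v2) - (u1 \<bullet> v2) * (u2 \<bullet> v1)"
  by (simp add: exterior_square_def)

lemma exterior_square_bounded_bilinear:
  assumes "exterior_square wedge"
  shows "bounded_bilinear wedge"
proof
  have lin: "linear (wedge u)" "linear (\<lambda>u. wedge u v)" for u v
    using assms by (auto simp: exterior_square_def bilinear_def)
  show "wedge (a + a') b = wedge a b + wedge a' b" for a a' b by (rule linear_add[OF lin(2)])
  show "wedge a (b + b') = wedge a b + wedge a b'" for a b b' by (rule linear_add[OF lin(1)])
  show "wedge (r *\<^sub>R a) b = r *\<^sub>R wedge a b" for r a b by (rule linear_scale[OF lin(2)])
  show "wedge a (r *\<^sub>R b) = r *\<^sub>R wedge a b" for r a b by (rule linear_scale[OF lin(1)])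
  have "norm (wedge a b) \<le> norm a * norm b" for a b
  proof (rule power2_le_imp_le)
    have "(norm (wedge a b))\<^sup>2 = (norm a)\<^sup>2 * (norm b)\<^sup>2 - (a \<bullet> b)\<^sup>2"
      unfolding power2_norm_eq_inner exterior_square_inner[OF assms]
      by (simp add: inner_commute power2_eq_square)
    then show "(norm (wedge a b))\<^sup>2 \<le> (norm a * norm b)\<^sup>2"
      by (simp add: power_mult_distrib)
  qed simp
  then show "\<exists>K. \<forall>a b. norm (wedge a b) \<le> norm a * norm b * K"
    by (intro exI[of _ 1]) simp
qed

lemma exterior_square_swap:
  assumes "exterior_square wedge"
  shows "wedge v u = - wedge u v"
proof -
  interpret bounded_bilinear wedge by (rule exterior_square_bounded_bilinear[OF assms])
  have "wedge x x = 0" for x using assms by (simp add: exterior_square_def)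
  then have "wedge (u + v) (u + v) = 0" "wedge u u = 0" "wedge v v = 0" by auto
  then have "wedge u v + wedge v u = 0" by (simp add: add_left add_right add.commute)
  then show ?thesis by (simp add: add_eq_0_iff)
qed

lemma bilinear_basis_eqI:
  assumes e: "orthonormal_basis I e"
    and F: "\<And>u. bounded_linear (F u)" "\<And>v. bounded_linear (\<lambda>u. F u v)"
    and G: "\<And>u. bounded_linear (G u)" "\<And>v. bounded_linear (\<lambda>u. G u v)"
    and eq: "\<And>i j. i \<in> I \<Longrightarrow> j \<in> I \<Longrightarrow> F (e i) (e j) = G (e i) (e j)"
  shows "F u v = G u v"
proof -
  have "F (e i) v = G (e i) v" if "i \<in> I" for i
    by (rule bounded_linear_basis_eqI[OF e F(1) G(1)]) (rule eq[OF that])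
  then show ?thesis by (rule bounded_linear_basis_eqI[OF e F(2) G(2)])
qed

lemma exterior_square_ext:
  assumes w: "exterior_square wedge" and eq: "\<And>u v. x \<bullet> wedge u v = y \<bullet> wedge u v"
  shows "x = y"
proof -
  let ?N = "{z. (x - y) \<bullet> z = 0}"
  have "closed ?N" by (intro closed_Collect_eq continuous_intros)
  moreover have "span (range (\<lambda>(u, v). wedge u v)) \<subseteq> ?N"
    using eq by (intro span_minimal) (auto simp: subspace_def inner_add_right inner_diff_left)
  ultimately have "closure (span (range (\<lambda>(u, v). wedge u v))) \<subseteq> ?N" by (rule closure_minimal[rotated])
  then have "UNIV \<subseteq> ?N" using w by (simp add: exterior_square_def)
  then have "x - y \<in> ?N" by (rule subsetD) simp
  then show ?thesis by simp
qed

lemma wedge_orthonormal: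
  assumes w: "exterior_square wedge" and e: "orthonormal_on I e"
  shows "orthonormal_on (increasing_pairs I) (\<lambda>(i, j). wedge (e i) (e j))"
  unfolding orthonormal_on_def
proof (intro ballI)
  fix p q assume "p \<in> increasing_pairs I" "q \<in> increasing_pairs I"
  then obtain i j k l where "p = (i, j)" "q = (k, l)" "i \<in> I" "j \<in> I" "k \<in> I" "l \<in> I" "i < j" "k < l"
    by (auto simp: increasing_pairs_def)
  then show "(case p of (i, j) \<Rightarrow> wedge (e i) (e j)) \<bullet> (case q of (i, j) \<Rightarrow> wedge (e i) (e j)) =
      (if p = q then 1 else 0)"
    by (auto simp: exterior_square_inner[OF w] orthonormal_onD(1)[OF e])
qed

text \<open>A vector orthogonal to \<open>e\<^sub>i \<and> e\<^sub>j\<close> for \<open>i < j\<close> is orthogonal to all \<open>e\<^sub>i \<and> e\<^sub>j\<close> by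
  antisymmetry, hence to all \<open>u \<and> v\<close> by continuity, and these span a dense subspace.\<close>

lemma wedge_basis:
  fixes wedge :: "'h::real_inner \<Rightarrow> 'h \<Rightarrow> 'l::{real_inner, complete_space}"
  assumes w: "exterior_square wedge" and e: "orthonormal_basis I e"
  shows "orthonormal_basis (increasing_pairs I) (\<lambda>(i, j). wedge (e i) (e j))"
proof (rule total_orthonormal_basis)
  show "orthonormal_on (increasing_pairs I) (\<lambda>(i, j). wedge (e i) (e j))"
    by (rule wedge_orthonormal[OF w orthonormal_basisD[OF e]])
next
  fix x assume x: "\<And>p. p \<in> increasing_pairs I \<Longrightarrow> x \<bullet> (case p of (i, j) \<Rightarrow> wedge (e i) (e j)) = 0"
  interpret bounded_bilinear wedge by (rule exterior_square_bounded_bilinear[OF w])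
  have "x \<bullet> wedge u v = 0" for u v
  proof (rule bilinear_basis_eqI[OF e, where F = "\<lambda>u v. x \<bullet> wedge u v" and G = "\<lambda>_ _. 0"])
    fix i j assume ij: "i \<in> I" "j \<in> I"
    consider "i < j" | "j < i" | "i = j" by linarith
    then show "x \<bullet> wedge (e i) (e j) = 0"
    proof cases
      case 1 then show ?thesis using x[of "(i, j)"] ij by (simp add: increasing_pairs_def)
    next
      case 2 then show ?thesis using x[of "(j, i)"] ij
        by (simp add: increasing_pairs_def exterior_square_swap[OF w, of "e i" "e j"])
    next
      case 3 then show ?thesis using w by (simp add: exterior_square_def)
    qed
  qed (auto intro: bounded_linear_compose[OF bounded_linear_inner_right] bounded_linear_left
      bounded_linear_right)
  then show "x = 0" by (intro exterior_square_ext[OF w]) simp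
qed

text \<open>Transposition permutes the basis \<open>e\<^sub>i \<otimes> e\<^sub>j\<close>. Thus the alternator exists as a bounded
  operator, and it is determined by its values on rank-one operators, whose span is dense.\<close>

lemma Alt2_spec:
  "bounded_linear (Alt2 :: ('h::{real_inner, complete_space}, 'h) hs \<Rightarrow> _)"
  "Alt2 (tensor u v) = (1/2) *\<^sub>R (tensor u v - tensor v (u :: 'h))"
proof -
  let ?B = "some_basis :: 'h set"
  let ?E = "\<lambda>(a, b). tensor (a::'h) b" and ?E' = "\<lambda>(a, b). tensor (b::'h) a"
  have E: "orthonormal_basis (?B \<times> ?B) ?E" by (rule tensor_basis[OF some_basis some_basis])
  have sw: "orthonormal_on (?B \<times> ?B) ?E'"
    using orthonormal_basisD[OF E] by (auto simp: orthonormal_on_def tensor_inner_tensor)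
  obtain U where U: "bounded_linear U"
    "\<And>x p. p \<in> ?B \<times> ?B \<Longrightarrow> U x \<bullet> ?E' p = x \<bullet> ?E p"
    by (rule coordinate_transfer[OF orthonormal_basisD[OF E] sw]) auto
  have Ut: "U (tensor u v) = tensor v u" for u v
  proof (rule basis_eqI[OF E])
    fix p assume "p \<in> ?B \<times> ?B"
    then obtain a b where "p = (a, b)" "a \<in> ?B" "b \<in> ?B" by auto
    then show "U (tensor u v) \<bullet> ?E p = tensor v u \<bullet> ?E p"
      using U(2)[of "(b, a)" "tensor u v"] by (simp add: tensor_inner_tensor mult.commute)
  qed
  have "Alt2 = (\<lambda>T. (1/2) *\<^sub>R (T - U T) :: ('h, 'h) hs)"
    unfolding Alt2_def
  proof (rule the_equality)
    have *: "bounded_linear (\<lambda>T. (1/2) *\<^sub>R (T - U T) :: ('h, 'h) hs)"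
      by (intro bounded_linear_const_scaleR bounded_linear_sub bounded_linear_ident U)
    then show "bounded_linear (\<lambda>T. (1/2) *\<^sub>R (T - U T) :: ('h, 'h) hs) \<and>
        (\<forall>u v. (1/2) *\<^sub>R (tensor u v - U (tensor u v)) = (1/2) *\<^sub>R (tensor u v - tensor v (u :: 'h)))"
      by (simp add: Ut)
    fix L :: "('h, 'h) hs \<Rightarrow> ('h, 'h) hs"
    assume L: "bounded_linear L \<and> (\<forall>u v. L (tensor u v) = (1/2) *\<^sub>R (tensor u v - tensor v u))"
    show "L = (\<lambda>T. (1/2) *\<^sub>R (T - U T))"
    proof
      fix T show "L T = (1/2) *\<^sub>R (T - U T)"
        by (rule bounded_linear_basis_eqI[OF E conjunct1[OF L] *]) (use L in \<open>auto simp: Ut\<close>)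
    qed
  qed
  note Alt2_eq = this
  show "bounded_linear (Alt2 :: ('h, 'h) hs \<Rightarrow> _)"
    unfolding Alt2_eq by (intro bounded_linear_const_scaleR bounded_linear_sub bounded_linear_ident U(1))
  show "Alt2 (tensor u v) = (1/2) *\<^sub>R (tensor u v - tensor v u)"
    by (simp add: Alt2_eq Ut)
qed

lemma Alt2_entry:
  "hs_apply (Alt2 T) v \<bullet> u = (hs_apply T v \<bullet> u - hs_apply T u \<bullet> v) / 2"
proof -
  interpret A: bounded_linear "Alt2 :: ('a, 'a) hs \<Rightarrow> _" by (rule Alt2_spec)
  have "Alt2 T \<bullet> tensor u v = (T \<bullet> tensor u v - T \<bullet> tensor v u) / 2"
  proof (rule bounded_linear_basis_eqI[OF tensor_basis[OF some_basis some_basis],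
        where F = "\<lambda>T. Alt2 T \<bullet> tensor u v" and G = "\<lambda>T. (T \<bullet> tensor u v - T \<bullet> tensor v u) / 2" and x = T])
    show "bounded_linear (\<lambda>T. Alt2 T \<bullet> tensor u v)"
      by (rule bounded_linear_compose[OF bounded_linear_inner_left A.bounded_linear_axioms])
    show "bounded_linear (\<lambda>T. (T \<bullet> tensor u v - T \<bullet> tensor v u) / 2)"
      by (intro bounded_linear_compose[OF bounded_linear_divide] bounded_linear_sub bounded_linear_inner_left)
  qed (auto simp: Alt2_spec(2) inner_diff_left tensor_inner_tensor)
  then show ?thesis by (simp add: inner_tensor)
qed

text \<open>The coordinate of \<open>\<alpha>\<^sub>A\<close> along \<open>e\<^sub>i \<and> e\<^sub>j\<close> is the matrix entry \<open>\<langle>A e\<^sub>j, e\<^sub>i\<rangle>\<close>; skewness makes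
  the defining identity hold for all pairs once it holds for \<open>i < j\<close>.\<close>

lemma bivector_Alt2:
  fixes wedge :: "'h::{real_inner, complete_space} \<Rightarrow> 'h \<Rightarrow> 'l::{real_inner, complete_space}"
    and e :: "nat \<Rightarrow> 'h"
  assumes w: "exterior_square wedge" and e: "orthonormal_basis I e"
  shows "bounded_linear (\<lambda>T. bivector wedge (Alt2 T))"
    and "bivector wedge (Alt2 T) \<bullet> wedge u v = hs_apply (Alt2 T) v \<bullet> u"
proof -
  interpret bounded_bilinear wedge by (rule exterior_square_bounded_bilinear[OF w])
  have "orthonormal_on (increasing_pairs I) (\<lambda>(i, j). tensor (e i) (e j))"
    using orthonormal_basisD[OF tensor_basis[OF e e]]
    by (auto simp: orthonormal_on_def increasing_pairs_def)
  then obtain U where U: "bounded_linear U"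
    "\<And>x p. p \<in> increasing_pairs I \<Longrightarrow>
        U x \<bullet> (case p of (i, j) \<Rightarrow> wedge (e i) (e j)) = x \<bullet> (case p of (i, j) \<Rightarrow> tensor (e i) (e j))"
    by (rule coordinate_transfer[OF _ wedge_orthonormal[OF w orthonormal_basisD[OF e]]]) auto
  have U_entry: "U (Alt2 T) \<bullet> wedge u v = hs_apply (Alt2 T) v \<bullet> u" for T u v
  proof (rule bilinear_basis_eqI[OF e, where F = "\<lambda>u v. U (Alt2 T) \<bullet> wedge u v"
        and G = "\<lambda>u v. hs_apply (Alt2 T) v \<bullet> u"])
    have *: "U (Alt2 T) \<bullet> wedge (e i) (e j) = hs_apply (Alt2 T) (e j) \<bullet> e i"
      if "i \<in> I" "j \<in> I" "i < j" for i j
      using U(2)[of "(i, j)" "Alt2 T"] that by (simp add: increasing_pairs_def inner_tensor)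
    fix i j assume ij: "i \<in> I" "j \<in> I"
    consider "i < j" | "j < i" | "i = j" by linarith
    then show "U (Alt2 T) \<bullet> wedge (e i) (e j) = hs_apply (Alt2 T) (e j) \<bullet> e i"
    proof cases
      case 1 then show ?thesis using * ij by simp
    next
      case 2 then show ?thesis using *[of j i] ij
        by (simp add: exterior_square_swap[OF w, of "e i" "e j"] Alt2_entry)
    next
      case 3 then show ?thesis using w by (simp add: exterior_square_def Alt2_entry)
    qed
  qed (auto intro: bounded_linear_compose[OF bounded_linear_inner_right] bounded_linear_left
      bounded_linear_right bounded_linear_compose[OF bounded_linear_inner_left bounded_linear_hs_apply]
      bounded_linear_inner_right)
  have biv: "bivector wedge (Alt2 T) = U (Alt2 T)" for T
    unfolding bivector_def
    by (rule the_equality) (auto simp: U_entry intro!: exterior_square_ext[OF w])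
  show "bounded_linear (\<lambda>T. bivector wedge (Alt2 T))"
    unfolding biv by (rule bounded_linear_compose[OF U(1) Alt2_spec(1)])
  show "bivector wedge (Alt2 T) \<bullet> wedge u v = hs_apply (Alt2 T) v \<bullet> u"
    unfolding biv by (rule U_entry)
qed


section \<open>The coefficient operator and the exterior square of the covariance\<close>

text \<open>The trace condition, applied to the eigenbasis itself, is summability of the eigenvalues.\<close>

lemma positive_trace_class_eigenvalues:
  fixes C :: "'h::real_inner \<Rightarrow>\<^sub>L 'h" and e :: "nat \<Rightarrow> 'h"
  assumes C: "positive_trace_class C" and e: "orthonormal_basis I e"
    and eig: "\<And>i. i \<in> I \<Longrightarrow> blinfun_apply C (e i) = c i *\<^sub>R e i"
  shows "\<And>i. i \<in> I \<Longrightarrow> 0 \<le> c i" and "c summable_on I"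
    and "\<And>i x. i \<in> I \<Longrightarrow> blinfun_apply C x \<bullet> e i = c i * (x \<bullet> e i)"
proof -
  have on: "orthonormal_on I e" by (rule orthonormal_basisD[OF e])
  have inj: "inj_on e I" by (rule orthonormal_on_inj[OF on])
  have ee: "e i \<bullet> e i = 1" if "i \<in> I" for i using orthonormal_onD(1)[OF on that that] by simp
  show "0 \<le> c i" if "i \<in> I" for i
  proof -
    have "0 \<le> blinfun_apply C (e i) \<bullet> e i" using C unfolding positive_trace_class_def by blast
    then show ?thesis by (simp add: eig[OF that] ee[OF that])
  qed
  show "blinfun_apply C x \<bullet> e i = c i * (x \<bullet> e i)" if "i \<in> I" for i x
    using C eig[OF that] by (simp add: positive_trace_class_def)
  have "orthonormal_basis (e ` I) (\<lambda>b. b)"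
    using e inj by (auto simp: orthonormal_basis_def orthonormal_on_def inj_on_def)
  then have "(\<lambda>b. blinfun_apply C b \<bullet> b) summable_on e ` I"
    using C unfolding positive_trace_class_def by blast
  then have "((\<lambda>b. blinfun_apply C b \<bullet> b) \<circ> e) summable_on I"
    by (simp add: summable_on_reindex[OF inj])
  then show "c summable_on I"
    by (rule summable_on_cong[THEN iffD1, rotated]) (simp add: eig ee)
qed

lemma product_summable:
  fixes a b :: "'i \<Rightarrow> real"
  assumes a: "a summable_on I" "\<And>i. i \<in> I \<Longrightarrow> 0 \<le> a i" and b: "b summable_on J" "\<And>i. i \<in> J \<Longrightarrow> 0 \<le> b i"
  shows "(\<lambda>(i, j). a i * b j) summable_on I \<times> J"
proof (rule nonneg_bdd_above_summable_on)
  show "bdd_above (sum (\<lambda>(i, j). a i * b j) ` {F. F \<subseteq> I \<times> J \<and> finite F})"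
  proof (rule bdd_aboveI2)
    fix F assume "F \<in> {F. F \<subseteq> I \<times> J \<and> finite F}"
    then have F: "F \<subseteq> I \<times> J" "finite F" by auto
    have sub: "F \<subseteq> fst ` F \<times> snd ` F" by force
    have fI: "fst ` F \<subseteq> I" "snd ` F \<subseteq> J" using F(1) by auto
    have "(\<Sum>(i, j)\<in>F. a i * b j) \<le> (\<Sum>(i, j)\<in>fst ` F \<times> snd ` F. a i * b j)"
      using F fI sub a(2) b(2) by (intro sum_mono2) (auto intro!: mult_nonneg_nonneg simp: subset_iff)
    also have "\<dots> = (\<Sum>i\<in>fst ` F. a i) * (\<Sum>j\<in>snd ` F. b j)"
      by (simp add: sum_product sum.cartesian_product)
    also have "\<dots> \<le> infsum a I * infsum b J"
      using F fI a b by (intro mult_mono finite_sum_le_infsum infsum_nonneg sum_nonneg) auto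
    finally show "(\<Sum>(i, j)\<in>F. a i * b j) \<le> infsum a I * infsum b J" .
  qed
qed (use a b in auto)

text \<open>Existence of the coefficient operator: its squared Hilbert--Schmidt norm would be
  \<open>t\<^sup>2/4 \<Sum> c\<^sub>i c\<^sub>j\<close>, which is finite because \<open>\<Sum>\<^sub>i c\<^sub>i\<close> is.\<close>

lemma K_op_apply:
  fixes wedge :: "'h::{real_inner, complete_space} \<Rightarrow> 'h \<Rightarrow> 'l::{real_inner, complete_space}"
    and f :: "nat \<times> nat \<Rightarrow> 'k::{real_inner, complete_space}"
  assumes w: "exterior_square wedge" and e: "orthonormal_on I e"
    and c: "c summable_on I" "\<And>i. i \<in> I \<Longrightarrow> 0 \<le> c i"
    and f: "orthonormal_basis (active I c) f" and ij: "(i, j) \<in> active I c"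
  shows "hs_apply (K_op I c e wedge f t) (f (i, j)) = (t / 2 * sqrt (c i * c j)) *\<^sub>R wedge (e i) (e j)"
proof -
  let ?k = "\<lambda>(i, j). t / 2 * sqrt (c i * c j)" and ?w = "\<lambda>(i, j). wedge (e i) (e j)"
  have sub: "active I c \<subseteq> I \<times> I" by (auto simp: active_def)
  have "(\<lambda>(i, j). c i * c j) summable_on I \<times> I" by (rule product_summable[OF c c])
  then have "(\<lambda>(i, j). c i * c j) summable_on active I c"
    by (rule summable_on_subset_banach[OF _ sub])
  then have "(\<lambda>p. t\<^sup>2 / 4 * (case p of (i, j) \<Rightarrow> c i * c j)) summable_on active I c"
    by (rule summable_on_cmult_right)
  then have "(\<lambda>p. (?k p)\<^sup>2) summable_on active I c"
    by (rule summable_on_cong[THEN iffD1, rotated])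
      (auto simp: active_def power_mult_distrib power_divide)
  moreover have "orthonormal_on (active I c) ?w"
    using wedge_orthonormal[OF w e] active_subset[of I c] unfolding orthonormal_on_def by blast
  ultimately obtain K where K: "\<And>p. p \<in> active I c \<Longrightarrow> hs_apply K (f p) = ?k p *\<^sub>R ?w p"
    using diagonal_hs[OF f, of ?w ?k] by blast
  have "K_op I c e wedge f t = K"
    unfolding K_op_def
  proof (rule the_equality)
    show "\<forall>(i, j)\<in>active I c. hs_apply K (f (i, j)) = (t / 2 * sqrt (c i * c j)) *\<^sub>R wedge (e i) (e j)"
      using K by auto
    fix K' assume K': "\<forall>(i, j)\<in>active I c.
      hs_apply K' (f (i, j)) = (t / 2 * sqrt (c i * c j)) *\<^sub>R wedge (e i) (e j)"
    have "hs_apply K' x = hs_apply K x" for x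
      by (rule bounded_linear_basis_eqI[OF f bounded_linear_hs_apply bounded_linear_hs_apply])
        (use K' K in auto)
    then show "K' = K" by (rule hs_eqI)
  qed
  then show ?thesis using K[OF ij] by simp
qed

text \<open>On coordinates both \<open>K K\<^sup>*\<close> and \<open>t\<^sup>2/4 \<Lambda>\<^sup>2C\<close> multiply the \<open>e\<^sub>i \<and> e\<^sub>j\<close> component by
  \<open>t\<^sup>2/4 c\<^sub>i c\<^sub>j\<close>; pairs outside the active set contribute the eigenvalue \<open>0\<close> to either side.\<close>

lemma K_op_adjoint:
  fixes wedge :: "'h::{real_inner, complete_space} \<Rightarrow> 'h \<Rightarrow> 'l::{real_inner, complete_space}"
    and f :: "nat \<times> nat \<Rightarrow> 'k::{real_inner, complete_space}" and e :: "nat \<Rightarrow> 'h"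
  assumes w: "exterior_square wedge" and e: "orthonormal_basis I e"
    and C: "positive_trace_class C" and eig: "\<And>i. i \<in> I \<Longrightarrow> blinfun_apply C (e i) = c i *\<^sub>R e i"
    and f: "orthonormal_basis (active I c) f" and t: "t > 0"
  defines "K \<equiv> K_op I c e wedge f t"
  shows "hs_apply K \<circ> adjoint (hs_apply K) = blinfun_apply ((t\<^sup>2 / 4) *\<^sub>R exterior_square_op wedge C)"
proof -
  note c = positive_trace_class_eigenvalues[OF C e eig]
  have eo: "orthonormal_on I e" by (rule orthonormal_basisD[OF e])
  have wo: "orthonormal_on (increasing_pairs I) (\<lambda>(i, j). wedge (e i) (e j))"
    by (rule wedge_orthonormal[OF w eo])
  have K: "hs_apply K (f (i, j)) = (t / 2 * sqrt (c i * c j)) *\<^sub>R wedge (e i) (e j)"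
    if "(i, j) \<in> active I c" for i j
    unfolding K_def by (rule K_op_apply[OF w eo c(2,1) f that])
  let ?A = "adjoint (hs_apply K)"
  have A_f: "?A y \<bullet> f (i, j) = t / 2 * sqrt (c i * c j) * (y \<bullet> wedge (e i) (e j))"
    if "(i, j) \<in> active I c" for y i j
    using hs_adjoint(2)[of K "f (i, j)" y] K[OF that] by (simp add: inner_commute)
  have A_w: "?A (wedge (e i) (e j)) = (t / 2 * sqrt (c i * c j)) *\<^sub>R (if (i, j) \<in> active I c then f (i, j) else 0)"
    if ij: "(i, j) \<in> increasing_pairs I" for i j
  proof (rule basis_eqI[OF f])
    fix p assume p: "p \<in> active I c"
    then have "p \<in> increasing_pairs I" using active_subset by blast
    with p show "?A (wedge (e i) (e j)) \<bullet> f p =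
        ((t / 2 * sqrt (c i * c j)) *\<^sub>R (if (i, j) \<in> active I c then f (i, j) else 0)) \<bullet> f p"
      using orthonormal_onD(1)[OF wo ij, of p] orthonormal_onD(1)[OF orthonormal_basisD[OF f] _ p, of "(i, j)"]
      by (cases p) (auto simp: A_f)
  qed
  have KA_w: "hs_apply K (?A y) \<bullet> wedge (e i) (e j) = t\<^sup>2 / 4 * (c i * c j) * (y \<bullet> wedge (e i) (e j))"
    if ij: "(i, j) \<in> increasing_pairs I" for y i j
  proof -
    have cc: "0 \<le> c i * c j" using c(1) ij by (auto simp: increasing_pairs_def)
    have "hs_apply K (?A y) \<bullet> wedge (e i) (e j) = ?A y \<bullet> ?A (wedge (e i) (e j))"
      by (rule hs_adjoint(2))
    also have "\<dots> = t\<^sup>2 / 4 * (c i * c j) * (y \<bullet> wedge (e i) (e j))"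
    proof (cases "(i, j) \<in> active I c")
      case True
      then have "?A y \<bullet> ?A (wedge (e i) (e j))
          = (t / 2 * sqrt (c i * c j)) * (t / 2 * sqrt (c i * c j)) * (y \<bullet> wedge (e i) (e j))"
        by (simp add: A_w[OF ij] A_f)
      also have "(t / 2 * sqrt (c i * c j)) * (t / 2 * sqrt (c i * c j)) = t\<^sup>2 / 4 * (c i * c j)"
        using cc by (simp add: power2_eq_square algebra_simps flip: real_sqrt_mult)
      finally show ?thesis .
    next
      case False
      then have "c i * c j = 0" using ij cc by (auto simp: active_def increasing_pairs_def)
      then show ?thesis unfolding A_w[OF ij] by (simp only:) simp
    qed
    finally show ?thesis .
  qed
  have bl: "bounded_linear (\<lambda>y. (4 / t\<^sup>2) *\<^sub>R hs_apply K (?A y))"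
    by (intro bounded_linear_const_scaleR bounded_linear_compose[OF bounded_linear_hs_apply] hs_adjoint(1))
  have wedge_eq: "(4 / t\<^sup>2) *\<^sub>R hs_apply K (?A (wedge u v)) = wedge (blinfun_apply C u) (blinfun_apply C v)" for u v
  proof (rule basis_eqI[OF wedge_basis[OF w e]])
    fix p assume p: "p \<in> increasing_pairs I"
    then obtain i j where ij: "p = (i, j)" "i \<in> I" "j \<in> I" by (auto simp: increasing_pairs_def)
    show "((4 / t\<^sup>2) *\<^sub>R hs_apply K (?A (wedge u v))) \<bullet> (case p of (i, j) \<Rightarrow> wedge (e i) (e j)) =
        wedge (blinfun_apply C u) (blinfun_apply C v) \<bullet> (case p of (i, j) \<Rightarrow> wedge (e i) (e j))"
      using KA_w[of i j "wedge u v"] p ij t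
      by (simp add: exterior_square_inner[OF w] c(3) field_simps)
  qed
  have "exterior_square_op wedge C = Blinfun (\<lambda>y. (4 / t\<^sup>2) *\<^sub>R hs_apply K (?A y))"
    unfolding exterior_square_op_def
  proof (rule the_equality)
    show "\<forall>u v. blinfun_apply (Blinfun (\<lambda>y. (4 / t\<^sup>2) *\<^sub>R hs_apply K (?A y))) (wedge u v)
        = wedge (blinfun_apply C u) (blinfun_apply C v)"
      by (simp add: bounded_linear_Blinfun_apply[OF bl] wedge_eq)
    fix T assume T: "\<forall>u v. blinfun_apply T (wedge u v) = wedge (blinfun_apply C u) (blinfun_apply C v)"
    show "T = Blinfun (\<lambda>y. (4 / t\<^sup>2) *\<^sub>R hs_apply K (?A y))"
    proof (rule blinfun_eqI)
      fix y show "blinfun_apply T y = blinfun_apply (Blinfun (\<lambda>y. (4 / t\<^sup>2) *\<^sub>R hs_apply K (?A y))) y"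
        unfolding bounded_linear_Blinfun_apply[OF bl]
        by (rule bounded_linear_basis_eqI[OF wedge_basis[OF w e] blinfun.bounded_linear_right bl])
          (use T in \<open>auto simp: wedge_eq\<close>)
    qed
  qed
  then show ?thesis
    using t by (auto simp: fun_eq_iff scaleR_blinfun.rep_eq bounded_linear_Blinfun_apply[OF bl])
qed

text \<open>The expansion of \<open>C x\<close> only involves eigenvectors with nonzero eigenvalue.\<close>

lemma infinite_rank_infinite_support:
  fixes C :: "'h::real_inner \<Rightarrow>\<^sub>L 'h"
  assumes e: "orthonormal_basis I e" and eig: "\<And>i. i \<in> I \<Longrightarrow> blinfun_apply C (e i) = c i *\<^sub>R e i"
    and inf: "\<not> finite_rank C"
  shows "infinite {i \<in> I. c i \<noteq> 0}"
proof
  let ?J = "{i \<in> I. c i \<noteq> 0}"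
  assume fin: "finite ?J"
  have "blinfun_apply C x \<in> span (e ` ?J)" for x
  proof -
    have "((\<lambda>i. blinfun_apply C ((x \<bullet> e i) *\<^sub>R e i)) has_sum blinfun_apply C x) I"
      by (rule has_sum_bounded_linear_image[OF blinfun.bounded_linear_right parseval[OF e]])
    moreover have "((\<lambda>i. blinfun_apply C ((x \<bullet> e i) *\<^sub>R e i)) has_sum
        (\<Sum>i\<in>?J. ((x \<bullet> e i) * c i) *\<^sub>R e i)) I \<longleftrightarrow>
      ((\<lambda>i. ((x \<bullet> e i) * c i) *\<^sub>R e i) has_sum (\<Sum>i\<in>?J. ((x \<bullet> e i) * c i) *\<^sub>R e i)) ?J"
      by (rule has_sum_cong_neutral) (auto simp: blinfun.scaleR_right eig)
    ultimately have "blinfun_apply C x = (\<Sum>i\<in>?J. ((x \<bullet> e i) * c i) *\<^sub>R e i)"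
      using has_sum_finite[OF fin] has_sum_unique by blast
    then show ?thesis by (simp only:) (intro span_sum span_scale span_base imageI)
  qed
  then have "finite_rank C" using fin unfolding finite_rank_def by (intro exI[of _ "e ` ?J"]) auto
  with inf show False by simp
qed


section \<open>Square-integrable random elements\<close>

lemma strongly_measurableE:
  assumes "strongly_measurable M f"
  obtains s where "\<forall>n. simple_function M (s n)" "\<forall>\<omega>\<in>space M. (\<lambda>n. s n \<omega>) \<longlonglongrightarrow> f \<omega>"
  using assms unfolding strongly_measurable_def by blast

lemma strongly_measurable_simple: "simple_function M f \<Longrightarrow> strongly_measurable M f"
  unfolding strongly_measurable_def by (intro exI[of _ "\<lambda>_. f"]) simp

lemma strongly_measurable_const: "strongly_measurable M (\<lambda>_. x)"
  by (intro strongly_measurable_simple) simp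

lemma strongly_measurable_pair:
  assumes "strongly_measurable M f" "strongly_measurable M g"
  shows "strongly_measurable M (\<lambda>\<omega>. (f \<omega>, g \<omega>))"
proof -
  from assms(1) obtain s
    where s: "\<forall>n. simple_function M (s n)" "\<forall>\<omega>\<in>space M. (\<lambda>n. s n \<omega>) \<longlonglongrightarrow> f \<omega>"
    by (rule strongly_measurableE)
  from assms(2) obtain s'
    where s': "\<forall>n. simple_function M (s' n)" "\<forall>\<omega>\<in>space M. (\<lambda>n. s' n \<omega>) \<longlonglongrightarrow> g \<omega>"
    by (rule strongly_measurableE)
  show ?thesis
    unfolding strongly_measurable_def
    by (rule exI[of _ "\<lambda>n \<omega>. (s n \<omega>, s' n \<omega>)"]) (use s s' in \<open>auto intro!: simple_function_Pair tendsto_Pair\<close>)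
qed

lemma strongly_measurable_compose:
  assumes "strongly_measurable M f" "continuous_on UNIV h"
  shows "strongly_measurable M (\<lambda>\<omega>. h (f \<omega>))"
proof -
  from assms(1) obtain s
    where s: "\<forall>n. simple_function M (s n)" "\<forall>\<omega>\<in>space M. (\<lambda>n. s n \<omega>) \<longlonglongrightarrow> f \<omega>"
    by (rule strongly_measurableE)
  show ?thesis
    unfolding strongly_measurable_def
  proof (intro exI[of _ "\<lambda>n \<omega>. h (s n \<omega>)"] conjI allI ballI)
    show "simple_function M (\<lambda>\<omega>. h (s n \<omega>))" for n
      by (rule simple_function_compose1) (use s in simp)
    show "(\<lambda>n. h (s n \<omega>)) \<longlonglongrightarrow> h (f \<omega>)" if "\<omega> \<in> space M" for \<omega>
      by (rule continuous_on_tendsto_compose[OF assms(2)]) (use s that in auto)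
  qed
qed

lemma strongly_measurable_compose2:
  assumes "strongly_measurable M f" "strongly_measurable M g" "continuous_on UNIV (\<lambda>x. h (fst x) (snd x))"
  shows "strongly_measurable M (\<lambda>\<omega>. h (f \<omega>) (g \<omega>))"
  using strongly_measurable_compose[OF strongly_measurable_pair[OF assms(1,2)] assms(3)] by simp

lemma strongly_measurable_borel:
  assumes "strongly_measurable M f"
  shows "f \<in> borel_measurable M"
proof -
  from assms obtain s
    where "\<forall>n. simple_function M (s n)" "\<forall>\<omega>\<in>space M. (\<lambda>n. s n \<omega>) \<longlonglongrightarrow> f \<omega>"
    by (rule strongly_measurableE)
  then show ?thesis
    by (intro borel_measurable_LIMSEQ_metric[of s M f] borel_measurable_simple_function) auto
qed

text \<open>Each value is approximated by the nearest of the first \<open>n\<close> points of a countable set whose closure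
  contains the range.\<close>

lemma separable_strongly_measurable:
  fixes f :: "'w \<Rightarrow> 'e::real_normed_vector"
  assumes f: "f \<in> borel_measurable M" and D: "countable D" "\<And>\<omega>. \<omega> \<in> space M \<Longrightarrow> f \<omega> \<in> closure D"
  shows "strongly_measurable M f"
proof (cases "D = {}")
  case True
  then have "space M = {}" using D(2) by auto
  then show ?thesis by (auto simp: strongly_measurable_def simple_function_def)
next
  case False
  define d where "d = from_nat_into D"
  have d: "range d = D" unfolding d_def by (rule range_from_nat_into[OF False D(1)])
  define k where "k n \<omega> = (LEAST i. i \<le> n \<and> (\<forall>j\<le>n. dist (f \<omega>) (d i) \<le> dist (f \<omega>) (d j)))" for n \<omega>
  have k: "k n \<omega> \<le> n \<and> (\<forall>j\<le>n. dist (f \<omega>) (d (k n \<omega>)) \<le> dist (f \<omega>) (d j))" for n \<omega>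
  proof -
    obtain i where "i \<in> {..n}" "\<forall>j\<in>{..n}. dist (f \<omega>) (d i) \<le> dist (f \<omega>) (d j)"
      using ex_is_arg_min_if_finite[of "{..n}" "\<lambda>i. dist (f \<omega>) (d i)"]
      by (auto simp: is_arg_min_linorder)
    then show ?thesis
      unfolding k_def
      by (intro LeastI[of "\<lambda>i. i \<le> n \<and> (\<forall>j\<le>n. dist (f \<omega>) (d i) \<le> dist (f \<omega>) (d j))" i]) auto
  qed
  have [measurable]: "(\<lambda>\<omega>. dist (f \<omega>) (d i)) \<in> borel_measurable M" for i
    by (rule measurable_compose[OF f borel_measurable_continuous_onI]) (intro continuous_intros)
  have k_meas: "k n \<in> measurable M (count_space UNIV)" for n
    unfolding k_def by measurable
  have "simple_function M (\<lambda>\<omega>. d (k n \<omega>))" for n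
  proof (rule simple_function_compose1[where f = "k n" and g = d])
    have "k n ` space M \<subseteq> {..n}" using k by auto
    then have "finite (k n ` space M)" by (rule finite_subset) simp
    then show "simple_function M (k n)"
      using measurable_sets[OF k_meas] by (auto simp: simple_function_def)
  qed
  moreover have "(\<lambda>n. d (k n \<omega>)) \<longlonglongrightarrow> f \<omega>" if sp: "\<omega> \<in> space M" for \<omega>
  proof (rule metric_LIMSEQ_I)
    fix r :: real assume "0 < r"
    then obtain j where j: "dist (d j) (f \<omega>) < r"
      using D(2)[OF sp] unfolding closure_approachable d[symmetric] by auto
    then have "dist (d (k n \<omega>)) (f \<omega>) < r" if "n \<ge> j" for n
      using k[of n \<omega>] that by (metis dist_commute le_less_trans)
    then show "\<exists>N. \<forall>n\<ge>N. dist (d (k n \<omega>)) (f \<omega>) < r" by blast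
  qed
  ultimately show ?thesis
    unfolding strongly_measurable_def by (intro exI[of _ "\<lambda>n \<omega>. d (k n \<omega>)"]) simp
qed

text \<open>The values of the approximating simple functions form a countable set, and all limits lie in its
  closure.\<close>

lemma strongly_measurable_LIMSEQ:
  fixes f :: "nat \<Rightarrow> 'w \<Rightarrow> 'e::real_normed_vector"
  assumes f: "\<And>n. strongly_measurable M (f n)" and lim: "\<And>\<omega>. \<omega> \<in> space M \<Longrightarrow> (\<lambda>n. f n \<omega>) \<longlonglongrightarrow> g \<omega>"
  shows "strongly_measurable M g"
proof -
  have "\<exists>s. (\<forall>k. simple_function M (s k)) \<and> (\<forall>\<omega>\<in>space M. (\<lambda>k. s k \<omega>) \<longlonglongrightarrow> f n \<omega>)" for n
    using f[of n] by (simp add: strongly_measurable_def)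
  then obtain s where s: "\<And>n k. simple_function M (s n k)"
    "\<And>n \<omega>. \<omega> \<in> space M \<Longrightarrow> (\<lambda>k. s n k \<omega>) \<longlonglongrightarrow> f n \<omega>" by metis
  define D where "D = (\<Union>n. \<Union>k. s n k ` space M)"
  show ?thesis
  proof (rule separable_strongly_measurable)
    show "g \<in> borel_measurable M"
      by (rule borel_measurable_LIMSEQ_metric[OF strongly_measurable_borel[OF f] lim])
    show "countable D"
      unfolding D_def by (intro countable_UN countable_finite simple_functionD(1)[OF s(1)] countableI_type)
    fix \<omega> assume \<omega>: "\<omega> \<in> space M"
    have "f n \<omega> \<in> closure D" for n
      by (rule closed_sequentially[OF closed_closure _ s(2)[OF \<omega>]])
        (use \<omega> in \<open>auto simp: D_def intro!: subsetD[OF closure_subset]\<close>)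
    then show "g \<omega> \<in> closure D" by (rule closed_sequentially[OF closed_closure _ lim[OF \<omega>]])
  qed
qed

lemma borel_strongly_measurable:
  fixes f :: "'w \<Rightarrow> 'e::{real_normed_vector, second_countable_topology}"
  assumes "f \<in> borel_measurable M"
  shows "strongly_measurable M f"
  using borel_measurable_implies_sequence_metric[OF assms, of 0] by (auto simp: strongly_measurable_def)

lemma strongly_measurable_add:
  "strongly_measurable M f \<Longrightarrow> strongly_measurable M g \<Longrightarrow> strongly_measurable M (\<lambda>\<omega>. f \<omega> + g \<omega>)"
  by (rule strongly_measurable_compose2) (auto intro!: continuous_intros)

lemma strongly_measurable_diff:
  "strongly_measurable M f \<Longrightarrow> strongly_measurable M g \<Longrightarrow> strongly_measurable M (\<lambda>\<omega>. f \<omega> - g \<omega>)"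
  by (rule strongly_measurable_compose2) (auto intro!: continuous_intros)

lemma strongly_measurable_scaleR:
  "strongly_measurable M f \<Longrightarrow> strongly_measurable M g \<Longrightarrow> strongly_measurable M (\<lambda>\<omega>. f \<omega> *\<^sub>R g \<omega>)"
  by (rule strongly_measurable_compose2[of M f g "(*\<^sub>R)"]) (auto intro!: continuous_intros)

lemma strongly_measurable_sum:
  "(\<And>i. i \<in> I \<Longrightarrow> strongly_measurable M (f i)) \<Longrightarrow> strongly_measurable M (\<lambda>\<omega>. \<Sum>i\<in>I. f i \<omega>)"
  by (induction I rule: infinite_finite_induct)
    (auto intro: strongly_measurable_add strongly_measurable_const)

lemma strongly_measurable_if_set:
  assumes "strongly_measurable M f" "A \<in> sets M"
  shows "strongly_measurable M (\<lambda>\<omega>. if \<omega> \<in> A then f \<omega> else 0)"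
proof -
  have "strongly_measurable M (\<lambda>\<omega>. (if \<omega> \<in> A then 1 else 0 :: real) *\<^sub>R f \<omega>)"
    using assms by (intro strongly_measurable_scaleR borel_strongly_measurable measurable_If_set) auto
  then show ?thesis by (rule back_subst[of "strongly_measurable M"]) auto
qed

lemma L2_iff_real: "f \<in> L2 M \<longleftrightarrow> f \<in> borel_measurable M \<and> integrable M (\<lambda>\<omega>. (f \<omega> :: real)\<^sup>2)"
  by (auto simp: L2_def intro: borel_strongly_measurable strongly_measurable_borel)

lemma L2_measurable: "f \<in> L2 M \<Longrightarrow> f \<in> borel_measurable M"
  by (auto simp: L2_def intro: strongly_measurable_borel)

lemma L2_integrable: "f \<in> L2 M \<Longrightarrow> integrable M (\<lambda>\<omega>. (norm (f \<omega>))\<^sup>2)"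
  by (simp add: L2_def)

lemma strongly_measurable_norm:
  "strongly_measurable M f \<Longrightarrow> (\<lambda>\<omega>. norm (f \<omega>)) \<in> borel_measurable M"
  by (rule strongly_measurable_borel[OF strongly_measurable_compose]) (auto intro!: continuous_intros)

lemma L2_add:
  assumes "f \<in> L2 M" "g \<in> L2 M"
  shows "(\<lambda>\<omega>. f \<omega> + g \<omega>) \<in> L2 M"
proof -
  have sm: "strongly_measurable M (\<lambda>\<omega>. f \<omega> + g \<omega>)"
    using assms by (auto simp: L2_def intro: strongly_measurable_add)
  have "integrable M (\<lambda>\<omega>. (norm (f \<omega> + g \<omega>))\<^sup>2)"
  proof (rule Bochner_Integration.integrable_bound)
    show "integrable M (\<lambda>\<omega>. 2 * (norm (f \<omega>))\<^sup>2 + 2 * (norm (g \<omega>))\<^sup>2)"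
      using assms by (auto simp: L2_def)
    show "(\<lambda>\<omega>. (norm (f \<omega> + g \<omega>))\<^sup>2) \<in> borel_measurable M"
      using strongly_measurable_norm[OF sm] by simp
    show "AE \<omega> in M. norm ((norm (f \<omega> + g \<omega>))\<^sup>2) \<le> norm (2 * (norm (f \<omega>))\<^sup>2 + 2 * (norm (g \<omega>))\<^sup>2)"
    proof (rule AE_I2)
      fix \<omega>
      have "(norm (f \<omega> + g \<omega>))\<^sup>2 + (norm (f \<omega> - g \<omega>))\<^sup>2 = 2 * (norm (f \<omega>))\<^sup>2 + 2 * (norm (g \<omega>))\<^sup>2"
        by (simp add: power2_norm_eq_inner algebra_simps inner_commute)
      then have "(norm (f \<omega> + g \<omega>))\<^sup>2 \<le> 2 * (norm (f \<omega>))\<^sup>2 + 2 * (norm (g \<omega>))\<^sup>2"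
        using zero_le_power2[of "norm (f \<omega> - g \<omega>)"] by linarith
      then show "norm ((norm (f \<omega> + g \<omega>))\<^sup>2) \<le> norm (2 * (norm (f \<omega>))\<^sup>2 + 2 * (norm (g \<omega>))\<^sup>2)"
        by simp
    qed
  qed
  with sm show ?thesis by (simp add: L2_def)
qed

lemma L2_scale: "f \<in> L2 M \<Longrightarrow> (\<lambda>\<omega>. r *\<^sub>R f \<omega>) \<in> L2 M"
  by (auto simp: L2_def power_mult_distrib intro: strongly_measurable_scaleR strongly_measurable_const)

lemma L2_diff: "f \<in> L2 M \<Longrightarrow> g \<in> L2 M \<Longrightarrow> (\<lambda>\<omega>. f \<omega> - g \<omega>) \<in> L2 M"
  using L2_add[OF _ L2_scale[of g M "-1"], of f] by simp

lemma L2_zero: "(\<lambda>_. 0) \<in> L2 M"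
  by (simp add: L2_def strongly_measurable_const)

lemma L2_sum: "(\<And>i. i \<in> I \<Longrightarrow> f i \<in> L2 M) \<Longrightarrow> (\<lambda>\<omega>. \<Sum>i\<in>I. f i \<omega>) \<in> L2 M"
  by (induction I rule: infinite_finite_induct) (auto intro: L2_add L2_zero)

lemma L2_bounded_linear:
  assumes h: "bounded_linear h" and f: "f \<in> L2 M"
  shows "(\<lambda>\<omega>. h (f \<omega>)) \<in> L2 M"
proof -
  interpret bounded_linear h by fact
  obtain B where B: "\<And>x. norm (h x) \<le> norm x * B" "0 \<le> B" using nonneg_bounded by auto
  have sm: "strongly_measurable M (\<lambda>\<omega>. h (f \<omega>))"
    by (rule strongly_measurable_compose[OF _ linear_continuous_on[OF h]]) (use f in \<open>simp add: L2_def\<close>)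
  have "integrable M (\<lambda>\<omega>. (norm (h (f \<omega>)))\<^sup>2)"
  proof (rule Bochner_Integration.integrable_bound)
    show "integrable M (\<lambda>\<omega>. (norm (f \<omega>))\<^sup>2 * B\<^sup>2)" using f by (simp add: L2_def)
    show "(\<lambda>\<omega>. (norm (h (f \<omega>)))\<^sup>2) \<in> borel_measurable M"
      using strongly_measurable_norm[OF sm] by simp
    show "AE \<omega> in M. norm ((norm (h (f \<omega>)))\<^sup>2) \<le> norm ((norm (f \<omega>))\<^sup>2 * B\<^sup>2)"
      using power_mono[OF B(1) norm_ge_zero, of _ 2] by (simp add: power_mult_distrib)
  qed
  with sm show ?thesis by (simp add: L2_def)
qed

lemma L2_scaleR_const: "f \<in> L2 M \<Longrightarrow> (\<lambda>\<omega>. f \<omega> *\<^sub>R v) \<in> L2 M"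
  by (rule L2_bounded_linear[OF bounded_linear_scaleR_left])

lemma L2_inner_const: "f \<in> L2 M \<Longrightarrow> (\<lambda>\<omega>. f \<omega> \<bullet> v) \<in> L2 M"
  by (rule L2_bounded_linear[OF bounded_linear_inner_left])

lemma L2_inner_integrable:
  assumes "f \<in> L2 M" "g \<in> L2 M"
  shows "integrable M (\<lambda>\<omega>. f \<omega> \<bullet> g \<omega>)"
proof (rule Bochner_Integration.integrable_bound)
  show "integrable M (\<lambda>\<omega>. (norm (f \<omega>))\<^sup>2 + (norm (g \<omega>))\<^sup>2)"
    using assms by (simp add: L2_def)
  have "strongly_measurable M (\<lambda>\<omega>. f \<omega> \<bullet> g \<omega>)"
    by (rule strongly_measurable_compose2[of M f g "(\<bullet>)"])
      (use assms in \<open>auto simp: L2_def intro!: continuous_intros\<close>)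
  then show "(\<lambda>\<omega>. f \<omega> \<bullet> g \<omega>) \<in> borel_measurable M" by (rule strongly_measurable_borel)
  show "AE \<omega> in M. norm (f \<omega> \<bullet> g \<omega>) \<le> norm ((norm (f \<omega>))\<^sup>2 + (norm (g \<omega>))\<^sup>2)"
  proof (rule AE_I2)
    fix \<omega>
    have "\<bar>f \<omega> \<bullet> g \<omega>\<bar> \<le> norm (f \<omega>) * norm (g \<omega>)" by (rule Cauchy_Schwarz_ineq2)
    also have "\<dots> \<le> (norm (f \<omega>))\<^sup>2 + (norm (g \<omega>))\<^sup>2"
      using sum_squares_bound[of "norm (f \<omega>)" "norm (g \<omega>)"]
        mult_nonneg_nonneg[OF norm_ge_zero[of "f \<omega>"] norm_ge_zero[of "g \<omega>"]]
      unfolding mult.assoc by linarith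
    finally show "norm (f \<omega> \<bullet> g \<omega>) \<le> norm ((norm (f \<omega>))\<^sup>2 + (norm (g \<omega>))\<^sup>2)" by simp
  qed
qed

lemma L2_mult_integrable: "f \<in> L2 M \<Longrightarrow> g \<in> L2 M \<Longrightarrow> integrable M (\<lambda>\<omega>. f \<omega> * g \<omega> :: real)"
  using L2_inner_integrable[of f M g] by simp

lemma L2_norm_nonneg [simp]: "0 \<le> L2_norm M f"
  by (simp add: L2_norm_def)

lemma L2_norm_square: "(L2_norm M f)\<^sup>2 = (\<integral>\<omega>. (norm (f \<omega>))\<^sup>2 \<partial>M)"
  by (simp add: L2_norm_def)

lemma L2_norm_minus_commute: "L2_norm M (\<lambda>\<omega>. f \<omega> - g \<omega>) = L2_norm M (\<lambda>\<omega>. g \<omega> - f \<omega>)"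
  by (simp add: L2_norm_def norm_minus_commute)

lemma L2_norm_scale: "L2_norm M (\<lambda>\<omega>. r *\<^sub>R f \<omega>) = \<bar>r\<bar> * L2_norm M f"
  by (simp add: L2_norm_def power_mult_distrib real_sqrt_mult)

lemma L2_norm_add_square:
  assumes "f \<in> L2 M" "g \<in> L2 M"
  shows "(L2_norm M (\<lambda>\<omega>. f \<omega> + g \<omega>))\<^sup>2 =
    (L2_norm M f)\<^sup>2 + 2 * (\<integral>\<omega>. f \<omega> \<bullet> g \<omega> \<partial>M) + (L2_norm M g)\<^sup>2"
proof -
  have "(L2_norm M (\<lambda>\<omega>. f \<omega> + g \<omega>))\<^sup>2
      = (\<integral>\<omega>. ((norm (f \<omega>))\<^sup>2 + 2 * (f \<omega> \<bullet> g \<omega>)) + (norm (g \<omega>))\<^sup>2 \<partial>M)"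
    unfolding L2_norm_square
    by (intro Bochner_Integration.integral_cong refl)
      (simp add: power2_norm_eq_inner algebra_simps inner_commute)
  also have "\<dots> = (\<integral>\<omega>. (norm (f \<omega>))\<^sup>2 \<partial>M) + 2 * (\<integral>\<omega>. f \<omega> \<bullet> g \<omega> \<partial>M) + (\<integral>\<omega>. (norm (g \<omega>))\<^sup>2 \<partial>M)"
    using L2_inner_integrable[OF assms] assms[THEN L2_integrable] by simp
  finally show ?thesis by (simp add: L2_norm_square)
qed

text \<open>The quadratic \<open>r \<mapsto> \<parallel>f + r g\<parallel>\<^sup>2\<close> is nonnegative. It degenerates to an affine function when
  \<open>\<parallel>g\<parallel> = 0\<close>.\<close>

lemma L2_Cauchy_Schwarz:
  assumes "f \<in> L2 M" "g \<in> L2 M"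
  shows "\<bar>\<integral>\<omega>. f \<omega> \<bullet> g \<omega> \<partial>M\<bar> \<le> L2_norm M f * L2_norm M g"
proof -
  define p F G where "p = (\<integral>\<omega>. f \<omega> \<bullet> g \<omega> \<partial>M)" and "F = (L2_norm M f)\<^sup>2" and "G = (L2_norm M g)\<^sup>2"
  have q: "0 \<le> F + 2 * r * p + r\<^sup>2 * G" for r
    using L2_norm_add_square[OF assms(1) L2_scale[OF assms(2), of r]]
      zero_le_power2[of "L2_norm M (\<lambda>\<omega>. f \<omega> + r *\<^sub>R g \<omega>)"]
    by (simp add: p_def F_def G_def L2_norm_scale power_mult_distrib)
  have "p\<^sup>2 \<le> F * G"
  proof (cases "G = 0")
    case True
    have "p = 0"
    proof (rule ccontr)
      assume "p \<noteq> 0"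
      then show False using q[of "- (F + 1) / (2 * p)"] True by (simp add: field_simps)
    qed
    then show ?thesis using True by simp
  next
    case False
    then have "G > 0" by (simp add: G_def)
    then show ?thesis using q[of "- p / G"] by (simp add: field_simps power2_eq_square)
  qed
  then have "\<bar>p\<bar>\<^sup>2 \<le> (L2_norm M f * L2_norm M g)\<^sup>2"
    by (simp add: F_def G_def power_mult_distrib)
  then show ?thesis unfolding p_def by (rule power2_le_imp_le) simp
qed

lemma L2_triangle:
  assumes "f \<in> L2 M" "g \<in> L2 M"
  shows "L2_norm M (\<lambda>\<omega>. f \<omega> + g \<omega>) \<le> L2_norm M f + L2_norm M g"
proof (rule power2_le_imp_le)
  show "(L2_norm M (\<lambda>\<omega>. f \<omega> + g \<omega>))\<^sup>2 \<le> (L2_norm M f + L2_norm M g)\<^sup>2"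
    using L2_norm_add_square[OF assms] L2_Cauchy_Schwarz[OF assms] by (simp add: power2_sum)
qed simp

lemma L2_triangle_diff:
  assumes "f \<in> L2 M" "g \<in> L2 M" "h \<in> L2 M"
  shows "L2_norm M (\<lambda>\<omega>. f \<omega> - h \<omega>) \<le> L2_norm M (\<lambda>\<omega>. f \<omega> - g \<omega>) + L2_norm M (\<lambda>\<omega>. g \<omega> - h \<omega>)"
  using L2_triangle[OF L2_diff[OF assms(1,2)] L2_diff[OF assms(2,3)]] by simp

lemma L2_norm_cong_AE:
  assumes "AE \<omega> in M. f \<omega> = g \<omega>" "strongly_measurable M f" "strongly_measurable M g"
  shows "L2_norm M f = L2_norm M g"
  unfolding L2_norm_def
  using assms(1) strongly_measurable_norm[OF assms(2)] strongly_measurable_norm[OF assms(3)]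
  by (intro arg_cong[of _ _ sqrt] integral_cong_AE) auto

lemma L2_norm_eq_0:
  assumes "f \<in> L2 M" "L2_norm M f = 0"
  shows "AE \<omega> in M. f \<omega> = 0"
  using assms integral_nonneg_eq_0_iff_AE[OF L2_integrable[OF assms(1)]] by (simp add: L2_norm_def)

lemma L2_tendstoD:
  "L2_tendsto M f g F \<Longrightarrow> g \<in> L2 M"
  "L2_tendsto M f g F \<Longrightarrow> \<forall>\<^sub>F n in F. f n \<in> L2 M"
  "L2_tendsto M f g F \<Longrightarrow> ((\<lambda>n. L2_norm M (\<lambda>\<omega>. f n \<omega> - g \<omega>)) \<longlongrightarrow> 0) F"
  by (auto simp: L2_tendsto_def)

lemma L2_tendsto_unique:
  assumes f: "L2_tendsto M f g F" "L2_tendsto M f g' F" and F: "F \<noteq> bot"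
  shows "AE \<omega> in M. g \<omega> = g' \<omega>"
proof -
  have g: "g \<in> L2 M" "g' \<in> L2 M" using f by (auto simp: L2_tendsto_def)
  let ?d = "L2_norm M (\<lambda>\<omega>. g \<omega> - g' \<omega>)"
  have "((\<lambda>n. L2_norm M (\<lambda>\<omega>. f n \<omega> - g \<omega>) + L2_norm M (\<lambda>\<omega>. f n \<omega> - g' \<omega>)) \<longlongrightarrow> 0 + 0) F"
    by (intro tendsto_add L2_tendstoD(3)[OF f(1)] L2_tendstoD(3)[OF f(2)])
  moreover have "\<forall>\<^sub>F n in F. ?d \<le> L2_norm M (\<lambda>\<omega>. f n \<omega> - g \<omega>) + L2_norm M (\<lambda>\<omega>. f n \<omega> - g' \<omega>)"
    using L2_tendstoD(2)[OF f(1)]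
    by eventually_elim (use L2_triangle_diff[OF g(1) _ g(2)] in \<open>simp add: L2_norm_minus_commute[of M g]\<close>)
  ultimately have "?d \<le> 0 + 0" by (intro tendsto_lowerbound[OF _ _ F]) auto
  then have "?d = 0" using L2_norm_nonneg[of M "\<lambda>\<omega>. g \<omega> - g' \<omega>"] by linarith
  then have "AE \<omega> in M. g \<omega> - g' \<omega> = 0" by (rule L2_norm_eq_0[OF L2_diff[OF g]])
  then show ?thesis by simp
qed

lemma L2_tendsto_cong_AE:
  fixes g :: "'w \<Rightarrow> 'e::real_inner"
  assumes f: "L2_tendsto M f g F" and g': "g' \<in> L2 M" and eq: "AE \<omega> in M. g \<omega> = g' \<omega>"
  shows "L2_tendsto M f g' F"
proof -
  have g: "g \<in> L2 M" using f by (simp add: L2_tendsto_def)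
  have "AE \<omega> in M. g \<omega> - g' \<omega> = 0" using eq by simp
  then have "L2_norm M (\<lambda>\<omega>. g \<omega> - g' \<omega>) = L2_norm M (\<lambda>_. 0 :: 'e)"
    using L2_diff[OF g g'] by (intro L2_norm_cong_AE) (auto simp: L2_def strongly_measurable_const)
  then have 0: "L2_norm M (\<lambda>\<omega>. g \<omega> - g' \<omega>) = 0" by (simp add: L2_norm_def)
  have "((\<lambda>n. L2_norm M (\<lambda>\<omega>. f n \<omega> - g' \<omega>)) \<longlongrightarrow> 0) F"
  proof (rule tendsto_sandwich[OF _ _ tendsto_const L2_tendstoD(3)[OF f]])
    show "\<forall>\<^sub>F n in F. L2_norm M (\<lambda>\<omega>. f n \<omega> - g' \<omega>) \<le> L2_norm M (\<lambda>\<omega>. f n \<omega> - g \<omega>)"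
      using L2_tendstoD(2)[OF f] by eventually_elim (use L2_triangle_diff[OF _ g g'] 0 in force)
  qed simp
  with f g' show ?thesis by (simp add: L2_tendsto_def)
qed

lemma L2_tendsto_inner:
  assumes f: "L2_tendsto M f g F" and f': "L2_tendsto M f' g' F"
  shows "((\<lambda>n. \<integral>\<omega>. f n \<omega> \<bullet> f' n \<omega> \<partial>M) \<longlongrightarrow> (\<integral>\<omega>. g \<omega> \<bullet> g' \<omega> \<partial>M)) F"
proof -
  have g: "g \<in> L2 M" "g' \<in> L2 M" using f f' by (auto simp: L2_tendsto_def)
  let ?a = "\<lambda>n. L2_norm M (\<lambda>\<omega>. f n \<omega> - g \<omega>)" and ?b = "\<lambda>n. L2_norm M (\<lambda>\<omega>. f' n \<omega> - g' \<omega>)"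
  have "((\<lambda>n. (\<integral>\<omega>. f n \<omega> \<bullet> f' n \<omega> \<partial>M) - (\<integral>\<omega>. g \<omega> \<bullet> g' \<omega> \<partial>M)) \<longlongrightarrow> 0) F"
  proof (rule Lim_null_comparison)
    have "((\<lambda>n. ?a n * ?b n + (?a n * L2_norm M g' + L2_norm M g * ?b n))
        \<longlongrightarrow> 0 * 0 + (0 * L2_norm M g' + L2_norm M g * 0)) F"
      by (intro tendsto_intros L2_tendstoD(3)[OF f] L2_tendstoD(3)[OF f'])
    then show "((\<lambda>n. ?a n * ?b n + (?a n * L2_norm M g' + L2_norm M g * ?b n)) \<longlongrightarrow> 0) F" by simp
    show "\<forall>\<^sub>F n in F. norm ((\<integral>\<omega>. f n \<omega> \<bullet> f' n \<omega> \<partial>M) - (\<integral>\<omega>. g \<omega> \<bullet> g' \<omega> \<partial>M))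
        \<le> ?a n * ?b n + (?a n * L2_norm M g' + L2_norm M g * ?b n)"
      using L2_tendstoD(2)[OF f] L2_tendstoD(2)[OF f']
    proof eventually_elim
      case (elim n)
      note d = L2_diff[OF elim(1) g(1)] L2_diff[OF elim(2) g(2)]
      have "(\<integral>\<omega>. f n \<omega> \<bullet> f' n \<omega> \<partial>M) - (\<integral>\<omega>. g \<omega> \<bullet> g' \<omega> \<partial>M)
          = (\<integral>\<omega>. (f n \<omega> - g \<omega>) \<bullet> (f' n \<omega> - g' \<omega>) + ((f n \<omega> - g \<omega>) \<bullet> g' \<omega> + g \<omega> \<bullet> (f' n \<omega> - g' \<omega>)) \<partial>M)"
        using L2_inner_integrable[OF elim] L2_inner_integrable[OF g]
        by (simp add: algebra_simps flip: Bochner_Integration.integral_diff)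
      also have "\<dots> = (\<integral>\<omega>. (f n \<omega> - g \<omega>) \<bullet> (f' n \<omega> - g' \<omega>) \<partial>M) +
          ((\<integral>\<omega>. (f n \<omega> - g \<omega>) \<bullet> g' \<omega> \<partial>M) + (\<integral>\<omega>. g \<omega> \<bullet> (f' n \<omega> - g' \<omega>) \<partial>M))"
        using L2_inner_integrable[OF d] L2_inner_integrable[OF d(1) g(2)] L2_inner_integrable[OF g(1) d(2)]
        by (subst Bochner_Integration.integral_add Bochner_Integration.integrable_add; simp)+
      finally show ?case
        using L2_Cauchy_Schwarz[OF d] L2_Cauchy_Schwarz[OF d(1) g(2)] L2_Cauchy_Schwarz[OF g(1) d(2)]
        by simp
    qed
  qed
  then show ?thesis by (simp add: LIM_zero_iff)
qed

lemma L2_tendsto_bounded_linear: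
  assumes h: "bounded_linear h" and f: "L2_tendsto M f g F"
  shows "L2_tendsto M (\<lambda>n \<omega>. h (f n \<omega>)) (\<lambda>\<omega>. h (g \<omega>)) F"
proof -
  interpret bounded_linear h by fact
  obtain B where B: "\<And>x. norm (h x) \<le> norm x * B" "0 \<le> B" using nonneg_bounded by auto
  have g: "g \<in> L2 M" using f by (simp add: L2_tendsto_def)
  have "((\<lambda>n. L2_norm M (\<lambda>\<omega>. h (f n \<omega>) - h (g \<omega>))) \<longlongrightarrow> 0) F"
  proof (rule tendsto_sandwich[where f = "\<lambda>_. 0"])
    have "((\<lambda>n. B * L2_norm M (\<lambda>\<omega>. f n \<omega> - g \<omega>)) \<longlongrightarrow> B * 0) F"
      by (intro tendsto_intros L2_tendstoD(3)[OF f])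
    then show "((\<lambda>n. B * L2_norm M (\<lambda>\<omega>. f n \<omega> - g \<omega>)) \<longlongrightarrow> 0) F" by simp
    show "\<forall>\<^sub>F n in F. L2_norm M (\<lambda>\<omega>. h (f n \<omega>) - h (g \<omega>)) \<le> B * L2_norm M (\<lambda>\<omega>. f n \<omega> - g \<omega>)"
      using L2_tendstoD(2)[OF f]
    proof eventually_elim
      case (elim n)
      have d: "(\<lambda>\<omega>. f n \<omega> - g \<omega>) \<in> L2 M" by (rule L2_diff[OF elim g])
      have "(L2_norm M (\<lambda>\<omega>. h (f n \<omega> - g \<omega>)))\<^sup>2 \<le> (\<integral>\<omega>. B\<^sup>2 * (norm (f n \<omega> - g \<omega>))\<^sup>2 \<partial>M)"
        unfolding L2_norm_square
      proof (rule integral_mono)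
        show "integrable M (\<lambda>\<omega>. (norm (h (f n \<omega> - g \<omega>)))\<^sup>2)"
          by (rule L2_integrable[OF L2_bounded_linear[OF h d]])
        show "(norm (h (f n \<omega> - g \<omega>)))\<^sup>2 \<le> B\<^sup>2 * (norm (f n \<omega> - g \<omega>))\<^sup>2" for \<omega>
          using power_mono[OF B(1) norm_ge_zero, of "f n \<omega> - g \<omega>" 2]
          by (simp add: power_mult_distrib mult.commute)
      qed (use L2_integrable[OF d] in simp)
      also have "\<dots> = (B * L2_norm M (\<lambda>\<omega>. f n \<omega> - g \<omega>))\<^sup>2"
        by (simp add: L2_norm_square power_mult_distrib)
      finally have "L2_norm M (\<lambda>\<omega>. h (f n \<omega> - g \<omega>)) \<le> B * L2_norm M (\<lambda>\<omega>. f n \<omega> - g \<omega>)"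
        by (rule power2_le_imp_le) (simp add: B)
      then show ?case by (simp add: diff)
    qed
  qed auto
  with L2_tendstoD(2)[OF f] g show ?thesis
    by (auto simp: L2_tendsto_def intro: L2_bounded_linear[OF h] elim: eventually_mono)
qed

lemma L2_tendsto_add:
  assumes f: "L2_tendsto M f g F" and f': "L2_tendsto M f' g' F"
  shows "L2_tendsto M (\<lambda>n \<omega>. f n \<omega> + f' n \<omega>) (\<lambda>\<omega>. g \<omega> + g' \<omega>) F"
proof -
  have g: "g \<in> L2 M" "g' \<in> L2 M" using f f' by (auto simp: L2_tendsto_def)
  have "((\<lambda>n. L2_norm M (\<lambda>\<omega>. (f n \<omega> + f' n \<omega>) - (g \<omega> + g' \<omega>))) \<longlongrightarrow> 0) F"
  proof (rule tendsto_sandwich[where f = "\<lambda>_. 0"])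
    show "((\<lambda>n. L2_norm M (\<lambda>\<omega>. f n \<omega> - g \<omega>) + L2_norm M (\<lambda>\<omega>. f' n \<omega> - g' \<omega>)) \<longlongrightarrow> 0) F"
      using tendsto_add[OF L2_tendstoD(3)[OF f] L2_tendstoD(3)[OF f']] by simp
    show "\<forall>\<^sub>F n in F. L2_norm M (\<lambda>\<omega>. (f n \<omega> + f' n \<omega>) - (g \<omega> + g' \<omega>))
        \<le> L2_norm M (\<lambda>\<omega>. f n \<omega> - g \<omega>) + L2_norm M (\<lambda>\<omega>. f' n \<omega> - g' \<omega>)"
      using L2_tendstoD(2)[OF f] L2_tendstoD(2)[OF f']
    proof eventually_elim
      case (elim n)
      show ?case
        using L2_triangle[OF L2_diff[OF elim(1) g(1)] L2_diff[OF elim(2) g(2)]]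
        by (simp add: algebra_simps)
    qed
  qed auto
  moreover have "\<forall>\<^sub>F n in F. (\<lambda>\<omega>. f n \<omega> + f' n \<omega>) \<in> L2 M"
    using L2_tendstoD(2)[OF f] L2_tendstoD(2)[OF f'] by eventually_elim (rule L2_add)
  ultimately show ?thesis using g by (auto simp: L2_tendsto_def intro: L2_add)
qed

lemma L2_tendsto_scale:
  "L2_tendsto M f g F \<Longrightarrow> L2_tendsto M (\<lambda>n \<omega>. r *\<^sub>R f n \<omega>) (\<lambda>\<omega>. r *\<^sub>R g \<omega>) F"
  by (rule L2_tendsto_bounded_linear[OF bounded_linear_scaleR_right])

lemma (in prob_space) L1_le_L2:
  assumes "f \<in> L2 M"
  shows "integrable M (\<lambda>\<omega>. norm (f \<omega>))" "(\<integral>\<omega>. norm (f \<omega>) \<partial>M) \<le> L2_norm M f"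
proof -
  have n: "(\<lambda>\<omega>. norm (f \<omega>)) \<in> L2 M"
    using assms strongly_measurable_norm[of M f] unfolding L2_iff_real by (auto simp: L2_def)
  have 1: "(\<lambda>_. 1 :: real) \<in> L2 M" by (simp add: L2_iff_real)
  show "integrable M (\<lambda>\<omega>. norm (f \<omega>))" using L2_mult_integrable[OF n 1] by simp
  show "(\<integral>\<omega>. norm (f \<omega>) \<partial>M) \<le> L2_norm M f"
    using L2_Cauchy_Schwarz[OF n 1] by (simp add: L2_norm_def prob_space)
qed


section \<open>Completeness of the space of square-integrable random elements\<close>

lemma summable_dist_Cauchy:
  fixes x :: "nat \<Rightarrow> 'a::metric_space"
  assumes "summable (\<lambda>k. dist (x (Suc k)) (x k))"
  shows "Cauchy x"
proof -
  define s where "s n = (\<Sum>k<n. dist (x (Suc k)) (x k))" for n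
  have le: "dist (x n) (x m) \<le> s n - s m" if "m \<le> n" for m n
    using that
  proof (induction n rule: dec_induct)
    case (step n)
    then show ?case using dist_triangle[of "x (Suc n)" "x m" "x n"] by (simp add: s_def)
  qed simp
  have "convergent (\<lambda>n. s n)" using assms by (simp only: s_def summable_iff_convergent)
  then have "Cauchy s" by (rule convergent_Cauchy)
  show ?thesis
  proof (rule metric_CauchyI)
    fix e :: real assume "0 < e"
    then obtain N where N: "\<And>m n. m \<ge> N \<Longrightarrow> n \<ge> N \<Longrightarrow> dist (s m) (s n) < e"
      using metric_CauchyD[OF \<open>Cauchy s\<close>] by blast
    have "dist (x m) (x n) < e" if "m \<ge> N" "n \<ge> N" for m n
    proof (cases "m \<le> n")
      case True
      then show ?thesis using le[OF True] N[OF that] by (simp add: dist_real_def dist_commute)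
    next
      case False
      then show ?thesis using le[of n m] N[OF that] by (simp add: dist_real_def)
    qed
    then show "\<exists>N. \<forall>m\<ge>N. \<forall>n\<ge>N. dist (x m) (x n) < e" by blast
  qed
qed

lemma L2_Fatou:
  fixes u :: "nat \<Rightarrow> 'w \<Rightarrow> 'e::real_inner"
  assumes u: "\<And>k. u k \<in> L2 M" and v: "strongly_measurable M v"
    and lim: "AE \<omega> in M. (\<lambda>k. u k \<omega>) \<longlonglongrightarrow> v \<omega>"
    and le: "\<And>k. k \<ge> N \<Longrightarrow> L2_norm M (u k) \<le> B"
  shows "v \<in> L2 M" "L2_norm M v \<le> B"
proof -
  have B: "0 \<le> B" using le[of N] L2_norm_nonneg[of M "u N"] by linarith
  have nm: "(\<lambda>\<omega>. norm (u k \<omega>)) \<in> borel_measurable M" for k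
    using u[of k] by (intro strongly_measurable_norm) (simp add: L2_def)
  have nv: "(\<lambda>\<omega>. norm (v \<omega>)) \<in> borel_measurable M" by (rule strongly_measurable_norm[OF v])
  have eq: "(\<integral>\<^sup>+\<omega>. ennreal ((norm (u k \<omega>))\<^sup>2) \<partial>M) = ennreal ((L2_norm M (u k))\<^sup>2)" for k
    unfolding L2_norm_square by (rule nn_integral_eq_integral[OF L2_integrable[OF u]]) simp
  have "(\<integral>\<^sup>+\<omega>. ennreal ((norm (v \<omega>))\<^sup>2) \<partial>M)
      = (\<integral>\<^sup>+\<omega>. liminf (\<lambda>k. ennreal ((norm (u k \<omega>))\<^sup>2)) \<partial>M)"
  proof (rule nn_integral_cong_AE)
    show "AE \<omega> in M. ennreal ((norm (v \<omega>))\<^sup>2) = liminf (\<lambda>k. ennreal ((norm (u k \<omega>))\<^sup>2))"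
      using lim
    proof eventually_elim
      case (elim \<omega>)
      have "(\<lambda>k. ennreal ((norm (u k \<omega>))\<^sup>2)) \<longlonglongrightarrow> ennreal ((norm (v \<omega>))\<^sup>2)"
        by (intro tendsto_intros elim)
      then show ?case by (intro lim_imp_Liminf[symmetric]) auto
    qed
  qed
  also have "\<dots> \<le> liminf (\<lambda>k. \<integral>\<^sup>+\<omega>. ennreal ((norm (u k \<omega>))\<^sup>2) \<partial>M)"
    by (rule nn_integral_liminf) (use nm in measurable)
  also have "\<dots> \<le> ennreal (B\<^sup>2)"
  proof (rule Liminf_le)
    show "\<forall>\<^sub>F k in sequentially. (\<integral>\<^sup>+\<omega>. ennreal ((norm (u k \<omega>))\<^sup>2) \<partial>M) \<le> ennreal (B\<^sup>2)"
      unfolding eq eventually_sequentially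
      by (intro exI[of _ N] allI impI ennreal_leI power_mono le) auto
  qed simp
  finally have bound: "(\<integral>\<^sup>+\<omega>. ennreal ((norm (v \<omega>))\<^sup>2) \<partial>M) \<le> ennreal (B\<^sup>2)" .
  have int: "integrable M (\<lambda>\<omega>. (norm (v \<omega>))\<^sup>2)"
  proof (rule integrableI_bounded)
    show "(\<lambda>\<omega>. (norm (v \<omega>))\<^sup>2) \<in> borel_measurable M" using nv by measurable
    show "(\<integral>\<^sup>+\<omega>. ennreal (norm ((norm (v \<omega>))\<^sup>2)) \<partial>M) < \<infinity>"
      using le_less_trans[OF bound ennreal_less_top] by simp
  qed
  with v show "v \<in> L2 M" by (simp add: L2_def)
  have "ennreal ((L2_norm M v)\<^sup>2) = (\<integral>\<^sup>+\<omega>. ennreal ((norm (v \<omega>))\<^sup>2) \<partial>M)"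
    unfolding L2_norm_square by (rule nn_integral_eq_integral[OF int, symmetric]) simp
  then have "ennreal ((L2_norm M v)\<^sup>2) \<le> ennreal (B\<^sup>2)" using bound by simp
  then have "(L2_norm M v)\<^sup>2 \<le> B\<^sup>2" by (simp add: ennreal_le_iff)
  then show "L2_norm M v \<le> B" by (rule power2_le_imp_le[OF _ B])
qed

text \<open>A subsequence whose consecutive distances are summable converges almost surely. Its pointwise limit is
  strongly measurable, and Fatou's lemma identifies it as the limit in \<open>L\<^sup>2\<close> of the whole sequence.\<close>

lemma (in prob_space) L2_complete:
  fixes f :: "nat \<Rightarrow> 'a \<Rightarrow> 'e::{real_inner, complete_space}"
  assumes f: "\<And>n. f n \<in> L2 M"
    and cauchy: "\<And>\<epsilon>. \<epsilon> > 0 \<Longrightarrow> \<exists>N. \<forall>m\<ge>N. \<forall>n\<ge>N. L2_norm M (\<lambda>\<omega>. f m \<omega> - f n \<omega>) \<le> \<epsilon>"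
  obtains g where "L2_tendsto M f g sequentially"
proof -
  have "\<forall>k. \<exists>N. \<forall>m\<ge>N. \<forall>n\<ge>N. L2_norm M (\<lambda>\<omega>. f m \<omega> - f n \<omega>) \<le> (1/2)^k"
    using cauchy by simp
  then obtain N where N: "\<And>k m n. m \<ge> N k \<Longrightarrow> n \<ge> N k \<Longrightarrow> L2_norm M (\<lambda>\<omega>. f m \<omega> - f n \<omega>) \<le> (1/2)^k"
    by metis
  \<comment> \<open>The sum makes \<open>r\<close> monotone, the summand \<open>k\<close> makes it unbounded.\<close>
  define r where "r k = k + (\<Sum>j\<le>k. N j)" for k
  have rN: "N k \<le> r k" for k
    unfolding r_def using member_le_sum[of k "{..k}" N] by simp
  have r_mono: "r k \<le> r (Suc k)" for k by (simp add: r_def)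
  define h where "h k \<omega> = norm (f (r (Suc k)) \<omega> - f (r k) \<omega>)" for k \<omega>
  note fd = L2_diff[OF f f]
  have hm [measurable]: "h k \<in> borel_measurable M" for k
    unfolding h_def using fd by (intro strongly_measurable_norm) (simp add: L2_def)
  have h_int: "(\<integral>\<^sup>+\<omega>. ennreal (h k \<omega>) \<partial>M) \<le> ennreal ((1/2)^k)" for k
  proof -
    have "(\<integral>\<^sup>+\<omega>. ennreal (h k \<omega>) \<partial>M) = ennreal (\<integral>\<omega>. h k \<omega> \<partial>M)"
      unfolding h_def by (rule nn_integral_eq_integral[OF L1_le_L2(1)[OF fd]]) simp
    also have "(\<integral>\<omega>. h k \<omega> \<partial>M) \<le> L2_norm M (\<lambda>\<omega>. f (r (Suc k)) \<omega> - f (r k) \<omega>)"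
      unfolding h_def by (rule L1_le_L2(2)[OF fd])
    also have "\<dots> \<le> (1/2)^k" using rN[of k] r_mono[of k] by (intro N) auto
    finally show ?thesis by (simp add: ennreal_leI)
  qed
  define D where "D = {\<omega> \<in> space M. (\<Sum>k. ennreal (h k \<omega>)) \<noteq> \<infinity>}"
  have D_sets: "D \<in> sets M" unfolding D_def by measurable
  have "(\<integral>\<^sup>+\<omega>. (\<Sum>k. ennreal (h k \<omega>)) \<partial>M) = (\<Sum>k. \<integral>\<^sup>+\<omega>. ennreal (h k \<omega>) \<partial>M)"
    by (rule nn_integral_suminf) measurable
  also have "\<dots> \<le> (\<Sum>k. ennreal ((1/2)^k))" by (rule suminf_le) (auto intro: h_int)
  also have "\<dots> = ennreal (\<Sum>k. (1/2)^k)" by (rule suminf_ennreal2) (auto intro: summable_geometric)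
  finally have "(\<integral>\<^sup>+\<omega>. (\<Sum>k. ennreal (h k \<omega>)) \<partial>M) \<noteq> \<infinity>" by (auto simp: top_unique)
  then have AE_D: "AE \<omega> in M. \<omega> \<in> D"
    using nn_integral_PInf_AE[of "\<lambda>\<omega>. \<Sum>k. ennreal (h k \<omega>)" M] by (auto simp: D_def AE_conj_iff)
  have lim: "(\<lambda>k. f (r k) \<omega>) \<longlonglongrightarrow> lim (\<lambda>k. f (r k) \<omega>)" if "\<omega> \<in> D" for \<omega>
  proof -
    have "summable (\<lambda>k. h k \<omega>)"
      using that by (intro summable_suminf_not_top) (auto simp: D_def h_def)
    then have "Cauchy (\<lambda>k. f (r k) \<omega>)"
      by (intro summable_dist_Cauchy) (simp add: h_def dist_norm)
    then show ?thesis using Cauchy_convergent convergent_LIMSEQ_iff by blast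
  qed
  define g where "g \<omega> = (if \<omega> \<in> D then lim (\<lambda>k. f (r k) \<omega>) else 0)" for \<omega>
  have g: "strongly_measurable M g"
  proof (rule strongly_measurable_LIMSEQ)
    show "strongly_measurable M (\<lambda>\<omega>. if \<omega> \<in> D then f (r k) \<omega> else 0)" for k
      using f[of "r k"] by (intro strongly_measurable_if_set D_sets) (simp add: L2_def)
    show "(\<lambda>k. if \<omega> \<in> D then f (r k) \<omega> else 0) \<longlonglongrightarrow> g \<omega>" for \<omega>
      using lim[of \<omega>] by (simp add: g_def)
  qed
  have near: "(\<lambda>\<omega>. f n \<omega> - g \<omega>) \<in> L2 M \<and> L2_norm M (\<lambda>\<omega>. f n \<omega> - g \<omega>) \<le> \<epsilon>"
    if "\<forall>m\<ge>K. \<forall>n\<ge>K. L2_norm M (\<lambda>\<omega>. f m \<omega> - f n \<omega>) \<le> \<epsilon>" "n \<ge> K" for K n \<epsilon>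
  proof -
    have rk: "k \<le> r k" for k by (simp add: r_def)
    have 1: "strongly_measurable M (\<lambda>\<omega>. f n \<omega> - g \<omega>)"
      using f[of n] g by (intro strongly_measurable_diff) (simp_all add: L2_def)
    have 2: "AE \<omega> in M. (\<lambda>k. f n \<omega> - f (r k) \<omega>) \<longlonglongrightarrow> f n \<omega> - g \<omega>"
      using AE_D
    proof eventually_elim
      case (elim \<omega>)
      then show ?case using lim[OF elim] by (auto simp: g_def intro!: tendsto_intros)
    qed
    have 3: "L2_norm M (\<lambda>\<omega>. f n \<omega> - f (r k) \<omega>) \<le> \<epsilon>" if "k \<ge> K" for k
    proof -
      have "r k \<ge> K" using rk[of k] that by linarith
      then show ?thesis using \<open>\<forall>m\<ge>K. _\<close> \<open>n \<ge> K\<close> by blast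
    qed
    show ?thesis using L2_Fatou[OF fd 1 2 3] by blast
  qed
  obtain K where K: "\<forall>m\<ge>K. \<forall>n\<ge>K. L2_norm M (\<lambda>\<omega>. f m \<omega> - f n \<omega>) \<le> 1"
    using cauchy[of 1] by auto
  have gL2: "g \<in> L2 M"
    using L2_diff[OF f[of K] conjunct1[OF near[OF K order_refl]]] by simp
  have "(\<lambda>n. L2_norm M (\<lambda>\<omega>. f n \<omega> - g \<omega>)) \<longlonglongrightarrow> 0"
  proof (rule LIMSEQ_I)
    fix e :: real assume e: "0 < e"
    obtain K where K: "\<forall>m\<ge>K. \<forall>n\<ge>K. L2_norm M (\<lambda>\<omega>. f m \<omega> - f n \<omega>) \<le> e / 2"
      using cauchy[of "e/2"] e by auto
    have "norm (L2_norm M (\<lambda>\<omega>. f n \<omega> - g \<omega>) - 0) < e" if "n \<ge> K" for n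
      using near[OF K that] e L2_norm_nonneg[of M "\<lambda>\<omega>. f n \<omega> - g \<omega>"] by simp
    then show "\<exists>K. \<forall>n\<ge>K. norm (L2_norm M (\<lambda>\<omega>. f n \<omega> - g \<omega>) - 0) < e" by blast
  qed
  then have "L2_tendsto M f g sequentially" using f gL2 by (simp add: L2_tendsto_def)
  then show ?thesis by (rule that)
qed


section \<open>Radonification along an orthonormal family\<close>

lemma orthonormal_expansion_inner:
  assumes X: "L2_orthonormal M A X" and P: "finite P" "P \<subseteq> A"
  shows "(\<integral>\<omega>. (\<Sum>p\<in>P. X p \<omega> *\<^sub>R v p) \<bullet> (\<Sum>p\<in>P. X p \<omega> *\<^sub>R w p) \<partial>M) = (\<Sum>p\<in>P. v p \<bullet> w p)"
proof -
  have int: "integrable M (\<lambda>\<omega>. X p \<omega> * X q \<omega>)" if "p \<in> P" "q \<in> P" for p q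
    using X P that by (intro L2_mult_integrable) (auto simp: L2_orthonormal_def)
  have "(\<integral>\<omega>. (\<Sum>p\<in>P. X p \<omega> *\<^sub>R v p) \<bullet> (\<Sum>p\<in>P. X p \<omega> *\<^sub>R w p) \<partial>M)
      = (\<integral>\<omega>. (\<Sum>p\<in>P. \<Sum>q\<in>P. (X p \<omega> * X q \<omega>) * (v p \<bullet> w q)) \<partial>M)"
    unfolding inner_sum_left
    by (intro Bochner_Integration.integral_cong sum.cong refl)
      (simp add: inner_sum_right sum_distrib_left mult_ac)
  also have "\<dots> = (\<Sum>p\<in>P. \<Sum>q\<in>P. (\<integral>\<omega>. X p \<omega> * X q \<omega> \<partial>M) * (v p \<bullet> w q))"
    using int by (simp add: Bochner_Integration.integral_sum)
  also have "\<dots> = (\<Sum>p\<in>P. \<Sum>q\<in>P. if p = q then v p \<bullet> w p else 0)"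
    using X P by (intro sum.cong refl) (auto simp: L2_orthonormal_def subset_iff)
  finally show ?thesis using P by simp
qed

lemma Rad_partial_L2:
  assumes X: "L2_orthonormal M A X" and P: "P \<subseteq> A"
  shows "Rad_partial f X K P \<in> L2 M"
  unfolding Rad_partial_def using X P
  by (intro L2_sum L2_scaleR_const) (auto simp: L2_orthonormal_def)

lemma Rad_partial_norm:
  assumes X: "L2_orthonormal M A X" and P: "finite P" "P \<subseteq> A"
  shows "(L2_norm M (Rad_partial f X K P))\<^sup>2 = (\<Sum>p\<in>P. (norm (hs_apply K (f p)))\<^sup>2)"
  unfolding L2_norm_square Rad_partial_def power2_norm_eq_inner
  by (rule orthonormal_expansion_inner[OF X P])

lemma finite_subsets_eventually_L2:
  "L2_orthonormal M A X \<Longrightarrow> \<forall>\<^sub>F P in finite_subsets_at_top A. Rad_partial f X K P \<in> L2 M"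
  by (rule eventually_finite_subsets_at_top_weakI) (rule Rad_partial_L2)

lemma summable_on_tail:
  fixes a :: "'p \<Rightarrow> real"
  assumes "a summable_on A" "\<And>p. p \<in> A \<Longrightarrow> 0 \<le> a p" "\<epsilon> > 0"
  obtains P where "finite P" "P \<subseteq> A" "\<And>Q. finite Q \<Longrightarrow> P \<subseteq> Q \<Longrightarrow> Q \<subseteq> A \<Longrightarrow> sum a (Q - P) < \<epsilon>"
proof -
  have "(sum a \<longlongrightarrow> infsum a A) (finite_subsets_at_top A)"
    using has_sum_infsum[OF assms(1)] by (simp add: has_sum_def)
  then have "\<forall>\<^sub>F P in finite_subsets_at_top A. infsum a A - \<epsilon> < sum a P"
    by (rule order_tendstoD(1)) (use assms(3) in simp)
  then obtain P where P: "finite P" "P \<subseteq> A" "infsum a A - \<epsilon> < sum a P"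
    unfolding eventually_finite_subsets_at_top by auto
  have "sum a (Q - P) < \<epsilon>" if "finite Q" "P \<subseteq> Q" "Q \<subseteq> A" for Q
  proof -
    have "sum a (Q - P) = sum a Q - sum a P" using that by (simp add: sum_diff)
    moreover have "sum a Q \<le> infsum a A" using that assms by (intro finite_sum_le_infsum) auto
    ultimately show ?thesis using P(3) by linarith
  qed
  with P show ?thesis by (intro that[of P]) auto
qed

text \<open>Orthonormality turns the \<open>L\<^sup>2\<close> distance of two partial sums into a tail of
  \<open>\<Sum>\<^sub>p \<parallel>K f\<^sub>p\<parallel>\<^sup>2 = \<parallel>K\<parallel>\<^sup>2\<close>. Hence the net of partial sums is Cauchy.\<close>

lemma (in prob_space) Rad_tendsto:
  fixes f :: "'p \<Rightarrow> 'k::{real_inner, complete_space}"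
    and K :: "('k, 'e::{real_inner, complete_space}) hs"
  assumes X: "L2_orthonormal M A X" and f: "orthonormal_basis A f"
  shows "L2_tendsto M (Rad_partial f X K) (Rad M A f X K) (finite_subsets_at_top A)"
proof -
  let ?R = "Rad_partial f X K" and ?a = "\<lambda>p. (norm (hs_apply K (f p)))\<^sup>2"
  have sum: "?a summable_on A" using hs_norm_basis[OF f, of K] by (auto simp: summable_on_def)
  have "\<exists>P. finite P \<and> P \<subseteq> A \<and> (\<forall>Q. finite Q \<longrightarrow> P \<subseteq> Q \<longrightarrow> Q \<subseteq> A \<longrightarrow>
      L2_norm M (\<lambda>\<omega>. ?R Q \<omega> - ?R P \<omega>) \<le> \<epsilon>)" if \<epsilon>: "\<epsilon> > 0" for \<epsilon>
  proof -
    obtain P where P: "finite P" "P \<subseteq> A"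
      "\<And>Q. finite Q \<Longrightarrow> P \<subseteq> Q \<Longrightarrow> Q \<subseteq> A \<Longrightarrow> sum ?a (Q - P) < \<epsilon>\<^sup>2"
      using summable_on_tail[OF sum, of "\<epsilon>\<^sup>2"] \<epsilon> by auto
    have "L2_norm M (\<lambda>\<omega>. ?R Q \<omega> - ?R P \<omega>) \<le> \<epsilon>" if Q: "finite Q" "P \<subseteq> Q" "Q \<subseteq> A" for Q
    proof (rule power2_le_imp_le)
      have "(\<lambda>\<omega>. ?R Q \<omega> - ?R P \<omega>) = ?R (Q - P)"
        using Q by (auto simp: Rad_partial_def sum_diff)
      then have "(L2_norm M (\<lambda>\<omega>. ?R Q \<omega> - ?R P \<omega>))\<^sup>2 = sum ?a (Q - P)"
        using Q by (simp only:) (rule Rad_partial_norm[OF X], auto)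
      then show "(L2_norm M (\<lambda>\<omega>. ?R Q \<omega> - ?R P \<omega>))\<^sup>2 \<le> \<epsilon>\<^sup>2" using P(3)[OF Q] by simp
    qed (use \<epsilon> in simp)
    with P show ?thesis by blast
  qed
  then have "\<forall>n. \<exists>P. finite P \<and> P \<subseteq> A \<and> (\<forall>Q. finite Q \<longrightarrow> P \<subseteq> Q \<longrightarrow> Q \<subseteq> A \<longrightarrow>
      L2_norm M (\<lambda>\<omega>. ?R Q \<omega> - ?R P \<omega>) \<le> 1 / real (Suc n))" by simp
  then obtain P where P: "\<And>n. finite (P n)" "\<And>n. P n \<subseteq> A"
    "\<And>n Q. finite Q \<Longrightarrow> P n \<subseteq> Q \<Longrightarrow> Q \<subseteq> A \<Longrightarrow> L2_norm M (\<lambda>\<omega>. ?R Q \<omega> - ?R (P n) \<omega>) \<le> 1 / real (Suc n)"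
    by metis
  have RP: "?R Q \<in> L2 M" if "Q \<subseteq> A" for Q by (rule Rad_partial_L2[OF X that])
  have mn: "L2_norm M (\<lambda>\<omega>. ?R (P m) \<omega> - ?R (P n) \<omega>) \<le> 1 / real (Suc m) + 1 / real (Suc n)" for m n
  proof -
    have "L2_norm M (\<lambda>\<omega>. ?R (P m) \<omega> - ?R (P n) \<omega>) \<le>
        L2_norm M (\<lambda>\<omega>. ?R (P m) \<omega> - ?R (P m \<union> P n) \<omega>) + L2_norm M (\<lambda>\<omega>. ?R (P m \<union> P n) \<omega> - ?R (P n) \<omega>)"
      by (rule L2_triangle_diff) (use P RP in auto)
    also have "\<dots> \<le> 1 / real (Suc m) + 1 / real (Suc n)"
      using P(3)[of "P m \<union> P n" m] P(3)[of "P m \<union> P n" n] P(1,2)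
      by (intro add_mono) (auto simp: L2_norm_minus_commute[of M "?R (P m)"])
    finally show ?thesis .
  qed
  have small: "\<exists>N. \<forall>n\<ge>N. 1 / real (Suc n) \<le> \<epsilon>" if "\<epsilon> > 0" for \<epsilon> :: real
  proof -
    obtain N where "1 / real (Suc N) < \<epsilon>" using nat_approx_posE[OF \<open>\<epsilon> > 0\<close>] by auto
    then have "1 / real (Suc n) \<le> \<epsilon>" if "n \<ge> N" for n
      using that frac_le[of 1 1 "real (Suc N)" "real (Suc n)"] by simp
    then show ?thesis by blast
  qed
  obtain g where g: "L2_tendsto M (\<lambda>n. ?R (P n)) g sequentially"
  proof (rule L2_complete)
    show "?R (P n) \<in> L2 M" for n by (rule RP[OF P(2)])
    show "\<exists>N. \<forall>m\<ge>N. \<forall>n\<ge>N. L2_norm M (\<lambda>\<omega>. ?R (P m) \<omega> - ?R (P n) \<omega>) \<le> \<epsilon>" if \<epsilon>: "\<epsilon> > 0" for \<epsilon>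
    proof -
      obtain N where N: "\<forall>n\<ge>N. 1 / real (Suc n) \<le> \<epsilon> / 2" using small[OF half_gt_zero[OF \<epsilon>]] by blast
      have "L2_norm M (\<lambda>\<omega>. ?R (P m) \<omega> - ?R (P n) \<omega>) \<le> \<epsilon>" if "m \<ge> N" "n \<ge> N" for m n
      proof -
        have "1 / real (Suc m) \<le> \<epsilon> / 2" "1 / real (Suc n) \<le> \<epsilon> / 2" using N that by blast+
        then show ?thesis using mn[of m n] by linarith
      qed
      then show ?thesis by blast
    qed
  qed
  have gL2: "g \<in> L2 M" by (rule L2_tendstoD(1)[OF g])
  have "((\<lambda>Q. L2_norm M (\<lambda>\<omega>. ?R Q \<omega> - g \<omega>)) \<longlongrightarrow> 0) (finite_subsets_at_top A)"
  proof (rule tendstoI)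
    fix \<epsilon> :: real assume \<epsilon>: "\<epsilon> > 0"
    obtain N where N: "\<forall>n\<ge>N. 1 / real (Suc n) \<le> \<epsilon> / 2" using small[OF half_gt_zero[OF \<epsilon>]] by blast
    have "\<forall>\<^sub>F n in sequentially. L2_norm M (\<lambda>\<omega>. ?R (P n) \<omega> - g \<omega>) < \<epsilon> / 2"
      by (rule order_tendstoD(2)[OF L2_tendstoD(3)[OF g]]) (use \<epsilon> in simp)
    then obtain n where n: "n \<ge> N" "L2_norm M (\<lambda>\<omega>. ?R (P n) \<omega> - g \<omega>) < \<epsilon> / 2"
      unfolding eventually_sequentially by (meson le_cases order_trans)
    have "dist (L2_norm M (\<lambda>\<omega>. ?R Q \<omega> - g \<omega>)) 0 < \<epsilon>" if Q: "finite Q" "P n \<subseteq> Q" "Q \<subseteq> A" for Q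
    proof -
      have "1 / real (Suc n) \<le> \<epsilon> / 2" using N n(1) by blast
      then show ?thesis
        using L2_triangle_diff[OF RP[OF Q(3)] RP[OF P(2)] gL2, of n] P(3)[OF Q] n(2)
          L2_norm_nonneg[of M "\<lambda>\<omega>. ?R Q \<omega> - g \<omega>"] by simp
    qed
    then show "\<forall>\<^sub>F Q in finite_subsets_at_top A. dist (L2_norm M (\<lambda>\<omega>. ?R Q \<omega> - g \<omega>)) 0 < \<epsilon>"
      unfolding eventually_finite_subsets_at_top
      by (intro exI[of _ "P n"] conjI allI impI P(1,2)) (elim conjE)
  qed
  then have "L2_tendsto M ?R g (finite_subsets_at_top A)"
    using gL2 finite_subsets_eventually_L2[OF X] by (simp add: L2_tendsto_def)
  then show ?thesis
    unfolding Rad_def by (rule someI[where P = "\<lambda>g. L2_tendsto M ?R g (finite_subsets_at_top A)"])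
qed

text \<open>Norms and linear relations of the partial sums pass to the \<open>L\<^sup>2\<close> limit; linearity holds only almost
  surely because a version of each limit has been chosen separately.\<close>

lemma (in prob_space) Rad_isometry:
  fixes f :: "'p \<Rightarrow> 'k::{real_inner, complete_space}"
  assumes X: "L2_orthonormal M A X" and f: "orthonormal_basis A f"
  shows "L2_linear_isometry M (Rad M A f X :: ('k, 'e::{real_inner, complete_space}) hs \<Rightarrow> _)"
  unfolding L2_linear_isometry_def
proof (intro conjI allI)
  note lim = Rad_tendsto[OF X f]
  fix K K' :: "('k, 'e) hs" and a b :: real
  show "Rad M A f X K \<in> L2 M" by (rule L2_tendstoD(1)[OF lim])
  have "((\<lambda>P. (L2_norm M (Rad_partial f X K P))\<^sup>2) \<longlongrightarrow> (L2_norm M (Rad M A f X K))\<^sup>2)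
      (finite_subsets_at_top A)"
    using L2_tendsto_inner[OF lim lim, of K K] unfolding L2_norm_square power2_norm_eq_inner .
  moreover have "\<forall>\<^sub>F P in finite_subsets_at_top A.
      (L2_norm M (Rad_partial f X K P))\<^sup>2 = (\<Sum>p\<in>P. (norm (hs_apply K (f p)))\<^sup>2)"
    by (rule eventually_finite_subsets_at_top_weakI) (rule Rad_partial_norm[OF X])
  ultimately have "((\<lambda>P. \<Sum>p\<in>P. (norm (hs_apply K (f p)))\<^sup>2) \<longlongrightarrow> (L2_norm M (Rad M A f X K))\<^sup>2)
      (finite_subsets_at_top A)" by (simp add: tendsto_cong)
  then have "(L2_norm M (Rad M A f X K))\<^sup>2 = (norm K)\<^sup>2"
    using hs_norm_basis[OF f, of K] unfolding has_sum_def
    by (intro tendsto_unique[OF finite_subsets_at_top_neq_bot])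
  then show "L2_norm M (Rad M A f X K) = norm K" by simp
  have "Rad_partial f X (a *\<^sub>R K + b *\<^sub>R K') P = (\<lambda>\<omega>. a *\<^sub>R Rad_partial f X K P \<omega> + b *\<^sub>R Rad_partial f X K' P \<omega>)" for P
    by (auto simp: Rad_partial_def scaleR_sum_right algebra_simps sum.distrib)
  then have "L2_tendsto M (Rad_partial f X (a *\<^sub>R K + b *\<^sub>R K'))
      (\<lambda>\<omega>. a *\<^sub>R Rad M A f X K \<omega> + b *\<^sub>R Rad M A f X K' \<omega>) (finite_subsets_at_top A)"
    using L2_tendsto_add[OF L2_tendsto_scale[OF lim, of a K] L2_tendsto_scale[OF lim, of b K']] by presburger
  from L2_tendsto_unique[OF lim this finite_subsets_at_top_neq_bot]
  show "AE \<omega> in M. Rad M A f X (a *\<^sub>R K + b *\<^sub>R K') \<omega> = a *\<^sub>R Rad M A f X K \<omega> + b *\<^sub>R Rad M A f X K' \<omega>" .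
qed

text \<open>The covariance form at \<open>(a, b)\<close> is the limit of \<open>\<Sum>\<^sub>p \<langle>K f\<^sub>p, a\<rangle> \<langle>K f\<^sub>p, b\<rangle>\<close>, which is
  Parseval's series for \<open>\<langle>K\<^sup>* a, K\<^sup>* b\<rangle>\<close>.\<close>

lemma (in prob_space) Rad_covariance:
  fixes f :: "'p \<Rightarrow> 'k::{real_inner, complete_space}" and K :: "('k, 'e::{real_inner, complete_space}) hs"
  assumes X: "L2_orthonormal M A X" and f: "orthonormal_basis A f"
    and mean: "\<And>p. p \<in> A \<Longrightarrow> (\<integral>\<omega>. X p \<omega> \<partial>M) = 0"
    and Y: "Y \<in> L2 M" "AE \<omega> in M. Rad M A f X K \<omega> = Y \<omega>"
  shows "blinfun_apply (covariance_op M Y) = hs_apply K \<circ> adjoint (hs_apply K)"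
proof -
  let ?F = "finite_subsets_at_top A" and ?R = "Rad_partial f X K"
  have lim: "L2_tendsto M ?R Y ?F" by (rule L2_tendsto_cong_AE[OF Rad_tendsto[OF X f] Y])
  have la: "L2_tendsto M (\<lambda>P \<omega>. ?R P \<omega> \<bullet> a) (\<lambda>\<omega>. Y \<omega> \<bullet> a) ?F" for a
    by (rule L2_tendsto_bounded_linear[OF bounded_linear_inner_left lim])
  have Ra: "?R P \<omega> \<bullet> a = (\<Sum>p\<in>P. X p \<omega> *\<^sub>R (hs_apply K (f p) \<bullet> a))" for P \<omega> a
    by (simp add: Rad_partial_def inner_sum_left)
  have XL: "X p \<in> L2 M" if "p \<in> A" for p using X that by (simp add: L2_orthonormal_def)
  have Xint: "integrable M (X p)" if "p \<in> A" for p
    by (rule integrable_norm_iff[THEN iffD1, OF L2_measurable[OF XL[OF that]] L1_le_L2(1)[OF XL[OF that]]])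
  have one: "L2_tendsto M (\<lambda>_ _. 1 :: real) (\<lambda>_. 1) ?F"
    by (simp add: L2_tendsto_def L2_iff_real L2_norm_def)
  have mean_Y: "(\<integral>\<omega>. Y \<omega> \<bullet> a \<partial>M) = 0" for a
  proof (rule tendsto_unique[OF finite_subsets_at_top_neq_bot])
    show "((\<lambda>P. \<integral>\<omega>. ?R P \<omega> \<bullet> a \<partial>M) \<longlongrightarrow> (\<integral>\<omega>. Y \<omega> \<bullet> a \<partial>M)) ?F"
      using L2_tendsto_inner[OF la one] by simp
    have "\<forall>\<^sub>F P in ?F. (\<integral>\<omega>. ?R P \<omega> \<bullet> a \<partial>M) = 0"
    proof (rule eventually_finite_subsets_at_top_weakI)
      fix P assume "finite P" "P \<subseteq> A"
      then show "(\<integral>\<omega>. ?R P \<omega> \<bullet> a \<partial>M) = 0"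
        unfolding Ra using Xint mean by (subst Bochner_Integration.integral_sum) (auto intro!: sum.neutral)
    qed
    then show "((\<lambda>P. \<integral>\<omega>. ?R P \<omega> \<bullet> a \<partial>M) \<longlongrightarrow> 0) ?F" by (rule tendsto_eventually)
  qed
  have cov: "(\<integral>\<omega>. (Y \<omega> \<bullet> a) * (Y \<omega> \<bullet> b) \<partial>M) = adjoint (hs_apply K) a \<bullet> adjoint (hs_apply K) b" for a b
  proof (rule tendsto_unique[OF finite_subsets_at_top_neq_bot])
    show "((\<lambda>P. \<integral>\<omega>. (?R P \<omega> \<bullet> a) * (?R P \<omega> \<bullet> b) \<partial>M) \<longlongrightarrow> (\<integral>\<omega>. (Y \<omega> \<bullet> a) * (Y \<omega> \<bullet> b) \<partial>M)) ?F"
      using L2_tendsto_inner[OF la la, of a b] by simp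
    have "\<forall>\<^sub>F P in ?F. (\<integral>\<omega>. (?R P \<omega> \<bullet> a) * (?R P \<omega> \<bullet> b) \<partial>M)
        = (\<Sum>p\<in>P. (adjoint (hs_apply K) a \<bullet> f p) * (adjoint (hs_apply K) b \<bullet> f p))"
    proof (rule eventually_finite_subsets_at_top_weakI)
      fix P assume P: "finite P" "P \<subseteq> A"
      show "(\<integral>\<omega>. (?R P \<omega> \<bullet> a) * (?R P \<omega> \<bullet> b) \<partial>M)
        = (\<Sum>p\<in>P. (adjoint (hs_apply K) a \<bullet> f p) * (adjoint (hs_apply K) b \<bullet> f p))"
        using orthonormal_expansion_inner[OF X P, of "\<lambda>p. hs_apply K (f p) \<bullet> a" "\<lambda>p. hs_apply K (f p) \<bullet> b"]
        unfolding Ra by (simp add: hs_adjoint(2) inner_commute[of "f _"])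
    qed
    moreover have "((\<lambda>P. \<Sum>p\<in>P. (adjoint (hs_apply K) a \<bullet> f p) * (adjoint (hs_apply K) b \<bullet> f p))
        \<longlongrightarrow> adjoint (hs_apply K) a \<bullet> adjoint (hs_apply K) b) ?F"
      using parseval_inner[OF f] by (simp add: has_sum_def)
    ultimately show "((\<lambda>P. \<integral>\<omega>. (?R P \<omega> \<bullet> a) * (?R P \<omega> \<bullet> b) \<partial>M)
        \<longlongrightarrow> adjoint (hs_apply K) a \<bullet> adjoint (hs_apply K) b) ?F"
      by (simp add: tendsto_cong)
  qed
  have bl: "bounded_linear (\<lambda>y. hs_apply K (adjoint (hs_apply K) y))"
    by (rule bounded_linear_compose[OF bounded_linear_hs_apply hs_adjoint(1)])
  have "covariance_op M Y = Blinfun (\<lambda>y. hs_apply K (adjoint (hs_apply K) y))"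
    unfolding covariance_op_def mean_Y
  proof (rule the_equality)
    show "\<forall>a b. blinfun_apply (Blinfun (\<lambda>y. hs_apply K (adjoint (hs_apply K) y))) a \<bullet> b =
        (\<integral>\<omega>. (Y \<omega> \<bullet> a - 0) * (Y \<omega> \<bullet> b - 0) \<partial>M)"
      by (simp add: bounded_linear_Blinfun_apply[OF bl] cov hs_adjoint(2))
    fix T assume T: "\<forall>a b. blinfun_apply T a \<bullet> b = (\<integral>\<omega>. (Y \<omega> \<bullet> a - 0) * (Y \<omega> \<bullet> b - 0) \<partial>M)"
    show "T = Blinfun (\<lambda>y. hs_apply K (adjoint (hs_apply K) y))"
    proof (rule blinfun_eqI)
      fix a
      have "(blinfun_apply T a - hs_apply K (adjoint (hs_apply K) a)) \<bullet> b = 0" for b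
        using T by (simp add: inner_diff_left cov hs_adjoint(2))
      then have "blinfun_apply T a - hs_apply K (adjoint (hs_apply K) a) = 0"
        using inner_eq_zero_iff by blast
      then show "blinfun_apply T a = blinfun_apply (Blinfun (\<lambda>y. hs_apply K (adjoint (hs_apply K) y))) a"
        by (simp add: bounded_linear_Blinfun_apply[OF bl])
    qed
  qed
  then show ?thesis by (auto simp: fun_eq_iff bounded_linear_Blinfun_apply[OF bl])
qed


section \<open>Independence of Brownian increments from the enlarged past\<close>

locale brownian_family = prob_space M
  for M :: "'w measure" +
  fixes I :: "nat set" and W :: "nat \<Rightarrow> real \<Rightarrow> 'w \<Rightarrow> real"
  assumes brownian: "\<And>i. i \<in> I \<Longrightarrow> brownian_motion M (W i)"
    and independent: "independent_processes M I W"
begin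

definition incr :: "nat \<Rightarrow> real \<Rightarrow> real \<Rightarrow> 'w \<Rightarrow> real" where
  "incr j a b \<omega> = W j b \<omega> - W j a \<omega>"

definition cylinder :: "(nat \<times> real) set \<Rightarrow> (nat \<times> real \<Rightarrow> real set) \<Rightarrow> 'w set" where
  "cylinder R A = {\<omega> \<in> space M. \<forall>p\<in>R. W (fst p) (snd p) \<omega> \<in> A p}"

text \<open>The past of the \<open>j\<close>-th motion at time \<open>s\<close>, enlarged by the whole paths of all the other
  motions. An increment of \<open>W\<^sup>j\<close> after \<open>s\<close> is independent of this much information, so that
  one independence statement serves both for the isometry of one integral and for the
  orthogonality of integrals driven by different motions.\<close>

definition enlarged_index :: "nat \<Rightarrow> real \<Rightarrow> (nat \<times> real) set" where
  "enlarged_index j s = {(i, r). i \<in> I \<and> 0 \<le> r \<and> (i = j \<longrightarrow> r \<le> s)}"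

definition enlarged_past :: "nat \<Rightarrow> real \<Rightarrow> 'w measure" where
  "enlarged_past j s = sigma (space M)
     {W i r -` A \<inter> space M | i r A. (i, r) \<in> enlarged_index j s \<and> A \<in> sets borel}"

lemma W_measurable: "i \<in> I \<Longrightarrow> 0 \<le> r \<Longrightarrow> W i r \<in> borel_measurable M"
  using brownian by (simp add: brownian_motion_def)

lemma incr_measurable: "i \<in> I \<Longrightarrow> 0 \<le> a \<Longrightarrow> 0 \<le> b \<Longrightarrow> incr i a b \<in> borel_measurable M"
  unfolding incr_def[abs_def] by (intro borel_measurable_diff W_measurable)

lemma cylinder_sets:
  assumes "finite R" "R \<subseteq> I \<times> {0..}" "\<And>p. p \<in> R \<Longrightarrow> A p \<in> sets borel"
  shows "cylinder R A \<in> sets M"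
  unfolding cylinder_def
proof (rule sets.sets_Collect_finite_All[OF _ assms(1)])
  fix p assume p: "p \<in> R"
  then have "W (fst p) (snd p) \<in> borel_measurable M" using assms(2) by (intro W_measurable) auto
  from measurable_sets[OF this assms(3)[OF p]]
  show "{\<omega> \<in> space M. W (fst p) (snd p) \<omega> \<in> A p} \<in> sets M"
    by (simp add: vimage_def Int_def conj_commute)
qed

text \<open>Sampling times are sorted, so that the positions of one motion become partial sums of independent
  increments.\<close>

lemma own_past_independent:
  assumes j: "j \<in> I" and R: "finite R" "R \<subseteq> {0..s}" and s: "0 \<le> s" "s \<le> u"
    and A: "\<And>r. r \<in> R \<Longrightarrow> A r \<in> sets borel" and B: "B \<in> sets borel"
  shows "prob {\<omega> \<in> space M. (\<forall>r\<in>R. W j r \<omega> \<in> A r) \<and> incr j s u \<omega> \<in> B}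
    = prob {\<omega> \<in> space M. \<forall>r\<in>R. W j r \<omega> \<in> A r} * prob {\<omega> \<in> space M. incr j s u \<omega> \<in> B}"
proof -
  define L where "L = sorted_list_of_set (insert 0 (insert s R))"
  define m where "m = length L"
  have L: "set L = insert 0 (insert s R)" "sorted L"
    unfolding L_def using R(1) by (simp_all only: set_sorted_list_of_set sorted_sorted_list_of_set finite_insert)
  have L_range: "0 \<le> L ! k" "L ! k \<le> s" if "k < m" for k
    using nth_mem[of k L] that L(1) R(2) s by (auto simp: m_def)
  have m: "0 < m" using L(1) by (auto simp: m_def)
  have L0: "L ! 0 = 0"
  proof -
    obtain k where "k < m" "L ! k = 0" using L(1) unfolding m_def by (metis in_set_conv_nth insertI1)
    then show ?thesis using sorted_nth_mono[OF L(2), of 0 k] L_range[of 0] m by (auto simp: m_def)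
  qed
  have Ls: "L ! (m - 1) = s"
  proof -
    obtain k where "k < m" "L ! k = s"
      using L(1) unfolding m_def by (metis in_set_conv_nth insertI1 insertI2)
    then show ?thesis using sorted_nth_mono[OF L(2), of k "m - 1"] L_range[of "m - 1"] m by (auto simp: m_def)
  qed
  define \<tau> where "\<tau> k = (if k < m then L ! k else u)" for k
  define \<Delta> where "\<Delta> k \<omega> = W j (\<tau> (Suc k)) \<omega> - W j (\<tau> k) \<omega>" for k \<omega>
  have \<tau>_nonneg: "0 \<le> \<tau> k" for k using L_range[of k] s by (auto simp: \<tau>_def)
  have "mono \<tau>"
  proof (rule monoI)
    fix x y :: nat assume "x \<le> y"
    then show "\<tau> x \<le> \<tau> y"
      using sorted_nth_mono[OF L(2), of x y] L_range[of x] s by (auto simp: \<tau>_def m_def)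
  qed
  moreover have "\<forall>\<tau> n. 0 \<le> \<tau> 0 \<and> mono \<tau> \<longrightarrow>
      indep_vars (\<lambda>_. borel) (\<lambda>k \<omega>. W j (\<tau> (Suc k)) \<omega> - W j (\<tau> k) \<omega>) {..<n::nat}"
    using brownian[OF j] unfolding brownian_motion_def by (elim conjE)
  ultimately have ind: "indep_vars (\<lambda>_. borel) \<Delta> {..<m}"
    unfolding \<Delta>_def[abs_def] using \<tau>_nonneg[of 0] by (elim allE[of _ \<tau>] allE[of _ m]) simp
  have \<Delta>_last: "\<Delta> (m - 1) \<omega> = incr j s u \<omega>" for \<omega>
    using m Ls by (simp add: \<Delta>_def incr_def \<tau>_def)
  let ?N = "PiM {..<m-1} (\<lambda>_. borel :: real measure)" and ?N' = "PiM {m-1} (\<lambda>_. borel :: real measure)"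
  let ?V = "\<lambda>\<omega>. restrict (\<lambda>k. \<Delta> k \<omega>) {..<m-1}" and ?Z = "\<lambda>\<omega>. restrict (\<lambda>k. \<Delta> k \<omega>) {m-1}"
  have iv: "indep_var ?N ?V ?N' ?Z"
    by (rule indep_var_restrict[OF ind]) (use m in auto)
  define Q where "Q = {x \<in> space ?N. \<forall>k\<in>{k. k < m \<and> L ! k \<in> R}. (\<Sum>i<k. x i) \<in> A (L ! k)}"
  define Q' where "Q' = {x \<in> space ?N'. x (m - 1) \<in> B}"
  have Q_sets: "Q \<in> sets ?N"
    unfolding Q_def
  proof (rule sets.sets_Collect_finite_All)
    fix k assume k: "k \<in> {k. k < m \<and> L ! k \<in> R}"
    then have "(\<lambda>x. \<Sum>i<k. x i) \<in> borel_measurable ?N"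
      by (intro borel_measurable_sum measurable_component_singleton) auto
    from measurable_sets[OF this A[of "L ! k"]] k
    show "{x \<in> space ?N. (\<Sum>i<k. x i) \<in> A (L ! k)} \<in> sets ?N"
      by (simp add: vimage_def Int_def conj_commute)
  qed simp
  have Q'_sets: "Q' \<in> sets ?N'"
    unfolding Q'_def using measurable_sets[OF measurable_component_singleton[of "m-1" "{m-1}" "\<lambda>_. borel :: real measure"] B]
    by (simp add: vimage_def Int_def conj_commute)
  have pos: "W j (L ! k) \<omega> = (\<Sum>i<k. \<Delta> i \<omega>)" if "W j 0 \<omega> = 0" "k < m" for k \<omega>
  proof -
    have "(\<Sum>i<k. \<Delta> i \<omega>) = W j (\<tau> k) \<omega> - W j (\<tau> 0) \<omega>"
      unfolding \<Delta>_def by (rule sum_lessThan_telescope)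
    then show ?thesis using that L0 m by (simp add: \<tau>_def)
  qed
  have zero: "AE \<omega> in M. W j 0 \<omega> = 0" using brownian[OF j] by (simp add: brownian_motion_def)
  have VQ: "?V \<omega> \<in> Q \<longleftrightarrow> (\<forall>r\<in>R. W j r \<omega> \<in> A r)" if w: "W j 0 \<omega> = 0" for \<omega>
  proof -
    have sum_eq: "(\<Sum>i<k. ?V \<omega> i) = W j (L ! k) \<omega>" if "k < m" for k
      unfolding pos[OF w that] by (rule sum.cong) (use that in auto)
    have "?V \<omega> \<in> space ?N" by (auto simp: space_PiM)
    then have "?V \<omega> \<in> Q \<longleftrightarrow> (\<forall>k. k < m \<and> L ! k \<in> R \<longrightarrow> W j (L ! k) \<omega> \<in> A (L ! k))"
      by (auto simp: Q_def sum_eq simp del: restrict_apply One_nat_def)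
    also have "\<dots> \<longleftrightarrow> (\<forall>r\<in>R. W j r \<omega> \<in> A r)"
    proof -
      have "\<exists>k<m. L ! k = r" if "r \<in> R" for r
        using that L(1) unfolding m_def by (metis in_set_conv_nth insertI2)
      moreover have "L ! k \<in> set L" if "k < m" for k using that by (simp add: m_def)
      ultimately show ?thesis by metis
    qed
    finally show ?thesis .
  qed
  have ZQ': "?Z \<omega> \<in> Q' \<longleftrightarrow> incr j s u \<omega> \<in> B" for \<omega>
    by (auto simp: Q'_def \<Delta>_last space_PiM simp del: One_nat_def)
  have Rs: "cylinder (Pair j ` R) (\<lambda>p. A (snd p)) = {\<omega> \<in> space M. \<forall>r\<in>R. W j r \<omega> \<in> A r}"
    by (auto simp: cylinder_def)
  have E: "{\<omega> \<in> space M. \<forall>r\<in>R. W j r \<omega> \<in> A r} \<in> sets M"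
    unfolding Rs[symmetric] by (rule cylinder_sets) (use R j A in auto)
  have D: "{\<omega> \<in> space M. incr j s u \<omega> \<in> B} \<in> sets M"
    using measurable_sets[OF incr_measurable[OF j, of s u] B] s
    by (simp add: vimage_def Int_def conj_commute)
  have ED: "{\<omega> \<in> space M. (\<forall>r\<in>R. W j r \<omega> \<in> A r) \<and> incr j s u \<omega> \<in> B}
      = {\<omega> \<in> space M. \<forall>r\<in>R. W j r \<omega> \<in> A r} \<inter> {\<omega> \<in> space M. incr j s u \<omega> \<in> B}" by auto
  have V_meas: "?V \<in> measurable M ?N" and Z_meas: "?Z \<in> measurable M ?N'"
    using iv by (auto dest: indep_var_rv1 indep_var_rv2)
  have "prob {\<omega> \<in> space M. (\<forall>r\<in>R. W j r \<omega> \<in> A r) \<and> incr j s u \<omega> \<in> B}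
      = prob ((\<lambda>\<omega>. (?V \<omega>, ?Z \<omega>)) -` (Q \<times> Q') \<inter> space M)"
  proof (rule measure_eq_AE)
    show "AE \<omega> in M. \<omega> \<in> {\<omega> \<in> space M. (\<forall>r\<in>R. W j r \<omega> \<in> A r) \<and> incr j s u \<omega> \<in> B} \<longleftrightarrow>
        \<omega> \<in> (\<lambda>\<omega>. (?V \<omega>, ?Z \<omega>)) -` (Q \<times> Q') \<inter> space M"
      using zero by eventually_elim (use VQ ZQ' in \<open>auto simp del: restrict_apply\<close>)
    show "{\<omega> \<in> space M. (\<forall>r\<in>R. W j r \<omega> \<in> A r) \<and> incr j s u \<omega> \<in> B} \<in> sets M"
      unfolding ED using E D by auto
    have "(\<lambda>\<omega>. (?V \<omega>, ?Z \<omega>)) -` (Q \<times> Q') \<inter> space M = (?V -` Q \<inter> space M) \<inter> (?Z -` Q' \<inter> space M)"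
      by auto
    then show "(\<lambda>\<omega>. (?V \<omega>, ?Z \<omega>)) -` (Q \<times> Q') \<inter> space M \<in> sets M"
      using measurable_sets[OF V_meas Q_sets] measurable_sets[OF Z_meas Q'_sets] by auto
  qed
  also have "\<dots> = prob (?V -` Q \<inter> space M) * prob (?Z -` Q' \<inter> space M)"
    by (rule indep_varD[OF iv Q_sets Q'_sets])
  also have "prob (?V -` Q \<inter> space M) = prob {\<omega> \<in> space M. \<forall>r\<in>R. W j r \<omega> \<in> A r}"
  proof (rule measure_eq_AE)
    show "AE \<omega> in M. \<omega> \<in> ?V -` Q \<inter> space M \<longleftrightarrow> \<omega> \<in> {\<omega> \<in> space M. \<forall>r\<in>R. W j r \<omega> \<in> A r}"
      using zero by eventually_elim (use VQ in \<open>auto simp del: restrict_apply\<close>)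
  qed (use E measurable_sets[OF V_meas Q_sets] in auto)
  also have "?Z -` Q' \<inter> space M = {\<omega> \<in> space M. incr j s u \<omega> \<in> B}"
    using ZQ' by auto
  finally show ?thesis .
qed

text \<open>The coordinates of \<open>W\<^sup>j\<close> and those of the other motions are separated first, by independence of the
  motions; the previous lemma treats the coordinates of \<open>W\<^sup>j\<close>.\<close>

lemma cylinder_independent:
  assumes j: "j \<in> I" and R: "finite R" "R \<subseteq> enlarged_index j s" and s: "0 \<le> s" "s \<le> u"
    and A: "\<And>p. p \<in> R \<Longrightarrow> A p \<in> sets borel" and B: "B \<in> sets borel"
  shows "prob (cylinder R A \<inter> (incr j s u -` B \<inter> space M))
    = prob (cylinder R A) * prob (incr j s u -` B \<inter> space M)"
proof -
  define Rj Ro where "Rj = {r. (j, r) \<in> R}" and "Ro = {p \<in> R. fst p \<noteq> j}"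
  let ?T = "\<Pi>\<^sub>M r\<in>{0::real..}. (borel :: real measure)"
  let ?X = "\<lambda>i \<omega>. \<lambda>r\<in>{0..}. W i r \<omega>"
  let ?N = "PiM {j} (\<lambda>_. ?T)" and ?N' = "PiM (I - {j}) (\<lambda>_. ?T)"
  let ?V = "\<lambda>\<omega>. restrict (\<lambda>i. ?X i \<omega>) {j}" and ?Z = "\<lambda>\<omega>. restrict (\<lambda>i. ?X i \<omega>) (I - {j})"
  have Rj: "finite Rj" "Rj \<subseteq> {0..s}"
  proof -
    have "Rj \<subseteq> snd ` R" by (force simp: Rj_def)
    then show "finite Rj" using R(1) by (auto intro: finite_subset)
    show "Rj \<subseteq> {0..s}" using R(2) by (auto simp: Rj_def enlarged_index_def)
  qed
  have Ro: "finite Ro" "Ro \<subseteq> (I - {j}) \<times> {0..}"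
    using R by (auto simp: Ro_def enlarged_index_def)
  have iv: "indep_var ?N ?V ?N' ?Z"
    by (rule indep_var_restrict[OF independent[unfolded independent_processes_def]]) (use j in auto)
  have comp: "(\<lambda>x. x i r) \<in> borel_measurable (PiM K (\<lambda>_. ?T))" if "i \<in> K" "0 \<le> r" for i r and K :: "nat set"
    by (rule measurable_compose[OF measurable_component_singleton[OF that(1)] measurable_component_singleton])
      (use that in simp)
  define Q1 where "Q1 = {x \<in> space ?N. \<forall>r\<in>Rj. x j r \<in> A (j, r)}"
  define Q where "Q = Q1 \<inter> {x \<in> space ?N. x j u - x j s \<in> B}"
  define Q' where "Q' = {x \<in> space ?N'. \<forall>p\<in>Ro. x (fst p) (snd p) \<in> A p}"
  have Q1_sets: "Q1 \<in> sets ?N"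
    unfolding Q1_def
  proof (rule sets.sets_Collect_finite_All[OF _ Rj(1)])
    fix r assume "r \<in> Rj"
    then show "{x \<in> space ?N. x j r \<in> A (j, r)} \<in> sets ?N"
      using measurable_sets[OF comp[of j "{j}" r] A[of "(j, r)"]] Rj(2)
      by (auto simp: vimage_def Int_def conj_commute Rj_def)
  qed
  have "(\<lambda>x. x j u - x j s) \<in> borel_measurable ?N"
    using s by (intro borel_measurable_diff comp) auto
  from measurable_sets[OF this B] have "{x \<in> space ?N. x j u - x j s \<in> B} \<in> sets ?N"
    by (simp add: vimage_def Int_def conj_commute)
  then have Q_sets: "Q \<in> sets ?N" unfolding Q_def by (rule sets.Int[OF Q1_sets])
  have Q'_sets: "Q' \<in> sets ?N'"
    unfolding Q'_def
  proof (rule sets.sets_Collect_finite_All[OF _ Ro(1)])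
    fix p assume "p \<in> Ro"
    then show "{x \<in> space ?N'. x (fst p) (snd p) \<in> A p} \<in> sets ?N'"
      using measurable_sets[OF comp[of "fst p" "I - {j}" "snd p"] A[of p]] Ro(2)
      by (auto simp: vimage_def Int_def conj_commute Ro_def)
  qed
  have VZ: "prob ((?V -` S \<inter> space M) \<inter> (?Z -` Q' \<inter> space M))
      = prob (?V -` S \<inter> space M) * prob (?Z -` Q' \<inter> space M)" if "S \<in> sets ?N" for S
  proof -
    have "(\<lambda>\<omega>. (?V \<omega>, ?Z \<omega>)) -` (S \<times> Q') \<inter> space M = (?V -` S \<inter> space M) \<inter> (?Z -` Q' \<inter> space M)"
      by auto
    with indep_varD[OF iv that Q'_sets] show ?thesis by simp
  qed
  have Vs: "?V \<omega> \<in> space ?N" and Zs: "?Z \<omega> \<in> space ?N'" for \<omega>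
    by (auto simp: space_PiM PiE_def)
  have VQ: "?V -` Q \<inter> space M = {\<omega> \<in> space M. (\<forall>r\<in>Rj. W j r \<omega> \<in> A (j, r)) \<and> incr j s u \<omega> \<in> B}"
  proof -
    have "?V \<omega> \<in> Q \<longleftrightarrow> (\<forall>r\<in>Rj. W j r \<omega> \<in> A (j, r)) \<and> incr j s u \<omega> \<in> B" for \<omega>
      using Vs[of \<omega>] Rj(2) s by (auto simp: Q_def Q1_def incr_def subset_iff)
    then show ?thesis by auto
  qed
  have ZQ: "?Z -` Q' \<inter> space M = cylinder Ro A"
  proof -
    have "?Z \<omega> \<in> Q' \<longleftrightarrow> (\<forall>p\<in>Ro. W (fst p) (snd p) \<omega> \<in> A p)" for \<omega>
    proof -
      have "?Z \<omega> (fst p) (snd p) = W (fst p) (snd p) \<omega>" if "p \<in> Ro" for p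
        using that Ro(2) by auto
      then show ?thesis using Zs[of \<omega>] by (auto simp: Q'_def simp del: restrict_apply)
    qed
    then show ?thesis by (auto simp: cylinder_def)
  qed
  have split: "cylinder R A = {\<omega> \<in> space M. \<forall>r\<in>Rj. W j r \<omega> \<in> A (j, r)} \<inter> cylinder Ro A"
    by (force simp: cylinder_def Rj_def Ro_def)
  have lhs: "cylinder R A \<inter> (incr j s u -` B \<inter> space M) = (?V -` Q \<inter> space M) \<inter> (?Z -` Q' \<inter> space M)"
    unfolding split VQ ZQ by auto
  have D: "{\<omega> \<in> space M. incr j s u \<omega> \<in> B} = incr j s u -` B \<inter> space M" by auto
  have own: "prob (?V -` Q \<inter> space M)
      = prob {\<omega> \<in> space M. \<forall>r\<in>Rj. W j r \<omega> \<in> A (j, r)} * prob (incr j s u -` B \<inter> space M)"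
    unfolding VQ D[symmetric]
    by (rule own_past_independent[OF j Rj s _ B]) (use A in \<open>auto simp: Rj_def\<close>)
  \<comment> \<open>The same factorisation without the increment identifies the probability of the cylinder itself.\<close>
  have VQ1: "?V -` Q1 \<inter> space M = {\<omega> \<in> space M. \<forall>r\<in>Rj. W j r \<omega> \<in> A (j, r)}"
  proof -
    have "?V \<omega> \<in> Q1 \<longleftrightarrow> (\<forall>r\<in>Rj. W j r \<omega> \<in> A (j, r))" for \<omega>
      using Vs[of \<omega>] Rj(2) by (auto simp: Q1_def subset_iff)
    then show ?thesis by auto
  qed
  have "prob (cylinder R A)
      = prob {\<omega> \<in> space M. \<forall>r\<in>Rj. W j r \<omega> \<in> A (j, r)} * prob (?Z -` Q' \<inter> space M)"
    using VZ[OF Q1_sets] by (simp only: split VQ1 ZQ)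
  then show ?thesis
    unfolding lhs VZ[OF Q_sets] own by simp
qed

text \<open>Cylinders over the enlarged index set form a \<open>\<pi>\<close>-system generating the enlarged past.\<close>

lemma increment_independent:
  assumes j: "j \<in> I" and s: "0 \<le> s" "s \<le> u" and Y: "Y \<in> borel_measurable (enlarged_past j s)"
  shows "indep_var borel Y borel (incr j s u)"
proof -
  define \<P> where "\<P> = {cylinder R A | R A. finite R \<and> R \<subseteq> enlarged_index j s \<and> (\<forall>p\<in>R. A p \<in> sets borel)}"
  define \<D> where "\<D> = {incr j s u -` B \<inter> space M | B. B \<in> sets borel}"
  have idx: "enlarged_index j s \<subseteq> I \<times> {0..}" by (auto simp: enlarged_index_def)
  have \<P>_events: "\<P> \<subseteq> events"
    unfolding \<P>_def using idx by (auto intro!: cylinder_sets)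
  have dm: "incr j s u \<in> borel_measurable M" using j s by (intro incr_measurable) auto
  have \<D>_events: "\<D> \<subseteq> events" unfolding \<D>_def using measurable_sets[OF dm] by auto
  have "indep_set \<P> \<D>"
    unfolding indep_sets2_eq
  proof (intro conjI \<P>_events \<D>_events ballI)
    fix a b assume "a \<in> \<P>" "b \<in> \<D>"
    then show "prob (a \<inter> b) = prob a * prob b"
      unfolding \<P>_def \<D>_def using cylinder_independent[OF j _ _ s] by blast
  qed
  moreover have "Int_stable \<P>"
  proof (rule Int_stableI)
    fix a b assume "a \<in> \<P>" "b \<in> \<P>"
    then obtain R A R' A' where a: "a = cylinder R A" "finite R" "R \<subseteq> enlarged_index j s" "\<forall>p\<in>R. A p \<in> sets borel"
      and b: "b = cylinder R' A'" "finite R'" "R' \<subseteq> enlarged_index j s" "\<forall>p\<in>R'. A' p \<in> sets borel"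
      unfolding \<P>_def by blast
    let ?A = "\<lambda>p. (if p \<in> R then A p else UNIV) \<inter> (if p \<in> R' then A' p else UNIV)"
    have "a \<inter> b = cylinder (R \<union> R') ?A" unfolding a(1) b(1) cylinder_def by auto
    moreover have "\<forall>p\<in>R \<union> R'. ?A p \<in> sets borel" using a b by auto
    ultimately show "a \<inter> b \<in> \<P>"
      unfolding \<P>_def using a(2,3) b(2,3) by blast
  qed
  moreover have "Int_stable \<D>"
  proof (rule Int_stableI)
    fix a b assume "a \<in> \<D>" "b \<in> \<D>"
    then obtain B B' where "a = incr j s u -` B \<inter> space M" "b = incr j s u -` B' \<inter> space M"
      "B \<in> sets borel" "B' \<in> sets borel" unfolding \<D>_def by blast
    then show "a \<inter> b \<in> \<D>" unfolding \<D>_def by (intro CollectI exI[of _ "B \<inter> B'"]) auto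
  qed
  ultimately have ind: "indep_set (sigma_sets (space M) \<P>) (sigma_sets (space M) \<D>)"
    by (rule indep_set_sigma_sets)
  let ?G = "{W i r -` A \<inter> space M | i r A. (i, r) \<in> enlarged_index j s \<and> A \<in> sets borel}"
  have "?G \<subseteq> \<P>"
  proof
    fix x assume "x \<in> ?G"
    then obtain i r A where x: "x = W i r -` A \<inter> space M" "(i, r) \<in> enlarged_index j s" "A \<in> sets borel"
      by blast
    then have "x = cylinder {(i, r)} (\<lambda>_. A)" by (auto simp: cylinder_def)
    with x show "x \<in> \<P>" unfolding \<P>_def by (intro CollectI exI[of _ "{(i, r)}"] exI[of _ "\<lambda>_. A"]) auto
  qed
  have GP: "?G \<subseteq> Pow (space M)" by auto
  have "sets (enlarged_past j s) = sigma_sets (space M) ?G"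
    unfolding enlarged_past_def by (rule sets_measure_of[OF GP])
  also have "\<dots> \<subseteq> sigma_sets (space M) \<P>" by (rule sigma_sets_mono') fact
  finally have sub: "sets (enlarged_past j s) \<subseteq> sigma_sets (space M) \<P>" .
  have sp: "space (enlarged_past j s) = space M"
    unfolding enlarged_past_def by (rule space_measure_of[OF GP])
  have ev: "sigma_sets (space M) \<P> \<subseteq> events"
    using \<P>_events by (rule sets.sigma_sets_subset)
  have Ym: "Y -` A \<inter> space M \<in> sigma_sets (space M) \<P>" if "A \<in> sets borel" for A
    using measurable_sets[OF Y that] sub sp by auto
  have Yrv: "Y \<in> borel_measurable M"
    by (rule measurableI) (use Ym ev in auto)
  have "sigma_sets (space M) {Y -` A \<inter> space M | A. A \<in> sets borel} \<subseteq> sigma_sets (space M) \<P>"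
    by (rule sigma_sets_mono) (use Ym in auto)
  with ind show ?thesis
    unfolding indep_var_eq indep_sets2_eq \<D>_def[symmetric] using Yrv dm by blast
qed

end


section \<open>The isometry of elementary integrals\<close>

definition overlap :: "real \<Rightarrow> real \<Rightarrow> real \<Rightarrow> real \<Rightarrow> real" where
  "overlap a b a' b' = max 0 (min b b' - max a a')"

lemma overlap_measure: "measure lborel ({a<..b} \<inter> {a'<..b'}) = overlap a b a' b'"
proof -
  have eq: "{a<..b} \<inter> {a'<..b'} = {max a a'<..min b b'}" by auto
  show ?thesis
  proof (cases "max a a' \<le> min b b'")
    case True
    then show ?thesis unfolding eq overlap_def measure_lborel_Ioc[OF True] by simp
  next
    case False
    then have empty: "{max a a'<..min b b'} = {}" by (intro greaterThanAtMost_empty) linarith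
    have "min b b' - max a a' \<le> 0" using False by linarith
    then show ?thesis unfolding eq empty overlap_def by (simp only: max_absorb1 measure_empty)
  qed
qed

context brownian_family
begin

lemma incr_moments:
  assumes j: "j \<in> I" and s: "0 \<le> s" "s \<le> u"
  shows "integrable M (incr j s u)" "(\<integral>\<omega>. incr j s u \<omega> \<partial>M) = 0"
    "integrable M (\<lambda>\<omega>. (incr j s u \<omega>)\<^sup>2)" "(\<integral>\<omega>. (incr j s u \<omega>)\<^sup>2 \<partial>M) = u - s"
proof -
  have "integrable M (incr j s u) \<and> (\<integral>\<omega>. incr j s u \<omega> \<partial>M) = 0 \<and>
    integrable M (\<lambda>\<omega>. (incr j s u \<omega>)\<^sup>2) \<and> (\<integral>\<omega>. (incr j s u \<omega>)\<^sup>2 \<partial>M) = u - s"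
  proof (cases "s = u")
    case True
    then have "incr j s u = (\<lambda>_. 0)" by (simp add: incr_def fun_eq_iff)
    then show ?thesis using True by simp
  next
    case False
    then have su: "0 < sqrt (u - s)" using s by simp
    have D: "distributed M lborel (incr j s u) (normal_density 0 (sqrt (u - s)))"
      using brownian[OF j] s False unfolding brownian_motion_def incr_def[abs_def] by auto
    have 1: "integrable M (\<lambda>\<omega>. (incr j s u \<omega>) ^ k)" for k
      using distributed_integrable[OF D, of "\<lambda>x. x ^ k"] integrable_normal_moment[OF su, of 0 k] by simp
    have 2: "(\<integral>\<omega>. incr j s u \<omega> \<partial>M) = 0" by (rule normal_distributed_expectation[OF su D])
    have "(\<integral>\<omega>. (incr j s u \<omega>)\<^sup>2 \<partial>M) = u - s"
      using normal_distributed_variance[OF su D] s by (simp add: 2)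
    then show ?thesis using 1[of 1] 1[of 2] 2 by simp
  qed
  then show "integrable M (incr j s u)" "(\<integral>\<omega>. incr j s u \<omega> \<partial>M) = 0"
    "integrable M (\<lambda>\<omega>. (incr j s u \<omega>)\<^sup>2)" "(\<integral>\<omega>. (incr j s u \<omega>)\<^sup>2 \<partial>M) = u - s" by auto
qed

abbreviation filtration :: "real \<Rightarrow> 'w measure" where
  "filtration \<equiv> natural_filtration M I W"

lemma enlarged_measurable_mono:
  assumes "f \<in> borel_measurable (enlarged_past j s)" "s \<le> s'"
  shows "f \<in> borel_measurable (enlarged_past j s')"
  using assms(1) unfolding enlarged_past_def
  by (rule subsetD[OF measurable_mono1, rotated -1])
    (use assms(2) in \<open>auto simp: enlarged_index_def\<close>, force)

lemma filtration_enlarged: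
  assumes "f \<in> borel_measurable (filtration s)" "s \<le> s'"
  shows "f \<in> borel_measurable (enlarged_past j s')"
  using assms(1) unfolding enlarged_past_def natural_filtration_def
  by (rule subsetD[OF measurable_mono1, rotated -1])
    (use assms(2) in \<open>auto simp: enlarged_index_def\<close>, force)

lemma W_enlarged:
  assumes "(i, r) \<in> enlarged_index j s"
  shows "W i r \<in> borel_measurable (enlarged_past j s)"
proof (rule measurableI)
  have P: "{W i r -` A \<inter> space M | i r A. (i, r) \<in> enlarged_index j s \<and> A \<in> sets borel} \<subseteq> Pow (space M)"
    by auto
  fix A :: "real set" assume "A \<in> sets borel"
  then show "W i r -` A \<inter> space (enlarged_past j s) \<in> sets (enlarged_past j s)"
    unfolding enlarged_past_def using assms
    by (auto simp: space_measure_of[OF P] sets_measure_of[OF P] intro!: sigma_sets.Basic)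
qed simp

lemma W_filtration:
  assumes "i \<in> I" "0 \<le> r" "r \<le> s"
  shows "W i r \<in> borel_measurable (filtration s)"
proof (rule measurableI)
  have P: "{W i r -` A \<inter> space M | i r A. i \<in> I \<and> 0 \<le> r \<and> r \<le> s \<and> A \<in> sets borel} \<subseteq> Pow (space M)"
    by auto
  fix A :: "real set" assume "A \<in> sets borel"
  then show "W i r -` A \<inter> space (filtration s) \<in> sets (filtration s)"
    unfolding natural_filtration_def using assms
    by (auto simp: space_measure_of[OF P] sets_measure_of[OF P] intro!: sigma_sets.Basic)
qed simp

lemma past_incr:
  assumes j: "j \<in> I" and s: "0 \<le> s" "s \<le> u"
    and Y: "integrable M Y" "Y \<in> borel_measurable (enlarged_past j s)"
  shows "integrable M (\<lambda>\<omega>. Y \<omega> * incr j s u \<omega>)" "(\<integral>\<omega>. Y \<omega> * incr j s u \<omega> \<partial>M) = 0"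
    "integrable M (\<lambda>\<omega>. Y \<omega> * (incr j s u \<omega>)\<^sup>2)"
    "(\<integral>\<omega>. Y \<omega> * (incr j s u \<omega>)\<^sup>2 \<partial>M) = (u - s) * (\<integral>\<omega>. Y \<omega> \<partial>M)"
proof -
  note m = incr_moments[OF j s]
  have ind: "indep_var borel Y borel (incr j s u)" by (rule increment_independent[OF j s Y(2)])
  have ind2: "indep_var borel Y borel (\<lambda>\<omega>. (incr j s u \<omega>)\<^sup>2)"
    using indep_var_compose[OF ind, of "\<lambda>x. x" borel "\<lambda>x. x\<^sup>2" borel] by (simp add: comp_def)
  show "integrable M (\<lambda>\<omega>. Y \<omega> * incr j s u \<omega>)" by (rule indep_var_integrable[OF ind Y(1) m(1)])
  show "(\<integral>\<omega>. Y \<omega> * incr j s u \<omega> \<partial>M) = 0"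
    using indep_var_lebesgue_integral[OF ind Y(1) m(1)] m(2) by simp
  show "integrable M (\<lambda>\<omega>. Y \<omega> * (incr j s u \<omega>)\<^sup>2)" by (rule indep_var_integrable[OF ind2 Y(1) m(3)])
  show "(\<integral>\<omega>. Y \<omega> * (incr j s u \<omega>)\<^sup>2 \<partial>M) = (u - s) * (\<integral>\<omega>. Y \<omega> \<partial>M)"
    using indep_var_lebesgue_integral[OF ind2 Y(1) m(3)] m(4) by (simp add: mult.commute)
qed

lemma past_incr_incr:
  assumes j: "j \<in> I" and s: "0 \<le> a" "a \<le> b" "b \<le> b'"
    and Y: "integrable M Y" "Y \<in> borel_measurable (enlarged_past j a)"
  shows "integrable M (\<lambda>\<omega>. Y \<omega> * incr j a b \<omega> * incr j a b' \<omega>)"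
    "(\<integral>\<omega>. Y \<omega> * incr j a b \<omega> * incr j a b' \<omega> \<partial>M) = (b - a) * (\<integral>\<omega>. Y \<omega> \<partial>M)"
proof -
  have Yb: "(\<lambda>\<omega>. Y \<omega> * incr j a b \<omega>) \<in> borel_measurable (enlarged_past j b)"
    unfolding incr_def using j s
    by (intro borel_measurable_times borel_measurable_diff enlarged_measurable_mono[OF Y(2)] W_enlarged)
      (auto simp: enlarged_index_def)
  note 1 = past_incr[OF j s(1,2) Y]
  note 2 = past_incr[OF j order_trans[OF s(1,2)] s(3) 1(1) Yb]
  have eq: "Y \<omega> * incr j a b \<omega> * incr j a b' \<omega>
      = Y \<omega> * (incr j a b \<omega>)\<^sup>2 + Y \<omega> * incr j a b \<omega> * incr j b b' \<omega>" for \<omega>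
    by (simp add: incr_def power2_eq_square algebra_simps)
  show "integrable M (\<lambda>\<omega>. Y \<omega> * incr j a b \<omega> * incr j a b' \<omega>)"
    unfolding eq by (rule Bochner_Integration.integrable_add[OF 1(3) 2(1)])
  show "(\<integral>\<omega>. Y \<omega> * incr j a b \<omega> * incr j a b' \<omega> \<partial>M) = (b - a) * (\<integral>\<omega>. Y \<omega> \<partial>M)"
    unfolding eq Bochner_Integration.integral_add[OF 1(3) 2(1)] by (simp add: 1(4) 2(2))
qed

lemma weighted_incr_L2:
  assumes j: "j \<in> I" and s: "0 \<le> s" "s \<le> u" and \<xi>: "\<xi> \<in> L2 M" "\<xi> \<in> borel_measurable (filtration s)"
  shows "(\<lambda>\<omega>. \<xi> \<omega> * incr j s u \<omega>) \<in> L2 M"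
proof -
  have "integrable M (\<lambda>\<omega>. (\<xi> \<omega>)\<^sup>2)" using \<xi>(1) by (simp add: L2_iff_real)
  moreover have "(\<lambda>\<omega>. (\<xi> \<omega>)\<^sup>2) \<in> borel_measurable (enlarged_past j s)"
    using filtration_enlarged[OF \<xi>(2) order_refl] by measurable
  ultimately have "integrable M (\<lambda>\<omega>. (\<xi> \<omega>)\<^sup>2 * (incr j s u \<omega>)\<^sup>2)" by (rule past_incr(3)[OF j s])
  moreover have "(\<lambda>\<omega>. \<xi> \<omega> * incr j s u \<omega>) \<in> borel_measurable M"
    using \<xi>(1) j s by (intro borel_measurable_times incr_measurable L2_measurable) auto
  ultimately show ?thesis by (simp add: L2_iff_real power_mult_distrib)
qed

text \<open>The later of two increments is split off at its starting point: what lies before is part of the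
  enlarged past and is annihilated, what overlaps contributes its length.\<close>

lemma weighted_incr_inner_ordered:
  assumes jl: "j \<in> I" "l \<in> I" and s: "0 \<le> s" "s \<le> u" "s \<le> s'" "s' \<le> u'"
    and \<xi>: "\<xi> \<in> L2 M" "\<xi> \<in> borel_measurable (filtration s)"
    and \<xi>': "\<xi>' \<in> L2 M" "\<xi>' \<in> borel_measurable (filtration s')"
  shows "(\<integral>\<omega>. (\<xi> \<omega> * incr j s u \<omega>) * (\<xi>' \<omega> * incr l s' u' \<omega>) \<partial>M)
    = (if j = l then (\<integral>\<omega>. \<xi> \<omega> * \<xi>' \<omega> \<partial>M) * overlap s u s' u' else 0)"
proof (cases "j = l")
  case False
  let ?Y = "\<lambda>\<omega>. (\<xi> \<omega> * incr j s u \<omega>) * \<xi>' \<omega>"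
  have "integrable M ?Y" by (rule L2_mult_integrable[OF weighted_incr_L2[OF jl(1) s(1,2) \<xi>] \<xi>'(1)])
  moreover have "?Y \<in> borel_measurable (enlarged_past l s')"
    unfolding incr_def using jl s False
    by (intro borel_measurable_times borel_measurable_diff filtration_enlarged[OF \<xi>(2)]
        filtration_enlarged[OF \<xi>'(2)] W_enlarged) (auto simp: enlarged_index_def)
  ultimately have "(\<integral>\<omega>. ?Y \<omega> * incr l s' u' \<omega> \<partial>M) = 0"
    using s by (intro past_incr(2)[OF jl(2)]) auto
  with False show ?thesis by (simp add: mult.assoc)
next
  case True
  define m v where "m = min u s'" and "v = max u s'"
  have mv: "s \<le> m" "m \<le> s'" "s' \<le> v" using s by (auto simp: m_def v_def)
  have s0: "0 \<le> s'" using s by simp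
  let ?Y1 = "\<lambda>\<omega>. (\<xi> \<omega> * incr j s m \<omega>) * \<xi>' \<omega>" and ?Y2 = "\<lambda>\<omega>. \<xi> \<omega> * \<xi>' \<omega>"
  have Y1: "integrable M ?Y1"
    by (rule L2_mult_integrable[OF weighted_incr_L2[OF jl(1) s(1) mv(1) \<xi>] \<xi>'(1)])
  have Y1m: "?Y1 \<in> borel_measurable (enlarged_past j s')"
    unfolding incr_def using jl s mv
    by (intro borel_measurable_times borel_measurable_diff filtration_enlarged[OF \<xi>(2)]
        filtration_enlarged[OF \<xi>'(2)] W_enlarged) (auto simp: enlarged_index_def)
  have Y2: "integrable M ?Y2" by (rule L2_mult_integrable[OF \<xi>(1) \<xi>'(1)])
  have Y2m: "?Y2 \<in> borel_measurable (enlarged_past j s')"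
    using s by (intro borel_measurable_times filtration_enlarged[OF \<xi>(2)] filtration_enlarged[OF \<xi>'(2)]) auto
  note 1 = past_incr(1,2)[OF jl(1) s0 s(4) Y1 Y1m]
  have 2: "integrable M (\<lambda>\<omega>. ?Y2 \<omega> * incr j s' v \<omega> * incr j s' u' \<omega>)"
    "(\<integral>\<omega>. ?Y2 \<omega> * incr j s' v \<omega> * incr j s' u' \<omega> \<partial>M) = (min v u' - s') * (\<integral>\<omega>. ?Y2 \<omega> \<partial>M)"
  proof -
    have "integrable M (\<lambda>\<omega>. ?Y2 \<omega> * incr j s' v \<omega> * incr j s' u' \<omega>) \<and>
      (\<integral>\<omega>. ?Y2 \<omega> * incr j s' v \<omega> * incr j s' u' \<omega> \<partial>M) = (min v u' - s') * (\<integral>\<omega>. ?Y2 \<omega> \<partial>M)"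
    proof (cases "v \<le> u'")
      case True
      then show ?thesis using past_incr_incr[OF jl(1) s0 mv(3) True Y2 Y2m] by (simp add: min_def)
    next
      case False
      then have "u' \<le> v" by simp
      from past_incr_incr[OF jl(1) s0 s(4) this Y2 Y2m] show ?thesis
        using False by (simp add: min_def mult.assoc mult.commute[of "incr j s' v _"])
    qed
    then show "integrable M (\<lambda>\<omega>. ?Y2 \<omega> * incr j s' v \<omega> * incr j s' u' \<omega>)"
      "(\<integral>\<omega>. ?Y2 \<omega> * incr j s' v \<omega> * incr j s' u' \<omega> \<partial>M) = (min v u' - s') * (\<integral>\<omega>. ?Y2 \<omega> \<partial>M)"
      by auto
  qed
  have split: "incr j s u \<omega> = incr j s m \<omega> + incr j s' v \<omega>" for \<omega>
    by (auto simp: incr_def m_def v_def min_def max_def)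
  have "(\<integral>\<omega>. (\<xi> \<omega> * incr j s u \<omega>) * (\<xi>' \<omega> * incr l s' u' \<omega>) \<partial>M)
      = (\<integral>\<omega>. ?Y1 \<omega> * incr j s' u' \<omega> + ?Y2 \<omega> * incr j s' v \<omega> * incr j s' u' \<omega> \<partial>M)"
    unfolding split True[symmetric] by (intro Bochner_Integration.integral_cong refl) (simp add: algebra_simps)
  also have "\<dots> = (min v u' - s') * (\<integral>\<omega>. ?Y2 \<omega> \<partial>M)"
    by (simp add: Bochner_Integration.integral_add[OF 1(1) 2(1)] 1(2) 2(2))
  also have "min v u' - s' = overlap s u s' u'"
    using s by (auto simp: overlap_def v_def min_def max_def)
  finally show ?thesis using True by (simp add: mult.commute)
qed

text \<open>Both sides are symmetric under exchanging the two weighted increments.\<close>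

lemma weighted_incr_inner:
  assumes jl: "j \<in> I" "l \<in> I" and s: "0 \<le> s" "s \<le> u" "0 \<le> s'" "s' \<le> u'"
    and \<xi>: "\<xi> \<in> L2 M" "\<xi> \<in> borel_measurable (filtration s)"
    and \<xi>': "\<xi>' \<in> L2 M" "\<xi>' \<in> borel_measurable (filtration s')"
  shows "(\<integral>\<omega>. (\<xi> \<omega> * incr j s u \<omega>) * (\<xi>' \<omega> * incr l s' u' \<omega>) \<partial>M)
    = (if j = l then (\<integral>\<omega>. \<xi> \<omega> * \<xi>' \<omega> \<partial>M) * overlap s u s' u' else 0)"
proof (cases "s \<le> s'")
  case True
  then show ?thesis by (rule weighted_incr_inner_ordered[OF jl s(1,2) _ s(4) \<xi> \<xi>'])
next
  case False
  have ov: "overlap s u s' u' = overlap s' u' s u"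
    by (simp add: overlap_def min.commute max.commute)
  have c1: "(\<integral>\<omega>. (\<xi> \<omega> * incr j s u \<omega>) * (\<xi>' \<omega> * incr l s' u' \<omega>) \<partial>M)
      = (\<integral>\<omega>. (\<xi>' \<omega> * incr l s' u' \<omega>) * (\<xi> \<omega> * incr j s u \<omega>) \<partial>M)"
    by (intro Bochner_Integration.integral_cong refl mult.commute)
  have c2: "(\<integral>\<omega>. \<xi> \<omega> * \<xi>' \<omega> \<partial>M) = (\<integral>\<omega>. \<xi>' \<omega> * \<xi> \<omega> \<partial>M)"
    by (intro Bochner_Integration.integral_cong refl mult.commute)
  have "s' \<le> s" using False by simp
  from weighted_incr_inner_ordered[OF jl(2,1) s(3,4) this s(2) \<xi>' \<xi>] show ?thesis
    unfolding c1 c2 ov by auto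
qed

lemma incr_integral:
  assumes j: "j \<in> I" and s: "0 \<le> s" "s \<le> u" and \<xi>: "\<xi> \<in> L2 M" "\<xi> \<in> borel_measurable (filtration s)"
  shows "integrable M (\<lambda>\<omega>. \<xi> \<omega> * incr j s u \<omega>)" "(\<integral>\<omega>. \<xi> \<omega> * incr j s u \<omega> \<partial>M) = 0"
proof -
  have "integrable M \<xi>"
    by (rule integrable_norm_iff[THEN iffD1, OF L2_measurable[OF \<xi>(1)] L1_le_L2(1)[OF \<xi>(1)]])
  from past_incr(1,2)[OF j s this filtration_enlarged[OF \<xi>(2) order_refl]]
  show "integrable M (\<lambda>\<omega>. \<xi> \<omega> * incr j s u \<omega>)" "(\<integral>\<omega>. \<xi> \<omega> * incr j s u \<omega> \<partial>M) = 0" .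
qed

abbreviation scalar_adapted :: "real \<Rightarrow> ('w, real) elementary_process \<Rightarrow> bool" where
  "scalar_adapted \<equiv> elementary_adapted M filtration"

lemma scalar_adaptedD:
  assumes "scalar_adapted T S" "k < pieces S"
  shows "0 \<le> times S k" "times S k \<le> times S (Suc k)" "times S (Suc k) \<le> T"
    "coeff S k \<in> L2 M" "coeff S k \<in> borel_measurable (filtration (times S k))"
  using assms unfolding elementary_adapted_def by (auto intro: strongly_measurable_borel)

lemma elementary_integral_incr:
  "elementary_integral (*) (W j) S \<omega> = (\<Sum>k<pieces S. coeff S k \<omega> * incr j (times S k) (times S (Suc k)) \<omega>)"
  by (simp add: elementary_integral_def incr_def)

lemma elementary_integral_L2:
  assumes "scalar_adapted T S" "j \<in> I"
  shows "elementary_integral (*) (W j) S \<in> L2 M"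
  unfolding elementary_integral_incr[abs_def]
  by (intro L2_sum weighted_incr_L2) (use scalar_adaptedD[OF assms(1)] assms(2) in auto)

lemma elementary_integral_mean:
  assumes "scalar_adapted T S" "j \<in> I"
  shows "(\<integral>\<omega>. elementary_integral (*) (W j) S \<omega> \<partial>M) = 0"
  unfolding elementary_integral_incr
  using incr_integral[OF assms(2)] scalar_adaptedD[OF assms(1)]
  by (subst Bochner_Integration.integral_sum) auto

lemma elementary_inner_sum:
  assumes S: "scalar_adapted T S" and S': "scalar_adapted T' S'" and jl: "j \<in> I" "l \<in> I"
  shows "(\<integral>\<omega>. elementary_integral (*) (W j) S \<omega> * elementary_integral (*) (W l) S' \<omega> \<partial>M) =
    (if j = l then \<Sum>k<pieces S. \<Sum>m<pieces S'. (\<integral>\<omega>. coeff S k \<omega> * coeff S' m \<omega> \<partial>M) *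
        overlap (times S k) (times S (Suc k)) (times S' m) (times S' (Suc m)) else 0)"
proof -
  note D = scalar_adaptedD[OF S] and D' = scalar_adaptedD[OF S']
  let ?x = "\<lambda>k \<omega>. coeff S k \<omega> * incr j (times S k) (times S (Suc k)) \<omega>"
  let ?y = "\<lambda>m \<omega>. coeff S' m \<omega> * incr l (times S' m) (times S' (Suc m)) \<omega>"
  have int: "integrable M (\<lambda>\<omega>. ?x k \<omega> * ?y m \<omega>)" if "k < pieces S" "m < pieces S'" for k m
    by (intro L2_mult_integrable weighted_incr_L2 jl) (use D D' that in auto)
  have "(\<integral>\<omega>. elementary_integral (*) (W j) S \<omega> * elementary_integral (*) (W l) S' \<omega> \<partial>M)
      = (\<integral>\<omega>. (\<Sum>k<pieces S. \<Sum>m<pieces S'. ?x k \<omega> * ?y m \<omega>) \<partial>M)"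
    by (simp add: elementary_integral_incr sum_product)
  also have "\<dots> = (\<Sum>k<pieces S. \<integral>\<omega>. (\<Sum>m<pieces S'. ?x k \<omega> * ?y m \<omega>) \<partial>M)"
    by (rule Bochner_Integration.integral_sum) (use int in auto)
  also have "\<dots> = (\<Sum>k<pieces S. \<Sum>m<pieces S'. \<integral>\<omega>. ?x k \<omega> * ?y m \<omega> \<partial>M)"
    by (intro sum.cong refl Bochner_Integration.integral_sum) (use int in auto)
  also have "\<dots> = (\<Sum>k<pieces S. \<Sum>m<pieces S'. if j = l then (\<integral>\<omega>. coeff S k \<omega> * coeff S' m \<omega> \<partial>M) *
        overlap (times S k) (times S (Suc k)) (times S' m) (times S' (Suc m)) else 0)"
    by (intro sum.cong refl weighted_incr_inner jl) (use D D' in auto)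
  finally show ?thesis by simp
qed

lemma elementary_value_product:
  assumes S: "scalar_adapted T S" and S': "scalar_adapted T' S'"
  shows "integrable M (\<lambda>\<omega>. elementary_value S s \<omega> * elementary_value S' s \<omega>)"
    "(\<integral>\<omega>. elementary_value S s \<omega> * elementary_value S' s \<omega> \<partial>M) =
      (\<Sum>k<pieces S. \<Sum>m<pieces S'. (\<integral>\<omega>. coeff S k \<omega> * coeff S' m \<omega> \<partial>M) *
        indicator ({times S k<..times S (Suc k)} \<inter> {times S' m<..times S' (Suc m)}) s)"
proof -
  have int: "integrable M (\<lambda>\<omega>. coeff S k \<omega> * coeff S' m \<omega>)" if "k < pieces S" "m < pieces S'" for k m
    by (intro L2_mult_integrable) (use scalar_adaptedD[OF S] scalar_adaptedD[OF S'] that in auto)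
  have eq: "elementary_value S s \<omega> * elementary_value S' s \<omega> =
      (\<Sum>k<pieces S. \<Sum>m<pieces S'. (coeff S k \<omega> * coeff S' m \<omega>) *
        indicator ({times S k<..times S (Suc k)} \<inter> {times S' m<..times S' (Suc m)}) s)" for \<omega>
    unfolding elementary_value_def sum_product
    by (intro sum.cong refl) (simp add: indicator_inter_arith mult_ac del: Int_greaterThanAtMost)
  show "integrable M (\<lambda>\<omega>. elementary_value S s \<omega> * elementary_value S' s \<omega>)"
    unfolding eq by (intro Bochner_Integration.integrable_sum integrable_mult_left int) auto
  have "(\<integral>\<omega>. elementary_value S s \<omega> * elementary_value S' s \<omega> \<partial>M) =
      (\<Sum>k<pieces S. \<integral>\<omega>. (\<Sum>m<pieces S'. (coeff S k \<omega> * coeff S' m \<omega>) *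
        indicator ({times S k<..times S (Suc k)} \<inter> {times S' m<..times S' (Suc m)}) s) \<partial>M)"
    unfolding eq
    by (intro Bochner_Integration.integral_sum Bochner_Integration.integrable_sum integrable_mult_left int) auto
  also have "\<dots> = (\<Sum>k<pieces S. \<Sum>m<pieces S'. (\<integral>\<omega>. coeff S k \<omega> * coeff S' m \<omega> \<partial>M) *
        indicator ({times S k<..times S (Suc k)} \<inter> {times S' m<..times S' (Suc m)}) s)"
  proof (rule sum.cong[OF refl])
    fix k assume k: "k \<in> {..<pieces S}"
    show "(\<integral>\<omega>. (\<Sum>m<pieces S'. (coeff S k \<omega> * coeff S' m \<omega>) *
        indicator ({times S k<..times S (Suc k)} \<inter> {times S' m<..times S' (Suc m)}) s) \<partial>M) =
      (\<Sum>m<pieces S'. (\<integral>\<omega>. coeff S k \<omega> * coeff S' m \<omega> \<partial>M) *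
        indicator ({times S k<..times S (Suc k)} \<inter> {times S' m<..times S' (Suc m)}) s)"
      by (subst Bochner_Integration.integral_sum)
        (use int k in \<open>auto simp del: Int_greaterThanAtMost intro!: integrable_mult_left\<close>)
  qed
  finally show "(\<integral>\<omega>. elementary_value S s \<omega> * elementary_value S' s \<omega> \<partial>M) =
      (\<Sum>k<pieces S. \<Sum>m<pieces S'. (\<integral>\<omega>. coeff S k \<omega> * coeff S' m \<omega> \<partial>M) *
        indicator ({times S k<..times S (Suc k)} \<inter> {times S' m<..times S' (Suc m)}) s)" .
qed

text \<open>The overlaps are the time integrals of products of indicators, so that the double sum is the time
  integral of \<open>E (S\<^sub>s S'\<^sub>s)\<close>.\<close>

lemma elementary_inner:
  assumes S: "scalar_adapted T S" and S': "scalar_adapted T' S'" and j: "j \<in> I"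
  shows "has_bochner_integral lborel (\<lambda>s. \<integral>\<omega>. elementary_value S s \<omega> * elementary_value S' s \<omega> \<partial>M)
    (\<integral>\<omega>. elementary_integral (*) (W j) S \<omega> * elementary_integral (*) (W j) S' \<omega> \<partial>M)"
  unfolding elementary_value_product(2)[OF S S'] elementary_inner_sum[OF S S' j j] if_P[OF refl]
proof (intro has_bochner_integral_sum has_bochner_integral_mult_right)
  fix k m
  have "{times S k<..times S (Suc k)} \<inter> {times S' m<..times S' (Suc m)}
      \<subseteq> {times S k..times S (Suc k)}" by auto
  then have "emeasure lborel ({times S k<..times S (Suc k)} \<inter> {times S' m<..times S' (Suc m)})
      \<le> emeasure lborel {times S k..times S (Suc k)}" by (intro emeasure_mono) auto
  also have "\<dots> < \<infinity>" by (simp add: emeasure_lborel_Icc_eq)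
  finally show "has_bochner_integral lborel
      (indicator ({times S k<..times S (Suc k)} \<inter> {times S' m<..times S' (Suc m)}))
      (overlap (times S k) (times S (Suc k)) (times S' m) (times S' (Suc m)))"
    unfolding overlap_measure[symmetric] by (intro has_bochner_integral_real_indicator) auto
qed

text \<open>The two processes may live on different partitions: the isometry is polarised rather than proved on a
  common refinement.\<close>

lemma elementary_isometry:
  assumes S: "scalar_adapted T S" and S': "scalar_adapted T' S'" and j: "j \<in> I"
  shows "has_bochner_integral lborel (\<lambda>s. \<integral>\<omega>. (elementary_value S s \<omega> - elementary_value S' s \<omega>)\<^sup>2 \<partial>M)
    ((L2_norm M (\<lambda>\<omega>. elementary_integral (*) (W j) S \<omega> - elementary_integral (*) (W j) S' \<omega>))\<^sup>2)"
proof -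
  let ?I = "\<lambda>S. elementary_integral (*) (W j) S" and ?v = "elementary_value"
  have L: "?I S \<in> L2 M" "?I S' \<in> L2 M" using S S' j by (auto intro: elementary_integral_L2)
  have 1: "(\<integral>\<omega>. (?v S s \<omega> - ?v S' s \<omega>)\<^sup>2 \<partial>M) = (\<integral>\<omega>. ?v S s \<omega> * ?v S s \<omega> \<partial>M)
      + (\<integral>\<omega>. ?v S' s \<omega> * ?v S' s \<omega> \<partial>M) - 2 * (\<integral>\<omega>. ?v S s \<omega> * ?v S' s \<omega> \<partial>M)" for s
  proof -
    have "(\<integral>\<omega>. (?v S s \<omega> - ?v S' s \<omega>)\<^sup>2 \<partial>M) =
        (\<integral>\<omega>. ?v S s \<omega> * ?v S s \<omega> + ?v S' s \<omega> * ?v S' s \<omega> - 2 * (?v S s \<omega> * ?v S' s \<omega>) \<partial>M)"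
      by (intro Bochner_Integration.integral_cong refl) (simp add: power2_eq_square algebra_simps)
    then show ?thesis
      using elementary_value_product(1)[OF S S] elementary_value_product(1)[OF S' S']
        elementary_value_product(1)[OF S S'] by simp
  qed
  have "(L2_norm M (\<lambda>\<omega>. ?I S \<omega> - ?I S' \<omega>))\<^sup>2 = (\<integral>\<omega>. ?I S \<omega> * ?I S \<omega> + ?I S' \<omega> * ?I S' \<omega> - 2 * (?I S \<omega> * ?I S' \<omega>) \<partial>M)"
    unfolding L2_norm_square
    by (intro Bochner_Integration.integral_cong refl) (simp add: power2_eq_square algebra_simps)
  also have "\<dots> = (\<integral>\<omega>. ?I S \<omega> * ?I S \<omega> \<partial>M) + (\<integral>\<omega>. ?I S' \<omega> * ?I S' \<omega> \<partial>M) - 2 * (\<integral>\<omega>. ?I S \<omega> * ?I S' \<omega> \<partial>M)"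
    using L2_mult_integrable[OF L(1) L(1)] L2_mult_integrable[OF L(2) L(2)] L2_mult_integrable[OF L] by simp
  finally show ?thesis
    unfolding 1
    by (simp only:) (intro has_bochner_integral_diff has_bochner_integral_add has_bochner_integral_mult_right
        elementary_inner[OF S S j] elementary_inner[OF S' S' j] elementary_inner[OF S S' j])
qed

text \<open>The bound is meant for \<open>g\<close> and \<open>g'\<close> the mean-square errors of \<open>S\<close> and \<open>S'\<close> as approximations
  of a common integrand. These are functions of the time alone, which avoids joint measurability in
  time and sample point.\<close>

lemma elementary_compare:
  assumes S: "scalar_adapted T S" and S': "scalar_adapted T S'" and j: "j \<in> I"
    and g: "g \<in> borel_measurable (restrict_space borel {0..T})"
    and g': "g' \<in> borel_measurable (restrict_space borel {0..T})"
    and le: "\<And>s. s \<in> {0..T} \<Longrightarrow>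
      (\<integral>\<^sup>+\<omega>. ennreal ((elementary_value S s \<omega> - elementary_value S' s \<omega>)\<^sup>2) \<partial>M) \<le> 2 * g s + 2 * g' s"
  shows "ennreal ((L2_norm M (\<lambda>\<omega>. elementary_integral (*) (W j) S \<omega> - elementary_integral (*) (W j) S' \<omega>))\<^sup>2)
    \<le> 2 * (\<integral>\<^sup>+s\<in>{0..T}. g s \<partial>lborel) + 2 * (\<integral>\<^sup>+s\<in>{0..T}. g' s \<partial>lborel)"
proof -
  let ?d = "\<lambda>s \<omega>. (elementary_value S s \<omega> - elementary_value S' s \<omega>)\<^sup>2"
  have "{0..T} \<inter> space borel \<in> sets borel" by simp
  note restrict = borel_measurable_restrict_space_iff_ennreal[OF this, THEN iffD1]
  note [measurable] = restrict[OF g] restrict[OF g']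
  have int: "integrable M (?d s)" for s
  proof -
    have "?d s = (\<lambda>\<omega>. elementary_value S s \<omega> * elementary_value S s \<omega>
        + elementary_value S' s \<omega> * elementary_value S' s \<omega> - 2 * (elementary_value S s \<omega> * elementary_value S' s \<omega>))"
      by (simp add: fun_eq_iff power2_eq_square algebra_simps)
    then show ?thesis
      using elementary_value_product(1)[OF S S] elementary_value_product(1)[OF S' S']
        elementary_value_product(1)[OF S S'] by simp
  qed
  have zero: "elementary_value R s \<omega> = 0" if "scalar_adapted T R" "s \<notin> {0..T}" for R s \<omega>
    unfolding elementary_value_def
  proof (rule sum.neutral, rule ballI)
    fix k assume "k \<in> {..<pieces R}"
    then have "s \<notin> {times R k<..times R (Suc k)}" using scalar_adaptedD[OF that(1), of k] that(2) by auto
    then show "indicator {times R k<..times R (Suc k)} s *\<^sub>R coeff R k \<omega> = 0" by simp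
  qed
  note iso = elementary_isometry[OF S S' j]
  have "ennreal ((L2_norm M (\<lambda>\<omega>. elementary_integral (*) (W j) S \<omega> - elementary_integral (*) (W j) S' \<omega>))\<^sup>2)
      = (\<integral>\<^sup>+s. ennreal (\<integral>\<omega>. ?d s \<omega> \<partial>M) \<partial>lborel)"
    using iso nn_integral_eq_integral[of lborel "\<lambda>s. \<integral>\<omega>. ?d s \<omega> \<partial>M"]
    by (simp add: has_bochner_integral_iff)
  also have "\<dots> = (\<integral>\<^sup>+s. (\<integral>\<^sup>+\<omega>. ennreal (?d s \<omega>) \<partial>M) \<partial>lborel)"
    by (intro nn_integral_cong nn_integral_eq_integral[symmetric] int) simp
  also have "\<dots> \<le> (\<integral>\<^sup>+s. 2 * (g s * indicator {0..T} s) + 2 * (g' s * indicator {0..T} s) \<partial>lborel)"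
  proof (rule nn_integral_mono)
    fix s
    show "(\<integral>\<^sup>+\<omega>. ennreal (?d s \<omega>) \<partial>M) \<le> 2 * (g s * indicator {0..T} s) + 2 * (g' s * indicator {0..T} s)"
      using le[of s] zero[OF S, of s] zero[OF S', of s] by (cases "s \<in> {0..T}") auto
  qed
  also have "\<dots> = 2 * (\<integral>\<^sup>+s\<in>{0..T}. g s \<partial>lborel) + 2 * (\<integral>\<^sup>+s\<in>{0..T}. g' s \<partial>lborel)"
    by (subst nn_integral_add) (auto simp: nn_integral_cmult)
  finally show ?thesis .
qed

end


section \<open>Riemann sums and the scalar Ito integrals\<close>

definition grid :: "real \<Rightarrow> nat \<Rightarrow> nat \<Rightarrow> real" where
  "grid T n k = T * real k / real (Suc n)"

definition riemann :: "(real \<Rightarrow> 'w \<Rightarrow> 'x) \<Rightarrow> real \<Rightarrow> nat \<Rightarrow> ('w, 'x) elementary_process" where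
  "riemann X T n = \<lparr>pieces = Suc n, times = grid T n, coeff = (\<lambda>k. X (grid T n k))\<rparr>"

lemma riemann_simps [simp]:
  "pieces (riemann X T n) = Suc n" "times (riemann X T n) = grid T n"
  "coeff (riemann X T n) k = X (grid T n k)"
  by (simp_all add: riemann_def)

lemma grid_0 [simp]: "grid T n 0 = 0" and grid_end [simp]: "grid T n (Suc n) = T"
  by (simp_all add: grid_def del: of_nat_Suc)

lemma grid_step: "grid T n (Suc k) - grid T n k = T / real (Suc n)"
  unfolding grid_def diff_divide_distrib[symmetric] right_diff_distrib[symmetric] by simp

lemma grid_mono: "0 \<le> T \<Longrightarrow> k \<le> m \<Longrightarrow> grid T n k \<le> grid T n m"
  unfolding grid_def by (intro divide_right_mono mult_left_mono) auto

lemma grid_nonneg: "0 \<le> T \<Longrightarrow> 0 \<le> grid T n k"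
  by (simp add: grid_def)

lemma grid_le: "0 \<le> T \<Longrightarrow> k \<le> Suc n \<Longrightarrow> grid T n k \<le> T"
  using grid_mono[of T k "Suc n" n] by simp

lemma grid_cell_exists:
  assumes "0 < T" "s \<in> {0<..T}"
  obtains k where "k < Suc n" "s \<in> {grid T n k<..grid T n (Suc k)}"
proof -
  define m where "m = (LEAST m. s \<le> grid T n m)"
  have ex: "s \<le> grid T n (Suc n)" using assms by simp
  have m: "s \<le> grid T n m" unfolding m_def by (rule LeastI[of _ "Suc n"]) (rule ex)
  have "m \<noteq> 0"
  proof
    assume "m = 0"
    with m have "s \<le> 0" by simp
    with assms(2) show False by simp
  qed
  then obtain k where k: "m = Suc k" by (cases m) auto
  have "\<not> s \<le> grid T n k" using not_less_Least[of k "\<lambda>m. s \<le> grid T n m"] k by (simp add: m_def)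
  moreover have "m \<le> Suc n" unfolding m_def by (rule Least_le) (rule ex)
  ultimately show ?thesis using m k by (intro that[of k]) auto
qed

lemma grid_cell_unique:
  assumes "0 \<le> T" "s \<in> {grid T n k<..grid T n (Suc k)}" "s \<in> {grid T n m<..grid T n (Suc m)}"
  shows "k = m"
proof (rule ccontr)
  assume "k \<noteq> m"
  then consider "Suc k \<le> m" | "Suc m \<le> k" by linarith
  then show False
  proof cases
    case 1 then show False using grid_mono[OF assms(1) 1, of n] assms by simp
  next
    case 2 then show False using grid_mono[OF assms(1) 2, of n] assms by simp
  qed
qed

lemma grid_cell_indicator:
  assumes "0 \<le> T" "s \<in> {grid T n k<..grid T n (Suc k)}"
  shows "indicator {grid T n m<..grid T n (Suc m)} s = (if m = k then 1 else (0 :: 'a::zero_neq_one))"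
proof (cases "m = k")
  case True
  then show ?thesis using assms(2) by simp
next
  case False
  then have "s \<notin> {grid T n m<..grid T n (Suc m)}" using grid_cell_unique[OF assms] by blast
  then have "indicator {grid T n m<..grid T n (Suc m)} s = (0 :: 'a)" by (rule indicator_simps(2))
  then show ?thesis using False by simp
qed

lemma riemann_value:
  assumes "0 \<le> T" "k < Suc n" "s \<in> {grid T n k<..grid T n (Suc k)}"
  shows "elementary_value (riemann X T n) s \<omega> = X (grid T n k) \<omega>"
proof -
  have "elementary_value (riemann X T n) s \<omega> = (\<Sum>m<Suc n. if m = k then X (grid T n k) \<omega> else 0)"
    unfolding elementary_value_def riemann_simps
    by (intro sum.cong refl) (simp add: grid_cell_indicator[OF assms(1,3)])
  then show ?thesis using assms(2) by simp
qed

lemma riemann_value_0: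
  assumes "0 \<le> T"
  shows "elementary_value (riemann X T n) 0 \<omega> = 0"
  unfolding elementary_value_def riemann_simps
proof (rule sum.neutral, rule ballI)
  fix k
  have "0 \<notin> {grid T n k<..grid T n (Suc k)}" using grid_nonneg[OF assms, of n k] by simp
  then have "indicator {grid T n k<..grid T n (Suc k)} 0 = (0 :: real)" by (rule indicator_simps(2))
  then show "indicator {grid T n k<..grid T n (Suc k)} 0 *\<^sub>R X (grid T n k) \<omega> = 0"
    by (simp only: scaleR_zero_left)
qed

text \<open>For a process with \<open>E \<parallel>X\<^sub>s - X\<^sub>a\<parallel>\<^sup>2 = \<kappa> (s - a)\<close> the error of the left-endpoint approximation is an
  explicit sawtooth function of time. Hence it is Borel and of order \<open>1/n\<close>.\<close>

lemma riemann_error: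
  fixes X :: "real \<Rightarrow> 'w \<Rightarrow> 'x::real_inner"
  assumes T: "0 < T" and \<kappa>: "0 \<le> \<kappa>"
    and err: "\<And>a s. 0 \<le> a \<Longrightarrow> a \<le> s \<Longrightarrow> (\<integral>\<^sup>+\<omega>. ennreal ((norm (X a \<omega> - X s \<omega>))\<^sup>2) \<partial>M) = ennreal (\<kappa> * (s - a))"
    and zero: "AE \<omega> in M. X 0 \<omega> = 0"
  defines "g \<equiv> \<lambda>n s. \<integral>\<^sup>+\<omega>. ennreal ((norm (elementary_value (riemann X T n) s \<omega> - X s \<omega>))\<^sup>2) \<partial>M"
  shows "g n \<in> borel_measurable (restrict_space borel {0..T})"
    and "(\<integral>\<^sup>+s\<in>{0..T}. g n s \<partial>lborel) \<le> ennreal (\<kappa> * T\<^sup>2 / real (Suc n))"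
proof -
  have g0: "g n 0 = 0"
    unfolding g_def using zero riemann_value_0[of T X n] T
    by (subst nn_integral_cong_AE[of _ "\<lambda>_. 0"]) auto
  have g_cell: "g n s = ennreal (\<kappa> * (s - grid T n k))"
    if "k < Suc n" "s \<in> {grid T n k<..grid T n (Suc k)}" for k s
  proof -
    have "0 \<le> grid T n k" using T by (intro grid_nonneg) simp
    then show ?thesis
      unfolding g_def riemann_value[OF less_imp_le[OF T] that] using that(2) by (intro err) auto
  qed
  have g_eq: "g n s = (\<Sum>k<Suc n. ennreal (\<kappa> * (s - grid T n k)) * indicator {grid T n k<..grid T n (Suc k)} s)"
    (is "_ = ?h s") if s: "s \<in> {0..T}" for s
  proof (cases "s = 0")
    case True
    have "s \<notin> {grid T n k<..grid T n (Suc k)}" for k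
      using grid_nonneg[of T n k] T True by simp
    then have "indicator {grid T n k<..grid T n (Suc k)} s = (0 :: ennreal)" for k
      by (rule indicator_simps(2))
    then have "?h s = 0" by simp
    then show ?thesis using g0 True by simp
  next
    case False
    then obtain k where k: "k < Suc n" "s \<in> {grid T n k<..grid T n (Suc k)}"
      using grid_cell_exists[OF T, of s n] s by auto
    have "?h s = (\<Sum>m<Suc n. if m = k then ennreal (\<kappa> * (s - grid T n k)) else 0)"
      by (intro sum.cong refl) (simp add: grid_cell_indicator[OF less_imp_le[OF T] k(2)])
    then show ?thesis using k g_cell[OF k] by simp
  qed
  have "?h \<in> borel_measurable borel" by measurable
  then show "g n \<in> borel_measurable (restrict_space borel {0..T})"
    by (intro measurable_cong[THEN iffD2, OF _ measurable_restrict_space1]) (auto simp: space_restrict_space g_eq)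
  have le: "g n s \<le> ennreal (\<kappa> * T / real (Suc n))" if s: "s \<in> {0..T}" for s
  proof (cases "s = 0")
    case False
    then obtain k where k: "k < Suc n" "s \<in> {grid T n k<..grid T n (Suc k)}"
      using grid_cell_exists[OF T, of s n] s by auto
    have "s - grid T n k \<le> T / real (Suc n)" using k(2) grid_step[of T n k] by simp
    from mult_left_mono[OF this \<kappa>] show ?thesis
      unfolding g_cell[OF k] by (intro ennreal_leI) simp
  qed (simp add: g0)
  have "(\<integral>\<^sup>+s\<in>{0..T}. g n s \<partial>lborel) \<le> (\<integral>\<^sup>+s. ennreal (\<kappa> * T / real (Suc n)) * indicator {0..T} s \<partial>lborel)"
    by (intro nn_integral_mono) (use le in \<open>auto simp: indicator_def\<close>)
  also have "\<dots> = ennreal (\<kappa> * T / real (Suc n)) * ennreal T"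
    using T by (subst nn_integral_cmult_indicator) auto
  also have "\<dots> = ennreal (\<kappa> * T\<^sup>2 / real (Suc n))"
    using T \<kappa> by (subst ennreal_mult[symmetric]) (auto simp: power2_eq_square)
  finally show "(\<integral>\<^sup>+s\<in>{0..T}. g n s \<partial>lborel) \<le> ennreal (\<kappa> * T\<^sup>2 / real (Suc n))" .
qed

lemma ennreal_inverse_Suc_null: "(\<lambda>n. ennreal (x / real (Suc n))) \<longlonglongrightarrow> 0"
proof -
  have "(\<lambda>n. x * inverse (real (Suc n))) \<longlonglongrightarrow> x * 0"
    by (intro tendsto_intros LIMSEQ_inverse_real_of_nat)
  from tendsto_ennrealI[OF this] show ?thesis by (simp add: divide_inverse)
qed

text \<open>The left-endpoint processes are admissible approximants, so that convergence of the Riemann sums is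
  all that is needed for the stochastic integral to exist.\<close>

lemma riemann_has_ito_integral:
  fixes X :: "real \<Rightarrow> 'w \<Rightarrow> 'x::real_inner"
  assumes T: "0 < T" and \<kappa>: "0 \<le> \<kappa>"
    and err: "\<And>a s. 0 \<le> a \<Longrightarrow> a \<le> s \<Longrightarrow> (\<integral>\<^sup>+\<omega>. ennreal ((norm (X a \<omega> - X s \<omega>))\<^sup>2) \<partial>M) = ennreal (\<kappa> * (s - a))"
    and zero: "AE \<omega> in M. X 0 \<omega> = 0"
    and X: "\<And>s. 0 \<le> s \<Longrightarrow> strongly_measurable (F s) (X s)" "\<And>s. 0 \<le> s \<Longrightarrow> X s \<in> L2 M"
    and lim: "L2_tendsto M (\<lambda>n. elementary_integral prd Z (riemann X T n)) J sequentially"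
  shows "has_ito_integral prd M F X Z T J"
  unfolding has_ito_integral_def
proof (intro conjI exI[of _ "riemann X T"] allI lim ballI)
  fix n
  show "elementary_adapted M F T (riemann X T n)"
    unfolding elementary_adapted_def using T grid_nonneg[of T n] grid_mono[of T _ _ n] grid_le[of T _ n]
    by (auto intro: X)
  show "(\<lambda>s. \<integral>\<^sup>+\<omega>. ennreal ((norm (elementary_value (riemann X T n) s \<omega> - X s \<omega>))\<^sup>2) \<partial>M)
      \<in> borel_measurable (restrict_space borel {0..T})"
    by (rule riemann_error(1)[OF T \<kappa> err zero])
next
  show "(\<lambda>n. \<integral>\<^sup>+s\<in>{0..T}. (\<integral>\<^sup>+\<omega>. ennreal ((norm (elementary_value (riemann X T n) s \<omega> - X s \<omega>))\<^sup>2) \<partial>M) \<partial>lborel)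
      \<longlonglongrightarrow> 0"
    by (rule tendsto_sandwich[OF _ _ tendsto_const ennreal_inverse_Suc_null[of "\<kappa> * T\<^sup>2"]])
      (auto intro!: always_eventually riemann_error(2)[OF T \<kappa> err zero] simp del: of_nat_Suc)
qed (use X in auto)

lemma nn_integral_square_triangle:
  fixes a b c :: "'w \<Rightarrow> real"
  assumes [measurable]: "a \<in> borel_measurable M" "b \<in> borel_measurable M" "c \<in> borel_measurable M"
  shows "(\<integral>\<^sup>+\<omega>. ennreal ((a \<omega> - b \<omega>)\<^sup>2) \<partial>M)
    \<le> 2 * (\<integral>\<^sup>+\<omega>. ennreal ((a \<omega> - c \<omega>)\<^sup>2) \<partial>M) + 2 * (\<integral>\<^sup>+\<omega>. ennreal ((b \<omega> - c \<omega>)\<^sup>2) \<partial>M)"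
proof -
  have "(\<integral>\<^sup>+\<omega>. ennreal ((a \<omega> - b \<omega>)\<^sup>2) \<partial>M)
      \<le> (\<integral>\<^sup>+\<omega>. 2 * ennreal ((a \<omega> - c \<omega>)\<^sup>2) + 2 * ennreal ((b \<omega> - c \<omega>)\<^sup>2) \<partial>M)"
  proof (rule nn_integral_mono)
    fix \<omega>
    have "(a \<omega> - b \<omega>)\<^sup>2 + ((a \<omega> - c \<omega>) + (b \<omega> - c \<omega>))\<^sup>2 = 2 * (a \<omega> - c \<omega>)\<^sup>2 + 2 * (b \<omega> - c \<omega>)\<^sup>2"
      by (simp add: power2_eq_square algebra_simps)
    then have "(a \<omega> - b \<omega>)\<^sup>2 \<le> 2 * (a \<omega> - c \<omega>)\<^sup>2 + 2 * (b \<omega> - c \<omega>)\<^sup>2"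
      using zero_le_power2[of "(a \<omega> - c \<omega>) + (b \<omega> - c \<omega>)"] by linarith
    then have "ennreal ((a \<omega> - b \<omega>)\<^sup>2) \<le> ennreal (2 * (a \<omega> - c \<omega>)\<^sup>2 + 2 * (b \<omega> - c \<omega>)\<^sup>2)"
      by (rule ennreal_leI)
    then show "ennreal ((a \<omega> - b \<omega>)\<^sup>2) \<le> 2 * ennreal ((a \<omega> - c \<omega>)\<^sup>2) + 2 * ennreal ((b \<omega> - c \<omega>)\<^sup>2)"
      by (simp add: ennreal_plus ennreal_mult)
  qed
  also have "\<dots> = 2 * (\<integral>\<^sup>+\<omega>. ennreal ((a \<omega> - c \<omega>)\<^sup>2) \<partial>M) + 2 * (\<integral>\<^sup>+\<omega>. ennreal ((b \<omega> - c \<omega>)\<^sup>2) \<partial>M)"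
    by (subst nn_integral_add) (auto simp: nn_integral_cmult)
  finally show ?thesis .
qed

lemma two_ennreal_add: "0 \<le> a \<Longrightarrow> 0 \<le> b \<Longrightarrow> 2 * ennreal a + 2 * ennreal b = ennreal (2 * a + 2 * b)"
  by (simp add: ennreal_plus ennreal_mult)

lemma null_of_ennreal_squares:
  fixes x :: "nat \<Rightarrow> real"
  assumes "\<And>n. ennreal ((x n)\<^sup>2) \<le> 2 * a n + 2 * b n" "a \<longlonglongrightarrow> 0" "b \<longlonglongrightarrow> 0"
  shows "x \<longlonglongrightarrow> 0"
proof -
  have "(\<lambda>n. 2 * a n + 2 * b n) \<longlonglongrightarrow> 2 * 0 + 2 * 0"
    using assms(2,3) by (intro tendsto_add ennreal_tendsto_cmult) auto
  then have lim: "(\<lambda>n. 2 * a n + 2 * b n) \<longlonglongrightarrow> 0" by simp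
  have "(\<lambda>n. ennreal ((x n)\<^sup>2)) \<longlonglongrightarrow> 0"
    by (rule tendsto_sandwich[OF always_eventually always_eventually tendsto_const lim]) (simp_all add: assms(1))
  then have "(\<lambda>n. ennreal ((x n)\<^sup>2)) \<longlonglongrightarrow> ennreal 0" by simp
  then have "(\<lambda>n. (x n)\<^sup>2) \<longlonglongrightarrow> 0"
    by (subst (asm) tendsto_ennreal_iff) (auto simp del: ennreal_0)
  then have "(\<lambda>n. sqrt ((x n)\<^sup>2)) \<longlonglongrightarrow> sqrt 0" by (rule tendsto_real_sqrt)
  then show ?thesis by (simp add: tendsto_rabs_zero_iff)
qed

lemma L2_tendsto_approx:
  assumes f: "L2_tendsto M f g sequentially" and f': "\<And>n. f' n \<in> L2 M"
    and d: "(\<lambda>n. L2_norm M (\<lambda>\<omega>. f n \<omega> - f' n \<omega>)) \<longlonglongrightarrow> 0"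
  shows "L2_tendsto M f' g sequentially"
proof -
  have g: "g \<in> L2 M" using f by (simp add: L2_tendsto_def)
  have "(\<lambda>n. L2_norm M (\<lambda>\<omega>. f' n \<omega> - g \<omega>)) \<longlonglongrightarrow> 0"
  proof (rule tendsto_sandwich[where f = "\<lambda>_. 0"])
    show "(\<lambda>n. L2_norm M (\<lambda>\<omega>. f n \<omega> - f' n \<omega>) + L2_norm M (\<lambda>\<omega>. f n \<omega> - g \<omega>)) \<longlonglongrightarrow> 0"
      using tendsto_add[OF d L2_tendstoD(3)[OF f]] by simp
    show "\<forall>\<^sub>F n in sequentially. L2_norm M (\<lambda>\<omega>. f' n \<omega> - g \<omega>)
        \<le> L2_norm M (\<lambda>\<omega>. f n \<omega> - f' n \<omega>) + L2_norm M (\<lambda>\<omega>. f n \<omega> - g \<omega>)"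
      using L2_tendstoD(2)[OF f]
    proof eventually_elim
      case (elim n)
      show ?case
        using L2_triangle_diff[OF f'[of n] elim g] L2_norm_minus_commute[of M "f' n" "f n"] by simp
    qed
  qed auto
  with f' g show ?thesis by (simp add: L2_tendsto_def)
qed

context brownian_family
begin

lemma W_zero: "i \<in> I \<Longrightarrow> AE \<omega> in M. W i 0 \<omega> = 0"
  using brownian by (simp add: brownian_motion_def)

lemma W_error:
  assumes "i \<in> I" "0 \<le> a" "a \<le> s"
  shows "(\<integral>\<^sup>+\<omega>. ennreal ((W i a \<omega> - W i s \<omega>)\<^sup>2) \<partial>M) = ennreal (s - a)"
proof -
  have "(\<integral>\<^sup>+\<omega>. ennreal ((W i a \<omega> - W i s \<omega>)\<^sup>2) \<partial>M) = (\<integral>\<^sup>+\<omega>. ennreal ((incr i a s \<omega>)\<^sup>2) \<partial>M)"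
    by (simp add: incr_def power2_commute)
  then show ?thesis
    using nn_integral_eq_integral[OF incr_moments(3)[OF assms]] incr_moments(4)[OF assms] by simp
qed

lemma W_error_norm:
  assumes "i \<in> I" "0 \<le> a" "a \<le> s"
  shows "(\<integral>\<^sup>+\<omega>. ennreal ((norm (W i a \<omega> - W i s \<omega>))\<^sup>2) \<partial>M) = ennreal (1 * (s - a))"
  using W_error[OF assms] by simp

lemma W_incr_AE:
  assumes "i \<in> I"
  shows "AE \<omega> in M. W i r \<omega> = incr i 0 r \<omega>"
  using W_zero[OF assms] by eventually_elim (simp add: incr_def)

lemma W_L2:
  assumes "i \<in> I" "0 \<le> r"
  shows "W i r \<in> L2 M"
proof -
  have "integrable M (\<lambda>\<omega>. (W i r \<omega>)\<^sup>2) \<longleftrightarrow> integrable M (\<lambda>\<omega>. (incr i 0 r \<omega>)\<^sup>2)"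
    using W_incr_AE[OF assms(1), of r] W_measurable[OF assms] incr_measurable[OF assms(1) order_refl assms(2)]
    by (intro integrable_cong_AE) auto
  then show ?thesis using incr_moments(3)[OF assms(1) order_refl assms(2)] W_measurable[OF assms]
    by (simp add: L2_iff_real)
qed

lemma W_inner:
  assumes ik: "i \<in> I" "k \<in> I" and ab: "0 \<le> a" "0 \<le> b"
  shows "(\<integral>\<omega>. W i a \<omega> * W k b \<omega> \<partial>M) = (if i = k then min a b else 0)"
proof -
  have "(\<integral>\<omega>. W i a \<omega> * W k b \<omega> \<partial>M) = (\<integral>\<omega>. (1 * incr i 0 a \<omega>) * (1 * incr k 0 b \<omega>) \<partial>M)"
  proof (rule integral_cong_AE)
    show "AE \<omega> in M. W i a \<omega> * W k b \<omega> = (1 * incr i 0 a \<omega>) * (1 * incr k 0 b \<omega>)"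
      using W_incr_AE[OF ik(1), of a] W_incr_AE[OF ik(2), of b] by eventually_elim simp
  qed (use W_measurable incr_measurable ik ab in \<open>auto intro!: borel_measurable_times\<close>)
  also have "\<dots> = (if i = k then (\<integral>\<omega>. 1 * 1 \<partial>M) * overlap 0 a 0 b else 0)"
    by (rule weighted_incr_inner) (use ik ab in \<open>auto simp: L2_iff_real\<close>)
  finally show ?thesis using ab by (simp add: overlap_def prob_space)
qed

lemma W_strongly_measurable: "i \<in> I \<Longrightarrow> 0 \<le> s \<Longrightarrow> strongly_measurable (filtration s) (W i s)"
  by (intro borel_strongly_measurable W_filtration) auto

lemma riemann_adapted:
  assumes "0 < T" "i \<in> I"
  shows "scalar_adapted T (riemann (W i) T n)"
  unfolding elementary_adapted_def using assms grid_nonneg[of T n] grid_mono[of T _ _ n] grid_le[of T _ n]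
  by (auto intro: W_strongly_measurable W_L2)

abbreviation riemann_sum :: "nat \<Rightarrow> nat \<Rightarrow> real \<Rightarrow> nat \<Rightarrow> 'w \<Rightarrow> real" where
  "riemann_sum i j T n \<equiv> elementary_integral (*) (W j) (riemann (W i) T n)"

lemma riemann_sum_L2: "0 < T \<Longrightarrow> i \<in> I \<Longrightarrow> j \<in> I \<Longrightarrow> riemann_sum i j T n \<in> L2 M"
  by (rule elementary_integral_L2[OF riemann_adapted])

lemma elementary_value_measurable:
  assumes "scalar_adapted T S"
  shows "elementary_value S s \<in> borel_measurable M"
  unfolding elementary_value_def[abs_def] using scalar_adaptedD(4)[OF assms]
  by (intro borel_measurable_sum borel_measurable_scaleR borel_measurable_const L2_measurable) auto

text \<open>A bound \<open>g\<close> on the approximation error suffices. This allows \<open>S\<close> to be a coordinate of a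
  Hilbert-valued process, whose scalar error is dominated by the Hilbert-space error.\<close>

lemma compare_riemann_sum:
  assumes T: "0 < T" and i: "i \<in> I" and j: "j \<in> I" and S: "scalar_adapted T S"
    and g: "g \<in> borel_measurable (restrict_space borel {0..T})"
    and le: "\<And>s. s \<in> {0..T} \<Longrightarrow> (\<integral>\<^sup>+\<omega>. ennreal ((elementary_value S s \<omega> - r * W i s \<omega>)\<^sup>2) \<partial>M) \<le> g s"
  shows "ennreal ((L2_norm M (\<lambda>\<omega>. elementary_integral (*) (W j) S \<omega> - r * riemann_sum i j T n \<omega>))\<^sup>2)
    \<le> 2 * (\<integral>\<^sup>+s\<in>{0..T}. g s \<partial>lborel) + 2 * ennreal (r\<^sup>2 * T\<^sup>2 / real (Suc n))"
proof -
  define R where "R = riemann (\<lambda>s \<omega>. r * W i s \<omega>) T n"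
  let ?g = "\<lambda>s. \<integral>\<^sup>+\<omega>. ennreal ((norm (elementary_value R s \<omega> - r * W i s \<omega>))\<^sup>2) \<partial>M"
  have R: "scalar_adapted T R"
    unfolding elementary_adapted_def R_def using T i grid_nonneg[of T n] grid_mono[of T _ _ n] grid_le[of T _ n]
    by (auto intro!: borel_strongly_measurable W_filtration borel_measurable_times L2_scale[where 'b = real, simplified] W_L2)
  have R_int: "elementary_integral (*) (W j) R \<omega> = r * riemann_sum i j T n \<omega>" for \<omega>
    unfolding elementary_integral_def R_def riemann_simps by (simp only: sum_distrib_left mult.assoc)
  have err: "(\<integral>\<^sup>+\<omega>. ennreal ((norm (r * W i a \<omega> - r * W i s \<omega>))\<^sup>2) \<partial>M) = ennreal (r\<^sup>2 * (s - a))"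
    if "0 \<le> a" "a \<le> s" for a s
  proof -
    have "(\<integral>\<^sup>+\<omega>. ennreal ((norm (r * W i a \<omega> - r * W i s \<omega>))\<^sup>2) \<partial>M)
        = (\<integral>\<^sup>+\<omega>. ennreal (r\<^sup>2) * ennreal ((W i a \<omega> - W i s \<omega>)\<^sup>2) \<partial>M)"
      by (intro nn_integral_cong) (simp add: power_mult_distrib flip: ennreal_mult right_diff_distrib)
    also have "\<dots> = ennreal (r\<^sup>2) * ennreal (s - a)"
      using W_measurable[OF i that(1)] W_measurable[OF i, of s] that
      by (subst nn_integral_cmult) (auto simp: W_error[OF i that])
    finally show ?thesis using that by (simp add: ennreal_mult)
  qed
  have zero: "AE \<omega> in M. r * W i 0 \<omega> = 0" using W_zero[OF i] by eventually_elim simp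
  note E = riemann_error[OF T zero_le_power2[of r] err zero, where n = n, folded R_def]
  have "ennreal ((L2_norm M (\<lambda>\<omega>. elementary_integral (*) (W j) S \<omega> - elementary_integral (*) (W j) R \<omega>))\<^sup>2)
    \<le> 2 * (\<integral>\<^sup>+s\<in>{0..T}. g s \<partial>lborel) + 2 * (\<integral>\<^sup>+s\<in>{0..T}. ?g s \<partial>lborel)"
  proof (rule elementary_compare[OF S R j g E(1)])
    fix s assume s: "s \<in> {0..T}"
    have [measurable]: "elementary_value S s \<in> borel_measurable M" "elementary_value R s \<in> borel_measurable M"
      "W i s \<in> borel_measurable M"
      using s i by (auto intro: elementary_value_measurable[OF S] elementary_value_measurable[OF R] W_measurable)
    have "(\<integral>\<^sup>+\<omega>. ennreal ((elementary_value S s \<omega> - elementary_value R s \<omega>)\<^sup>2) \<partial>M)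
        \<le> 2 * (\<integral>\<^sup>+\<omega>. ennreal ((elementary_value S s \<omega> - r * W i s \<omega>)\<^sup>2) \<partial>M)
          + 2 * (\<integral>\<^sup>+\<omega>. ennreal ((elementary_value R s \<omega> - r * W i s \<omega>)\<^sup>2) \<partial>M)"
      by (rule nn_integral_square_triangle) measurable
    also have "\<dots> \<le> 2 * g s + 2 * ?g s"
      using le[OF s] by (intro add_mono mult_left_mono) auto
    finally show "(\<integral>\<^sup>+\<omega>. ennreal ((elementary_value S s \<omega> - elementary_value R s \<omega>)\<^sup>2) \<partial>M) \<le> 2 * g s + 2 * ?g s" .
  qed
  also have "\<dots> \<le> 2 * (\<integral>\<^sup>+s\<in>{0..T}. g s \<partial>lborel) + 2 * ennreal (r\<^sup>2 * T\<^sup>2 / real (Suc n))"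
    by (intro add_mono mult_left_mono order_refl E(2)) auto
  finally show ?thesis unfolding R_int .
qed

lemma riemann_sum_Cauchy_bound:
  assumes T: "0 < T" and i: "i \<in> I" and j: "j \<in> I"
  shows "(L2_norm M (\<lambda>\<omega>. riemann_sum i j T m \<omega> - riemann_sum i j T n \<omega>))\<^sup>2
    \<le> 2 * (T\<^sup>2 / real (Suc m)) + 2 * (T\<^sup>2 / real (Suc n))"
proof -
  note E = riemann_error[OF T zero_le_one W_error_norm[OF i] W_zero[OF i], where n = m]
  have "ennreal ((L2_norm M (\<lambda>\<omega>. riemann_sum i j T m \<omega> - 1 * riemann_sum i j T n \<omega>))\<^sup>2)
    \<le> 2 * (\<integral>\<^sup>+s\<in>{0..T}. (\<integral>\<^sup>+\<omega>. ennreal ((norm (elementary_value (riemann (W i) T m) s \<omega> - W i s \<omega>))\<^sup>2) \<partial>M) \<partial>lborel)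
      + 2 * ennreal (1\<^sup>2 * T\<^sup>2 / real (Suc n))"
    by (rule compare_riemann_sum[OF T i j riemann_adapted[OF T i] E(1)]) auto
  also have "\<dots> \<le> 2 * ennreal (1 * T\<^sup>2 / real (Suc m)) + 2 * ennreal (1\<^sup>2 * T\<^sup>2 / real (Suc n))"
    by (intro add_mono mult_left_mono E(2)) auto
  also have "\<dots> = ennreal (2 * (1 * T\<^sup>2 / real (Suc m)) + 2 * (1\<^sup>2 * T\<^sup>2 / real (Suc n)))"
    by (rule two_ennreal_add) auto
  finally show ?thesis by (subst (asm) ennreal_le_iff) auto
qed

lemma riemann_sum_converges:
  assumes T: "0 < T" and i: "i \<in> I" and j: "j \<in> I"
  obtains J where "L2_tendsto M (riemann_sum i j T) J sequentially"
proof (rule L2_complete)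
  show "riemann_sum i j T n \<in> L2 M" for n by (rule riemann_sum_L2[OF T i j])
  fix \<epsilon> :: real assume \<epsilon>: "\<epsilon> > 0"
  have "(\<lambda>n. 2 * (T\<^sup>2 * inverse (real (Suc n)))) \<longlonglongrightarrow> 2 * (T\<^sup>2 * 0)"
    by (intro tendsto_intros LIMSEQ_inverse_real_of_nat)
  then have "\<forall>\<^sub>F n in sequentially. 2 * (T\<^sup>2 * inverse (real (Suc n))) < \<epsilon>\<^sup>2 / 2"
    by (rule order_tendstoD(2)) (use \<epsilon> in simp)
  then obtain N where N: "\<And>n. n \<ge> N \<Longrightarrow> 2 * (T\<^sup>2 / real (Suc n)) < \<epsilon>\<^sup>2 / 2"
    unfolding eventually_sequentially divide_inverse by blast
  have "L2_norm M (\<lambda>\<omega>. riemann_sum i j T m \<omega> - riemann_sum i j T n \<omega>) \<le> \<epsilon>" if "m \<ge> N" "n \<ge> N" for m n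
  proof (rule power2_le_imp_le)
    show "(L2_norm M (\<lambda>\<omega>. riemann_sum i j T m \<omega> - riemann_sum i j T n \<omega>))\<^sup>2 \<le> \<epsilon>\<^sup>2"
      using riemann_sum_Cauchy_bound[OF T i j, of m n] N[OF that(1)] N[OF that(2)] by linarith
  qed (use \<epsilon> in simp)
  then show "\<exists>N. \<forall>m\<ge>N. \<forall>n\<ge>N. L2_norm M (\<lambda>\<omega>. riemann_sum i j T m \<omega> - riemann_sum i j T n \<omega>) \<le> \<epsilon>"
    by blast
qed

abbreviation ito :: "nat \<Rightarrow> nat \<Rightarrow> real \<Rightarrow> 'w \<Rightarrow> real" where
  "ito i j T \<equiv> ito_integral (*) M filtration (W i) (W j) T"

text \<open>Any two approximating sequences are compared through the isometry, so the version picked by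
  \<^const>\<open>ito_integral\<close> is the limit of the Riemann sums.\<close>

lemma riemann_sum_tendsto_ito:
  assumes T: "0 < T" and i: "i \<in> I" and j: "j \<in> I"
  shows "L2_tendsto M (riemann_sum i j T) (ito i j T) sequentially"
proof -
  obtain J where J: "L2_tendsto M (riemann_sum i j T) J sequentially"
    by (rule riemann_sum_converges[OF T i j])
  have "has_ito_integral (*) M filtration (W i) (W j) T J"
    by (rule riemann_has_ito_integral[OF T zero_le_one W_error_norm[OF i] W_zero[OF i]
          W_strongly_measurable[OF i] W_L2[OF i] J])
  then have "has_ito_integral (*) M filtration (W i) (W j) T (ito i j T)"
    unfolding ito_integral_def
    by (rule someI[where P = "has_ito_integral (*) M filtration (W i) (W j) T"])
  then obtain S where S: "\<And>n. scalar_adapted T (S n)"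
    "\<And>n. (\<lambda>s. \<integral>\<^sup>+\<omega>. ennreal ((norm (elementary_value (S n) s \<omega> - W i s \<omega>))\<^sup>2) \<partial>M)
        \<in> borel_measurable (restrict_space borel {0..T})"
    "(\<lambda>n. \<integral>\<^sup>+s\<in>{0..T}. (\<integral>\<^sup>+\<omega>. ennreal ((norm (elementary_value (S n) s \<omega> - W i s \<omega>))\<^sup>2) \<partial>M) \<partial>lborel) \<longlonglongrightarrow> 0"
    "L2_tendsto M (\<lambda>n. elementary_integral (*) (W j) (S n)) (ito i j T) sequentially"
    unfolding has_ito_integral_def by auto
  have "ennreal ((L2_norm M (\<lambda>\<omega>. elementary_integral (*) (W j) (S n) \<omega> - 1 * riemann_sum i j T n \<omega>))\<^sup>2)
    \<le> 2 * (\<integral>\<^sup>+s\<in>{0..T}. (\<integral>\<^sup>+\<omega>. ennreal ((norm (elementary_value (S n) s \<omega> - W i s \<omega>))\<^sup>2) \<partial>M) \<partial>lborel)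
      + 2 * ennreal (1\<^sup>2 * T\<^sup>2 / real (Suc n))" for n
    by (rule compare_riemann_sum[OF T i j S(1) S(2)]) auto
  from null_of_ennreal_squares[OF this S(3) ennreal_inverse_Suc_null]
  have "(\<lambda>n. L2_norm M (\<lambda>\<omega>. elementary_integral (*) (W j) (S n) \<omega> - riemann_sum i j T n \<omega>)) \<longlonglongrightarrow> 0"
    by simp
  then show ?thesis by (rule L2_tendsto_approx[OF S(4) riemann_sum_L2[OF T i j]])
qed

lemma overlap_grid:
  assumes "0 \<le> T"
  shows "overlap (grid T n k) (grid T n (Suc k)) (grid T n m) (grid T n (Suc m))
    = (if k = m then T / real (Suc n) else 0)"
proof (cases "k = m")
  case True
  then show ?thesis using grid_step[of T n m] assms by (simp add: overlap_def)
next
  case False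
  then consider "Suc k \<le> m" | "Suc m \<le> k" by linarith
  then show ?thesis
  proof cases
    case 1 then show ?thesis using grid_mono[OF assms 1, of n] False by (simp add: overlap_def)
  next
    case 2 then show ?thesis using grid_mono[OF assms 2, of n] False by (simp add: overlap_def)
  qed
qed

text \<open>For left endpoints on one grid only equal cells overlap, and the cell at \<open>s\<close> contributes
  \<open>E (W\<^sup>i\<^sub>s W\<^sup>k\<^sub>s) = s\<close> or \<open>0\<close> times its length. The factor \<open>n / (n + 1)\<close> is the defect of the
  left Riemann sum of \<open>\<integral> s ds\<close>.\<close>

lemma riemann_sum_inner:
  assumes T: "0 < T" and I: "i \<in> I" "j \<in> I" "k \<in> I" "l \<in> I"
  shows "(\<integral>\<omega>. riemann_sum i j T n \<omega> * riemann_sum k l T n \<omega> \<partial>M)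
    = (if i = k \<and> j = l then T\<^sup>2 / 2 * (real n / real (Suc n)) else 0)"
proof -
  have "(\<Sum>p<Suc n. \<Sum>q<Suc n. (\<integral>\<omega>. W i (grid T n p) \<omega> * W k (grid T n q) \<omega> \<partial>M) *
      overlap (grid T n p) (grid T n (Suc p)) (grid T n q) (grid T n (Suc q)))
    = (\<Sum>p<Suc n. \<Sum>q<Suc n. if p = q then (if i = k then grid T n p * (T / real (Suc n)) else 0) else 0)"
    using T I grid_nonneg[of T n]
    by (intro sum.cong refl) (simp add: W_inner overlap_grid)
  also have "\<dots> = (\<Sum>p<Suc n. if i = k then grid T n p * (T / real (Suc n)) else 0)"
    by (intro sum.cong refl) simp
  also have "\<dots> = (if i = k then T\<^sup>2 / 2 * (real n / real (Suc n)) else 0)"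
  proof -
    have "(\<Sum>p<Suc n. grid T n p * (T / real (Suc n))) = (T / real (Suc n)) * (T / real (Suc n)) * (\<Sum>p<Suc n. real p)"
      unfolding sum_distrib_left by (intro sum.cong refl) (simp add: grid_def)
    also have "(\<Sum>p<Suc n. real p) = real n * real (Suc n) / 2"
      by (induction n) (auto simp: field_simps)
    also have "(T / real (Suc n)) * (T / real (Suc n)) * (real n * real (Suc n) / 2) = T\<^sup>2 / 2 * (real n / real (Suc n))"
      by (simp add: power2_eq_square divide_simps)
    finally show ?thesis by simp
  qed
  finally show ?thesis
    using elementary_inner_sum[OF riemann_adapted[OF T I(1)] riemann_adapted[OF T I(3)] I(2,4), of n n]
    by auto
qed

lemma ito_L2: "0 < T \<Longrightarrow> i \<in> I \<Longrightarrow> j \<in> I \<Longrightarrow> ito i j T \<in> L2 M"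
  by (rule L2_tendstoD(1)[OF riemann_sum_tendsto_ito])

lemma ito_inner:
  assumes T: "0 < T" and I: "i \<in> I" "j \<in> I" "k \<in> I" "l \<in> I"
  shows "(\<integral>\<omega>. ito i j T \<omega> * ito k l T \<omega> \<partial>M) = (if i = k \<and> j = l then T\<^sup>2 / 2 else 0)"
proof (rule LIMSEQ_unique)
  show "(\<lambda>n. \<integral>\<omega>. riemann_sum i j T n \<omega> * riemann_sum k l T n \<omega> \<partial>M) \<longlonglongrightarrow> (\<integral>\<omega>. ito i j T \<omega> * ito k l T \<omega> \<partial>M)"
    using L2_tendsto_inner[OF riemann_sum_tendsto_ito[OF T I(1,2)] riemann_sum_tendsto_ito[OF T I(3,4)]] by simp
  have "(\<lambda>n. T\<^sup>2 / 2 * (real n / real (Suc n))) \<longlonglongrightarrow> T\<^sup>2 / 2 * 1"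
    by (intro tendsto_intros LIMSEQ_n_over_Suc_n)
  then have lim: "(\<lambda>n. T\<^sup>2 / 2 * (real n / real (Suc n))) \<longlonglongrightarrow> T\<^sup>2 / 2" by (simp only: mult_1_right)
  show "(\<lambda>n. \<integral>\<omega>. riemann_sum i j T n \<omega> * riemann_sum k l T n \<omega> \<partial>M) \<longlonglongrightarrow> (if i = k \<and> j = l then T\<^sup>2 / 2 else 0)"
  proof (cases "i = k \<and> j = l")
    case True
    show ?thesis unfolding riemann_sum_inner[OF T I] if_P[OF True] by (rule lim)
  next
    case False
    show ?thesis unfolding riemann_sum_inner[OF T I] if_not_P[OF False] by (rule tendsto_const)
  qed
qed

lemma ito_mean:
  assumes T: "0 < T" and I: "i \<in> I" "j \<in> I"
  shows "(\<integral>\<omega>. ito i j T \<omega> \<partial>M) = 0"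
proof (rule LIMSEQ_unique)
  have one: "L2_tendsto M (\<lambda>_ _. 1 :: real) (\<lambda>_. 1) sequentially"
    by (simp add: L2_tendsto_def L2_iff_real L2_norm_def)
  show "(\<lambda>n. \<integral>\<omega>. riemann_sum i j T n \<omega> \<partial>M) \<longlonglongrightarrow> (\<integral>\<omega>. ito i j T \<omega> \<partial>M)"
    using L2_tendsto_inner[OF riemann_sum_tendsto_ito[OF T I] one] by simp
  show "(\<lambda>n. \<integral>\<omega>. riemann_sum i j T n \<omega> \<partial>M) \<longlonglongrightarrow> 0"
    by (simp add: elementary_integral_mean[OF riemann_adapted[OF T I(1)] I(2)])
qed

lemma Xi_apply: "Xi M I W T (i, j) \<omega> = inverse T * (ito i j T \<omega> - ito j i T \<omega>)"
  by (simp add: Xi_def)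

lemma Xi_L2: "0 < T \<Longrightarrow> i \<in> I \<Longrightarrow> j \<in> I \<Longrightarrow> Xi M I W T (i, j) \<in> L2 M"
  using L2_scale[OF L2_diff[OF ito_L2[of T i j] ito_L2[of T j i]], of "inverse T"]
  by (simp add: Xi_apply[abs_def] fun_eq_iff Xi_def)

lemma Xi_mean: "0 < T \<Longrightarrow> i \<in> I \<Longrightarrow> j \<in> I \<Longrightarrow> (\<integral>\<omega>. Xi M I W T (i, j) \<omega> \<partial>M) = 0"
proof -
  assume a: "0 < T" "i \<in> I" "j \<in> I"
  have "integrable M (ito k l T)" if "k \<in> I" "l \<in> I" for k l
    by (rule integrable_norm_iff[THEN iffD1, OF L2_measurable[OF ito_L2[OF a(1) that]] L1_le_L2(1)[OF ito_L2[OF a(1) that]]])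
  then show ?thesis using a by (simp add: Xi_apply ito_mean)
qed

text \<open>Since \<open>i < j\<close> and \<open>k < l\<close>, the mixed terms \<open>E (I\<^sub>i\<^sub>j I\<^sub>l\<^sub>k)\<close> vanish and the two others agree.\<close>

lemma Xi_orthonormal:
  assumes T: "0 < T"
  shows "L2_orthonormal M (increasing_pairs I) (Xi M I W T)"
  unfolding L2_orthonormal_def
proof (intro conjI ballI)
  show "Xi M I W T p \<in> L2 M" if "p \<in> increasing_pairs I" for p
    using that Xi_L2[OF T] by (auto simp: increasing_pairs_def)
  fix p q assume "p \<in> increasing_pairs I" "q \<in> increasing_pairs I"
  then obtain i j k l where pq: "p = (i, j)" "q = (k, l)" and I: "i \<in> I" "j \<in> I" "k \<in> I" "l \<in> I"
    and less: "i < j" "k < l" by (auto simp: increasing_pairs_def)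
  note int = L2_mult_integrable[OF ito_L2[OF T] ito_L2[OF T]]
  have "(\<integral>\<omega>. Xi M I W T p \<omega> * Xi M I W T q \<omega> \<partial>M)
      = (\<integral>\<omega>. (inverse T)\<^sup>2 * (ito i j T \<omega> * ito k l T \<omega> - ito i j T \<omega> * ito l k T \<omega>
          - ito j i T \<omega> * ito k l T \<omega> + ito j i T \<omega> * ito l k T \<omega>) \<partial>M)"
    unfolding pq by (intro Bochner_Integration.integral_cong refl) (simp add: Xi_apply power2_eq_square algebra_simps)
  also have "\<dots> = (inverse T)\<^sup>2 * ((\<integral>\<omega>. ito i j T \<omega> * ito k l T \<omega> \<partial>M) - (\<integral>\<omega>. ito i j T \<omega> * ito l k T \<omega> \<partial>M)
          - (\<integral>\<omega>. ito j i T \<omega> * ito k l T \<omega> \<partial>M) + (\<integral>\<omega>. ito j i T \<omega> * ito l k T \<omega> \<partial>M))"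
    using I by (simp add: int)
  also have "\<dots> = (if p = q then 1 else 0)"
    using T I less by (auto simp: ito_inner pq field_simps power2_eq_square)
  finally show "(\<integral>\<omega>. Xi M I W T p \<omega> * Xi M I W T q \<omega> \<partial>M) = (if p = q then 1 else 0)" .
qed

end


section \<open>Hilbert-valued Brownian motion and its Levy area\<close>

lemma has_sum_countable_sums:
  fixes A :: "'p::countable set"
  assumes "(f has_sum s) A"
  shows "(\<lambda>n. if n \<in> to_nat ` A then f (from_nat n) else 0) sums s"
proof -
  have "((f \<circ> from_nat) has_sum s) (to_nat ` A)"
    using assms by (subst has_sum_reindex) (auto simp: comp_def)
  then have "((\<lambda>n. if n \<in> to_nat ` A then f (from_nat n) else 0) has_sum s) UNIV"
    by (rule has_sum_cong_neutral[THEN iffD1, rotated -1]) auto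
  then show ?thesis by (rule has_sum_imp_sums)
qed

lemma countable_summable_summable_on:
  fixes A :: "'p::countable set" and f :: "'p \<Rightarrow> real"
  assumes "summable (\<lambda>n. if n \<in> to_nat ` A then f (from_nat n) else 0)" "\<And>p. p \<in> A \<Longrightarrow> 0 \<le> f p"
  shows "f summable_on A"
proof -
  have "(\<lambda>n. if n \<in> to_nat ` A then f (from_nat n) else 0) summable_on UNIV"
    by (rule summable_nonneg_imp_summable_on[OF assms(1)]) (use assms(2) in auto)
  then have "(f \<circ> from_nat) summable_on (to_nat ` A)"
    by (rule summable_on_cong_neutral[THEN iffD1, rotated -1]) auto
  then show ?thesis by (subst (asm) summable_on_reindex) (auto simp: comp_def)
qed

text \<open>Monotone convergence along an enumeration of the index set.\<close>

lemma nn_integral_has_sum: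
  fixes A :: "'p::countable set" and f :: "'p \<Rightarrow> 'w \<Rightarrow> real"
  assumes f: "\<And>p. p \<in> A \<Longrightarrow> f p \<in> borel_measurable M" "\<And>p \<omega>. p \<in> A \<Longrightarrow> 0 \<le> f p \<omega>"
    and int: "\<And>p. p \<in> A \<Longrightarrow> (\<integral>\<^sup>+\<omega>. ennreal (f p \<omega>) \<partial>M) = ennreal (a p)" "\<And>p. p \<in> A \<Longrightarrow> 0 \<le> a p"
    and a: "(a has_sum s) A"
  shows "AE \<omega> in M. (\<lambda>p. f p \<omega>) summable_on A"
    and "AE \<omega> in M. ((\<lambda>p. f p \<omega>) has_sum g \<omega>) A \<Longrightarrow> (\<integral>\<^sup>+\<omega>. ennreal (g \<omega>) \<partial>M) = ennreal s"
proof -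
  define f' where "f' n \<omega> = (if n \<in> to_nat ` A then f (from_nat n) \<omega> else 0)" for n \<omega>
  define a' where "a' n = (if n \<in> to_nat ` A then a (from_nat n) else 0)" for n
  have f'0: "0 \<le> f' n \<omega>" for n \<omega> using f(2) by (auto simp: f'_def)
  have f'm [measurable]: "f' n \<in> borel_measurable M" for n
  proof (cases "n \<in> to_nat ` A")
    case True
    then have "f' n = f (from_nat n)" by (auto simp: f'_def fun_eq_iff)
    then show ?thesis using f(1) True by auto
  next
    case False
    then have "f' n = (\<lambda>_. 0)" by (auto simp: f'_def fun_eq_iff)
    then show ?thesis by simp
  qed
  have f'i: "(\<integral>\<^sup>+\<omega>. ennreal (f' n \<omega>) \<partial>M) = ennreal (a' n)" for n
    using int(1) by (auto simp: f'_def a'_def)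
  have a's: "a' sums s" unfolding a'_def[abs_def] by (rule has_sum_countable_sums[OF a])
  have a'0: "0 \<le> a' n" for n using int(2) by (auto simp: a'_def)
  have total: "(\<integral>\<^sup>+\<omega>. (\<Sum>n. ennreal (f' n \<omega>)) \<partial>M) = ennreal s"
  proof -
    have "(\<integral>\<^sup>+\<omega>. (\<Sum>n. ennreal (f' n \<omega>)) \<partial>M) = (\<Sum>n. \<integral>\<^sup>+\<omega>. ennreal (f' n \<omega>) \<partial>M)"
      by (rule nn_integral_suminf) measurable
    also have "\<dots> = ennreal s" unfolding f'i by (rule suminf_ennreal_eq[OF a'0 a's])
    finally show ?thesis .
  qed
  have "AE \<omega> in M. (\<Sum>n. ennreal (f' n \<omega>)) \<noteq> \<infinity>"
    by (rule nn_integral_PInf_AE) (auto simp: total)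
  then show "AE \<omega> in M. (\<lambda>p. f p \<omega>) summable_on A"
  proof eventually_elim
    case (elim \<omega>)
    then have "summable (\<lambda>n. f' n \<omega>)" by (intro summable_suminf_not_top f'0) simp
    then show ?case unfolding f'_def by (rule countable_summable_summable_on) (rule f(2))
  qed
  assume g: "AE \<omega> in M. ((\<lambda>p. f p \<omega>) has_sum g \<omega>) A"
  have "(\<integral>\<^sup>+\<omega>. ennreal (g \<omega>) \<partial>M) = (\<integral>\<^sup>+\<omega>. (\<Sum>n. ennreal (f' n \<omega>)) \<partial>M)"
  proof (rule nn_integral_cong_AE)
    show "AE \<omega> in M. ennreal (g \<omega>) = (\<Sum>n. ennreal (f' n \<omega>))"
      using g
    proof eventually_elim
      case (elim \<omega>)
      then have "(\<lambda>n. f' n \<omega>) sums g \<omega>" unfolding f'_def by (rule has_sum_countable_sums)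
      then show ?case by (rule suminf_ennreal_eq[OF f'0, symmetric])
    qed
  qed
  with total show "(\<integral>\<^sup>+\<omega>. ennreal (g \<omega>) \<partial>M) = ennreal s" by simp
qed

context brownian_family
begin

lemma filtration_measurable_M:
  assumes "f \<in> measurable (filtration s) N"
  shows "f \<in> measurable M N"
proof -
  have sub: "{W i r -` A \<inter> space M | i r A. i \<in> I \<and> 0 \<le> r \<and> r \<le> s \<and> A \<in> sets borel} \<subseteq> sets M"
    using measurable_sets[OF W_measurable] by auto
  have P: "{W i r -` A \<inter> space M | i r A. i \<in> I \<and> 0 \<le> r \<and> r \<le> s \<and> A \<in> sets borel} \<subseteq> Pow (space M)"
    by auto
  have "sets (filtration s) \<subseteq> sets M"
    unfolding natural_filtration_def sets_measure_of[OF P] by (rule sets.sigma_sets_subset[OF sub])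
  moreover have "space (filtration s) = space M"
    unfolding natural_filtration_def by (rule space_measure_of[OF P])
  ultimately show ?thesis using assms unfolding measurable_def by auto
qed

lemma space_filtration: "space (filtration s) = space M"
  unfolding natural_filtration_def by (rule space_measure_of) auto

end

locale hilbert_brownian = brownian_family M I W
  for M :: "'w measure" and I W +
  fixes c :: "nat \<Rightarrow> real" and e :: "nat \<Rightarrow> 'h::{real_inner, polish_space}"
  assumes basis: "orthonormal_basis I e"
    and c_nonneg: "\<And>i. i \<in> I \<Longrightarrow> 0 \<le> c i" and c_summable: "c summable_on I"
begin

abbreviation B :: "real \<Rightarrow> 'w \<Rightarrow> 'h" where
  "B \<equiv> hilbert_BM I c e W"

text \<open>The trace of the covariance.\<close>

definition \<kappa> :: real where
  "\<kappa> = (\<Sum>\<^sub>\<infinity>i\<in>I. c i)"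

lemma \<kappa>_nonneg: "0 \<le> \<kappa>"
  unfolding \<kappa>_def by (rule infsum_nonneg) (rule c_nonneg)

lemma B_summable_iff:
  "(\<lambda>i. (sqrt (c i) * W i s \<omega>) *\<^sub>R e i) summable_on I \<longleftrightarrow> (\<lambda>i. c i * (W i s \<omega>)\<^sup>2) summable_on I"
proof -
  have eo: "orthonormal_on I e" by (rule orthonormal_basisD[OF basis])
  have sq: "(\<lambda>i. (sqrt (c i) * W i s \<omega>)\<^sup>2) summable_on I \<longleftrightarrow> (\<lambda>i. c i * (W i s \<omega>)\<^sup>2) summable_on I"
    by (rule summable_on_cong) (simp add: power_mult_distrib c_nonneg)
  have nrm: "(\<lambda>i. (norm ((sqrt (c i) * W i s \<omega>) *\<^sub>R e i))\<^sup>2) summable_on I \<longleftrightarrow>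
      (\<lambda>i. c i * (W i s \<omega>)\<^sup>2) summable_on I"
    by (rule summable_on_cong) (simp add: power_mult_distrib c_nonneg orthonormal_onD(2)[OF eo])
  show ?thesis
  proof
    assume "(\<lambda>i. (sqrt (c i) * W i s \<omega>) *\<^sub>R e i) summable_on I"
    then obtain x where "((\<lambda>i. (sqrt (c i) * W i s \<omega>) *\<^sub>R e i) has_sum x) I" by (auto simp: summable_on_def)
    then have "((\<lambda>i. (norm ((sqrt (c i) * W i s \<omega>) *\<^sub>R e i))\<^sup>2) has_sum (norm x)\<^sup>2) I"
      by (rule orthogonal_has_sum_norm[rotated]) (simp add: orthonormal_onD(1)[OF eo])
    then show "(\<lambda>i. c i * (W i s \<omega>)\<^sup>2) summable_on I" using nrm by (auto simp: summable_on_def)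
  next
    assume "(\<lambda>i. c i * (W i s \<omega>)\<^sup>2) summable_on I"
    then show "(\<lambda>i. (sqrt (c i) * W i s \<omega>) *\<^sub>R e i) summable_on I"
      by (intro orthonormal_summable[OF eo] sq[THEN iffD2])
  qed
qed

lemma B_summable_AE:
  assumes "0 \<le> s"
  shows "AE \<omega> in M. (\<lambda>i. c i * (W i s \<omega>)\<^sup>2) summable_on I"
proof (rule nn_integral_has_sum(1))
  show "(\<lambda>\<omega>. c i * (W i s \<omega>)\<^sup>2) \<in> borel_measurable M" if "i \<in> I" for i
    using W_measurable[OF that assms] by measurable
  show "0 \<le> c i * (W i s \<omega>)\<^sup>2" if "i \<in> I" for i \<omega> using c_nonneg[OF that] by simp
  show "(\<integral>\<^sup>+\<omega>. ennreal (c i * (W i s \<omega>)\<^sup>2) \<partial>M) = ennreal (c i * s)" if "i \<in> I" for i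
  proof -
    have "integrable M (\<lambda>\<omega>. (W i s \<omega>)\<^sup>2)" using W_L2[OF that assms] by (simp add: L2_iff_real)
    then have "(\<integral>\<^sup>+\<omega>. ennreal (c i * (W i s \<omega>)\<^sup>2) \<partial>M) = ennreal (\<integral>\<omega>. c i * (W i s \<omega>)\<^sup>2 \<partial>M)"
      by (intro nn_integral_eq_integral) (auto simp: c_nonneg[OF that])
    then show ?thesis using W_inner[OF that that assms assms] by (simp add: power2_eq_square)
  qed
  show "((\<lambda>i. c i * s) has_sum \<kappa> * s) I"
    unfolding \<kappa>_def by (intro has_sum_cmult_left has_sum_infsum c_summable)
  show "0 \<le> c i * s" if "i \<in> I" for i using c_nonneg[OF that] assms by simp
qed

lemma B_coord_AE:
  assumes "0 \<le> s"
  shows "AE \<omega> in M. \<forall>i\<in>I. B s \<omega> \<bullet> e i = sqrt (c i) * W i s \<omega>"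
  using B_summable_AE[OF assms]
proof eventually_elim
  case (elim \<omega>)
  then have "((\<lambda>i. (sqrt (c i) * W i s \<omega>) *\<^sub>R e i) has_sum B s \<omega>) I"
    unfolding hilbert_BM_def using B_summable_iff by (intro has_sum_infsum) blast
  then show ?case by (intro ballI orthonormal_has_sum_coeff[OF orthonormal_basisD[OF basis]])
qed

text \<open>The set where the series diverges belongs to the filtration although the latter is not completed, and
  the process is \<open>0\<close> there. Hence adaptedness holds everywhere, not only up to null sets.\<close>

lemma B_filtration:
  assumes s: "0 \<le> s"
  shows "strongly_measurable (filtration s) (B s)"
proof -
  define q where "q n \<omega> = (if n \<in> I then c n * (W n s \<omega>)\<^sup>2 else 0)" for n \<omega>
  define G where "G = {\<omega> \<in> space (filtration s). (\<Sum>n. ennreal (q n \<omega>)) \<noteq> \<infinity>}"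
  have q0: "0 \<le> q n \<omega>" for n \<omega> using c_nonneg by (simp add: q_def)
  have [measurable]: "q n \<in> borel_measurable (filtration s)" for n
    unfolding q_def[abs_def] using W_filtration[of n s s] s by (cases "n \<in> I") auto
  have G: "G \<in> sets (filtration s)" unfolding G_def by measurable
  have G_iff: "\<omega> \<in> G \<longleftrightarrow> (\<lambda>i. c i * (W i s \<omega>)\<^sup>2) summable_on I" if "\<omega> \<in> space M" for \<omega>
  proof -
    have "(\<lambda>i. c i * (W i s \<omega>)\<^sup>2) summable_on I \<longleftrightarrow> (\<lambda>n. q n \<omega>) summable_on UNIV"
      by (rule summable_on_cong_neutral) (auto simp: q_def)
    also have "\<dots> \<longleftrightarrow> summable (\<lambda>n. q n \<omega>)"
    proof
      assume "(\<lambda>n. q n \<omega>) summable_on UNIV"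
      then show "summable (\<lambda>n. q n \<omega>)"
        using has_sum_imp_sums by (auto simp: summable_on_def summable_def)
    qed (rule summable_nonneg_imp_summable_on, auto simp: q0)
    also have "\<dots> \<longleftrightarrow> \<omega> \<in> G"
    proof
      assume "summable (\<lambda>n. q n \<omega>)"
      then have "(\<Sum>n. ennreal (q n \<omega>)) = ennreal (\<Sum>n. q n \<omega>)" by (intro suminf_ennreal2 q0)
      then show "\<omega> \<in> G" using that by (simp add: G_def space_filtration)
    qed (auto simp: G_def intro: summable_suminf_not_top q0)
    finally show ?thesis by simp
  qed
  show ?thesis
  proof (rule strongly_measurable_LIMSEQ)
    let ?p = "\<lambda>n \<omega>. \<Sum>i<n. (if i \<in> I then (sqrt (c i) * W i s \<omega>) *\<^sub>R e i else 0)"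
    show "strongly_measurable (filtration s) (\<lambda>\<omega>. if \<omega> \<in> G then ?p n \<omega> else 0)" for n
    proof (intro strongly_measurable_if_set G strongly_measurable_sum)
      fix i show "strongly_measurable (filtration s) (\<lambda>\<omega>. if i \<in> I then (sqrt (c i) * W i s \<omega>) *\<^sub>R e i else 0)"
        using W_filtration[of i s s] s
        by (cases "i \<in> I") (auto intro!: borel_strongly_measurable)
    qed
    fix \<omega> assume "\<omega> \<in> space (filtration s)"
    then have \<omega>: "\<omega> \<in> space M" by (simp add: space_filtration)
    show "(\<lambda>n. if \<omega> \<in> G then ?p n \<omega> else 0) \<longlonglongrightarrow> B s \<omega>"
    proof (cases "\<omega> \<in> G")
      case True
      then have "((\<lambda>i. (sqrt (c i) * W i s \<omega>) *\<^sub>R e i) has_sum B s \<omega>) I"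
        unfolding hilbert_BM_def using G_iff[OF \<omega>] B_summable_iff by (intro has_sum_infsum) blast
      then have "((\<lambda>i. if i \<in> I then (sqrt (c i) * W i s \<omega>) *\<^sub>R e i else 0) has_sum B s \<omega>) UNIV"
        by (rule has_sum_cong_neutral[THEN iffD1, rotated -1]) auto
      from has_sum_imp_sums[OF this] True show ?thesis by (simp add: sums_def)
    next
      case False
      then have "B s \<omega> = 0"
        unfolding hilbert_BM_def using G_iff[OF \<omega>] B_summable_iff by (intro infsum_not_exists) blast
      then show ?thesis using False by simp
    qed
  qed
qed

lemma B_measurable: "0 \<le> s \<Longrightarrow> strongly_measurable M (B s)"
  by (intro borel_strongly_measurable filtration_measurable_M[OF strongly_measurable_borel[OF B_filtration]])

text \<open>By Parseval the squared norm is the series of the squared coordinates. Countably many coordinates are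
  identified simultaneously outside one null set.\<close>

lemma B_error:
  assumes s: "0 \<le> a" "a \<le> s"
  shows "(\<integral>\<^sup>+\<omega>. ennreal ((norm (B a \<omega> - B s \<omega>))\<^sup>2) \<partial>M) = ennreal (\<kappa> * (s - a))"
proof (rule nn_integral_has_sum(2))
  have s0: "0 \<le> s" using s by simp
  show "(\<lambda>\<omega>. c i * (W i a \<omega> - W i s \<omega>)\<^sup>2) \<in> borel_measurable M" if "i \<in> I" for i
    using W_measurable[OF that s(1)] W_measurable[OF that s0] by measurable
  show "0 \<le> c i * (W i a \<omega> - W i s \<omega>)\<^sup>2" if "i \<in> I" for i \<omega> using c_nonneg[OF that] by simp
  show "(\<integral>\<^sup>+\<omega>. ennreal (c i * (W i a \<omega> - W i s \<omega>)\<^sup>2) \<partial>M) = ennreal (c i * (s - a))" if "i \<in> I" for i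
    using W_measurable[OF that s(1)] W_measurable[OF that s0] c_nonneg[OF that] s
    by (simp add: ennreal_mult nn_integral_cmult W_error[OF that s])
  show "((\<lambda>i. c i * (s - a)) has_sum \<kappa> * (s - a)) I"
    unfolding \<kappa>_def by (intro has_sum_cmult_left has_sum_infsum c_summable)
  show "0 \<le> c i * (s - a)" if "i \<in> I" for i using c_nonneg[OF that] s by simp
  show "AE \<omega> in M. ((\<lambda>i. c i * (W i a \<omega> - W i s \<omega>)\<^sup>2) has_sum (norm (B a \<omega> - B s \<omega>))\<^sup>2) I"
    using B_coord_AE[OF s(1)] B_coord_AE[OF s0]
  proof eventually_elim
    case (elim \<omega>)
    show ?case
    proof (rule has_sum_cong[THEN iffD1, OF _ parseval_norm[OF basis]])
      fix i assume i: "i \<in> I"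
      have "(B a \<omega> - B s \<omega>) \<bullet> e i = sqrt (c i) * (W i a \<omega> - W i s \<omega>)"
        using elim i by (simp add: inner_diff_left right_diff_distrib)
      then show "((B a \<omega> - B s \<omega>) \<bullet> e i)\<^sup>2 = c i * (W i a \<omega> - W i s \<omega>)\<^sup>2"
        using c_nonneg[OF i] by (simp add: power_mult_distrib)
    qed
  qed
qed

lemma B_zero: "AE \<omega> in M. B 0 \<omega> = 0"
proof -
  have "AE \<omega> in M. \<forall>i\<in>I. W i 0 \<omega> = 0"
    using W_zero by (subst AE_ball_countable) auto
  with B_coord_AE[OF order_refl] show ?thesis
  proof eventually_elim
    case (elim \<omega>)
    show ?case by (rule basis_eqI[OF basis]) (use elim in simp)
  qed
qed

lemma B_L2:
  assumes s: "0 \<le> s"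
  shows "B s \<in> L2 M"
proof -
  have "(\<integral>\<^sup>+\<omega>. ennreal (norm ((norm (B s \<omega>))\<^sup>2)) \<partial>M) = (\<integral>\<^sup>+\<omega>. ennreal ((norm (B 0 \<omega> - B s \<omega>))\<^sup>2) \<partial>M)"
  proof (rule nn_integral_cong_AE)
    show "AE \<omega> in M. ennreal (norm ((norm (B s \<omega>))\<^sup>2)) = ennreal ((norm (B 0 \<omega> - B s \<omega>))\<^sup>2)"
      using B_zero by eventually_elim simp
  qed
  also have "\<dots> < \<infinity>" unfolding B_error[OF order_refl s] by simp
  finally have "integrable M (\<lambda>\<omega>. (norm (B s \<omega>))\<^sup>2)"
    using strongly_measurable_norm[OF B_measurable[OF s]] by (intro integrableI_bounded) auto
  then show ?thesis using B_measurable[OF s] by (simp add: L2_def)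
qed

text \<open>Hilbert--Schmidt norms are computed entrywise: \<open>\<parallel>T\<parallel>\<^sup>2 = \<Sum>\<^sub>i\<^sub>j \<langle>T e\<^sub>j, e\<^sub>i\<rangle>\<^sup>2\<close>. A uniform bound on
  the scalar entries thus costs only a factor \<open>(tr C)\<^sup>2\<close>.\<close>

lemma hs_entries_bound:
  fixes Y :: "'w \<Rightarrow> ('h, 'h) hs"
  assumes Y: "strongly_measurable M Y" and b: "0 \<le> b"
    and Z: "\<And>i j. i \<in> I \<Longrightarrow> j \<in> I \<Longrightarrow> Z i j \<in> L2 M" "\<And>i j. i \<in> I \<Longrightarrow> j \<in> I \<Longrightarrow> (L2_norm M (Z i j))\<^sup>2 \<le> b"
    and entries: "AE \<omega> in M. \<forall>i\<in>I. \<forall>j\<in>I. Y \<omega> \<bullet> tensor (e i) (e j) = sqrt (c i) * sqrt (c j) * Z i j \<omega>"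
  shows "Y \<in> L2 M" "(L2_norm M Y)\<^sup>2 \<le> b * \<kappa>\<^sup>2"
proof -
  let ?a = "\<lambda>(i, j). c i * c j * (L2_norm M (Z i j))\<^sup>2"
  have cc: "(\<lambda>(i, j). c i * c j) summable_on I \<times> I"
    by (rule product_summable) (auto intro: c_nonneg c_summable)
  have a0: "0 \<le> ?a p" if "p \<in> I \<times> I" for p using that c_nonneg by auto
  have ale: "?a p \<le> b * (case p of (i, j) \<Rightarrow> c i * c j)" if "p \<in> I \<times> I" for p
    using that Z(2) c_nonneg by (auto simp: mult.commute[of b] intro!: mult_left_mono)
  have bcc: "(\<lambda>p. b * (case p of (i, j) \<Rightarrow> c i * c j)) summable_on I \<times> I"
    by (rule summable_on_cmult_right[OF cc])
  have asum: "?a summable_on I \<times> I"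
    by (rule summable_on_comparison_test[OF bcc ale a0])
  have tot: "(\<Sum>\<^sub>\<infinity>(i, j)\<in>I \<times> I. c i * c j) = \<kappa>\<^sup>2"
  proof -
    have "(\<Sum>\<^sub>\<infinity>(i, j)\<in>I \<times> I. c i * c j) = (\<Sum>\<^sub>\<infinity>i\<in>I. \<Sum>\<^sub>\<infinity>j\<in>I. c i * c j)"
      using infsum_Sigma'_banach[of "\<lambda>i j. c i * c j" I "\<lambda>_. I"] cc by simp
    then show ?thesis
      by (simp add: \<kappa>_def power2_eq_square infsum_cmult_right' infsum_cmult_left')
  qed
  have le: "infsum ?a (I \<times> I) \<le> b * \<kappa>\<^sup>2"
  proof -
    have "infsum ?a (I \<times> I) \<le> (\<Sum>\<^sub>\<infinity>p\<in>I \<times> I. b * (case p of (i, j) \<Rightarrow> c i * c j))"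
      by (rule infsum_mono[OF asum bcc ale])
    then show ?thesis using tot by (simp add: infsum_cmult_right')
  qed
  have nn: "(\<integral>\<^sup>+\<omega>. ennreal ((norm (Y \<omega>))\<^sup>2) \<partial>M) = ennreal (infsum ?a (I \<times> I))"
  proof (rule nn_integral_has_sum(2)[where f = "\<lambda>(i, j) \<omega>. c i * c j * (Z i j \<omega>)\<^sup>2" and a = ?a])
    fix p assume p: "p \<in> I \<times> I"
    show "(case p of (i, j) \<Rightarrow> \<lambda>\<omega>. c i * c j * (Z i j \<omega>)\<^sup>2) \<in> borel_measurable M"
      using p L2_measurable[OF Z(1)] by (auto intro!: borel_measurable_times borel_measurable_power)
    show "0 \<le> (case p of (i, j) \<Rightarrow> \<lambda>\<omega>. c i * c j * (Z i j \<omega>)\<^sup>2) \<omega>" for \<omega>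
      using p c_nonneg by auto
    show "(\<integral>\<^sup>+\<omega>. ennreal ((case p of (i, j) \<Rightarrow> \<lambda>\<omega>. c i * c j * (Z i j \<omega>)\<^sup>2) \<omega>) \<partial>M) = ennreal (?a p)"
    proof -
      obtain i j where ij: "p = (i, j)" "i \<in> I" "j \<in> I" using p by auto
      have "integrable M (\<lambda>\<omega>. (Z i j \<omega>)\<^sup>2)" using Z(1)[OF ij(2,3)] by (simp add: L2_iff_real)
      then have "(\<integral>\<^sup>+\<omega>. ennreal (c i * c j * (Z i j \<omega>)\<^sup>2) \<partial>M) = ennreal (\<integral>\<omega>. c i * c j * (Z i j \<omega>)\<^sup>2 \<partial>M)"
        by (intro nn_integral_eq_integral) (auto simp: c_nonneg ij)
      then show ?thesis by (simp add: ij L2_norm_square)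
    qed
    show "0 \<le> ?a p" by (rule a0[OF p])
  next
    show "(?a has_sum infsum ?a (I \<times> I)) (I \<times> I)" by (rule has_sum_infsum[OF asum])
    show "AE \<omega> in M. ((\<lambda>p. (case p of (i, j) \<Rightarrow> \<lambda>\<omega>. c i * c j * (Z i j \<omega>)\<^sup>2) \<omega>) has_sum (norm (Y \<omega>))\<^sup>2) (I \<times> I)"
      using entries
    proof eventually_elim
      case (elim \<omega>)
      show ?case
        by (rule has_sum_cong[THEN iffD1, OF _ parseval_norm[OF tensor_basis[OF basis basis]]])
          (use elim c_nonneg in \<open>auto simp: power_mult_distrib\<close>)
    qed
  qed
  have int: "integrable M (\<lambda>\<omega>. (norm (Y \<omega>))\<^sup>2)"
    using strongly_measurable_norm[OF Y] by (intro integrableI_bounded) (auto simp: nn)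
  with Y show "Y \<in> L2 M" by (simp add: L2_def)
  have "(\<integral>\<^sup>+\<omega>. ennreal ((norm (Y \<omega>))\<^sup>2) \<partial>M) = ennreal ((L2_norm M Y)\<^sup>2)"
    unfolding L2_norm_square[of M Y] by (rule nn_integral_eq_integral[OF int]) simp
  then have "ennreal ((L2_norm M Y)\<^sup>2) = ennreal (infsum ?a (I \<times> I))" by (simp only: nn)
  then have "(L2_norm M Y)\<^sup>2 = infsum ?a (I \<times> I)"
    using infsum_nonneg[OF a0] by (subst (asm) ennreal_inj) auto
  with le show "(L2_norm M Y)\<^sup>2 \<le> b * \<kappa>\<^sup>2" by simp
qed

abbreviation tensor_sum :: "('w, 'h) elementary_process \<Rightarrow> 'w \<Rightarrow> ('h, 'h) hs" where
  "tensor_sum S \<equiv> elementary_integral tensor B S"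

definition coordinate :: "nat \<Rightarrow> ('w, 'h) elementary_process \<Rightarrow> ('w, real) elementary_process" where
  "coordinate i S = \<lparr>pieces = pieces S, times = times S, coeff = (\<lambda>k \<omega>. coeff S k \<omega> \<bullet> e i)\<rparr>"

lemma coordinate_simps [simp]:
  "pieces (coordinate i S) = pieces S" "times (coordinate i S) = times S"
  "coeff (coordinate i S) k \<omega> = coeff S k \<omega> \<bullet> e i"
  by (simp_all add: coordinate_def)

lemma coordinate_adapted:
  assumes "elementary_adapted M filtration T S"
  shows "scalar_adapted T (coordinate i S)"
  using assms unfolding elementary_adapted_def coordinate_simps
  by (auto simp: coordinate_def intro!: L2_inner_const strongly_measurable_compose[of _ _ "\<lambda>x. x \<bullet> e i"] continuous_intros)

lemma coordinate_value: "elementary_value (coordinate i S) s \<omega> = elementary_value S s \<omega> \<bullet> e i"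
  by (simp add: elementary_value_def inner_sum_left)

lemma tensor_sum_entry:
  assumes times: "\<And>k. k < pieces S \<Longrightarrow> 0 \<le> times S k \<and> 0 \<le> times S (Suc k)"
  shows "AE \<omega> in M. \<forall>i. \<forall>j\<in>I. tensor_sum S \<omega> \<bullet> tensor (e i) (e j) =
    sqrt (c j) * elementary_integral (*) (W j) (coordinate i S) \<omega>"
proof -
  have "AE \<omega> in M. \<forall>k\<in>{..<pieces S}.
      (\<forall>i\<in>I. B (times S k) \<omega> \<bullet> e i = sqrt (c i) * W i (times S k) \<omega>) \<and>
      (\<forall>i\<in>I. B (times S (Suc k)) \<omega> \<bullet> e i = sqrt (c i) * W i (times S (Suc k)) \<omega>)"
    using times by (subst AE_ball_countable) (auto intro!: AE_conjI B_coord_AE simp: AE_conj_iff)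
  then show ?thesis
  proof eventually_elim
    case (elim \<omega>)
    show ?case
    proof (intro allI ballI)
      fix i j assume j: "j \<in> I"
      have "tensor_sum S \<omega> \<bullet> tensor (e i) (e j)
          = (\<Sum>k<pieces S. (coeff S k \<omega> \<bullet> e i) * ((B (times S (Suc k)) \<omega> - B (times S k) \<omega>) \<bullet> e j))"
        by (simp add: elementary_integral_def inner_sum_left tensor_inner_tensor)
      also have "\<dots> = (\<Sum>k<pieces S. sqrt (c j) * ((coeff S k \<omega> \<bullet> e i) * (W j (times S (Suc k)) \<omega> - W j (times S k) \<omega>)))"
        using elim j by (intro sum.cong refl) (simp add: inner_diff_left algebra_simps)
      finally show "tensor_sum S \<omega> \<bullet> tensor (e i) (e j) = sqrt (c j) * elementary_integral (*) (W j) (coordinate i S) \<omega>"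
        by (simp add: elementary_integral_def sum_distrib_left)
    qed
  qed
qed

lemma riemann_tensor_entry:
  assumes T: "0 < T"
  shows "AE \<omega> in M. \<forall>i\<in>I. \<forall>j\<in>I. tensor_sum (riemann B T n) \<omega> \<bullet> tensor (e i) (e j) =
    sqrt (c i) * sqrt (c j) * riemann_sum i j T n \<omega>"
proof -
  have "AE \<omega> in M. \<forall>k\<in>{..n}. \<forall>i\<in>I. B (grid T n k) \<omega> \<bullet> e i = sqrt (c i) * W i (grid T n k) \<omega>"
    using B_coord_AE grid_nonneg T by (subst AE_ball_countable) auto
  moreover have "AE \<omega> in M. \<forall>i. \<forall>j\<in>I. tensor_sum (riemann B T n) \<omega> \<bullet> tensor (e i) (e j) =
    sqrt (c j) * elementary_integral (*) (W j) (coordinate i (riemann B T n)) \<omega>"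
    by (rule tensor_sum_entry) (use grid_nonneg T in auto)
  ultimately show ?thesis
  proof eventually_elim
    case (elim \<omega>)
    show ?case
    proof (intro ballI)
      fix i j assume ij: "i \<in> I" "j \<in> I"
      have "elementary_integral (*) (W j) (coordinate i (riemann B T n)) \<omega> = sqrt (c i) * riemann_sum i j T n \<omega>"
        unfolding elementary_integral_def coordinate_simps riemann_simps sum_distrib_left
        by (intro sum.cong refl) (use elim(1) ij in auto)
      then show "tensor_sum (riemann B T n) \<omega> \<bullet> tensor (e i) (e j) = sqrt (c i) * sqrt (c j) * riemann_sum i j T n \<omega>"
        using elim(2) ij by simp
    qed
  qed
qed

lemma tensor_sum_measurable:
  assumes "0 < T"
  shows "strongly_measurable M (tensor_sum (riemann B T n))"
  unfolding elementary_integral_def[abs_def] riemann_simps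
proof (rule strongly_measurable_sum)
  fix k
  have 1: "strongly_measurable M (B (grid T n k))" "strongly_measurable M (B (grid T n (Suc k)))"
    using assms by (auto intro!: B_measurable grid_nonneg)
  show "strongly_measurable M (\<lambda>\<omega>. tensor (B (grid T n k) \<omega>) (B (grid T n (Suc k)) \<omega> - B (grid T n k) \<omega>))"
    by (rule strongly_measurable_compose2[OF 1(1) strongly_measurable_diff[OF 1(2,1)]])
      (intro bounded_bilinear.continuous_on[OF bounded_bilinear_tensor] continuous_intros)
qed

text \<open>Entry by entry the Riemann sums are multiples of scalar Riemann sums, which are Cauchy uniformly in the
  entry.\<close>

lemma riemann_tensor_converges:
  assumes T: "0 < T"
  obtains J where "L2_tendsto M (\<lambda>n. tensor_sum (riemann B T n)) J sequentially"
proof (rule L2_complete)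
  let ?E = "\<lambda>n. tensor_sum (riemann B T n)"
  show "?E n \<in> L2 M" for n
  proof -
    have bound: "(L2_norm M (riemann_sum i j T n))\<^sup>2 \<le> T\<^sup>2" if "i \<in> I" "j \<in> I" for i j
    proof -
      have "(L2_norm M (riemann_sum i j T n))\<^sup>2 = T\<^sup>2 / 2 * (real n / real (Suc n))"
        using riemann_sum_inner[OF T that that, of n]
        unfolding L2_norm_square by (simp flip: power2_eq_square del: of_nat_Suc)
      also have "\<dots> \<le> T\<^sup>2 * 1"
        by (intro mult_mono) auto
      finally show ?thesis by simp
    qed
    show ?thesis
      by (rule hs_entries_bound(1)[OF tensor_sum_measurable[OF T] zero_le_power2[of T]
            riemann_sum_L2[OF T] bound riemann_tensor_entry[OF T]])
  qed
  fix \<epsilon> :: real assume \<epsilon>: "\<epsilon> > 0"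
  have "(\<lambda>n. 2 * (T\<^sup>2 * inverse (real (Suc n))) * \<kappa>\<^sup>2) \<longlonglongrightarrow> 2 * (T\<^sup>2 * 0) * \<kappa>\<^sup>2"
    by (intro tendsto_intros LIMSEQ_inverse_real_of_nat)
  then have "\<forall>\<^sub>F n in sequentially. 2 * (T\<^sup>2 * inverse (real (Suc n))) * \<kappa>\<^sup>2 < \<epsilon>\<^sup>2 / 2"
    by (rule order_tendstoD(2)) (use \<epsilon> in simp)
  then obtain N where N: "\<And>n. n \<ge> N \<Longrightarrow> 2 * (T\<^sup>2 / real (Suc n)) * \<kappa>\<^sup>2 < \<epsilon>\<^sup>2 / 2"
    unfolding eventually_sequentially divide_inverse by blast
  have "L2_norm M (\<lambda>\<omega>. ?E m \<omega> - ?E n \<omega>) \<le> \<epsilon>" if mn: "m \<ge> N" "n \<ge> N" for m n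
  proof (rule power2_le_imp_le)
    have "(L2_norm M (\<lambda>\<omega>. ?E m \<omega> - ?E n \<omega>))\<^sup>2 \<le> (2 * (T\<^sup>2 / real (Suc m)) + 2 * (T\<^sup>2 / real (Suc n))) * \<kappa>\<^sup>2"
    proof -
      have 1: "strongly_measurable M (\<lambda>\<omega>. ?E m \<omega> - ?E n \<omega>)"
        by (intro strongly_measurable_diff tensor_sum_measurable T)
      have 2: "0 \<le> 2 * (T\<^sup>2 / real (Suc m)) + 2 * (T\<^sup>2 / real (Suc n))" by simp
      have 3: "AE \<omega> in M. \<forall>i\<in>I. \<forall>j\<in>I. (?E m \<omega> - ?E n \<omega>) \<bullet> tensor (e i) (e j) =
          sqrt (c i) * sqrt (c j) * (riemann_sum i j T m \<omega> - riemann_sum i j T n \<omega>)"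
        using riemann_tensor_entry[OF T, of m] riemann_tensor_entry[OF T, of n]
        by eventually_elim (simp add: inner_diff_left right_diff_distrib)
      show ?thesis
        by (rule hs_entries_bound(2)[where Z = "\<lambda>i j \<omega>. riemann_sum i j T m \<omega> - riemann_sum i j T n \<omega>",
              OF 1 2 L2_diff[OF riemann_sum_L2[OF T] riemann_sum_L2[OF T]] riemann_sum_Cauchy_bound[OF T] 3])
    qed
    then show "(L2_norm M (\<lambda>\<omega>. ?E m \<omega> - ?E n \<omega>))\<^sup>2 \<le> \<epsilon>\<^sup>2"
      using N[OF mn(1)] N[OF mn(2)] by (simp only: distrib_right)
  qed (use \<epsilon> in simp)
  then show "\<exists>N. \<forall>m\<ge>N. \<forall>n\<ge>N. L2_norm M (\<lambda>\<omega>. ?E m \<omega> - ?E n \<omega>) \<le> \<epsilon>" by blast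
qed

abbreviation tensor_ito :: "real \<Rightarrow> 'w \<Rightarrow> ('h, 'h) hs" where
  "tensor_ito T \<equiv> ito_integral tensor M filtration B B T"

text \<open>Whatever approximating processes define the chosen version of \<open>\<integral> B \<otimes> dB\<close>, their coordinates
  are scalar elementary processes for the integrands \<open>\<surd>c\<^sub>i W\<^sup>i\<close>, so each entry of the
  integral is a scalar integral.\<close>

lemma tensor_ito_entry:
  assumes T: "0 < T"
  shows "tensor_ito T \<in> L2 M"
    and "\<And>i j. i \<in> I \<Longrightarrow> j \<in> I \<Longrightarrow>
      AE \<omega> in M. tensor_ito T \<omega> \<bullet> tensor (e i) (e j) = sqrt (c i) * sqrt (c j) * ito i j T \<omega>"
proof -
  obtain J where J: "L2_tendsto M (\<lambda>n. tensor_sum (riemann B T n)) J sequentially"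
    by (rule riemann_tensor_converges[OF T])
  have "has_ito_integral tensor M filtration B B T J"
    by (rule riemann_has_ito_integral[OF T \<kappa>_nonneg B_error B_zero B_filtration B_L2 J])
  then have "has_ito_integral tensor M filtration B B T (tensor_ito T)"
    unfolding ito_integral_def by (rule someI[where P = "has_ito_integral tensor M filtration B B T"])
  then obtain S where S: "\<And>n. elementary_adapted M filtration T (S n)"
    "\<And>n. (\<lambda>s. \<integral>\<^sup>+\<omega>. ennreal ((norm (elementary_value (S n) s \<omega> - B s \<omega>))\<^sup>2) \<partial>M)
        \<in> borel_measurable (restrict_space borel {0..T})"
    "(\<lambda>n. \<integral>\<^sup>+s\<in>{0..T}. (\<integral>\<^sup>+\<omega>. ennreal ((norm (elementary_value (S n) s \<omega> - B s \<omega>))\<^sup>2) \<partial>M) \<partial>lborel) \<longlonglongrightarrow> 0"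
    "L2_tendsto M (\<lambda>n. tensor_sum (S n)) (tensor_ito T) sequentially"
    unfolding has_ito_integral_def by auto
  show "tensor_ito T \<in> L2 M" by (rule L2_tendstoD(1)[OF S(4)])
  fix i j assume i: "i \<in> I" and j: "j \<in> I"
  let ?S = "\<lambda>n. coordinate i (S n)"
  note Sa = coordinate_adapted[OF S(1)]
  have bound: "ennreal ((L2_norm M (\<lambda>\<omega>. elementary_integral (*) (W j) (?S n) \<omega> - sqrt (c i) * riemann_sum i j T n \<omega>))\<^sup>2)
    \<le> 2 * (\<integral>\<^sup>+s\<in>{0..T}. (\<integral>\<^sup>+\<omega>. ennreal ((norm (elementary_value (S n) s \<omega> - B s \<omega>))\<^sup>2) \<partial>M) \<partial>lborel)
      + 2 * ennreal ((sqrt (c i))\<^sup>2 * T\<^sup>2 / real (Suc n))" for n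
  proof (rule compare_riemann_sum[OF T i j Sa S(2)])
    fix s assume s: "s \<in> {0..T}"
    have "AE \<omega> in M. \<forall>i\<in>I. B s \<omega> \<bullet> e i = sqrt (c i) * W i s \<omega>"
      using s by (intro B_coord_AE) auto
    then show "(\<integral>\<^sup>+\<omega>. ennreal ((elementary_value (?S n) s \<omega> - sqrt (c i) * W i s \<omega>)\<^sup>2) \<partial>M)
        \<le> (\<integral>\<^sup>+\<omega>. ennreal ((norm (elementary_value (S n) s \<omega> - B s \<omega>))\<^sup>2) \<partial>M)"
    proof (intro nn_integral_mono_AE, eventually_elim)
      case (elim \<omega>)
      have "elementary_value (?S n) s \<omega> - sqrt (c i) * W i s \<omega> = (elementary_value (S n) s \<omega> - B s \<omega>) \<bullet> e i"
        using elim i by (simp add: coordinate_value inner_diff_left)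
      moreover have "\<bar>(elementary_value (S n) s \<omega> - B s \<omega>) \<bullet> e i\<bar> \<le> norm (elementary_value (S n) s \<omega> - B s \<omega>)"
        using Cauchy_Schwarz_ineq2[of "elementary_value (S n) s \<omega> - B s \<omega>" "e i"]
          orthonormal_onD(2)[OF orthonormal_basisD[OF basis] i] by simp
      ultimately show ?case
        using power_mono[of "\<bar>(elementary_value (S n) s \<omega> - B s \<omega>) \<bullet> e i\<bar>" _ 2]
        by (intro ennreal_leI) simp
    qed
  qed
  from null_of_ennreal_squares[OF this S(3) ennreal_inverse_Suc_null]
  have null: "(\<lambda>n. L2_norm M (\<lambda>\<omega>. sqrt (c i) * riemann_sum i j T n \<omega> - elementary_integral (*) (W j) (?S n) \<omega>)) \<longlonglongrightarrow> 0"
    by (subst L2_norm_minus_commute)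
  have "L2_tendsto M (\<lambda>n \<omega>. sqrt (c i) * riemann_sum i j T n \<omega>) (\<lambda>\<omega>. sqrt (c i) * ito i j T \<omega>) sequentially"
    using L2_tendsto_scale[OF riemann_sum_tendsto_ito[OF T i j], of "sqrt (c i)"] by simp
  from L2_tendsto_approx[OF this elementary_integral_L2[OF Sa j] null]
  have lim1: "L2_tendsto M (\<lambda>n \<omega>. sqrt (c j) * elementary_integral (*) (W j) (?S n) \<omega>)
      (\<lambda>\<omega>. sqrt (c j) * (sqrt (c i) * ito i j T \<omega>)) sequentially"
    using L2_tendsto_scale[of M "\<lambda>n. elementary_integral (*) (W j) (?S n)" _ sequentially "sqrt (c j)"] by simp
  have Z_L2: "(\<lambda>\<omega>. sqrt (c j) * elementary_integral (*) (W j) (?S n) \<omega>) \<in> L2 M" for n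
    using L2_scale[OF elementary_integral_L2[OF Sa j], of "sqrt (c j)"] by simp
  have lim2: "L2_tendsto M (\<lambda>n \<omega>. tensor_sum (S n) \<omega> \<bullet> tensor (e i) (e j))
      (\<lambda>\<omega>. tensor_ito T \<omega> \<bullet> tensor (e i) (e j)) sequentially"
    by (rule L2_tendsto_bounded_linear[OF bounded_linear_inner_left S(4)])
  have "L2_norm M (\<lambda>\<omega>. tensor_sum (S n) \<omega> \<bullet> tensor (e i) (e j) - sqrt (c j) * elementary_integral (*) (W j) (?S n) \<omega>) = 0" for n
  proof -
    have "AE \<omega> in M. \<forall>i. \<forall>j\<in>I. tensor_sum (S n) \<omega> \<bullet> tensor (e i) (e j) =
        sqrt (c j) * elementary_integral (*) (W j) (coordinate i (S n)) \<omega>"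
      by (rule tensor_sum_entry) (use S(1)[of n] in \<open>force simp: elementary_adapted_def\<close>)
    then have "AE \<omega> in M. tensor_sum (S n) \<omega> \<bullet> tensor (e i) (e j) - sqrt (c j) * elementary_integral (*) (W j) (?S n) \<omega> = 0"
      by eventually_elim (use j in simp)
    then show ?thesis
      unfolding L2_norm_def by (subst integral_eq_zero_AE) (auto elim: eventually_mono)
  qed
  then have "(\<lambda>n. L2_norm M (\<lambda>\<omega>. tensor_sum (S n) \<omega> \<bullet> tensor (e i) (e j)
      - sqrt (c j) * elementary_integral (*) (W j) (?S n) \<omega>)) \<longlonglongrightarrow> 0" by simp
  from L2_tendsto_unique[OF L2_tendsto_approx[OF lim2 Z_L2 this] lim1]
  show "AE \<omega> in M. tensor_ito T \<omega> \<bullet> tensor (e i) (e j) = sqrt (c i) * sqrt (c j) * ito i j T \<omega>"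
    by (auto simp: mult_ac)
qed

end


section \<open>The bivector of the area as a second-chaos radonification\<close>

lemma L2_orthonormal_subset: "L2_orthonormal M A X \<Longrightarrow> A' \<subseteq> A \<Longrightarrow> L2_orthonormal M A' X"
  by (simp add: L2_orthonormal_def subset_iff)

lemma L2_tendsto_eventually_eq:
  assumes "g \<in> L2 M" "\<forall>\<^sub>F n in F. f n = g"
  shows "L2_tendsto M f g F"
proof -
  have "\<forall>\<^sub>F n in F. L2_norm M (\<lambda>\<omega>. f n \<omega> - g \<omega>) = 0"
    using assms(2) by eventually_elim (simp add: L2_norm_def)
  then have "((\<lambda>n. L2_norm M (\<lambda>\<omega>. f n \<omega> - g \<omega>)) \<longlongrightarrow> 0) F" by (rule tendsto_eventually)
  moreover have "\<forall>\<^sub>F n in F. f n \<in> L2 M" using assms(2) by eventually_elim (simp add: assms(1))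
  ultimately show ?thesis using assms(1) by (simp add: L2_tendsto_def)
qed

context hilbert_brownian
begin

context
  fixes wedge :: "'h \<Rightarrow> 'h \<Rightarrow> 'l::{real_inner, complete_space}"
    and f :: "nat \<times> nat \<Rightarrow> 'k::{real_inner, complete_space}"
    and T :: real
  assumes wedge: "exterior_square wedge" and f: "orthonormal_basis (active I c) f" and T: "0 < T"
begin

lemma active_orthonormal: "L2_orthonormal M (active I c) (Xi M I W T)"
  by (rule L2_orthonormal_subset[OF Xi_orthonormal[OF T] active_subset])

lemma area_bivector_L2: "(\<lambda>\<omega>. bivector wedge (levy_area M I c e W T \<omega>)) \<in> L2 M"
  unfolding levy_area_def
  by (rule L2_bounded_linear[OF bivector_Alt2(1)[OF wedge basis] tensor_ito_entry(1)[OF T]])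

text \<open>The matrix entries of the alternation are half the differences of those of \<open>\<integral> B \<otimes> dB\<close>.\<close>

lemma area_bivector_coordinate:
  assumes ij: "(i, j) \<in> increasing_pairs I"
  shows "AE \<omega> in M. bivector wedge (levy_area M I c e W T \<omega>) \<bullet> wedge (e i) (e j)
    = T / 2 * sqrt (c i * c j) * Xi M I W T (i, j) \<omega>"
proof -
  have i: "i \<in> I" and j: "j \<in> I" using ij by (auto simp: increasing_pairs_def)
  show ?thesis
    using tensor_ito_entry(2)[OF T i j] tensor_ito_entry(2)[OF T j i]
  proof eventually_elim
    case (elim \<omega>)
    have "bivector wedge (levy_area M I c e W T \<omega>) \<bullet> wedge (e i) (e j)
        = (tensor_ito T \<omega> \<bullet> tensor (e i) (e j) - tensor_ito T \<omega> \<bullet> tensor (e j) (e i)) / 2"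
      unfolding levy_area_def bivector_Alt2(2)[OF wedge basis] by (simp add: Alt2_entry inner_tensor)
    also have "\<dots> = sqrt (c i) * sqrt (c j) / 2 * (ito i j T \<omega> - ito j i T \<omega>)"
      unfolding elim by (simp add: algebra_simps diff_divide_distrib)
    also have "ito i j T \<omega> - ito j i T \<omega> = T * Xi M I W T (i, j) \<omega>"
      using T by (simp add: Xi_apply)
    finally show ?case by (simp add: real_sqrt_mult)
  qed
qed

text \<open>The coordinate of a partial sum is the single term of its pair. For a pair outside the active set one
  of the eigenvalues vanishes, and both sides are \<open>0\<close>.\<close>

lemma Rad_coordinate:
  assumes ij: "(i, j) \<in> increasing_pairs I"
  shows "AE \<omega> in M. Rad M (active I c) f (Xi M I W T) (K_op I c e wedge f T) \<omega> \<bullet> wedge (e i) (e j)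
    = T / 2 * sqrt (c i * c j) * Xi M I W T (i, j) \<omega>"
proof -
  let ?A = "active I c" and ?X = "Xi M I W T" and ?K = "K_op I c e wedge f T"
  let ?k = "\<lambda>(i, j). T / 2 * sqrt (c i * c j)" and ?w = "\<lambda>(i, j). wedge (e i) (e j)"
  define q where "q = (i, j)"
  have q: "q \<in> increasing_pairs I" using ij by (simp add: q_def)
  have eo: "orthonormal_on I e" by (rule orthonormal_basisD[OF basis])
  note wo = wedge_orthonormal[OF wedge eo]
  have K: "hs_apply ?K (f p) = ?k p *\<^sub>R ?w p" if "p \<in> ?A" for p
    using K_op_apply[OF wedge eo c_summable c_nonneg f, of "fst p" "snd p" T] that by (cases p) auto
  have partial: "Rad_partial f ?X ?K P \<omega> \<bullet> ?w q = (if q \<in> P then ?k q * ?X q \<omega> else 0)"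
    if P: "finite P" "P \<subseteq> ?A" for P \<omega>
  proof -
    have "Rad_partial f ?X ?K P \<omega> \<bullet> ?w q = (\<Sum>p\<in>P. if p = q then ?k q * ?X q \<omega> else 0)"
      unfolding Rad_partial_def inner_sum_left
    proof (rule sum.cong[OF refl])
      fix p assume "p \<in> P"
      then have p: "p \<in> ?A" "p \<in> increasing_pairs I" using P active_subset by auto
      show "(?X p \<omega> *\<^sub>R hs_apply ?K (f p)) \<bullet> ?w q = (if p = q then ?k q * ?X q \<omega> else 0)"
        using orthonormal_onD(1)[OF wo p(2) q] by (simp add: K[OF p(1)] mult.commute)
    qed
    then show ?thesis using P by simp
  qed
  have "L2_tendsto M (\<lambda>P \<omega>. Rad_partial f ?X ?K P \<omega> \<bullet> ?w q) (\<lambda>\<omega>. ?k q * ?X q \<omega>) (finite_subsets_at_top ?A)"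
  proof (rule L2_tendsto_eventually_eq)
    have "?X q \<in> L2 M" using Xi_orthonormal[OF T] q by (simp add: L2_orthonormal_def)
    then show "(\<lambda>\<omega>. ?k q * ?X q \<omega>) \<in> L2 M" using L2_scale[of "?X q" M "?k q"] by simp
    show "\<forall>\<^sub>F P in finite_subsets_at_top ?A. (\<lambda>\<omega>. Rad_partial f ?X ?K P \<omega> \<bullet> ?w q) = (\<lambda>\<omega>. ?k q * ?X q \<omega>)"
    proof (cases "q \<in> ?A")
      case True
      then have "\<forall>\<^sub>F P in finite_subsets_at_top ?A. finite P \<and> {q} \<subseteq> P \<and> P \<subseteq> ?A"
        unfolding eventually_finite_subsets_at_top by (intro exI[of _ "{q}"]) auto
      then show ?thesis by eventually_elim (use partial in auto)
    next
      case False
      have "0 \<le> c i * c j" using q c_nonneg by (auto simp: q_def increasing_pairs_def)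
      then have "c i * c j = 0" using False q by (auto simp: q_def active_def increasing_pairs_def)
      then have k0: "?k q = 0" by (simp only: q_def case_prod_conv real_sqrt_zero mult_zero_right)
      show ?thesis
        by (rule eventually_finite_subsets_at_top_weakI) (use partial k0 False in auto)
    qed
  qed
  moreover have "L2_tendsto M (\<lambda>P \<omega>. Rad_partial f ?X ?K P \<omega> \<bullet> ?w q)
      (\<lambda>\<omega>. Rad M ?A f ?X ?K \<omega> \<bullet> ?w q) (finite_subsets_at_top ?A)"
    by (rule L2_tendsto_bounded_linear[OF bounded_linear_inner_left Rad_tendsto[OF active_orthonormal f]])
  ultimately have "AE \<omega> in M. Rad M ?A f ?X ?K \<omega> \<bullet> ?w q = ?k q * ?X q \<omega>"
    by (intro L2_tendsto_unique[OF _ _ finite_subsets_at_top_neq_bot])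
  then show ?thesis by (simp add: q_def)
qed

text \<open>Two vectors of the exterior square with the same coordinates along \<open>e\<^sub>i \<and> e\<^sub>j\<close> agree, and there are
  only countably many coordinates.\<close>

lemma area_bivector_Rad:
  "AE \<omega> in M. bivector wedge (levy_area M I c e W T \<omega>)
    = Rad M (active I c) f (Xi M I W T) (K_op I c e wedge f T) \<omega>"
proof -
  have "AE \<omega> in M. \<forall>p\<in>increasing_pairs I. bivector wedge (levy_area M I c e W T \<omega>) \<bullet> (case p of (i, j) \<Rightarrow> wedge (e i) (e j))
    = Rad M (active I c) f (Xi M I W T) (K_op I c e wedge f T) \<omega> \<bullet> (case p of (i, j) \<Rightarrow> wedge (e i) (e j))"
  proof (subst AE_ball_countable, simp, intro ballI)
    fix p assume p: "p \<in> increasing_pairs I"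
    obtain i j where ij: "p = (i, j)" by (cases p)
    show "AE \<omega> in M. bivector wedge (levy_area M I c e W T \<omega>) \<bullet> (case p of (i, j) \<Rightarrow> wedge (e i) (e j))
      = Rad M (active I c) f (Xi M I W T) (K_op I c e wedge f T) \<omega> \<bullet> (case p of (i, j) \<Rightarrow> wedge (e i) (e j))"
      using area_bivector_coordinate[OF p[unfolded ij]] Rad_coordinate[OF p[unfolded ij]]
      unfolding ij by eventually_elim simp
  qed
  then show ?thesis by eventually_elim (intro basis_eqI[OF wedge_basis[OF wedge basis]], blast)
qed

end

end


section \<open>Almost sure divergence of the active coordinates\<close>

lemma exp_minus_Lipschitz:
  fixes a b :: real
  assumes "0 \<le> a" "0 \<le> b"
  shows "\<bar>exp (- a) - exp (- b)\<bar> \<le> \<bar>a - b\<bar>"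
proof -
  have *: "\<bar>exp (- a) - exp (- b)\<bar> \<le> \<bar>a - b\<bar>" if "0 \<le> a" "a \<le> b" for a b :: real
  proof -
    have h: "1 - exp (- (b - a)) \<le> b - a" using exp_ge_add_one_self[of "- (b - a)"] by linarith
    have "exp (- a) - exp (- b) = exp (- a) * (1 - exp (- (b - a)))"
      by (simp add: algebra_simps flip: exp_add)
    also have "\<dots> \<le> 1 * (b - a)"
      using that by (intro mult_mono h) auto
    finally show ?thesis using that by simp
  qed
  show ?thesis
  proof (cases "a \<le> b")
    case True then show ?thesis using *[of a b] assms by simp
  next
    case False then show ?thesis using *[of b a] assms by (simp add: abs_minus_commute)
  qed
qed

text \<open>The difference of the exponentials is at most \<open>\<Sum>\<^sub>p \<bar>X\<^sub>p - Y\<^sub>p\<bar> \<bar>X\<^sub>p + Y\<^sub>p\<bar>\<close>, whose factors are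
  small and bounded in \<open>L\<^sup>2\<close>.\<close>

lemma (in prob_space) exp_square_L2_continuous:
  assumes P: "finite P" and X: "\<And>p. p \<in> P \<Longrightarrow> L2_tendsto M (\<lambda>n. X n p) (Y p :: 'a \<Rightarrow> real) sequentially"
    and Xn: "\<And>n p. p \<in> P \<Longrightarrow> X n p \<in> L2 M"
  shows "(\<lambda>n. \<integral>\<omega>. exp (- (\<Sum>p\<in>P. (X n p \<omega>)\<^sup>2)) \<partial>M) \<longlonglongrightarrow> (\<integral>\<omega>. exp (- (\<Sum>p\<in>P. (Y p \<omega>)\<^sup>2)) \<partial>M)"
proof -
  have Y: "Y p \<in> L2 M" if "p \<in> P" for p using X[OF that] by (rule L2_tendstoD(1))
  let ?d = "\<lambda>n p. L2_norm M (\<lambda>\<omega>. X n p \<omega> - Y p \<omega>)"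
  have absL2: "(\<lambda>\<omega>. \<bar>g \<omega>\<bar>) \<in> L2 M" if "g \<in> L2 M" for g :: "'a \<Rightarrow> real"
    using that by (auto simp: L2_iff_real intro: borel_measurable_abs)
  have bound: "\<bar>(\<integral>\<omega>. exp (- (\<Sum>p\<in>P. (X n p \<omega>)\<^sup>2)) \<partial>M) - (\<integral>\<omega>. exp (- (\<Sum>p\<in>P. (Y p \<omega>)\<^sup>2)) \<partial>M)\<bar>
      \<le> (\<Sum>p\<in>P. ?d n p * (?d n p + 2 * L2_norm M (Y p)))" for n
  proof -
    have int: "integrable M (\<lambda>\<omega>. exp (- (\<Sum>p\<in>P. (Z p \<omega>)\<^sup>2)))" if "\<And>p. p \<in> P \<Longrightarrow> Z p \<in> L2 M" for Z :: "_ \<Rightarrow> 'a \<Rightarrow> real"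
    proof (rule integrable_const_bound[of _ 1])
      show "(\<lambda>\<omega>. exp (- (\<Sum>p\<in>P. (Z p \<omega>)\<^sup>2))) \<in> borel_measurable M"
      proof -
        have [measurable]: "Z p \<in> borel_measurable M" if "p \<in> P" for p
          by (rule L2_measurable[OF \<open>\<And>p. p \<in> P \<Longrightarrow> Z p \<in> L2 M\<close>[OF that]])
        show ?thesis by measurable
      qed
    qed (simp add: sum_nonneg)
    have int2: "integrable M (\<lambda>\<omega>. \<bar>X n p \<omega> - Y p \<omega>\<bar> * \<bar>X n p \<omega> + Y p \<omega>\<bar>)" if "p \<in> P" for p
      using that by (intro L2_mult_integrable absL2 L2_diff L2_add Xn Y)
    have "\<bar>(\<integral>\<omega>. exp (- (\<Sum>p\<in>P. (X n p \<omega>)\<^sup>2)) \<partial>M) - (\<integral>\<omega>. exp (- (\<Sum>p\<in>P. (Y p \<omega>)\<^sup>2)) \<partial>M)\<bar>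
        = \<bar>\<integral>\<omega>. exp (- (\<Sum>p\<in>P. (X n p \<omega>)\<^sup>2)) - exp (- (\<Sum>p\<in>P. (Y p \<omega>)\<^sup>2)) \<partial>M\<bar>"
      using int[OF Xn] int[OF Y] by simp
    also have "\<dots> \<le> (\<integral>\<omega>. (\<Sum>p\<in>P. \<bar>X n p \<omega> - Y p \<omega>\<bar> * \<bar>X n p \<omega> + Y p \<omega>\<bar>) \<partial>M)"
    proof (rule order_trans[OF integral_abs_bound integral_mono])
      show "integrable M (\<lambda>\<omega>. \<bar>exp (- (\<Sum>p\<in>P. (X n p \<omega>)\<^sup>2)) - exp (- (\<Sum>p\<in>P. (Y p \<omega>)\<^sup>2))\<bar>)"
        using int[OF Xn] int[OF Y] by simp
      show "integrable M (\<lambda>\<omega>. (\<Sum>p\<in>P. \<bar>X n p \<omega> - Y p \<omega>\<bar> * \<bar>X n p \<omega> + Y p \<omega>\<bar>))"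
        using int2 by (intro Bochner_Integration.integrable_sum)
      fix \<omega>
      have "\<bar>exp (- (\<Sum>p\<in>P. (X n p \<omega>)\<^sup>2)) - exp (- (\<Sum>p\<in>P. (Y p \<omega>)\<^sup>2))\<bar>
          \<le> \<bar>(\<Sum>p\<in>P. (X n p \<omega>)\<^sup>2) - (\<Sum>p\<in>P. (Y p \<omega>)\<^sup>2)\<bar>"
        by (intro exp_minus_Lipschitz sum_nonneg) auto
      also have "\<dots> \<le> (\<Sum>p\<in>P. \<bar>(X n p \<omega>)\<^sup>2 - (Y p \<omega>)\<^sup>2\<bar>)"
        unfolding sum_subtractf[symmetric] by (rule sum_abs)
      also have "\<dots> = (\<Sum>p\<in>P. \<bar>X n p \<omega> - Y p \<omega>\<bar> * \<bar>X n p \<omega> + Y p \<omega>\<bar>)"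
        by (intro sum.cong refl) (simp add: power2_eq_square square_diff_square_factored abs_mult mult.commute)
      finally show "\<bar>exp (- (\<Sum>p\<in>P. (X n p \<omega>)\<^sup>2)) - exp (- (\<Sum>p\<in>P. (Y p \<omega>)\<^sup>2))\<bar>
          \<le> (\<Sum>p\<in>P. \<bar>X n p \<omega> - Y p \<omega>\<bar> * \<bar>X n p \<omega> + Y p \<omega>\<bar>)" .
    qed
    also have "\<dots> = (\<Sum>p\<in>P. \<integral>\<omega>. \<bar>X n p \<omega> - Y p \<omega>\<bar> * \<bar>X n p \<omega> + Y p \<omega>\<bar> \<partial>M)"
      by (rule Bochner_Integration.integral_sum) (rule int2)
    also have "\<dots> \<le> (\<Sum>p\<in>P. ?d n p * (?d n p + 2 * L2_norm M (Y p)))"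
    proof (rule sum_mono)
      fix p assume p: "p \<in> P"
      note d = L2_diff[OF Xn[OF p, of n] Y[OF p]] and s = L2_add[OF Xn[OF p, of n] Y[OF p]]
      have "(\<integral>\<omega>. \<bar>X n p \<omega> - Y p \<omega>\<bar> * \<bar>X n p \<omega> + Y p \<omega>\<bar> \<partial>M) \<le> ?d n p * L2_norm M (\<lambda>\<omega>. X n p \<omega> + Y p \<omega>)"
        using L2_Cauchy_Schwarz[OF absL2[OF d] absL2[OF s]] by (simp add: L2_norm_def)
      also have "\<dots> \<le> ?d n p * (?d n p + 2 * L2_norm M (Y p))"
      proof (rule mult_left_mono)
        have "L2_norm M (\<lambda>\<omega>. X n p \<omega> + Y p \<omega>) = L2_norm M (\<lambda>\<omega>. (X n p \<omega> - Y p \<omega>) + 2 *\<^sub>R Y p \<omega>)"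
          by (rule arg_cong[of _ _ "L2_norm M"]) (simp add: fun_eq_iff)
        also have "\<dots> \<le> ?d n p + 2 * L2_norm M (Y p)"
          using L2_triangle[OF d L2_scale[OF Y[OF p], of 2]] unfolding L2_norm_scale[of M 2] by simp
        finally show "L2_norm M (\<lambda>\<omega>. X n p \<omega> + Y p \<omega>) \<le> ?d n p + 2 * L2_norm M (Y p)" .
      qed simp
      finally show "(\<integral>\<omega>. \<bar>X n p \<omega> - Y p \<omega>\<bar> * \<bar>X n p \<omega> + Y p \<omega>\<bar> \<partial>M) \<le> ?d n p * (?d n p + 2 * L2_norm M (Y p))" .
    qed
    finally show ?thesis .
  qed
  have "(\<lambda>n. \<Sum>p\<in>P. ?d n p * (?d n p + 2 * L2_norm M (Y p))) \<longlonglongrightarrow> (\<Sum>p\<in>P. 0 * (0 + 2 * L2_norm M (Y p)))"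
    by (intro tendsto_intros L2_tendstoD(3)[OF X])
  then have "(\<lambda>n. \<Sum>p\<in>P. ?d n p * (?d n p + 2 * L2_norm M (Y p))) \<longlonglongrightarrow> 0" by simp
  then have "(\<lambda>n. (\<integral>\<omega>. exp (- (\<Sum>p\<in>P. (X n p \<omega>)\<^sup>2)) \<partial>M) - (\<integral>\<omega>. exp (- (\<Sum>p\<in>P. (Y p \<omega>)\<^sup>2)) \<partial>M)) \<longlonglongrightarrow> 0"
    by (rule Lim_null_comparison[rotated]) (simp add: bound)
  then show ?thesis by (simp add: LIM_zero_iff)
qed

context brownian_family
begin

context
  fixes T :: real
  assumes T: "0 < T"
begin

definition incr_vector :: "nat \<Rightarrow> nat \<Rightarrow> 'w \<Rightarrow> nat \<Rightarrow> real" where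
  "incr_vector n i \<omega> = (\<lambda>k\<in>{..<Suc n}. incr i (grid T n k) (grid T n (Suc k)) \<omega>)"

text \<open>A Riemann sum of \<open>\<integral> W\<^sup>i dW\<^sup>j\<close> as a function of the increments of the two motions.\<close>

definition discrete_ito :: "nat \<Rightarrow> (nat \<Rightarrow> real) \<Rightarrow> (nat \<Rightarrow> real) \<Rightarrow> real" where
  "discrete_ito n x y = (\<Sum>k<Suc n. (\<Sum>l<k. x l) * y k)"

definition discrete_kernel :: "nat \<Rightarrow> (nat \<Rightarrow> real) \<Rightarrow> (nat \<Rightarrow> real) \<Rightarrow> real" where
  "discrete_kernel n x y = exp (- (inverse T * (discrete_ito n x y - discrete_ito n y x))\<^sup>2)"

abbreviation vectors :: "nat \<Rightarrow> (nat \<Rightarrow> real) measure" where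
  "vectors n \<equiv> \<Pi>\<^sub>M k\<in>{..<Suc n}. borel"

lemma discrete_kernel_measurable:
  assumes x: "x \<in> measurable N (vectors n)" and y: "y \<in> measurable N (vectors n)"
  shows "(\<lambda>z. discrete_kernel n (x z) (y z)) \<in> borel_measurable N"
proof -
  have [measurable]: "(\<lambda>z. x z k) \<in> borel_measurable N" "(\<lambda>z. y z k) \<in> borel_measurable N" if "k < Suc n" for k
    using measurable_compose[OF x measurable_component_singleton[of k]]
      measurable_compose[OF y measurable_component_singleton[of k]] that by auto
  have "(\<lambda>z. discrete_ito n (x z) (y z)) \<in> borel_measurable N" "(\<lambda>z. discrete_ito n (y z) (x z)) \<in> borel_measurable N"
    unfolding discrete_ito_def by (auto intro!: borel_measurable_sum borel_measurable_times)
  then show ?thesis unfolding discrete_kernel_def by measurable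
qed

lemma incr_vectors_independent: "indep_vars (\<lambda>_. vectors n) (incr_vector n) I"
proof -
  have "indep_vars (\<lambda>_. vectors n)
      (\<lambda>i \<omega>. (\<lambda>x. \<lambda>k\<in>{..<Suc n}. x (grid T n (Suc k)) - x (grid T n k)) (\<lambda>t\<in>{0..}. W i t \<omega>)) I"
    by (rule indep_vars_compose2[OF independent[unfolded independent_processes_def]])
      (intro measurable_restrict borel_measurable_diff measurable_component_singleton,
        simp_all add: grid_nonneg[OF less_imp_le[OF T]])
  also have "(\<lambda>i \<omega>. (\<lambda>x. \<lambda>k\<in>{..<Suc n}. x (grid T n (Suc k)) - x (grid T n k)) (\<lambda>t\<in>{0..}. W i t \<omega>)) = incr_vector n"
    using grid_nonneg[OF less_imp_le[OF T]] by (auto simp: fun_eq_iff incr_vector_def incr_def)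
  finally show ?thesis .
qed

lemma incr_vector_measurable: "i \<in> I \<Longrightarrow> incr_vector n i \<in> measurable M (vectors n)"
  using incr_vectors_independent by (simp add: indep_vars_def)

text \<open>The law does not depend on \<open>i\<close>. This makes the coordinates of disjoint pairs identically
  distributed.\<close>

lemma incr_vector_law:
  assumes i: "i \<in> I"
  shows "distr M (vectors n) (incr_vector n i)
    = (\<Pi>\<^sub>M k\<in>{..<Suc n}. density lborel (\<lambda>x. ennreal (normal_density 0 (sqrt (T / real (Suc n))) x)))"
proof -
  let ?X = "\<lambda>k. incr i (grid T n k) (grid T n (Suc k))"
  have step: "grid T n (Suc k) - grid T n k = T / real (Suc n)" "grid T n k < grid T n (Suc k)" for k
    using grid_step[of T n k] T by (auto simp: algebra_simps intro: less_add_same_cancel1[THEN iffD2])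
  have X: "?X k \<in> borel_measurable M" for k
    using i T by (intro incr_measurable grid_nonneg) auto
  have "\<forall>\<tau> n. 0 \<le> \<tau> 0 \<and> mono \<tau> \<longrightarrow>
      indep_vars (\<lambda>_. borel) (\<lambda>k \<omega>. W i (\<tau> (Suc k)) \<omega> - W i (\<tau> k) \<omega>) {..<n::nat}"
    using brownian[OF i] unfolding brownian_motion_def by (elim conjE)
  moreover have "mono (grid T n)" using T by (intro monoI grid_mono) auto
  ultimately have "indep_vars (\<lambda>_. borel) ?X {..<Suc n}"
    unfolding incr_def[abs_def] by (elim allE[of _ "grid T n"] allE[of _ "Suc n"]) simp
  then have "distr M (vectors n) (incr_vector n i) = (\<Pi>\<^sub>M k\<in>{..<Suc n}. distr M borel (?X k))"
    using X by (subst (asm) indep_vars_iff_distr_eq_PiM') (auto simp: incr_vector_def[abs_def] lessThan_empty_iff)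
  also have "\<dots> = (\<Pi>\<^sub>M k\<in>{..<Suc n}. density lborel (\<lambda>x. ennreal (normal_density 0 (sqrt (T / real (Suc n))) x)))"
  proof (rule PiM_cong[OF refl])
    fix k
    have "\<forall>s t. 0 \<le> s \<and> s < t \<longrightarrow>
        distributed M lborel (\<lambda>\<omega>. W i t \<omega> - W i s \<omega>) (normal_density 0 (sqrt (t - s)))"
      using brownian[OF i] unfolding brownian_motion_def by (elim conjE)
    then have "distributed M lborel (?X k) (normal_density 0 (sqrt (grid T n (Suc k) - grid T n k)))"
      using grid_nonneg[of T n k] T step(2)[of k] unfolding incr_def[abs_def] by auto
    then have "distr M lborel (?X k) = density lborel (\<lambda>x. ennreal (normal_density 0 (sqrt (T / real (Suc n))) x))"
      unfolding step(1) by (rule distributed_distr_eq_density)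
    then show "distr M borel (?X k) = density lborel (\<lambda>x. ennreal (normal_density 0 (sqrt (T / real (Suc n))) x))"
      by (subst distr_cong[of M M borel lborel "?X k" "?X k"]) auto
  qed
  finally show ?thesis .
qed

text \<open>The common expectation of the kernel for all pairs of distinct motions, as an integral over the
  product of two Gaussian laws.\<close>

definition kernel_mean :: "nat \<Rightarrow> real" where
  "kernel_mean n =
    (let \<nu> = \<Pi>\<^sub>M k\<in>{..<Suc n}. density lborel (\<lambda>x. ennreal (normal_density 0 (sqrt (T / real (Suc n))) x))
     in \<integral>z. discrete_kernel n (fst z) (snd z) \<partial>(\<nu> \<Otimes>\<^sub>M \<nu>))"

lemma pair_kernel_mean:
  assumes ij: "i \<in> I" "j \<in> I" "i \<noteq> j"
  shows "(\<integral>\<omega>. discrete_kernel n (incr_vector n i \<omega>) (incr_vector n j \<omega>) \<partial>M) = kernel_mean n"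
proof -
  let ?V = "incr_vector n"
  have "indep_var (PiM {i} (\<lambda>_. vectors n)) (\<lambda>\<omega>. restrict (\<lambda>k. ?V k \<omega>) {i})
      (PiM {j} (\<lambda>_. vectors n)) (\<lambda>\<omega>. restrict (\<lambda>k. ?V k \<omega>) {j})"
    by (rule indep_var_restrict[OF incr_vectors_independent]) (use ij in auto)
  from indep_var_compose[OF this measurable_component_singleton[of i] measurable_component_singleton[of j]]
  have "indep_var (vectors n) (?V i) (vectors n) (?V j)" by (simp add: comp_def)
  then have eq: "distr M (vectors n) (?V i) \<Otimes>\<^sub>M distr M (vectors n) (?V j)
      = distr M (vectors n \<Otimes>\<^sub>M vectors n) (\<lambda>\<omega>. (?V i \<omega>, ?V j \<omega>))"
    unfolding indep_var_distribution_eq by simp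
  have F: "(\<lambda>z. discrete_kernel n (fst z) (snd z)) \<in> borel_measurable (vectors n \<Otimes>\<^sub>M vectors n)"
    by (rule discrete_kernel_measurable) (rule measurable_fst measurable_snd)+
  have "(\<integral>\<omega>. discrete_kernel n (?V i \<omega>) (?V j \<omega>) \<partial>M)
      = (\<integral>z. discrete_kernel n (fst z) (snd z) \<partial>distr M (vectors n \<Otimes>\<^sub>M vectors n) (\<lambda>\<omega>. (?V i \<omega>, ?V j \<omega>)))"
    using incr_vector_measurable[OF ij(1)] incr_vector_measurable[OF ij(2)]
    by (subst integral_distr[OF _ F]) auto
  then show ?thesis
    unfolding eq[symmetric] incr_vector_law[OF ij(1)] incr_vector_law[OF ij(2)] kernel_mean_def Let_def .
qed

text \<open>The position at a grid point is the sum of the preceding increments, up to the initial value, which is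
  \<open>0\<close> only almost surely.\<close>

lemma riemann_discrete:
  assumes "i \<in> I" "j \<in> I"
  shows "AE \<omega> in M. riemann_sum i j T n \<omega> = discrete_ito n (incr_vector n i \<omega>) (incr_vector n j \<omega>)"
  using W_zero[OF assms(1)]
proof eventually_elim
  case (elim \<omega>)
  have "W i (grid T n k) \<omega> = (\<Sum>l<k. incr_vector n i \<omega> l)" if "k < Suc n" for k
  proof -
    have "(\<Sum>l<k. incr_vector n i \<omega> l) = (\<Sum>l<k. W i (grid T n (Suc l)) \<omega> - W i (grid T n l) \<omega>)"
      using that by (intro sum.cong refl) (auto simp: incr_vector_def incr_def)
    also have "\<dots> = W i (grid T n k) \<omega> - W i (grid T n 0) \<omega>" by (rule sum_lessThan_telescope)
    finally show ?thesis using elim by simp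
  qed
  then show ?case
    unfolding elementary_integral_incr riemann_simps discrete_ito_def
    by (intro sum.cong refl) (auto simp: incr_vector_def)
qed

abbreviation Xi_approx :: "nat \<Rightarrow> nat \<times> nat \<Rightarrow> 'w \<Rightarrow> real" where
  "Xi_approx n p \<omega> \<equiv> inverse T * (riemann_sum (fst p) (snd p) T n \<omega> - riemann_sum (snd p) (fst p) T n \<omega>)"

lemma Xi_approx_L2:
  assumes "fst p \<in> I" "snd p \<in> I"
  shows "Xi_approx n p \<in> L2 M"
  using L2_scale[OF L2_diff[OF riemann_sum_L2[OF T assms] riemann_sum_L2[OF T assms(2,1)]], of "inverse T"]
  by simp

lemma Xi_approx_tendsto:
  assumes "fst p \<in> I" "snd p \<in> I"
  shows "L2_tendsto M (\<lambda>n. Xi_approx n p) (Xi M I W T p) sequentially"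
proof -
  note lim = riemann_sum_tendsto_ito[OF T]
  have "L2_tendsto M (\<lambda>n \<omega>. inverse T *\<^sub>R (riemann_sum (fst p) (snd p) T n \<omega> + (- 1) *\<^sub>R riemann_sum (snd p) (fst p) T n \<omega>))
      (\<lambda>\<omega>. inverse T *\<^sub>R (ito (fst p) (snd p) T \<omega> + (- 1) *\<^sub>R ito (snd p) (fst p) T \<omega>)) sequentially"
    by (intro L2_tendsto_scale L2_tendsto_add lim assms)
  moreover have "Xi M I W T p = (\<lambda>\<omega>. inverse T * (ito (fst p) (snd p) T \<omega> - ito (snd p) (fst p) T \<omega>))"
    using Xi_apply[of T "fst p" "snd p"] by (simp add: fun_eq_iff)
  ultimately show ?thesis by simp
qed

text \<open>At the level of Riemann sums, disjoint pairs of motions give independent, identically distributed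
  variables. The Laplace functional of their squares therefore factorises, and this passes to
  the limit.\<close>

lemma disjoint_pairs_Laplace:
  assumes L: "finite L" and p: "\<And>m. m \<in> L \<Longrightarrow> fst (p m) \<in> I \<and> snd (p m) \<in> I \<and> fst (p m) \<noteq> snd (p m)"
    and disj: "disjoint_family_on (\<lambda>m. {fst (p m), snd (p m)}) L"
  shows "(\<lambda>n. kernel_mean n ^ card L) \<longlonglongrightarrow> (\<integral>\<omega>. exp (- (\<Sum>m\<in>L. (Xi M I W T (p m) \<omega>)\<^sup>2)) \<partial>M)"
proof -
  let ?V = "incr_vector"
  let ?X = "\<lambda>n m \<omega>. discrete_kernel n (?V n (fst (p m)) \<omega>) (?V n (snd (p m)) \<omega>)"
  have approx: "(\<integral>\<omega>. exp (- (\<Sum>m\<in>L. (Xi_approx n (p m) \<omega>)\<^sup>2)) \<partial>M) = kernel_mean n ^ card L" for n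
  proof -
    have "AE \<omega> in M. \<forall>m\<in>L. exp (- (Xi_approx n (p m) \<omega>)\<^sup>2) = ?X n m \<omega>"
    proof (subst AE_ball_countable)
      show "countable L" using L by (rule countable_finite)
      show "\<forall>m\<in>L. AE \<omega> in M. exp (- (Xi_approx n (p m) \<omega>)\<^sup>2) = ?X n m \<omega>"
      proof
        fix m assume "m \<in> L"
        then have "fst (p m) \<in> I" "snd (p m) \<in> I" using p by auto
        from riemann_discrete[OF this, of n] riemann_discrete[OF this(2,1), of n]
        show "AE \<omega> in M. exp (- (Xi_approx n (p m) \<omega>)\<^sup>2) = ?X n m \<omega>"
          by eventually_elim (simp add: discrete_kernel_def)
      qed
    qed
    then have AE: "AE \<omega> in M. exp (- (\<Sum>m\<in>L. (Xi_approx n (p m) \<omega>)\<^sup>2)) = (\<Prod>m\<in>L. ?X n m \<omega>)"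
      by eventually_elim (simp add: exp_sum[OF L] flip: sum_negf)
    have Xm: "?X n m \<in> borel_measurable M" if "m \<in> L" for m
      using p[OF that] by (intro discrete_kernel_measurable incr_vector_measurable) auto
    have "(\<integral>\<omega>. exp (- (\<Sum>m\<in>L. (Xi_approx n (p m) \<omega>)\<^sup>2)) \<partial>M) = (\<integral>\<omega>. (\<Prod>m\<in>L. ?X n m \<omega>) \<partial>M)"
    proof (rule integral_cong_AE[OF _ _ AE])
      have m: "Xi_approx n (p m) \<in> borel_measurable M" if "m \<in> L" for m
        by (rule L2_measurable[OF Xi_approx_L2]) (use p[OF that] in auto)
      have "(\<lambda>\<omega>. (Xi_approx n (p m) \<omega>)\<^sup>2) \<in> borel_measurable M" if "m \<in> L" for m
        by (rule borel_measurable_power[OF m[OF that]])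
      then have [measurable]: "(\<lambda>\<omega>. \<Sum>m\<in>L. (Xi_approx n (p m) \<omega>)\<^sup>2) \<in> borel_measurable M"
        by (rule borel_measurable_sum)
      show "(\<lambda>\<omega>. exp (- (\<Sum>m\<in>L. (Xi_approx n (p m) \<omega>)\<^sup>2))) \<in> borel_measurable M"
        by measurable
      show "(\<lambda>\<omega>. \<Prod>m\<in>L. ?X n m \<omega>) \<in> borel_measurable M" using Xm by (intro borel_measurable_prod)
    qed
    also have "\<dots> = (\<Prod>m\<in>L. \<integral>\<omega>. ?X n m \<omega> \<partial>M)"
    proof (rule indep_vars_lebesgue_integral[OF L])
      have "indep_vars (\<lambda>m. PiM {fst (p m), snd (p m)} (\<lambda>_. vectors n))
          (\<lambda>m \<omega>. restrict (\<lambda>i. ?V n i \<omega>) {fst (p m), snd (p m)}) L"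
        by (rule indep_vars_restrict[OF incr_vectors_independent _ disj]) (use p in auto)
      from indep_vars_compose2[OF this, of "\<lambda>m z. discrete_kernel n (z (fst (p m))) (z (snd (p m)))" "\<lambda>_. borel"]
      show "indep_vars (\<lambda>_. borel) (?X n) L"
        by (simp add: discrete_kernel_measurable measurable_component_singleton)
      show "integrable M (?X n m)" if "m \<in> L" for m
        by (rule integrable_const_bound[of _ 1]) (auto simp: discrete_kernel_def Xm[OF that, unfolded discrete_kernel_def])
    qed
    also have "\<dots> = (\<Prod>m\<in>L. kernel_mean n)"
      by (intro prod.cong refl pair_kernel_mean) (use p in auto)
    finally show ?thesis by simp
  qed
  have "(\<lambda>n. \<integral>\<omega>. exp (- (\<Sum>m\<in>L. (Xi_approx n (p m) \<omega>)\<^sup>2)) \<partial>M)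
      \<longlonglongrightarrow> (\<integral>\<omega>. exp (- (\<Sum>m\<in>L. (Xi M I W T (p m) \<omega>)\<^sup>2)) \<partial>M)"
    by (rule exp_square_L2_continuous[OF L Xi_approx_tendsto Xi_approx_L2]) (use p in auto)
  then show ?thesis unfolding approx .
qed

text \<open>If the squares summed to at most \<open>b\<close> on an event of probability \<open>q\<close>, then
  \<open>q exp (- b) \<le> E exp (- \<Sum>\<^sub>m\<^sub><\<^sub>N \<Xi>\<^sub>m\<^sup>2) = \<psi>\<^sup>N\<close> for all \<open>N\<close>, where
  \<open>\<psi> = E exp (- \<Xi>\<^sub>0\<^sup>2) < 1\<close> because \<open>\<Xi>\<^sub>0\<close> has variance \<open>1\<close>.\<close>

lemma Xi_squares_diverge:
  assumes p: "\<And>m. p m \<in> increasing_pairs I"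
    and disj: "disjoint_family (\<lambda>m::nat. {fst (p m), snd (p m)})"
  shows "AE \<omega> in M. \<forall>b::nat. \<exists>N. real b < (\<Sum>m<N. (Xi M I W T (p m) \<omega>)\<^sup>2)"
proof -
  let ?X = "\<lambda>m. Xi M I W T (p m)"
  have p': "fst (p m) \<in> I \<and> snd (p m) \<in> I \<and> fst (p m) \<noteq> snd (p m)" for m
    using p[of m] by (auto simp: increasing_pairs_def)
  have XL: "?X m \<in> L2 M" and X1: "(\<integral>\<omega>. (?X m \<omega>)\<^sup>2 \<partial>M) = 1" for m
    using Xi_orthonormal[OF T] p[of m] by (auto simp: L2_orthonormal_def power2_eq_square)
  have [measurable]: "?X m \<in> borel_measurable M" for m by (rule L2_measurable[OF XL])
  define \<psi> where "\<psi> = (\<integral>\<omega>. exp (- (?X 0 \<omega>)\<^sup>2) \<partial>M)"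
  have eint: "integrable M (\<lambda>\<omega>. exp (- (\<Sum>m<N. (?X m \<omega>)\<^sup>2)))" for N
    by (rule integrable_const_bound[of _ 1]) (auto simp: sum_nonneg)
  have e0: "integrable M (\<lambda>\<omega>. exp (- (?X 0 \<omega>)\<^sup>2))" using eint[of 1] by simp
  have "kernel_mean \<longlonglongrightarrow> \<psi>"
    using disjoint_pairs_Laplace[of "{0::nat}" p] p' unfolding \<psi>_def by (simp add: disjoint_family_on_def)
  then have "(\<lambda>n. kernel_mean n ^ N) \<longlonglongrightarrow> \<psi> ^ N" for N by (rule tendsto_power)
  moreover have "(\<lambda>n. kernel_mean n ^ N) \<longlonglongrightarrow> (\<integral>\<omega>. exp (- (\<Sum>m<N. (?X m \<omega>)\<^sup>2)) \<partial>M)" for N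
    using disjoint_pairs_Laplace[of "{..<N}" p] p' disj by (auto simp: disjoint_family_on_def)
  ultimately have Laplace: "(\<integral>\<omega>. exp (- (\<Sum>m<N. (?X m \<omega>)\<^sup>2)) \<partial>M) = \<psi> ^ N" for N
    using LIMSEQ_unique by blast
  have \<psi>0: "0 \<le> \<psi>" unfolding \<psi>_def by (rule Bochner_Integration.integral_nonneg) simp
  have "\<psi> \<le> (\<integral>\<omega>. 1 \<partial>M)" unfolding \<psi>_def by (rule integral_mono[OF e0]) auto
  then have \<psi>_le: "\<psi> \<le> 1" by (simp add: prob_space)
  have "\<psi> \<noteq> 1"
  proof
    assume 1: "\<psi> = 1"
    have "(\<integral>\<omega>. 1 - exp (- (?X 0 \<omega>)\<^sup>2) \<partial>M) = 0"
      using 1 e0 by (simp add: \<psi>_def prob_space)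
    then have "AE \<omega> in M. 1 - exp (- (?X 0 \<omega>)\<^sup>2) = 0"
      using e0 by (subst (asm) integral_nonneg_eq_0_iff_AE) auto
    then have "AE \<omega> in M. (?X 0 \<omega>)\<^sup>2 = 0" by eventually_elim simp
    then have "(\<integral>\<omega>. (?X 0 \<omega>)\<^sup>2 \<partial>M) = 0" by (rule integral_eq_zero_AE)
    with X1 show False by simp
  qed
  with \<psi>_le have \<psi>1: "\<psi> < 1" by simp
  have null: "AE \<omega> in M. \<exists>N. real b < (\<Sum>m<N. (?X m \<omega>)\<^sup>2)" for b :: nat
  proof -
    define E where "E = {\<omega> \<in> space M. \<forall>N. (\<Sum>m<N. (?X m \<omega>)\<^sup>2) \<le> real b}"
    have E [measurable]: "E \<in> sets M" unfolding E_def by measurable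
    have "exp (- real b) * prob E \<le> \<psi> ^ N" for N
    proof -
      have "exp (- real b) * prob E = (\<integral>\<omega>. exp (- real b) * indicator E \<omega> \<partial>M)" by simp
      also have "\<dots> \<le> (\<integral>\<omega>. exp (- (\<Sum>m<N. (?X m \<omega>)\<^sup>2)) \<partial>M)"
      proof (rule integral_mono[OF _ eint])
        show "integrable M (\<lambda>\<omega>. exp (- real b) * indicator E \<omega>)"
          using E by (intro integrable_mult_right integrable_real_indicator) (auto simp: less_top[symmetric])
      qed (auto simp: E_def indicator_def)
      finally show ?thesis by (simp add: Laplace)
    qed
    moreover have "(\<lambda>N. \<psi> ^ N) \<longlonglongrightarrow> 0" by (rule LIMSEQ_power_zero) (use \<psi>0 \<psi>1 in simp)
    ultimately have "exp (- real b) * prob E \<le> 0" by (intro LIMSEQ_le_const) auto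
    then have "prob E = 0" using measure_nonneg[of M E] by (simp add: mult_le_0_iff)
    then have "AE \<omega> in M. \<omega> \<notin> E" using E by (simp add: prob_eq_0)
    then show ?thesis
      using AE_space by eventually_elim (auto simp: E_def not_le)
  qed
  then show ?thesis by (subst AE_all_countable) auto
qed

end

end


section \<open>Point evaluation on the chaos space\<close>

text \<open>Point evaluation is well defined: the squared norm of a difference of two combinations is the sum of
  the squared differences of their coefficients, so that almost sure equality forces equal values
  everywhere.\<close>

lemma orthonormal_coefficients_unique:
  assumes X: "L2_orthonormal M A X" and P: "finite P" "P \<subseteq> A" and Q: "finite Q" "Q \<subseteq> A"
    and eq: "AE \<omega> in M. (\<Sum>p\<in>P. a p * X p \<omega>) = (\<Sum>p\<in>Q. b p * X p \<omega>)"
  shows "(\<Sum>p\<in>P. a p * X p \<omega>) = (\<Sum>p\<in>Q. b p * X p (\<omega> :: 'w) :: real)"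
proof -
  define d where "d p = (if p \<in> P then a p else 0) - (if p \<in> Q then b p else 0)" for p
  have PQ: "finite (P \<union> Q)" "P \<union> Q \<subseteq> A" using P Q by auto
  have diff: "(\<Sum>p\<in>P \<union> Q. X p \<omega> *\<^sub>R d p) = (\<Sum>p\<in>P. a p * X p \<omega>) - (\<Sum>p\<in>Q. b p * X p \<omega>)" for \<omega>
  proof -
    have "(\<Sum>p\<in>P. a p * X p \<omega>) = (\<Sum>p\<in>P \<union> Q. (if p \<in> P then a p else 0) * X p \<omega>)"
      using PQ(1) by (intro sum.mono_neutral_cong_left) auto
    moreover have "(\<Sum>p\<in>Q. b p * X p \<omega>) = (\<Sum>p\<in>P \<union> Q. (if p \<in> Q then b p else 0) * X p \<omega>)"
      using PQ(1) by (intro sum.mono_neutral_cong_left) auto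
    ultimately show ?thesis by (simp add: d_def algebra_simps flip: sum_subtractf)
  qed
  have "(\<Sum>p\<in>P \<union> Q. d p * d p) = (\<integral>\<omega>. (\<Sum>p\<in>P \<union> Q. X p \<omega> *\<^sub>R d p) * (\<Sum>p\<in>P \<union> Q. X p \<omega> *\<^sub>R d p) \<partial>M)"
    using orthonormal_expansion_inner[OF X PQ, of d d] by simp
  also have "\<dots> = 0"
  proof (rule integral_eq_zero_AE)
    show "AE \<omega> in M. (\<Sum>p\<in>P \<union> Q. X p \<omega> *\<^sub>R d p) * (\<Sum>p\<in>P \<union> Q. X p \<omega> *\<^sub>R d p) = 0"
      using eq by eventually_elim (simp only: diff, simp)
  qed
  finally have "\<forall>p\<in>P \<union> Q. d p * d p = 0"
    using PQ(1) by (subst (asm) sum_nonneg_eq_0_iff) auto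
  then have "(\<Sum>p\<in>P \<union> Q. X p \<omega> *\<^sub>R d p) = 0" by (intro sum.neutral) auto
  then show ?thesis using diff[of \<omega>] by simp
qed

text \<open>The norm of point evaluation at \<open>\<omega>\<close> is the \<open>\<ell>\<^sup>2\<close> norm of the sample \<open>(X\<^sub>p(\<omega>))\<^sub>p\<close>: test it
  on the elements \<open>\<Sum>\<^sub>p X\<^sub>p(\<omega>) X\<^sub>p\<close>.\<close>

lemma point_eval_unbounded:
  assumes X: "L2_orthonormal M A X"
    and big: "\<And>b. \<exists>P. finite P \<and> P \<subseteq> A \<and> b < (\<Sum>p\<in>P. (X p \<omega>)\<^sup>2)"
  shows "\<not> has_bounded_extension M (chaos_space M A X) (point_eval M A X \<omega>)"
proof
  assume "has_bounded_extension M (chaos_space M A X) (point_eval M A X \<omega>)"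
  then obtain \<Lambda> b where b: "\<And>g. g \<in> L2_closure M (chaos_space M A X) \<Longrightarrow> \<bar>\<Lambda> g\<bar> \<le> b * L2_norm M g"
    and \<Lambda>: "\<And>g. g \<in> chaos_space M A X \<Longrightarrow> \<Lambda> g = point_eval M A X \<omega> g"
    unfolding has_bounded_extension_def by blast
  obtain P where P: "finite P" "P \<subseteq> A" "b\<^sup>2 < (\<Sum>p\<in>P. (X p \<omega>)\<^sup>2)" using big by blast
  define S where "S = (\<Sum>p\<in>P. (X p \<omega>)\<^sup>2)"
  define g where "g \<omega>' = (\<Sum>p\<in>P. X p \<omega> * X p \<omega>')" for \<omega>'
  have XL: "X p \<in> L2 M" if "p \<in> A" for p using X that by (simp add: L2_orthonormal_def)
  have gL: "g \<in> L2 M"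
    unfolding g_def[abs_def] using L2_scale[OF XL] P(2) by (intro L2_sum) auto
  have gV: "g \<in> chaos_space M A X"
    unfolding chaos_space_def using gL P g_def by (intro CollectI conjI exI[of _ P] exI[of _ "\<lambda>p. X p \<omega>"]) auto
  have "L2_tendsto M (\<lambda>_. g) g sequentially" by (rule L2_tendsto_eventually_eq[OF gL]) simp
  then have gC: "g \<in> L2_closure M (chaos_space M A X)" unfolding L2_closure_def using gV by auto
  have "point_eval M A X \<omega> g = S"
    unfolding point_eval_def
  proof (rule the_equality)
    show "\<exists>Q a. finite Q \<and> Q \<subseteq> A \<and> (AE \<omega>' in M. g \<omega>' = (\<Sum>p\<in>Q. a p * X p \<omega>')) \<and> S = (\<Sum>p\<in>Q. a p * X p \<omega>)"
      using P by (intro exI[of _ P] exI[of _ "\<lambda>p. X p \<omega>"]) (auto simp: g_def S_def power2_eq_square)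
    fix r assume "\<exists>Q a. finite Q \<and> Q \<subseteq> A \<and> (AE \<omega>' in M. g \<omega>' = (\<Sum>p\<in>Q. a p * X p \<omega>')) \<and> r = (\<Sum>p\<in>Q. a p * X p \<omega>)"
    then obtain Q a where Q: "finite Q" "Q \<subseteq> A" "AE \<omega>' in M. g \<omega>' = (\<Sum>p\<in>Q. a p * X p \<omega>')"
      "r = (\<Sum>p\<in>Q. a p * X p \<omega>)" by blast
    have "(\<Sum>p\<in>P. X p \<omega> * X p \<omega>) = (\<Sum>p\<in>Q. a p * X p \<omega>)"
      by (rule orthonormal_coefficients_unique[OF X P(1,2) Q(1,2)]) (use Q(3) in \<open>simp add: g_def\<close>)
    then show "r = S" by (simp add: Q(4) S_def power2_eq_square)
  qed
  moreover have "(L2_norm M g)\<^sup>2 = S"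
    using orthonormal_expansion_inner[OF X P(1,2), of "\<lambda>p. X p \<omega>" "\<lambda>p. X p \<omega>"]
    unfolding L2_norm_square by (simp add: g_def S_def power2_eq_square mult.commute)
  moreover have "0 \<le> S" by (simp add: S_def sum_nonneg)
  ultimately have "(L2_norm M g)\<^sup>2 \<le> b * L2_norm M g" using b[OF gC] \<Lambda>[OF gV] by simp
  moreover have "0 < L2_norm M g"
  proof -
    have "0 < S" using P(3) zero_le_power2[of b] unfolding S_def by linarith
    then have "L2_norm M g \<noteq> 0" using \<open>(L2_norm M g)\<^sup>2 = S\<close> by auto
    then show ?thesis by (simp add: less_le)
  qed
  ultimately have "L2_norm M g \<le> b" by (simp add: power2_eq_square)
  then have "(L2_norm M g)\<^sup>2 \<le> b\<^sup>2" by (intro power_mono) auto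
  then show False using P(3) \<open>(L2_norm M g)\<^sup>2 = S\<close> by (simp add: S_def)
qed

text \<open>Infinitely many positive eigenvalues, taken two by two, give infinitely many disjoint active pairs.\<close>

lemma (in brownian_family) active_point_eval_unbounded:
  assumes T: "0 < T" and inf: "infinite {i \<in> I. c i \<noteq> 0}" and c: "\<And>i. i \<in> I \<Longrightarrow> 0 \<le> c i"
  shows "AE \<omega> in M. \<not> has_bounded_extension M (chaos_space M (active I c) (Xi M I W T))
    (point_eval M (active I c) (Xi M I W T) \<omega>)"
proof -
  define s where "s = enumerate {i \<in> I. c i \<noteq> 0}"
  have s: "strict_mono s" unfolding s_def by (rule strict_mono_enumerate[OF inf])
  have sI: "s n \<in> I" "0 < c (s n)" for n
    using enumerate_in_set[OF inf, of n] c[of "s n"] by (auto simp: s_def less_le)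
  define p where "p m = (s (2 * m), s (2 * m + 1))" for m
  have p: "p m \<in> active I c" for m
    using sI strict_monoD[OF s, of "2 * m" "2 * m + 1"] by (auto simp: p_def active_def)
  have s_eq: "s x = s y \<longleftrightarrow> x = y" for x y by (rule strict_mono_eq[OF s])
  have disj: "disjoint_family (\<lambda>m. {fst (p m), snd (p m)})"
    unfolding disjoint_family_on_def p_def by (auto simp: s_eq)
  have inj: "inj p" by (rule injI) (auto simp: p_def s_eq)
  have o: "L2_orthonormal M (active I c) (Xi M I W T)"
    by (rule L2_orthonormal_subset[OF Xi_orthonormal[OF T] active_subset])
  have "AE \<omega> in M. \<forall>b::nat. \<exists>N. real b < (\<Sum>m<N. (Xi M I W T (p m) \<omega>)\<^sup>2)"
    by (rule Xi_squares_diverge[OF T _ disj]) (use p active_subset in blast)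
  then show ?thesis
  proof eventually_elim
    case (elim \<omega>)
    show ?case
    proof (rule point_eval_unbounded[OF o])
      fix b :: real
      obtain b' :: nat where "b \<le> real b'" using real_arch_simple by blast
      moreover obtain N where "real b' < (\<Sum>m<N. (Xi M I W T (p m) \<omega>)\<^sup>2)" using elim by blast
      moreover have "(\<Sum>q\<in>p ` {..<N}. (Xi M I W T q \<omega>)\<^sup>2) = (\<Sum>m<N. (Xi M I W T (p m) \<omega>)\<^sup>2)"
        using inj by (subst sum.reindex) (auto intro: inj_on_subset)
      ultimately show "\<exists>P. finite P \<and> P \<subseteq> active I c \<and> b < (\<Sum>q\<in>P. (Xi M I W T q \<omega>)\<^sup>2)"
        using p by (intro exI[of _ "p ` {..<N}"]) auto
    qed
  qed
qed

theorem proposition9p1: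
  fixes M :: "'w measure"
    and C :: "'h::{real_inner, polish_space} \<Rightarrow>\<^sub>L 'h"
    and I :: "nat set" and c :: "nat \<Rightarrow> real" and e :: "nat \<Rightarrow> 'h"
    and W :: "nat \<Rightarrow> real \<Rightarrow> 'w \<Rightarrow> real"
    and wedge :: "'h \<Rightarrow> 'h \<Rightarrow> 'l::{real_inner, complete_space}"
    and f :: "nat \<times> nat \<Rightarrow> 'k::{real_inner, complete_space}"
    and t :: real
  assumes "prob_space M"
    and "positive_trace_class C"
    and "orthonormal_basis I e"
    and "\<And>i. i \<in> I \<Longrightarrow> blinfun_apply C (e i) = c i *\<^sub>R e i"
    and "\<And>i. i \<in> I \<Longrightarrow> brownian_motion M (W i)"
    and "independent_processes M I W"
    and "exterior_square wedge"
    and "orthonormal_basis (active I c) f"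
    and "t > 0"
  shows "L2_orthonormal M (active I c) (Xi M I W t) \<and>
    (\<forall>K :: ('k, 'e::{real_inner, complete_space}) hs.
       L2_tendsto M (Rad_partial f (Xi M I W t) K) (Rad M (active I c) f (Xi M I W t) K)
         (finite_subsets_at_top (active I c))) \<and>
    L2_linear_isometry M
      (Rad M (active I c) f (Xi M I W t) :: ('k, 'e) hs \<Rightarrow> 'w \<Rightarrow> 'e) \<and>
    (\<lambda>\<omega>. bivector wedge (levy_area M I c e W t \<omega>)) \<in> L2 M \<and>
    (AE \<omega> in M. bivector wedge (levy_area M I c e W t \<omega>)
       = Rad M (active I c) f (Xi M I W t) (K_op I c e wedge f t) \<omega>) \<and>
    blinfun_apply (covariance_op M (\<lambda>\<omega>. bivector wedge (levy_area M I c e W t \<omega>)))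
      = hs_apply (K_op I c e wedge f t) \<circ> adjoint (hs_apply (K_op I c e wedge f t)) \<and>
    hs_apply (K_op I c e wedge f t) \<circ> adjoint (hs_apply (K_op I c e wedge f t))
      = blinfun_apply ((t\<^sup>2 / 4) *\<^sub>R exterior_square_op wedge C) \<and>
    (\<not> finite_rank C \<longrightarrow>
       (AE \<omega> in M. \<not> has_bounded_extension M (chaos_space M (active I c) (Xi M I W t))
          (point_eval M (active I c) (Xi M I W t) \<omega>)))"
proof -
  note C = assms(2) and e = assms(3) and eig = assms(4) and w = assms(7) and f = assms(8) and t = assms(9)
  note c = positive_trace_class_eigenvalues[OF C e eig]
  interpret prob_space M by fact
  interpret hilbert_brownian M I W c e
  proof unfold_locales
    show "brownian_motion M (W i)" if "i \<in> I" for i by (rule assms(5)[OF that])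
    show "independent_processes M I W" by (rule assms(6))
    show "orthonormal_basis I e" by (rule e)
    show "0 \<le> c i" if "i \<in> I" for i by (rule c(1)) (use that in auto)
    show "c summable_on I" by (rule c(2)) auto
  qed
  note o = active_orthonormal[OF w f t]
  show ?thesis
  proof (intro conjI allI impI)
    show "L2_orthonormal M (active I c) (Xi M I W t)" by (rule o)
    show "L2_tendsto M (Rad_partial f (Xi M I W t) K) (Rad M (active I c) f (Xi M I W t) K)
        (finite_subsets_at_top (active I c))" for K :: "('k, 'e) hs"
      by (rule Rad_tendsto[OF o f])
    show "L2_linear_isometry M (Rad M (active I c) f (Xi M I W t) :: ('k, 'e) hs \<Rightarrow> 'w \<Rightarrow> 'e)"
      by (rule Rad_isometry[OF o f])
    show "(\<lambda>\<omega>. bivector wedge (levy_area M I c e W t \<omega>)) \<in> L2 M" by (rule area_bivector_L2[OF w f t])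
    show "AE \<omega> in M. bivector wedge (levy_area M I c e W t \<omega>)
        = Rad M (active I c) f (Xi M I W t) (K_op I c e wedge f t) \<omega>"
      by (rule area_bivector_Rad[OF w f t])
    show "blinfun_apply (covariance_op M (\<lambda>\<omega>. bivector wedge (levy_area M I c e W t \<omega>)))
        = hs_apply (K_op I c e wedge f t) \<circ> adjoint (hs_apply (K_op I c e wedge f t))"
    proof (rule Rad_covariance[OF o f _ area_bivector_L2[OF w f t]])
      show "(\<integral>\<omega>. Xi M I W t p \<omega> \<partial>M) = 0" if "p \<in> active I c" for p
        using that Xi_mean[OF t] by (auto simp: active_def)
      show "AE \<omega> in M. Rad M (active I c) f (Xi M I W t) (K_op I c e wedge f t) \<omega>
          = bivector wedge (levy_area M I c e W t \<omega>)"
        using area_bivector_Rad[OF w f t] by eventually_elim simp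
    qed
    show "hs_apply (K_op I c e wedge f t) \<circ> adjoint (hs_apply (K_op I c e wedge f t))
        = blinfun_apply ((t\<^sup>2 / 4) *\<^sub>R exterior_square_op wedge C)"
      by (rule K_op_adjoint[OF w e C _ f t]) (rule eig)
    show "AE \<omega> in M. \<not> has_bounded_extension M (chaos_space M (active I c) (Xi M I W t))
        (point_eval M (active I c) (Xi M I W t) \<omega>)" if "\<not> finite_rank C"
    proof (rule active_point_eval_unbounded[OF t _ c_nonneg])
      show "infinite {i \<in> I. c i \<noteq> 0}" by (rule infinite_rank_infinite_support[OF e eig that])
    qed
  qed
qed

end
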